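(* Let $A$ be a sectorial operator on a Banach space $X$ and let $\phi\in(\phi_A,\pi)$. Assume that $\psi$ is a holomorphic function on $S_\phi$ such that: (i) $\psi\in\mathcal{E}(S_\phi)$ and $(\cdot)^{-1}\psi\in\mathcal{E}(S_\phi)$; (ii) $\lim_{z\to0}z^{-1}\psi(z)\neq0$, $\psi(z)\neq0$ for all $z\in S_\phi$, and $$\sup_{z\in S_\phi,\ s\ge1}\left|\frac{\psi(sz)}{s\,\psi(z)}\right|<\infty .$$ Then, for every Banach function space $\Phi$ over $\mathbb{R}_+$ such that the Hardy operator $P$ is bounded on $\Phi$ and $\min(1,\tfrac1{(\cdot)})\in\Phi$, $$(X,D_A)_\Phi=\bigl\{x\in X:\ [(0,\infty)\ni t\mapsto |t^{-1}\psi(tA)x|_X]\in\Phi\bigr\}$$ and $$|x|_{(X,D_A)_\Phi}\simeq |x|_X+\bigl\|(\cdot)^{-1}|\psi(\cdot A)x|_X\bigr\|_\Phi\qquad(x\in(X,D_A)_\Phi).$$ If, in addition, $A$ is invertible, then $$|x|_{(X,D_A)_\Phi}\simeq \bigl\|(\cdot)^{-1}|\psi(\cdot A)x|_X\bigr\|_\Phi\qquad(x\in(X,D_A)_\Phi).$$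
   Context: Banach function space: $\mathcal{M}$ is the set of complex measurable functions on $\mathbb{R}_+=[0,\infty)$ (topology of convergence in Lebesgue measure). A Banach function space over $\mathbb{R}_+$ is a Banach space $\Phi$ that is a Banach lattice and an order ideal of $\mathcal{M}$: it is a sublattice of $\mathcal{M}$, and $|f|\le|g|$, $g\in\Phi$, $f\in\mathcal{M}$ implies $f\in\Phi$, $\|f\|_\Phi\le\|g\|_\Phi$. The Hardy operator is $Pf(t)=\frac1t\int_0^tf(s)\,ds$ on $L^1_{loc}(\mathbb{R}_+)$; $P$ bounded on $\Phi$ means $\Phi\subseteq L^1_{loc}(\mathbb{R}_+)$ and $P:\Phi\to\Phi$ is bounded. Interpolation space: $D_A$ is the domain of $A$ with the graph norm. For $x\in X+D_A=X$, $K(t,x)=\inf\{|a|_X+t|b|_{D_A}:a\in X,\,b\in D_A,\,a+b=x\}$, and $(X,D_A)_\Phi=\{x\in X:[t\mapsto t^{-1}K(t,x)]\in\Phi\}$ with norm $\|(\cdot)^{-1}K(\cdot,x)\|_\Phi$. Sectorial operators: for $\phi\in(0,\pi)$, $S_\phi=\{z\in\mathbb{C}:z\ne0,|\arg z|<\phi\}$. A linear, not necessarily densely defined operator $A$ on $X$ is sectorial of angle $\phi\in(0,\pi)$ if $\sigma(A)\subseteq\overline{S_\phi}$ and $\sup_{\lambda\in\mathbb{C}\setminus S_{\phi'}}|\lambda R(\lambda,A)|_{\mathcal{L}(X)}<\infty$ for every $\phi'\in(\phi,\pi)$, where $R(\lambda,A)=(\lambda-A)^{-1}$; $A$ is sectorial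 if it is sectorial of some angle in $(0,\pi)$, and $\phi_A$ is the infimum of all $\phi>0$ such that $A$ is sectorial of angle $\phi$. $A$ need not be injective. Functional calculus: $H^\infty(S_\phi)$ is the algebra of bounded holomorphic functions on $S_\phi$; $H^\infty_0(S_\phi)=\{f\in H^\infty(S_\phi):\exists C,s>0,\ |f(z)|\le C\min(|z|^s,|z|^{-s})\ (z\in S_\phi)\}$; $\mathcal{E}(S_\phi)=H_0^\infty(S_\phi)\oplus\langle(1+z)^{-1}\rangle\oplus\langle1\rangle$. For $f\in H^\infty_0(S_\phi)$, $f(A)=\frac1{2\pi i}\int_{\partial S_{\phi'}}f(z)R(z,A)\,dz$ for any $\phi'\in(\phi_A,\phi)$ (positively oriented boundary), and for $f=f_0+\frac{\lambda}{1+\cdot}+\mu\in\mathcal{E}(S_\phi)$ with $f_0\in H^\infty_0(S_\phi)$, $\lambda,\mu\in\mathbb{C}$, $f(A)=f_0(A)+\lambda(I+A)^{-1}+\mu$. For $t>0$, $\psi(tA)$ is this calculus applied to the sectorial operator $tA$. $\simeq$ means equivalence up to positive multiplicative constants independent of $x$. *)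

theory Defs
  imports "HOL-Analysis.Analysis"
begin

section \<open>Complex Banach spaces\<close>

class complex_banach = banach +
  fixes scaleC :: "complex \<Rightarrow> 'a \<Rightarrow> 'a"  (infixr "*C" 75)
  assumes scaleC_add_right: "c *C (x + y) = c *C x + c *C y"
    and scaleC_add_left: "(c + d) *C x = c *C x + d *C x"
    and scaleC_scaleC: "c *C (d *C x) = (c * d) *C x"
    and scaleR_scaleC: "r *\<^sub>R x = complex_of_real r *C x"
    and norm_scaleC: "norm (c *C x) = cmod c * norm x"

instantiation complex :: complex_banach
begin

definition scaleC_complex :: "complex \<Rightarrow> complex \<Rightarrow> complex" where
  "scaleC_complex c x = c * x"

instance
  by standard (auto simp: scaleC_complex_def algebra_simps norm_mult scaleR_conv_of_real)

end


section \<open>Sectorial operators\<close>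

text \<open>An unbounded operator is given by its domain \<open>D\<close> and a total function \<open>A\<close>
  of which only the values on \<open>D\<close> matter.\<close>

definition linear_operator :: "'a::complex_banach set \<Rightarrow> ('a \<Rightarrow> 'a) \<Rightarrow> bool" where
  "linear_operator D A \<longleftrightarrow>
     0 \<in> D \<and> (\<forall>x\<in>D. \<forall>y\<in>D. x + y \<in> D \<and> A (x + y) = A x + A y) \<and>
     (\<forall>c. \<forall>x\<in>D. c *C x \<in> D \<and> A (c *C x) = c *C A x)"

definition resolvent :: "'a::complex_banach set \<Rightarrow> ('a \<Rightarrow> 'a) \<Rightarrow> complex \<Rightarrow> 'a \<Rightarrow> 'a" where
  "resolvent D A l = inv_into D (\<lambda>x. l *C x - A x)"

definition resolvent_set :: "'a::complex_banach set \<Rightarrow> ('a \<Rightarrow> 'a) \<Rightarrow> complex set" where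
  "resolvent_set D A =
     {l. bij_betw (\<lambda>x. l *C x - A x) D UNIV \<and> bounded_linear (resolvent D A l)}"

definition spectrum :: "'a::complex_banach set \<Rightarrow> ('a \<Rightarrow> 'a) \<Rightarrow> complex set" where
  "spectrum D A = - resolvent_set D A"

definition sector :: "real \<Rightarrow> complex set" where
  "sector \<phi> = {z. z \<noteq> 0 \<and> \<bar>Arg z\<bar> < \<phi>}"

text \<open>The point \<open>0\<close>, which lies outside every sector, is left out of the supremum, since it may
  belong to the spectrum.\<close>

definition sectorial_of_angle :: "'a::complex_banach set \<Rightarrow> ('a \<Rightarrow> 'a) \<Rightarrow> real \<Rightarrow> bool" where
  "sectorial_of_angle D A \<phi> \<longleftrightarrow>
     \<phi> \<in> {0<..<pi} \<and> linear_operator D A \<and> spectrum D A \<subseteq> closure (sector \<phi>) \<and>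
     (\<forall>\<phi>'\<in>{\<phi><..<pi}.
        bdd_above ((\<lambda>l. onorm (\<lambda>x. l *C resolvent D A l x)) ` (- sector \<phi>' - {0})))"

definition sectorial :: "'a::complex_banach set \<Rightarrow> ('a \<Rightarrow> 'a) \<Rightarrow> bool" where
  "sectorial D A \<longleftrightarrow> (\<exists>\<phi>. sectorial_of_angle D A \<phi>)"

definition sectoriality_angle :: "'a::complex_banach set \<Rightarrow> ('a \<Rightarrow> 'a) \<Rightarrow> real" where
  "sectoriality_angle D A = Inf {\<phi>. sectorial_of_angle D A \<phi>}"

text \<open>Invertible means \<open>0 \<in> \<rho>(A)\<close>, which is more than injective.\<close>

definition invertible_operator :: "'a::complex_banach set \<Rightarrow> ('a \<Rightarrow> 'a) \<Rightarrow> bool" where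
  "invertible_operator D A \<longleftrightarrow> 0 \<in> resolvent_set D A"


section \<open>The elementary functional calculus\<close>

text \<open>Functions on a sector are total functions on \<open>complex\<close> of which only the values on the
  sector matter.\<close>

definition Hinf :: "real \<Rightarrow> (complex \<Rightarrow> complex) set" where
  "Hinf \<phi> = {f. f holomorphic_on sector \<phi> \<and> bounded (f ` sector \<phi>)}"

definition Hinf0 :: "real \<Rightarrow> (complex \<Rightarrow> complex) set" where
  "Hinf0 \<phi> = {f \<in> Hinf \<phi>. \<exists>C>0. \<exists>s>0. \<forall>z\<in>sector \<phi>.
      cmod (f z) \<le> C * min (cmod z powr s) (cmod z powr - s)}"

definition elem_remainder :: "(complex \<Rightarrow> complex) \<Rightarrow> complex \<Rightarrow> complex \<Rightarrow> complex \<Rightarrow> complex" where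
  "elem_remainder f l m = (\<lambda>z. f z - l / (1 + z) - m)"

text \<open>\<open>f\<close> lies in \<open>Hinf0 \<phi> \<oplus> \<langle>1/(1+z)\<rangle> \<oplus> \<langle>1\<rangle>\<close>; the pair \<open>(l, m)\<close> is unique for
  \<open>0 < \<phi> < \<pi>\<close>.\<close>

definition elem_fun :: "real \<Rightarrow> (complex \<Rightarrow> complex) set" where
  "elem_fun \<phi> = {f. \<exists>l m. elem_remainder f l m \<in> Hinf0 \<phi>}"

definition ray_integral :: "real \<Rightarrow> (complex \<Rightarrow> 'a::complex_banach) \<Rightarrow> 'a" where
  "ray_integral \<theta> g = integral {0<..} (\<lambda>r. cis \<theta> *C g (complex_of_real r * cis \<theta>))"

text \<open>The boundary of the sector of angle \<open>\<nu>\<close>, with the sector on its left, runs from infinity to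
  \<open>0\<close> along the upper ray and back to infinity along the lower one. The operator-valued integral is
  taken pointwise, as a Henstock-Kurzweil integral, because the Bochner integral of the library
  exists in separable spaces only.\<close>

definition Hinf0_calculus ::
    "'a::complex_banach set \<Rightarrow> ('a \<Rightarrow> 'a) \<Rightarrow> real \<Rightarrow> (complex \<Rightarrow> complex) \<Rightarrow> 'a \<Rightarrow> 'a" where
  "Hinf0_calculus D A \<nu> f x =
     (1 / (2 * of_real pi * \<i>)) *C
       (ray_integral (- \<nu>) (\<lambda>z. f z *C resolvent D A z x) -
        ray_integral \<nu> (\<lambda>z. f z *C resolvent D A z x))"

text \<open>The operator \<open>f(A)\<close> for \<open>f \<in> elem_fun \<phi>\<close>, computed with the contour of angle
  \<open>\<nu> \<in> (\<phi>\<^sub>A, \<phi>)\<close>, on the choice of which it does not depend.\<close>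

definition elem_calculus ::
    "'a::complex_banach set \<Rightarrow> ('a \<Rightarrow> 'a) \<Rightarrow> real \<Rightarrow> real \<Rightarrow> (complex \<Rightarrow> complex) \<Rightarrow> 'a \<Rightarrow> 'a" where
  "elem_calculus D A \<phi> \<nu> f x =
     (let (l, m) = (THE p. elem_remainder f (fst p) (snd p) \<in> Hinf0 \<phi>)
      in Hinf0_calculus D A \<nu> (elem_remainder f l m) x
           + l *C inv_into D (\<lambda>y. y + A y) x + m *C x)"


section \<open>Banach function spaces over the half-line\<close>

text \<open>Measurable functions on \<open>[0,\<infinity>)\<close> modulo equality almost everywhere are rendered by
  representatives: \<open>\<Phi>\<close> is a set of functions closed under almost everywhere equality on \<open>[0,\<infinity>)\<close>
  (by \<open>ideal\<close>), and \<open>N\<close> is its norm. That \<open>\<Phi>\<close> is a sublattice follows from \<open>ideal\<close> and \<open>add\<close>.\<close>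

locale banach_function_space =
  fixes \<Phi> :: "(real \<Rightarrow> complex) set" and N :: "(real \<Rightarrow> complex) \<Rightarrow> real"
  assumes measurable: "\<Phi> \<subseteq> borel_measurable (lebesgue_on {0..})"
    and zero: "(\<lambda>t. 0) \<in> \<Phi>"
    and add: "f \<in> \<Phi> \<Longrightarrow> g \<in> \<Phi> \<Longrightarrow> (\<lambda>t. f t + g t) \<in> \<Phi>"
    and mult: "f \<in> \<Phi> \<Longrightarrow> (\<lambda>t. c * f t) \<in> \<Phi>"
    and norm_nonneg: "f \<in> \<Phi> \<Longrightarrow> 0 \<le> N f"
    and norm_eq_0: "f \<in> \<Phi> \<Longrightarrow> N f = 0 \<longleftrightarrow> (AE t in lebesgue_on {0..}. f t = 0)"
    and norm_triangle: "f \<in> \<Phi> \<Longrightarrow> g \<in> \<Phi> \<Longrightarrow> N (\<lambda>t. f t + g t) \<le> N f + N g"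
    and norm_mult: "f \<in> \<Phi> \<Longrightarrow> N (\<lambda>t. c * f t) = cmod c * N f"
    and complete: "\<lbrakk>\<And>n. u n \<in> \<Phi>;
          \<And>e. e > 0 \<Longrightarrow> \<exists>M. \<forall>m\<ge>M. \<forall>n\<ge>M. N (\<lambda>t. u m t - u n t) < e\<rbrakk>
        \<Longrightarrow> \<exists>f\<in>\<Phi>. (\<lambda>n. N (\<lambda>t. u n t - f t)) \<longlonglongrightarrow> 0"
    and ideal: "\<lbrakk>g \<in> \<Phi>; f \<in> borel_measurable (lebesgue_on {0..});
          AE t in lebesgue_on {0..}. cmod (f t) \<le> cmod (g t)\<rbrakk> \<Longrightarrow> f \<in> \<Phi> \<and> N f \<le> N g"

definition L1_loc :: "(real \<Rightarrow> complex) set" where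
  "L1_loc = {f. \<forall>T\<ge>0. integrable (lebesgue_on {0..T}) f}"

definition hardy :: "(real \<Rightarrow> complex) \<Rightarrow> real \<Rightarrow> complex" where
  "hardy f t = complex_of_real (1 / t) * integral\<^sup>L (lebesgue_on {0..t}) f"

definition hardy_bounded_on ::
    "(real \<Rightarrow> complex) set \<Rightarrow> ((real \<Rightarrow> complex) \<Rightarrow> real) \<Rightarrow> bool" where
  "hardy_bounded_on \<Phi> N \<longleftrightarrow>
     \<Phi> \<subseteq> L1_loc \<and> (\<forall>f\<in>\<Phi>. hardy f \<in> \<Phi>) \<and> (\<exists>C. \<forall>f\<in>\<Phi>. N (hardy f) \<le> C * N f)"


section \<open>Interpolation spaces\<close>

definition graph_norm :: "('a::complex_banach \<Rightarrow> 'a) \<Rightarrow> 'a \<Rightarrow> real" where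
  "graph_norm A x = norm x + norm (A x)"

definition K_functional :: "'a::complex_banach set \<Rightarrow> ('a \<Rightarrow> 'a) \<Rightarrow> real \<Rightarrow> 'a \<Rightarrow> real" where
  "K_functional D A t x = Inf {norm a + t * graph_norm A b |a b. b \<in> D \<and> a + b = x}"

definition K_function :: "'a::complex_banach set \<Rightarrow> ('a \<Rightarrow> 'a) \<Rightarrow> 'a \<Rightarrow> real \<Rightarrow> complex" where
  "K_function D A x = (\<lambda>t. complex_of_real (K_functional D A t x / t))"

definition interp_space ::
    "'a::complex_banach set \<Rightarrow> ('a \<Rightarrow> 'a) \<Rightarrow> (real \<Rightarrow> complex) set \<Rightarrow> 'a set" where
  "interp_space D A \<Phi> = {x. K_function D A x \<in> \<Phi>}"

definition interp_norm ::
    "'a::complex_banach set \<Rightarrow> ('a \<Rightarrow> 'a) \<Rightarrow> ((real \<Rightarrow> complex) \<Rightarrow> real) \<Rightarrow> 'a \<Rightarrow> real" where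
  "interp_norm D A N x = N (K_function D A x)"

text \<open>The function \<open>t \<mapsto> |t\<inverse> \<psi>(tA) x|\<close>; its value at the null set \<open>{0}\<close> is irrelevant.\<close>

definition calculus_function ::
    "'a::complex_banach set \<Rightarrow> ('a \<Rightarrow> 'a) \<Rightarrow> real \<Rightarrow> real \<Rightarrow> (complex \<Rightarrow> complex) \<Rightarrow> 'a \<Rightarrow> real \<Rightarrow> complex"
  where
  "calculus_function D A \<phi> \<nu> \<psi> x =
     (\<lambda>t. complex_of_real (norm ((1 / t) *\<^sub>R elem_calculus D (\<lambda>y. t *\<^sub>R A y) \<phi> \<nu> \<psi> x)))"

definition equivalent_on :: "'a set \<Rightarrow> ('a \<Rightarrow> real) \<Rightarrow> ('a \<Rightarrow> real) \<Rightarrow> bool" where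
  "equivalent_on S p q \<longleftrightarrow> (\<exists>c>0. \<exists>C>0. \<forall>x\<in>S. c * q x \<le> p x \<and> p x \<le> C * q x)"

end

theory Submission
  imports Defs "HOL-Complex_Analysis.Complex_Analysis"
begin

text \<open>Put \<open>g(z) = \<psi>(z)/z\<close>, \<open>g\<^sup>*(z) = cnj (g (cnj z))\<close> and \<open>k(z) = c z g\<^sup>*(z) / (1 + z)\<^sup>3\<close>. Then \<open>g k\<close> has
  constant phase on \<open>(0,\<infinity>)\<close>, so \<open>c\<close> can be chosen such that the primitive \<open>q\<close> of \<open>- g k\<close> runs from
  \<open>q(0) = 1\<close> to \<open>q(\<infinity>) = 0\<close>; by the supremum condition on \<open>\<psi>\<close> the quotient \<open>r = q / g\<close> is again an
  elementary function. In the decomposition \<open>x = (x - q(tA) x) + q(tA) x\<close> the second part satisfies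
  \<open>A q(tA) x = t\<inverse> r(tA) \<psi>(tA) x\<close>, and the first is the integral of \<open>k(\<sigma>A) \<psi>(\<sigma>A) x d\<sigma>/\<sigma>\<close> over \<open>(0,t)\<close>.
  Hence \<open>K(t,x)/t\<close> is bounded by \<open>u(t) = |t\<inverse> \<psi>(tA) x|\<close>, its Hardy average and \<open>|x| min(1,1/t)\<close>. The
  converse bound follows from \<open>|\<psi>(tA) b| \<le> C t |A b|\<close>.\<close>

text \<open>Three obstacles shape the details. The domain need not be dense, so q(\<epsilon>A) x
  need not tend to x as \<epsilon> tends to 0. Local integrability of \<open>u\<close> forces it:
  the increments of q(\<epsilon>A) x are bounded by those of the primitive of \<open>u\<close>, so a
  limit exists, and it is identified with x after applying the injective operator (1 + A)^{-1},
  whose values lie in the domain. Next, the contour integrals are pointwise gauge integrals;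
  identities between them are tested with continuous functionals, which leaves scalar statements
  accessible to antiderivatives, Cauchy's theorem and Fubini's theorem. Finally, all bounds must be
  uniform in t: positive dilations preserve the sectors and the resolvent bound, so one set of
  constants serves every tA. The factor (1 + z)^{-3} keeps k of order z at 0 and of order z^{-2} at
  infinity, which makes the integrals defining q converge at both ends. In the invertible case |x|
  is recovered from the parameters t in [1,2] alone, where the second part b of the decomposition
  satisfies |b| \<le> c |A b|.\<close>

section \<open>Norming functionals and integrals over the half-line\<close>

text \<open>A linear functional below the norm is handled through its graph, a subspace of the product with
  the reals, so that Zorn's lemma applies to sets.\<close>

lemma hahn_banach_extend:
  fixes G :: "('a::real_normed_vector \<times> real) set"
  assumes sub: "subspace G" and dom: "\<And>x a. (x, a) \<in> G \<Longrightarrow> a \<le> norm x"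
  shows "\<exists>c H. subspace H \<and> (\<forall>x a. (x, a) \<in> H \<longrightarrow> a \<le> norm x) \<and> G \<subseteq> H \<and> (x0, c) \<in> H"
proof -
  define S where "S = (\<lambda>(y, a). a - norm (y - x0)) ` G"
  \<comment> \<open>The value at x0 must lie above all a - |y - x0| and below all |y + x0| - a. By
    \<open>key\<close> the two families do not cross, and the supremum of the first is one
    admissible choice.\<close>
  define c where "c = Sup S"
  have key: "a - norm (y - x0) \<le> norm (y' + x0) - a'" if "(y, a) \<in> G" "(y', a') \<in> G" for y a y' a'
  proof -
    have "(y + y', a + a') \<in> G" using subspace_add[OF sub that] by simp
    then have "a + a' \<le> norm (y + y')" by (rule dom)
    also have "\<dots> \<le> norm (y - x0) + norm (y' + x0)"
      using norm_triangle_ineq[of "y - x0" "y' + x0"] by simp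
    finally show ?thesis by simp
  qed
  have G0: "(0, 0) \<in> G" using subspace_0[OF sub] by (simp add: zero_prod_def)
  have bdd: "bdd_above S" unfolding S_def using key[OF _ G0]
    by (intro bdd_aboveI[of _ "norm x0"]) auto
  have ne: "S \<noteq> {}" using G0 by (auto simp: S_def)
  have lo: "a - norm (y - x0) \<le> c" if "(y, a) \<in> G" for y a
    unfolding c_def using that by (intro cSup_upper bdd) (auto simp: S_def)
  have hi: "c \<le> norm (y + x0) - a" if "(y, a) \<in> G" for y a
    unfolding c_def using key[OF _ that] by (intro cSup_least ne) (auto simp: S_def)
  define H where "H = {(y + s *\<^sub>R x0, a + s * c) | y a s. (y, a) \<in> G}"
  have "subspace H"
  proof (rule subspaceI)
    show "0 \<in> H" unfolding H_def zero_prod_def using G0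
      by (intro CollectI exI[of _ 0] conjI) auto
  next
    fix p q assume "p \<in> H" "q \<in> H"
    then obtain y a s y' a' s' where
      "p = (y + s *\<^sub>R x0, a + s * c)" "(y, a) \<in> G" "q = (y' + s' *\<^sub>R x0, a' + s' * c)" "(y', a') \<in> G"
      by (auto simp: H_def)
    then show "p + q \<in> H" unfolding H_def
      using subspace_add[OF sub, of "(y, a)" "(y', a')"]
      by (intro CollectI exI[of _ "y + y'"] exI[of _ "a + a'"] exI[of _ "s + s'"]) (simp add: algebra_simps)
  next
    fix k p assume "p \<in> H"
    then obtain y a s where "p = (y + s *\<^sub>R x0, a + s * c)" "(y, a) \<in> G"
      by (auto simp: H_def)
    then show "k *\<^sub>R p \<in> H" unfolding H_def
      using subspace_scale[OF sub, of "(y, a)" k]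
      by (intro CollectI exI[of _ "k *\<^sub>R y"] exI[of _ "k * a"] exI[of _ "k * s"]) (simp add: algebra_simps)
  qed
  \<comment> \<open>Homogeneity reduces s \<noteq> 0 to s = 1 and s = -1, which are the bounds
    \<open>hi\<close> and \<open>lo\<close>.\<close>
  moreover have "a + s * c \<le> norm (y + s *\<^sub>R x0)" if ya: "(y, a) \<in> G" for y a s
  proof (cases s "0::real" rule: linorder_cases)
    case equal then show ?thesis using dom[OF ya] by simp
  next
    case greater
    have "((1/s) *\<^sub>R y, (1/s) * a) \<in> G" using subspace_scale[OF sub ya, of "1/s"] by simp
    from hi[OF this] have "s * c \<le> s * (norm ((1/s) *\<^sub>R y + x0) - (1/s) * a)"
      using greater by (intro mult_left_mono) auto
    also have "\<dots> = norm (s *\<^sub>R ((1/s) *\<^sub>R y + x0)) - a"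
      unfolding norm_scaleR using greater by (simp add: right_diff_distrib)
    also have "s *\<^sub>R ((1/s) *\<^sub>R y + x0) = y + s *\<^sub>R x0"
      using greater by (simp add: scaleR_right_distrib)
    finally show ?thesis by simp
  next
    case less
    have "((1/(-s)) *\<^sub>R y, (1/(-s)) * a) \<in> G" using subspace_scale[OF sub ya, of "1/(-s)"] by simp
    from lo[OF this] have "(-s) * ((1/(-s)) * a - norm ((1/(-s)) *\<^sub>R y - x0)) \<le> (-s) * c"
      using less by (intro mult_left_mono) auto
    moreover have "(-s) * norm ((1/(-s)) *\<^sub>R y - x0) = norm ((-s) *\<^sub>R ((1/(-s)) *\<^sub>R y - x0))"
      using less by (subst norm_scaleR) simp
    moreover have "(-s) *\<^sub>R ((1/(-s)) *\<^sub>R y - x0) = y + s *\<^sub>R x0"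
      using less by (simp add: scaleR_right_diff_distrib)
    moreover have "(-s) * ((1/(-s)) * a) = a" using less by simp
    ultimately show ?thesis by (simp only: right_diff_distrib)
  qed
  then have "\<forall>x a. (x, a) \<in> H \<longrightarrow> a \<le> norm x" by (auto simp: H_def)
  moreover have "G \<subseteq> H"
  proof
    fix p assume "p \<in> G"
    then show "p \<in> H" unfolding H_def
      by (intro CollectI exI[of _ "fst p"] exI[of _ "snd p"] exI[of _ 0]) simp
  qed
  moreover have "(x0, c) \<in> H" unfolding H_def using G0
    by (intro CollectI exI[of _ 0] exI[of _ 1] conjI) auto
  ultimately show ?thesis by blast
qed

text \<open>A maximal dominated graph is the graph of a function: \<open>hahn_banach_extend\<close>
  makes it total, and domination over the point 0 with both signs makes it single-valued. The
  one-sided bound suffices, since replacing x by -x gives the other side.\<close>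

lemma norming_functional_real:
  fixes v :: "'a::real_normed_vector"
  shows "\<exists>\<xi>::'a \<Rightarrow> real. linear \<xi> \<and> (\<forall>x. \<xi> x \<le> norm x) \<and> \<xi> v = norm v"
proof -
  define \<A> where "\<A> = {G::('a \<times> real) set. subspace G \<and> (\<forall>x a. (x, a) \<in> G \<longrightarrow> a \<le> norm x) \<and> (v, norm v) \<in> G}"
  \<comment> \<open>The line through \<open>(v, norm v)\<close> is the starting graph; keeping this
    point in every member of \<open>\<A>\<close> fixes the value at v.\<close>
  have "k * norm v \<le> \<bar>k\<bar> * norm v" for k by (intro mult_right_mono) auto
  then have "span {(v, norm v)} \<in> \<A>"
    unfolding \<A>_def by (intro CollectI conjI subspace_span) (auto simp: span_singleton image_iff intro: exI[of _ 1])
  then have "\<A> \<noteq> {}" by blast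
  moreover have "\<Union>\<C> \<in> \<A>" if "\<C> \<noteq> {}" "subset.chain \<A> \<C>" for \<C>
  proof -
    have ch: "\<C> \<subseteq> \<A>" "\<And>G H. G \<in> \<C> \<Longrightarrow> H \<in> \<C> \<Longrightarrow> G \<subseteq> H \<or> H \<subseteq> G"
      using that(2) by (auto simp: subset_chain_def)
    have "subspace (\<Union>\<C>)"
    proof (rule subspaceI)
      obtain G where "G \<in> \<C>" using \<open>\<C> \<noteq> {}\<close> by blast
      moreover from this have "subspace G" using ch(1) by (auto simp: \<A>_def)
      ultimately show "0 \<in> \<Union>\<C>" using subspace_0 by blast
      show "x + y \<in> \<Union>\<C>" if xy: "x \<in> \<Union>\<C>" "y \<in> \<Union>\<C>" for x y
      proof -
        obtain G H where "x \<in> G" "G \<in> \<C>" "y \<in> H" "H \<in> \<C>" using xy by blast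
        then obtain M where "M \<in> \<C>" "x \<in> M" "y \<in> M" using ch(2) by blast
        moreover from this have "subspace M" using ch(1) by (auto simp: \<A>_def)
        ultimately show ?thesis using subspace_add by blast
      qed
      show "c *\<^sub>R x \<in> \<Union>\<C>" if xy: "x \<in> \<Union>\<C>" for c x
      proof -
        obtain G where "x \<in> G" "G \<in> \<C>" using xy by blast
        moreover from this have "subspace G" using ch(1) by (auto simp: \<A>_def)
        ultimately show ?thesis using subspace_scale by blast
      qed
    qed
    moreover have "a \<le> norm x" if "(x, a) \<in> \<Union>\<C>" for x a
      using that ch(1) by (auto simp: \<A>_def)
    moreover have "(v, norm v) \<in> \<Union>\<C>"
      using that(1) ch(1) by (auto simp: \<A>_def)
    ultimately show ?thesis by (simp add: \<A>_def)
  qed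
  ultimately obtain G where G: "G \<in> \<A>" "\<And>H. H \<in> \<A> \<Longrightarrow> G \<subseteq> H \<Longrightarrow> H = G"
    using subset_Zorn_nonempty[of \<A>] by metis
  have sub: "subspace G" and dom: "\<And>x a. (x, a) \<in> G \<Longrightarrow> a \<le> norm x" and v: "(v, norm v) \<in> G"
    using G(1) by (auto simp: \<A>_def)
  have ex: "\<exists>c. (x, c) \<in> G" for x
  proof -
    obtain c H where H: "subspace H" "\<forall>x a. (x, a) \<in> H \<longrightarrow> a \<le> norm x" "G \<subseteq> H" "(x, c) \<in> H"
      using hahn_banach_extend[OF sub dom] by blast
    then have "H = G" using v by (intro G(2)) (auto simp: \<A>_def)
    then show ?thesis using H(4) by blast
  qed
  have un: "a = b" if "(x, a) \<in> G" "(x, b) \<in> G" for x a b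
  proof -
    have "(0, a - b) \<in> G" "(0, b - a) \<in> G"
      using subspace_diff[OF sub that] subspace_diff[OF sub that(2) that(1)] by auto
    from this[THEN dom] show ?thesis by simp
  qed
  define \<xi> where "\<xi> x = (THE a. (x, a) \<in> G)" for x
  have \<xi>: "(x, \<xi> x) \<in> G" for x
    unfolding \<xi>_def using ex[of x] un by (metis theI)
  have eq: "\<xi> x = a" if "(x, a) \<in> G" for x a using un[OF \<xi> that] .
  have "linear \<xi>"
  proof (rule linearI)
    show "\<xi> (x + y) = \<xi> x + \<xi> y" for x y
      using subspace_add[OF sub \<xi>[of x] \<xi>[of y]] by (intro eq) simp
    show "\<xi> (r *\<^sub>R x) = r *\<^sub>R \<xi> x" for r x
      using subspace_scale[OF sub \<xi>[of x], of r] by (intro eq) simp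
  qed
  then show ?thesis using dom[OF \<xi>] eq[OF v] by blast
qed

section \<open>Scalar multiplication and continuous complex functionals\<close>

lemma scaleC_zero_left [simp]: "0 *C (x::'a::complex_banach) = 0"
  using scaleR_scaleC[of 0 x] by simp

lemma scaleC_one [simp]: "1 *C (x::'a::complex_banach) = x"
  using scaleR_scaleC[of 1 x] by simp

lemma scaleC_minus_left [simp]: "(- c) *C (x::'a::complex_banach) = - (c *C x)"
  using scaleC_add_left[of "-c" c x] by (simp add: eq_neg_iff_add_eq_0)

lemma scaleC_diff_left: "(c - d) *C (x::'a::complex_banach) = c *C x - d *C x"
  using scaleC_add_left[of c "-d" x] by simp

lemma bounded_bilinear_scaleC: "bounded_bilinear ((*C) :: complex \<Rightarrow> 'a \<Rightarrow> 'a::complex_banach)"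
proof
  show "(r *\<^sub>R a) *C b = r *\<^sub>R a *C b" for r a and b :: 'a
    by (simp only: scaleR_conv_of_real scaleC_scaleC[symmetric] scaleR_scaleC[symmetric])
  show "a *C (r *\<^sub>R b) = r *\<^sub>R a *C b" for r a and b :: 'a
    by (simp only: scaleR_scaleC scaleC_scaleC mult.commute)
  show "\<exists>K. \<forall>a b. norm (a *C b :: 'a) \<le> norm a * norm b * K"
    by (rule exI[of _ 1]) (simp add: norm_scaleC)
qed (simp_all add: scaleC_add_left scaleC_add_right)

lemmas bounded_linear_scaleC_right = bounded_bilinear.bounded_linear_right[OF bounded_bilinear_scaleC]
lemmas continuous_on_scaleC = bounded_bilinear.continuous_on[OF bounded_bilinear_scaleC]

lemma scaleC_zero_right [simp]: "c *C (0::'a::complex_banach) = 0"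
  using bounded_linear_scaleC_right by (rule bounded_linear.linear[THEN linear_0])

lemma scaleC_diff_right: "c *C (x - y::'a::complex_banach) = c *C x - c *C y"
  using bounded_linear_scaleC_right by (rule bounded_linear.linear[THEN linear_diff])

text \<open>The continuous dual of the space. Vector-valued integrals are compared by testing
  against it, so that only complex-valued forms of Cauchy's and Fubini's theorems are
  needed.\<close>

definition cfunctional :: "('a::complex_banach \<Rightarrow> complex) \<Rightarrow> bool" where
  "cfunctional \<xi> \<longleftrightarrow> bounded_linear \<xi> \<and> (\<forall>c x. \<xi> (c *C x) = c * \<xi> x)"

text \<open>The real norming functional f is complexified to f(x) - i f(i x). The crude factor 2,
  from adding the bounds of real and imaginary part, replaces the rotation argument that would give
  norm one; only bounds up to constants are at stake.\<close>

lemma norming_functional: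
  fixes v :: "'a::complex_banach"
  shows "\<exists>\<xi>. cfunctional \<xi> \<and> (\<forall>x. cmod (\<xi> x) \<le> 2 * norm x) \<and> norm v \<le> cmod (\<xi> v)"
proof -
  obtain f :: "'a \<Rightarrow> real" where f: "linear f" "\<And>x. f x \<le> norm x" "f v = norm v"
    using norming_functional_real by blast
  define \<xi> where "\<xi> x = Complex (f x) (- f (\<i> *C x))" for x
  have fabs: "\<bar>f x\<bar> \<le> norm x" for x
    using f(2)[of x] f(2)[of "-x"] linear_neg[OF f(1), of x] by simp
  have fR: "f (complex_of_real r *C x) = r * f x" for r x
    using linear_scale[OF f(1), of r x] by (simp add: scaleR_scaleC)
  have bd: "cmod (\<xi> x) \<le> 2 * norm x" for x
    using cmod_le[of "\<xi> x"] fabs[of x] fabs[of "\<i> *C x"] by (simp add: \<xi>_def norm_scaleC)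
  have add: "\<xi> (x + y) = \<xi> x + \<xi> y" for x y
    by (simp add: \<xi>_def complex_eq_iff scaleC_add_right linear_add[OF f(1)])
  have sc: "\<xi> (c *C x) = c * \<xi> x" for c x
  proof -
    have c: "c = of_real (Re c) + \<i> * of_real (Im c)" by (simp add: complex_eq)
    have 1: "f (c *C x) = Re c * f x + Im c * f (\<i> *C x)"
      by (subst c, simp only: scaleC_add_left linear_add[OF f(1)])
         (simp add: fR scaleC_scaleC[symmetric] flip: mult.commute[of "of_real (Im c)" \<i>])
    have "\<i> * c = of_real (- Im c) + \<i> * of_real (Re c)" by (simp add: complex_eq_iff)
    then have "\<i> *C c *C x = of_real (- Im c) *C x + of_real (Re c) *C \<i> *C x"
      by (simp only: scaleC_scaleC scaleC_add_left mult.commute)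
    then have 2: "f (\<i> *C c *C x) = - Im c * f x + Re c * f (\<i> *C x)"
      by (simp only: linear_add[OF f(1)] fR)
    show ?thesis by (simp add: \<xi>_def complex_eq_iff 1 2)
  qed
  have "\<xi> (r *\<^sub>R x) = r *\<^sub>R \<xi> x" for r x
    by (simp only: scaleR_scaleC[of r x] sc scaleR_conv_of_real)
  then have "bounded_linear \<xi>"
    by (intro bounded_linear_intro[where K=2]) (simp_all only: add bd mult.commute[of _ 2])
  moreover have "norm v \<le> cmod (\<xi> v)"
    using complex_Re_le_cmod[of "\<xi> v"] f(3) by (simp add: \<xi>_def)
  ultimately show ?thesis using bd sc by (auto simp: cfunctional_def)
qed

lemma cfunctional_eqI:
  fixes x y :: "'a::complex_banach"
  assumes "\<And>\<xi>. cfunctional \<xi> \<Longrightarrow> \<xi> x = \<xi> y"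
  shows "x = y"
proof -
  obtain \<xi> where \<xi>: "cfunctional \<xi>" "norm (x - y) \<le> cmod (\<xi> (x - y))"
    using norming_functional by blast
  have "\<xi> (x - y) = \<xi> x - \<xi> y"
    using \<xi>(1) by (simp add: cfunctional_def bounded_linear.linear linear_diff)
  then show ?thesis using \<xi> assms[OF \<xi>(1)] by simp
qed

section \<open>Improper integrals over the half-line\<close>

lemma has_integral_half_line:
  fixes F :: "real \<Rightarrow> 'a::banach"
  assumes cont: "continuous_on {0..} F"
    and der: "\<And>x. 0 < x \<Longrightarrow> (F has_vector_derivative f x) (at x)"
    and lim: "(F \<longlongrightarrow> I) at_top"
  shows "(f has_integral (I - F 0)) {0<..}"
proof -
  \<comment> \<open>On a bounded interval differentiability in the interior and continuity up to the
    ends suffice; leaving out the point 0 changes a null set.\<close>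
  have fin: "(f has_integral (F b - F 0)) {0<..b}" if "0 \<le> b" for b
  proof -
    have "(f has_integral (F b - F 0)) {0..b}"
      using that by (intro fundamental_theorem_of_calculus_interior der continuous_on_subset[OF cont]) auto
    moreover have "negligible {x \<in> {0..b} - {0<..b}. f x \<noteq> 0}"
      by (rule negligible_subset[of "{0}"]) auto
    moreover have "negligible {x \<in> {0<..b} - {0..b}. f x \<noteq> 0}"
      by (rule negligible_subset[of "{0}"]) auto
    ultimately show ?thesis using has_integral_spike_set_eq[of "{0..b}" "{0<..b}" f] by blast
  qed
  have nb: "\<nexists>a b. {0<..} = cbox a (b::real)"
  proof safe
    fix a b :: real assume *: "{0<..} = cbox a b"
    have "\<bar>b\<bar> + 1 \<in> {0<..}" by simp
    then show False unfolding * by auto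
  qed
  show ?thesis
  proof (subst has_integral_alt, subst if_not_P[OF nb], intro allI impI)
    fix e :: real assume "e > 0"
    then have "eventually (\<lambda>x. dist (F x) I < e) at_top" by (rule tendstoD[OF lim])
    then obtain B0 where B0: "\<And>x. x \<ge> B0 \<Longrightarrow> dist (F x) I < e" by (auto simp: eventually_at_top_linorder)
    \<comment> \<open>The ball is open and may miss its ends, so the interior points -B/2 and B/2
      are used; hence the doubling.\<close>
    define B where "B = 2 * (\<bar>B0\<bar> + 1)"
    show "\<exists>B>0. \<forall>a b. ball 0 B \<subseteq> cbox a b \<longrightarrow>
        (\<exists>z. ((\<lambda>x. if x \<in> {0<..} then f x else 0) has_integral z) (cbox a b) \<and> norm (z - (I - F 0)) < e)"
    proof (intro exI conjI allI impI)
      show "B > 0" by (simp add: B_def)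
      fix a b :: real assume sub: "ball 0 B \<subseteq> cbox a b"
      have "- (B/2) \<in> ball 0 B" "B/2 \<in> ball 0 B" by (auto simp: B_def dist_norm)
      then have "- (B/2) \<in> cbox a b" "B/2 \<in> cbox a b" using sub by blast+
      then have ab: "a \<le> - (B/2)" "b \<ge> B/2" by auto
      moreover have "B > 0" "B / 2 \<ge> B0" by (auto simp: B_def)
      ultimately have b: "b \<ge> B0" "b > 0" "a \<le> 0" by linarith+
      have "((\<lambda>x. if x \<in> {0<..b} then f x else 0) has_integral (F b - F 0)) (cbox a b)"
        using fin[of b] b by (subst has_integral_restrict) auto
      then show "((\<lambda>x. if x \<in> {0<..} then f x else 0) has_integral (F b - F 0)) (cbox a b)"
        by (rule has_integral_eq[rotated]) auto
      show "norm (F b - F 0 - (I - F 0)) < e" using B0[OF b(1)] by (simp add: dist_norm)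
    qed
  qed
qed

text \<open>The weight \<open>r * decay s r\<close> is comparable to \<open>min (r powr s) (r powr - s)\<close> and, unlike it, smooth;
  \<open>decay s\<close> has the antiderivative \<open>decay_int s\<close>.\<close>

definition decay :: "real \<Rightarrow> real \<Rightarrow> real" where
  "decay s r = r powr (s - 1) / (1 + r powr s)\<^sup>2"

definition decay_int :: "real \<Rightarrow> real \<Rightarrow> real" where
  "decay_int s r = r powr s / (1 + r powr s) / s"

lemma decay_nonneg: "0 \<le> decay s r"
  by (simp add: decay_def)

lemma one_plus_powr_neq_0 [simp]: "1 + (r::real) powr s \<noteq> 0"
  using powr_ge_zero[of r s] by linarith

lemma decay_int_deriv:
  assumes "0 < s" "0 < x"
  shows "(decay_int s has_vector_derivative decay s x) (at x)"
proof -
  define u v where "u = x powr s" and "v = x powr (s - 1)"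
  have "u \<ge> 0" by (simp add: u_def)
  then have nz: "1 + u \<noteq> 0" by linarith
  have d: "((\<lambda>x. x powr s) has_real_derivative s * v) (at x)"
    unfolding v_def using assms by (intro has_real_derivative_powr)
  have "((\<lambda>x. x powr s / (1 + x powr s) / s) has_real_derivative
      (s * v * (1 + u) - u * (0 + s * v)) / ((1 + u) * (1 + u)) / s) (at x)"
    unfolding u_def
    by (intro DERIV_cdivide DERIV_divide d DERIV_add DERIV_const) (use nz u_def in auto)
  moreover have "(s * v * (1 + u) - u * (0 + s * v)) / ((1 + u) * (1 + u)) / s = v / (1 + u)\<^sup>2"
  proof -
    have "s * v * (1 + u) - u * (0 + s * v) = s * v" by (simp add: algebra_simps)
    then show ?thesis using assms(1) by (simp add: power2_eq_square)
  qed
  ultimately have "(decay_int s has_real_derivative decay s x) (at x)"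
    by (simp add: decay_int_def[abs_def] decay_def u_def v_def)
  then show ?thesis by (simp add: has_real_derivative_iff_has_vector_derivative)
qed

lemma decay_int_0 [simp]: "decay_int s 0 = 0" by (simp add: decay_int_def)

lemma decay_int_cont: "0 < s \<Longrightarrow> continuous_on {0..} (decay_int s)"
  unfolding decay_int_def
  by (intro continuous_intros continuous_on_powr') auto

lemma decay_int_lim: "0 < s \<Longrightarrow> (decay_int s \<longlongrightarrow> 1 / s) at_top"
proof -
  assume s: "0 < s"
  then have "filterlim (\<lambda>r::real. r powr s) at_top at_top" by real_asymp
  then have "filterlim (\<lambda>r::real. 1 + r powr s) at_infinity at_top"
    by (intro filterlim_at_top_imp_at_infinity filterlim_tendsto_add_at_top[OF tendsto_const])
  then have "((\<lambda>r::real. (1 - 1 / (1 + r powr s)) / s) \<longlongrightarrow> (1 - 0) / s) at_top"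
    using s by (intro tendsto_intros tendsto_divide_0[OF tendsto_const]) auto
  moreover have "(\<lambda>r::real. (1 - 1 / (1 + r powr s)) / s) = decay_int s"
    by (rule ext) (simp add: decay_int_def diff_divide_eq_iff)
  ultimately show ?thesis by simp
qed

lemma decay_has_integral: "0 < s \<Longrightarrow> (decay s has_integral (1 / s)) {0<..}"
  using has_integral_half_line[OF decay_int_cont decay_int_deriv decay_int_lim, of s] by simp

lemma decay_cont: "continuous_on {0<..} (decay s)"
  unfolding decay_def
  by (intro continuous_intros) auto

text \<open>Fubini's theorem is applied to Lebesgue integrals, so the gauge integral of this
  nonnegative weight is converted once and for all.\<close>

lemma decay_set_integrable: "0 < s \<Longrightarrow> set_integrable lborel {0<..} (decay s)"
proof -
  assume "0 < s"
  then have "decay s absolutely_integrable_on {0<..}"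
    by (intro nonnegative_absolutely_integrable_1 decay_nonneg has_integral_integrable[OF decay_has_integral])
  moreover have "(\<lambda>x. indicator {0<..} x *\<^sub>R decay s x) \<in> borel_measurable lborel"
    using borel_measurable_continuous_on_indicator[OF _ decay_cont] by simp
  ultimately show ?thesis by (simp add: set_integrable_def integrable_completion)
qed

lemma antiderivative_pos:
  fixes f :: "real \<Rightarrow> 'a::banach"
  assumes f: "continuous_on {0<..} f"
  obtains F where "\<And>x. 0 < x \<Longrightarrow> (F has_vector_derivative f x) (at x)"
proof
  \<comment> \<open>One of the two intervals is always empty or a point, so this is the signed
    integral from 1 to x. The base point is 1 because f may be singular at 0.\<close>
  define F where "F x = integral {1..x} f - integral {x..1} f" for x
  fix x :: real assume x: "0 < x"
  \<comment> \<open>A point to the left of both x and 1: beyond it F is an indefinite integral from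
    \<open>a\<close> up to a constant.\<close>
  define a where "a = min (x/2) (1/2)"
  have a: "0 < a" "a < x" "a < 1" using x by (auto simp: a_def)
  have int: "f integrable_on {u..v}" if "0 < u" for u v
    using that by (intro integrable_continuous_real continuous_on_subset[OF f]) auto
  have eq: "F y = integral {a..y} f - integral {a..1} f" if "y > a" for y
  proof (cases "y \<le> 1")
    case True
    have "integral {a..y} f + integral {y..1} f = integral {a..1} f"
      by (rule Henstock_Kurzweil_Integration.integral_combine) (use True that a in \<open>auto intro: int\<close>)
    moreover have "integral {1..y} f = 0" using True by (cases "y = 1") auto
    ultimately show ?thesis by (simp add: F_def algebra_simps)
  next
    case False
    have "integral {a..1} f + integral {1..y} f = integral {a..y} f"
      by (rule Henstock_Kurzweil_Integration.integral_combine) (use False that a in \<open>auto intro: int\<close>)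
    then show ?thesis using False by (simp add: F_def algebra_simps)
  qed
  have "((\<lambda>y. integral {a..y} f) has_vector_derivative f x) (at x within {a..x+1})"
    using a by (intro integral_has_vector_derivative continuous_on_subset[OF f]) auto
  then have "((\<lambda>y. integral {a..y} f) has_vector_derivative f x) (at x)"
    using a by (simp add: at_within_Icc_at)
  then have "((\<lambda>y. integral {a..y} f - integral {a..1} f) has_vector_derivative f x) (at x)"
    by (auto intro!: derivative_eq_intros)
  then show "(F has_vector_derivative f x) (at x)"
    by (rule has_vector_derivative_transform_within_open[where S="{a<..}"]) (use a eq in auto)
qed

text \<open>\<open>F\<close> is Cauchy along the filter because \<open>G\<close> is, and the space
  is complete. In its uses \<open>G\<close> is, up to a constant factor, an antiderivative of a
  weight that controls the increments of \<open>F\<close>, and \<open>P\<close> restricts to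
  positive arguments.\<close>

lemma lipschitz_limit:
  fixes F :: "'b \<Rightarrow> 'a::banach" and G :: "'b \<Rightarrow> real"
  assumes G: "(G \<longlongrightarrow> l) flt" and nt: "flt \<noteq> bot" and P: "eventually P flt"
    and lip: "\<And>x y. P x \<Longrightarrow> P y \<Longrightarrow> norm (F x - F y) \<le> C * \<bar>G x - G y\<bar>"
  shows "\<exists>l'. (F \<longlongrightarrow> l') flt"
proof -
  have "cauchy_filter (filtermap F flt)"
  proof (subst cauchy_filter_metric_filtermap, intro allI impI)
    fix e :: real assume e: "e > 0"
    \<comment> \<open>Two values of \<open>G\<close> within d of the limit differ by less than 2 d;
      adding 1 to |C| keeps the denominator positive.\<close>
    define d where "d = e / (2 * (\<bar>C\<bar> + 1))"
    have d: "d > 0" using e by (simp add: d_def)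
    have "eventually (\<lambda>x. P x \<and> dist (G x) l < d) flt"
      using tendstoD[OF G d] P by eventually_elim auto
    moreover have "dist (F x) (F y) < e" if "P x" "dist (G x) l < d" "P y" "dist (G y) l < d" for x y
    proof -
      have "\<bar>G x - G y\<bar> < 2 * d" using that(2,4) by (simp add: dist_real_def)
      have "norm (F x - F y) \<le> C * \<bar>G x - G y\<bar>" by (rule lip[OF that(1,3)])
      also have "\<dots> \<le> \<bar>C\<bar> * \<bar>G x - G y\<bar>" by (intro mult_right_mono) auto
      also have "\<dots> \<le> \<bar>C\<bar> * (2 * d)" using \<open>\<bar>G x - G y\<bar> < 2 * d\<close> by (intro mult_left_mono) auto
      also have "\<dots> < (\<bar>C\<bar> + 1) * (2 * d)" using d by (intro mult_strict_right_mono) auto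
      also have "\<dots> = e" using abs_ge_zero[of C] by (simp add: d_def field_simps)
      finally show ?thesis by (simp add: dist_norm)
    qed
    ultimately show "\<exists>P. eventually P flt \<and> (\<forall>x y. P x \<and> P y \<longrightarrow> dist (F x) (F y) < e)" by blast
  qed
  moreover have "filtermap F flt \<noteq> bot" using nt by (simp add: filtermap_bot_iff)
  ultimately have "\<exists>x\<in>UNIV. filtermap F flt \<le> nhds x"
    using complete_UNIV[where 'a='a] unfolding complete_uniform by auto
  then show ?thesis by (auto simp: filterlim_def)
qed

text \<open>The increments of an antiderivative are at most \<open>C\<close> times those of
  \<open>decay_int s\<close>, which converges at both ends. Completeness gives the limits, and the
  limit at 0 is taken as the value there.\<close>

lemma half_line_antiderivative:
  fixes f :: "real \<Rightarrow> 'a::banach"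
  assumes f: "continuous_on {0<..} f" and s: "0 < s"
    and bd: "\<And>r. 0 < r \<Longrightarrow> norm (f r) \<le> C * decay s r"
  obtains F I where "continuous_on {0..} F" "\<And>x. 0 < x \<Longrightarrow> (F has_vector_derivative f x) (at x)"
    "(F \<longlongrightarrow> I) at_top"
proof -
  obtain F where F: "\<And>x. 0 < x \<Longrightarrow> (F has_vector_derivative f x) (at x)"
    using antiderivative_pos[OF f] by blast
  have le: "norm (F y - F x) \<le> C * (decay_int s y - decay_int s x)" if "0 < x" "x \<le> y" for x y
  proof -
    have "(f has_integral (F y - F x)) {x..y}"
      using that by (intro fundamental_theorem_of_calculus has_vector_derivative_at_within[OF F]) auto
    moreover have "(decay s has_integral (decay_int s y - decay_int s x)) {x..y}"
      using that s by (intro fundamental_theorem_of_calculus has_vector_derivative_at_within[OF decay_int_deriv]) auto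
    then have "((\<lambda>r. C * decay s r) has_integral (C * (decay_int s y - decay_int s x))) {x..y}"
      by (rule has_integral_mult_right)
    ultimately show ?thesis
      using integral_norm_bound_integral[of f "{x..y}" "\<lambda>r. C * decay s r"] that(1)
      by (auto simp: has_integral_iff bd)
  qed
  \<comment> \<open>The sign of C is not assumed; it follows from the bound at r = 1, where the
    weight is positive.\<close>
  have C: "0 \<le> C"
  proof -
    have "0 \<le> C * decay s 1" using bd[of 1] norm_ge_zero[of "f 1"] by linarith
    moreover have "decay s 1 > 0" by (simp add: decay_def)
    ultimately show ?thesis by (simp add: zero_le_mult_iff)
  qed
  have lip: "norm (F y - F x) \<le> C * \<bar>decay_int s y - decay_int s x\<bar>" if "0 < y" "0 < x" for x y
  proof (cases "x \<le> y")
    case True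
    have "norm (F y - F x) \<le> C * (decay_int s y - decay_int s x)" using le[OF that(2) True] .
    also have "\<dots> \<le> C * \<bar>decay_int s y - decay_int s x\<bar>" using C by (intro mult_left_mono) auto
    finally show ?thesis .
  next
    case False
    then have "norm (F x - F y) \<le> C * (decay_int s x - decay_int s y)" using le[OF that(1)] by simp
    also have "\<dots> \<le> C * \<bar>decay_int s y - decay_int s x\<bar>" using C by (intro mult_left_mono) auto
    finally show ?thesis by (simp add: norm_minus_commute)
  qed
  have "(decay_int s \<longlongrightarrow> decay_int s 0) (at 0 within {0..})"
    using decay_int_cont[OF s, unfolded continuous_on, rule_format, of 0] by simp
  then have G0: "(decay_int s \<longlongrightarrow> decay_int s 0) (at_right 0)"
    by (rule tendsto_mono[rotated]) (auto intro: at_le)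
  obtain l0 where l0: "(F \<longlongrightarrow> l0) (at_right 0)"
    using lipschitz_limit[OF G0 _ eventually_at_right_less lip] by auto
  obtain I where I: "(F \<longlongrightarrow> I) at_top"
    using lipschitz_limit[OF decay_int_lim[OF s] _ eventually_gt_at_top[of 0] lip] by auto
  define H where "H x = (if x \<le> 0 then l0 else F x)" for x
  have dH: "(H has_vector_derivative f x) (at x)" if "0 < x" for x
    by (rule has_vector_derivative_transform_within_open[OF F[OF that], where S="{0<..}"])
      (use that in \<open>auto simp: H_def\<close>)
  have "continuous (at x within {0..}) H" if "x \<ge> 0" for x
  proof (cases "x = 0")
    case True
    have "(H \<longlongrightarrow> l0) (at_right 0)"
      by (rule Lim_transform_eventually[OF l0]) (auto simp: H_def eventually_at_filter)
    moreover have "{0..} - {0} = {0<..} - {0::real}" by auto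
    then have "at 0 within {0..} = at_right (0::real)" by (simp add: at_within_def)
    ultimately show ?thesis by (simp add: continuous_within H_def True)
  next
    case False
    then show ?thesis
      using continuous_at_imp_continuous_within[OF has_vector_derivative_continuous[OF dH[of x]]] that by auto
  qed
  then have "continuous_on {0..} H" by (simp add: continuous_on_eq_continuous_within)
  moreover have "(H \<longlongrightarrow> I) at_top"
    by (rule Lim_transform_eventually[OF I]) (auto simp: H_def intro: eventually_mono[OF eventually_gt_at_top[of 0]])
  ultimately show ?thesis using dH that by blast
qed

text \<open>All three claims are read off one antiderivative F. In particular the dilation rule is
  no change of variables under the integral: F(t x) / t is an antiderivative of f(t r).\<close>

lemma half_line_integral:
  fixes f :: "real \<Rightarrow> 'a::banach"
  assumes f: "continuous_on {0<..} f" and s: "0 < s"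
    and bd: "\<And>r. 0 < r \<Longrightarrow> norm (f r) \<le> C * decay s r"
  shows "f integrable_on {0<..}" "norm (integral {0<..} f) \<le> C / s"
    "0 < t \<Longrightarrow> ((\<lambda>r. f (t * r)) has_integral ((1 / t) *\<^sub>R integral {0<..} f)) {0<..}"
proof -
  obtain F I where F: "continuous_on {0..} F" "\<And>x. 0 < x \<Longrightarrow> (F has_vector_derivative f x) (at x)"
    "(F \<longlongrightarrow> I) at_top" using half_line_antiderivative[OF assms] by metis
  have int: "(f has_integral (I - F 0)) {0<..}" by (rule has_integral_half_line[OF F])
  then show ii: "f integrable_on {0<..}" by blast
  have "((\<lambda>r. C * decay s r) has_integral (C * (1 / s))) {0<..}"
    by (intro has_integral_mult_right decay_has_integral s)
  then show "norm (integral {0<..} f) \<le> C / s"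
    using integral_norm_bound_integral[OF ii, of "\<lambda>r. C * decay s r"] bd by (auto simp: has_integral_iff)
  assume t: "0 < t"
  define G where "G x = (1 / t) *\<^sub>R F (t * x)" for x
  have "(f \<circ> (\<lambda>r. t * r) has_integral ((1/t) *\<^sub>R I - G 0)) {0<..}"
  proof (rule has_integral_half_line)
    show "continuous_on {0..} G" unfolding G_def
      using t by (intro continuous_intros continuous_on_compose2[OF F(1)]) auto
    show "(G has_vector_derivative (f \<circ> (\<lambda>r. t * r)) x) (at x)" if "0 < x" for x
    proof -
      have "((\<lambda>x. t * x) has_vector_derivative t) (at x)"
        by (auto intro!: derivative_eq_intros)
      then have "((F \<circ> (\<lambda>x. t * x)) has_vector_derivative (t *\<^sub>R f (t * x))) (at x)"
        by (rule vector_diff_chain_at) (use F(2) t that in auto)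
      then have "((\<lambda>x. (1/t) *\<^sub>R (F \<circ> (\<lambda>x. t * x)) x) has_vector_derivative ((1/t) *\<^sub>R t *\<^sub>R f (t * x))) (at x)"
        by (rule bounded_linear.has_vector_derivative[OF bounded_linear_scaleR_right])
      then show ?thesis using t by (simp add: G_def[abs_def])
    qed
    have "filterlim (\<lambda>x. t * x) at_top at_top" using t by real_asymp
    then show "(G \<longlongrightarrow> (1/t) *\<^sub>R I) at_top" unfolding G_def
      by (intro tendsto_intros filterlim_compose[OF F(3)])
  qed
  moreover have "(1/t) *\<^sub>R I - G 0 = (1/t) *\<^sub>R integral {0<..} f"
    using int by (simp add: G_def has_integral_iff scaleR_diff_right)
  ultimately show "((\<lambda>r. f (t * r)) has_integral ((1 / t) *\<^sub>R integral {0<..} f)) {0<..}"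
    by (simp add: o_def)
qed

text \<open>The kernel, extended by 0 off S x T, is dominated by a product of integrable functions
  and hence Lebesgue integrable on the plane. The integrability of both outer integrands is recorded
  because sums of such integrals have to be split later.\<close>

lemma integral_swap_dominated:
  fixes K :: "real \<Rightarrow> real \<Rightarrow> complex"
  assumes S: "S \<in> sets borel" and T: "T \<in> sets borel"
    and K: "continuous_on (S \<times> T) (\<lambda>(r, s). K r s)"
    and bd: "\<And>r s. r \<in> S \<Longrightarrow> s \<in> T \<Longrightarrow> cmod (K r s) \<le> a r * b s"
    and a: "set_integrable lborel S a" and b: "set_integrable lborel T b"
  shows "integral S (\<lambda>r. integral T (K r)) = integral T (\<lambda>s. integral S (\<lambda>r. K r s))"
    and "(\<lambda>r. integral T (K r)) integrable_on S" and "(\<lambda>s. integral S (\<lambda>r. K r s)) integrable_on T"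
proof -
  define K' where "K' = (\<lambda>(r, s). indicator (S \<times> T) (r, s) *\<^sub>R K r s)"
  define a' where "a' r = indicator S r *\<^sub>R a r" for r
  define b' where "b' s = indicator T s *\<^sub>R b s" for s
  have a': "integrable lborel a'" and b': "integrable lborel b'"
    using a b by (simp_all add: set_integrable_def a'_def[abs_def] b'_def[abs_def])
  have [measurable]: "a' \<in> borel_measurable borel" "b' \<in> borel_measurable borel"
    using a' b' by auto
  have ab: "integrable (lborel \<Otimes>\<^sub>M lborel) (\<lambda>(r, s). a' r * b' s)"
  proof (rule lborel_pair.Fubini_integrable)
    show "(\<lambda>(r, s). a' r * b' s) \<in> borel_measurable (lborel \<Otimes>\<^sub>M lborel)" by measurable
    show "integrable lborel (\<lambda>x. \<integral>y. norm (case (x, y) of (r, s) \<Rightarrow> a' r * b' s) \<partial>lborel)"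
      using a' by (simp add: abs_mult)
    show "AE x in lborel. integrable lborel (\<lambda>y. case (x, y) of (r, s) \<Rightarrow> a' r * b' s)"
      using b' by simp
  qed
  have "S \<times> T \<in> sets (borel \<Otimes>\<^sub>M borel)" using S T by auto
  then have ST: "S \<times> T \<in> sets borel" by (simp only: borel_prod)
  have "(\<lambda>p. indicator (S \<times> T) p *\<^sub>R (case p of (r, s) \<Rightarrow> K r s)) \<in> borel_measurable borel"
    by (rule borel_measurable_continuous_on_indicator[OF ST K])
  then have K'm: "K' \<in> borel_measurable (lborel \<Otimes>\<^sub>M lborel)"
    by (simp add: K'_def split_def lborel_prod)
  have K'i: "integrable (lborel \<Otimes>\<^sub>M lborel) K'"
  proof (rule Bochner_Integration.integrable_bound[OF ab K'm])
    have "norm (K' (r, s)) \<le> norm (a' r * b' s)" for r s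
    proof (cases "r \<in> S \<and> s \<in> T")
      case True
      then show ?thesis using bd[of r s] by (simp add: K'_def a'_def b'_def)
    qed (auto simp: K'_def)
    then show "AE x in lborel \<Otimes>\<^sub>M lborel. norm (K' x) \<le> norm (case x of (r, s) \<Rightarrow> a' r * b' s)"
      by (auto simp: split_def)
  qed
  have cont1: "continuous_on T (K r)" if "r \<in> S" for r
    using that by (intro continuous_on_compose2[OF K, of T "\<lambda>s. (r, s)", simplified] continuous_intros) auto
  have cont2: "continuous_on S (\<lambda>r. K r s)" if "s \<in> T" for s
    using that by (intro continuous_on_compose2[OF K, of S "\<lambda>r. (r, s)", simplified] continuous_intros) auto
  \<comment> \<open>On S the section is majorised by a multiple of b', so its Lebesgue and gauge
    integrals agree; off S both sides vanish.\<close>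
  have inner1: "(\<integral>s. K' (r, s) \<partial>lborel) = indicator S r *\<^sub>R integral T (K r)" for r
  proof (cases "r \<in> S")
    case True
    have "set_integrable lborel T (K r)"
      unfolding set_integrable_def
    proof (rule Bochner_Integration.integrable_bound[OF integrable_mult_right[OF b', of "a r"]])
      show "(\<lambda>x. indicator T x *\<^sub>R K r x) \<in> borel_measurable lborel"
        using borel_measurable_continuous_on_indicator[OF T cont1[OF True]] by simp
    qed (use bd[OF True] in \<open>auto simp: b'_def indicator_def intro!: order_trans[OF _ abs_ge_self]\<close>)
    from set_borel_integral_eq_integral(2)[OF this]
    show ?thesis using True by (simp add: K'_def set_lebesgue_integral_def indicator_times)
  qed (simp add: K'_def)
  have inner2: "(\<integral>r. K' (r, s) \<partial>lborel) = indicator T s *\<^sub>R integral S (\<lambda>r. K r s)" for s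
  proof (cases "s \<in> T")
    case True
    have "set_integrable lborel S (\<lambda>r. K r s)"
      unfolding set_integrable_def
    proof (rule Bochner_Integration.integrable_bound[OF integrable_mult_left[OF a', of "b s"]])
      show "(\<lambda>x. indicator S x *\<^sub>R K x s) \<in> borel_measurable lborel"
        using borel_measurable_continuous_on_indicator[OF S cont2[OF True]] by simp
    qed (use bd[OF _ True] in \<open>auto simp: a'_def indicator_def intro!: order_trans[OF _ abs_ge_self]\<close>)
    from set_borel_integral_eq_integral(2)[OF this]
    show ?thesis using True by (simp add: K'_def set_lebesgue_integral_def indicator_times)
  qed (simp add: K'_def)
  have i1: "integrable lborel (\<lambda>r. \<integral>s. K' (r, s) \<partial>lborel)"
    using lborel_pair.integrable_fst'[OF K'i] by simp
  have i2: "integrable lborel (\<lambda>s. \<integral>r. K' (r, s) \<partial>lborel)"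
    using lborel_pair.integrable_snd[of "\<lambda>r s. K' (r, s)"] K'i by simp
  have "integral S (\<lambda>r. integral T (K r)) = (\<integral>r. (\<integral>s. K' (r, s) \<partial>lborel) \<partial>lborel)"
    using set_borel_integral_eq_integral(2)[of S "\<lambda>r. integral T (K r)"] i1
    by (simp add: inner1 set_integrable_def set_lebesgue_integral_def)
  also have "\<dots> = (\<integral>s. (\<integral>r. K' (r, s) \<partial>lborel) \<partial>lborel)"
    using lborel_pair.Fubini_integral[of "\<lambda>r s. K' (r, s)"] K'i by simp
  also have "\<dots> = integral T (\<lambda>s. integral S (\<lambda>r. K r s))"
    using set_borel_integral_eq_integral(2)[of T "\<lambda>s. integral S (\<lambda>r. K r s)"] i2
    by (simp add: inner2 set_integrable_def set_lebesgue_integral_def)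
  finally show "integral S (\<lambda>r. integral T (K r)) = integral T (\<lambda>s. integral S (\<lambda>r. K r s))" .
  show "(\<lambda>r. integral T (K r)) integrable_on S"
    using set_borel_integral_eq_integral(1)[of S "\<lambda>r. integral T (K r)"] i1
    by (simp add: inner1 set_integrable_def)
  show "(\<lambda>s. integral S (\<lambda>r. K r s)) integrable_on T"
    using set_borel_integral_eq_integral(1)[of T "\<lambda>s. integral S (\<lambda>r. K r s)"] i2
    by (simp add: inner2 set_integrable_def)
qed

section \<open>Estimates for the decay weight\<close>

lemma times_decay_eq: "0 < r \<Longrightarrow> r * decay s r = r powr s / (1 + r powr s)\<^sup>2"
  by (simp add: decay_def powr_diff)

lemma decay_1: "0 < r \<Longrightarrow> decay 1 r = 1 / (1 + r)\<^sup>2"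
  by (simp add: decay_def)

lemma decay_pos: "0 < r \<Longrightarrow> 0 < decay s r"
  using one_plus_powr_neq_0[of r s] by (simp add: decay_def)

lemma frac_le_min: "0 < u \<Longrightarrow> u / (1 + u)\<^sup>2 \<le> min u (1 / u)" for u :: real
proof -
  assume u: "0 < u"
  have "1 \<le> (1 + u)\<^sup>2" using u by (simp add: power2_eq_square algebra_simps)
  then have "u / (1 + u)\<^sup>2 \<le> u / 1" using u by (intro divide_left_mono) auto
  moreover have "u * u \<le> (1 + u)\<^sup>2" using u by (simp add: power2_eq_square algebra_simps)
  then have "u / (1 + u)\<^sup>2 \<le> 1 / u" using u by (simp add: field_simps)
  ultimately show ?thesis by simp
qed

text \<open>1 + u is at most twice the larger of 1 and u; squaring gives the constant 4.\<close>

lemma min_le_frac: "0 < u \<Longrightarrow> min u (1 / u) \<le> 4 * (u / (1 + u)\<^sup>2)" for u :: real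
proof -
  assume u: "0 < u"
  show ?thesis
  proof (cases "u \<le> 1")
    case True
    then have "(1 + u)\<^sup>2 \<le> 2\<^sup>2" using u by (intro power_mono) auto
    then have "u * (1 + u)\<^sup>2 \<le> u * 4" using u by (intro mult_left_mono) auto
    then have "u \<le> 4 * (u / (1 + u)\<^sup>2)" using u by (simp add: field_simps)
    then show ?thesis by simp
  next
    case False
    then have "(1 + u)\<^sup>2 \<le> (2 * u)\<^sup>2" using u by (intro power_mono) auto
    then have "1 / u \<le> 4 * (u / (1 + u)\<^sup>2)" using u by (simp add: field_simps power2_eq_square)
    then show ?thesis by simp
  qed
qed

lemma times_decay_le_min: "0 < r \<Longrightarrow> r * decay s r \<le> min (r powr s) (r powr - s)"
  using frac_le_min[of "r powr s"] by (simp add: times_decay_eq powr_minus_divide)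

lemma min_le_times_decay: "0 < r \<Longrightarrow> min (r powr s) (r powr - s) \<le> 4 * (r * decay s r)"
  using min_le_frac[of "r powr s"] by (simp add: times_decay_eq powr_minus_divide)

lemma min_powr_le_1: "0 < r \<Longrightarrow> 0 < s \<Longrightarrow> min (r powr s) (r powr - s) \<le> (1::real)"
proof -
  assume r: "0 < r" "0 < s"
  show ?thesis
  proof (cases "r \<le> 1")
    case True then show ?thesis using r powr_le1[of s r] by simp
  next
    case False
    then have "r powr - s \<le> 1" using r ge_one_powr_ge_zero[of r s] by (simp add: powr_minus_divide)
    then show ?thesis by simp
  qed
qed

lemma times_decay_le_1: "0 < r \<Longrightarrow> 0 < s \<Longrightarrow> r * decay s r \<le> 1"
  using times_decay_le_min[of r s] min_powr_le_1[of r s] by linarith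

text \<open>A larger exponent means faster decay at both ends; the factor 4 is lost in returning
  from \<open>min (r powr s) (r powr - s)\<close> to the weight. It lets functions with different
  exponents share the smaller one.\<close>

lemma times_decay_mono:
  assumes "0 < r" "0 < s'" "s' \<le> s"
  shows "r * decay s r \<le> 4 * (r * decay s' r)"
proof -
  have "min (r powr s) (r powr - s) \<le> min (r powr s') (r powr - s')"
  proof (cases "r \<le> 1")
    case True
    then have "r powr s \<le> r powr s'" using assms by (intro powr_mono') auto
    moreover have "r powr s' \<le> 1" using assms True by (intro powr_le1) auto
    moreover have "1 \<le> r powr - s'" using \<open>r powr s' \<le> 1\<close> assms(1) by (simp add: powr_minus_divide)
    ultimately show ?thesis by linarith
  next
    case False
    then have "r powr - s \<le> r powr - s'" using assms by (intro powr_mono) auto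
    moreover have "1 \<le> r powr s'" using assms False by (intro ge_one_powr_ge_zero) auto
    moreover have "r powr - s' \<le> 1" using \<open>1 \<le> r powr s'\<close> assms(1) by (simp add: powr_minus_divide divide_le_eq)
    ultimately show ?thesis by linarith
  qed
  then show ?thesis using times_decay_le_min[of r s] min_le_times_decay[of r s'] assms by linarith
qed

lemma decay_mono:
  assumes "0 < r" "0 < s'" "s' \<le> s"
  shows "decay s r \<le> 4 * decay s' r"
  using times_decay_mono[OF assms] mult_le_cancel_left_pos[OF assms(1), of "decay s r" "4 * decay s' r"]
  by (simp add: mult.left_commute)

lemma times_decay_lim_0: "0 < s \<Longrightarrow> ((\<lambda>r. r * decay s r) \<longlongrightarrow> 0) (at_right 0)"
proof -
  assume s: "0 < s"
  have "((\<lambda>r::real. r powr s) \<longlongrightarrow> 0) (at_right 0)" using s by real_asymp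
  then show ?thesis
  proof (rule Lim_null_comparison[rotated])
    show "\<forall>\<^sub>F r in at_right 0. norm (r * decay s r) \<le> r powr s"
      using eventually_at_right_less[of 0]
    proof eventually_elim
      case (elim r)
      then show ?case using times_decay_le_min[of r s] decay_nonneg[of s r] by simp
    qed
  qed
qed

lemma times_decay_lim_top: "0 < s \<Longrightarrow> ((\<lambda>r. r * decay s r) \<longlongrightarrow> 0) at_top"
proof -
  assume s: "0 < s"
  have "((\<lambda>r::real. r powr - s) \<longlongrightarrow> 0) at_top" using s by real_asymp
  then show ?thesis
  proof (rule Lim_null_comparison[rotated])
    show "\<forall>\<^sub>F r in at_top. norm (r * decay s r) \<le> r powr - s"
      using eventually_gt_at_top[of "0::real"]
    proof eventually_elim
      case (elim r)
      then show ?case using times_decay_le_min[of r s] decay_nonneg[of s r] by simp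
    qed
  qed
qed

section \<open>Cauchy's theorem on sectors\<close>

lemma ray_integral_complex:
  fixes f :: "complex \<Rightarrow> complex"
  shows "ray_integral \<theta> f = integral {0<..} (\<lambda>r. cis \<theta> * f (of_real r * cis \<theta>))"
  by (simp add: ray_integral_def scaleC_complex_def)

lemma exp_log_polar: "0 < r \<Longrightarrow> exp (of_real (ln r) + \<i> * of_real \<theta>) = of_real r * cis \<theta>"
  by (simp add: exp_add cis_conv_exp exp_of_real)

text \<open>The logarithm straightens the angular region to a convex strip, where exp w f(exp w) has
  a primitive. Rays become horizontal lines, so both integrals are differences of limits of one
  primitive. On the vertical segment joining the two lines at ln r the primitive changes by at most
  a multiple of \<open>r * decay s r\<close>, which tends to 0 at both ends.\<close>

lemma ray_integral_rotate:
  fixes f :: "complex \<Rightarrow> complex"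
  assumes \<alpha>: "a < \<alpha>" "\<alpha> < b" and \<beta>: "a < \<beta>" "\<beta> < b" and s: "0 < s"
    and hol: "\<And>r \<theta>. 0 < r \<Longrightarrow> a < \<theta> \<Longrightarrow> \<theta> < b \<Longrightarrow> f field_differentiable (at (of_real r * cis \<theta>))"
    and bd: "\<And>r \<theta>. 0 < r \<Longrightarrow> a < \<theta> \<Longrightarrow> \<theta> < b \<Longrightarrow> cmod (f (of_real r * cis \<theta>)) \<le> C * decay s r"
  shows "ray_integral \<alpha> f = ray_integral \<beta> f"
proof -
  define S where "S = {w. a < Im w} \<inter> {w. Im w < b}"
  have "open S" "convex S" unfolding S_def
    by (auto intro!: open_Int open_halfspace_Im_gt open_halfspace_Im_lt convex_Int
        convex_halfspace_Im_gt convex_halfspace_Im_lt)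
  define h where "h w = exp w * f (exp w)" for w
  have polar: "exp w = of_real (exp (Re w)) * cis (Im w)" for w
    by (simp add: exp_eq_polar)
  have "h field_differentiable (at w)" if "w \<in> S" for w
  proof -
    have "f field_differentiable (at (exp w))"
      using hol[of "exp (Re w)" "Im w"] that by (simp add: polar S_def)
    then have "(f \<circ> exp) field_differentiable (at w)"
      by (intro field_differentiable_compose) (auto simp: field_differentiable_within_exp)
    then show ?thesis unfolding h_def[abs_def]
      by (intro field_differentiable_mult field_differentiable_within_exp) (simp add: o_def)
  qed
  then have "h holomorphic_on S"
    by (simp add: holomorphic_on_def field_differentiable_at_within)
  from holomorphic_convex_primitive'[OF \<open>convex S\<close> \<open>open S\<close> this]
  obtain H where H: "\<And>w. w \<in> S \<Longrightarrow> (H has_field_derivative h w) (at w within S)" by blast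
  have H': "(H has_field_derivative h w) (at w)" if "w \<in> S" for w
    using H[OF that] by (simp only: at_within_open[OF that \<open>open S\<close>])
  \<comment> \<open>The primitive read along the ray of angle \<theta>, with the modulus as
    parameter; the derivative 1/r of ln r cancels the modulus of exp w.\<close>
  define P where "P \<theta> r = H (of_real (ln r) + \<i> * of_real \<theta>)" for \<theta> r
  have P: "(P \<theta> has_vector_derivative cis \<theta> * f (of_real r * cis \<theta>)) (at r)"
    if "0 < r" "a < \<theta>" "\<theta> < b" for r \<theta>
  proof -
    have in_S: "of_real (ln r) + \<i> * of_real \<theta> \<in> S" using that by (simp add: S_def)
    have "((\<lambda>r. of_real (ln r) + \<i> * of_real \<theta>) has_vector_derivative (of_real (1/r) + 0 :: complex)) (at r)"
      using that(1)
      by (intro has_vector_derivative_add has_vector_derivative_const has_vector_derivative_of_real)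
        (auto intro!: derivative_eq_intros)
    from field_vector_diff_chain_at[OF this H'[OF in_S]]
    have "(P \<theta> has_vector_derivative (of_real (1/r) * h (of_real (ln r) + \<i> * of_real \<theta>))) (at r)"
      by (simp add: P_def[abs_def] o_def)
    moreover have "of_real (1/r) * h (of_real (ln r) + \<i> * of_real \<theta>) = cis \<theta> * f (of_real r * cis \<theta>)"
      using that(1) unfolding h_def exp_log_polar[OF that(1)] by simp
    ultimately show ?thesis by simp
  qed
  have ray: "\<exists>J0 J1. ray_integral \<theta> f = J1 - J0 \<and> (P \<theta> \<longlongrightarrow> J1) at_top \<and> (P \<theta> \<longlongrightarrow> J0) (at_right 0)"
    if \<theta>: "a < \<theta>" "\<theta> < b" for \<theta>
  proof -
    have "continuous (at r) (\<lambda>r. cis \<theta> * f (of_real r * cis \<theta>))" if "0 < r" for r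
    proof -
      have "isCont f (of_real r * cis \<theta>)"
        by (intro field_differentiable_imp_continuous_at hol that \<theta>)
      then show ?thesis
        by (intro continuous_intros continuous_at_compose[of r "\<lambda>r. of_real r * cis \<theta>" f, unfolded o_def])
    qed
    then have cont: "continuous_on {0<..} (\<lambda>r. cis \<theta> * f (of_real r * cis \<theta>))"
      by (auto intro!: continuous_at_imp_continuous_on)
    have "norm (cis \<theta> * f (of_real r * cis \<theta>)) \<le> C * decay s r" if "0 < r" for r
      using bd[OF that \<theta>] by (simp add: norm_mult)
    from half_line_antiderivative[OF cont s this]
    obtain F I where F: "continuous_on {0..} F"
      "\<And>x. 0 < x \<Longrightarrow> (F has_vector_derivative cis \<theta> * f (of_real x * cis \<theta>)) (at x)"
      "(F \<longlongrightarrow> I) at_top" by metis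
    \<comment> \<open>On the ray \<open>P \<theta>\<close> and the antiderivative F from the decay
      estimate differ by a constant, so \<open>P \<theta>\<close> inherits the limits at 0 and at
      infinity.\<close>
    have "\<exists>c. \<forall>x\<in>{0<..}. P \<theta> x - F x = c"
    proof (rule has_vector_derivative_zero_constant)
      fix x :: real assume "x \<in> {0<..}"
      then have "((\<lambda>x. P \<theta> x - F x) has_vector_derivative 0) (at x)"
        using has_vector_derivative_diff[OF P[of x \<theta>] F(2)[of x]] \<theta> by simp
      then show "((\<lambda>x. P \<theta> x - F x) has_vector_derivative 0) (at x within {0<..})"
        by (rule has_vector_derivative_at_within)
    qed auto
    then obtain c where c: "\<And>x. 0 < x \<Longrightarrow> P \<theta> x = F x + c" by (auto simp: algebra_simps)
    have "(F \<longlongrightarrow> F 0) (at 0 within {0..})"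
      using F(1)[unfolded continuous_on, rule_format, of 0] by simp
    then have F0: "(F \<longlongrightarrow> F 0) (at_right 0)"
      by (rule tendsto_mono[rotated]) (auto intro: at_le)
    have "(P \<theta> \<longlongrightarrow> F 0 + c) (at_right 0)"
      by (rule Lim_transform_eventually[OF tendsto_add[OF F0 tendsto_const[of c]]])
        (auto simp: c eventually_at_filter)
    moreover have "(P \<theta> \<longlongrightarrow> I + c) at_top"
      by (rule Lim_transform_eventually[OF tendsto_add[OF F(3) tendsto_const[of c]]])
        (auto simp: c intro: eventually_mono[OF eventually_gt_at_top[of 0]])
    moreover have "ray_integral \<theta> f = I - F 0"
      unfolding ray_integral_complex by (intro integral_unique has_integral_half_line[OF F])
    ultimately show ?thesis by (intro exI[of _ "F 0 + c"] exI[of _ "I + c"]) auto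
  qed
  \<comment> \<open>On the segment Re w = ln r the derivative of H is at most r |C|
    \<open>decay s r\<close>, and the segment has length |\<alpha> - \<beta>|.\<close>
  have near: "cmod (P \<alpha> r - P \<beta> r) \<le> \<bar>C\<bar> * \<bar>\<alpha> - \<beta>\<bar> * (r * decay s r)" if r: "0 < r" for r
  proof -
    define T where "T = {w. Re w = ln r} \<inter> S"
    have "convex {w. Re w = ln r}"
      using convex_hyperplane[of "1::complex" "ln r"] by simp
    then have "convex T" unfolding T_def by (rule convex_Int[OF _ \<open>convex S\<close>])
    have "cmod (H (of_real (ln r) + \<i> * of_real \<alpha>) - H (of_real (ln r) + \<i> * of_real \<beta>))
        \<le> (r * (\<bar>C\<bar> * decay s r)) * cmod ((of_real (ln r) + \<i> * of_real \<alpha>) - (of_real (ln r) + \<i> * of_real \<beta>))"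
    proof (rule field_differentiable_bound[OF \<open>convex T\<close>])
      fix w assume w: "w \<in> T"
      then show "(H has_field_derivative h w) (at w within T)"
        by (intro has_field_derivative_at_within[OF H']) (simp add: T_def)
      have e: "exp w = of_real r * cis (Im w)" using w r by (simp add: polar T_def)
      have "cmod (h w) = r * cmod (f (of_real r * cis (Im w)))"
        using r by (simp add: h_def e norm_mult)
      also have "\<dots> \<le> r * (C * decay s r)"
        using w r by (intro mult_left_mono bd) (auto simp: T_def S_def)
      also have "\<dots> \<le> r * (\<bar>C\<bar> * decay s r)"
        using r by (intro mult_left_mono mult_right_mono decay_nonneg) auto
      finally show "cmod (h w) \<le> r * (\<bar>C\<bar> * decay s r)" .
    qed (use \<alpha> \<beta> in \<open>auto simp: T_def S_def\<close>)
    moreover have "cmod ((of_real (ln r) + \<i> * of_real \<alpha>) - (of_real (ln r) + \<i> * of_real \<beta>)) = \<bar>\<alpha> - \<beta>\<bar>"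
    proof -
      have "(of_real (ln r) + \<i> * of_real \<alpha>) - (of_real (ln r) + \<i> * of_real \<beta>) = \<i> * of_real (\<alpha> - \<beta>)"
        by (simp add: algebra_simps)
      then show ?thesis by (simp only: norm_mult norm_ii norm_of_real mult_1)
    qed
    ultimately show ?thesis by (simp add: P_def mult_ac)
  qed
  obtain J0 J1 where J: "ray_integral \<alpha> f = J1 - J0" "(P \<alpha> \<longlongrightarrow> J1) at_top" "(P \<alpha> \<longlongrightarrow> J0) (at_right 0)"
    using ray[OF \<alpha>] by blast
  obtain L0 L1 where L: "ray_integral \<beta> f = L1 - L0" "(P \<beta> \<longlongrightarrow> L1) at_top" "(P \<beta> \<longlongrightarrow> L0) (at_right 0)"
    using ray[OF \<beta>] by blast
  have "((\<lambda>r. P \<alpha> r - P \<beta> r) \<longlongrightarrow> 0) at_top"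
    by (rule Lim_null_comparison[OF _ tendsto_mult_right_zero[OF times_decay_lim_top[OF s], of "\<bar>C\<bar> * \<bar>\<alpha> - \<beta>\<bar>"]])
      (rule eventually_mono[OF eventually_gt_at_top[of 0] near])
  moreover have "((\<lambda>r. P \<alpha> r - P \<beta> r) \<longlongrightarrow> 0) (at_right 0)"
    by (rule Lim_null_comparison[OF _ tendsto_mult_right_zero[OF times_decay_lim_0[OF s], of "\<bar>C\<bar> * \<bar>\<alpha> - \<beta>\<bar>"]])
      (rule eventually_mono[OF eventually_at_right_less[of 0] near])
  ultimately have "J1 - L1 = 0" "J0 - L0 = 0"
    using tendsto_unique[OF _ tendsto_diff[OF J(2) L(2)]] tendsto_unique[OF _ tendsto_diff[OF J(3) L(3)]]
    by simp_all
  then show ?thesis using J(1) L(1) by simp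
qed

section \<open>Geometry of sectors in polar coordinates\<close>

lemma Arg_polar: "0 < r \<Longrightarrow> - pi < \<theta> \<Longrightarrow> \<theta> \<le> pi \<Longrightarrow> Arg (of_real r * cis \<theta>) = \<theta>"
  by (rule Arg_unique[of r]) (auto simp: cis_conv_exp)

lemma polar_in_sector:
  "0 < r \<Longrightarrow> \<bar>\<theta>\<bar> < \<phi> \<Longrightarrow> \<phi> \<le> pi \<Longrightarrow> of_real r * cis \<theta> \<in> sector \<phi>"
  unfolding sector_def mem_Collect_eq by (subst Arg_polar) auto

lemma polar_form: "z = of_real (cmod z) * cis (Arg z)"
  using rcis_cmod_Arg[of z] by (simp add: rcis_def)

lemma sector_polarE:
  assumes "z \<in> sector \<phi>"
  obtains r \<theta> where "0 < r" "\<bar>\<theta>\<bar> < \<phi>" "z = of_real r * cis \<theta>" "cmod z = r" "\<theta> = Arg z"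
proof (rule that)
  show "z = of_real (cmod z) * cis (Arg z)" by (rule polar_form)
  show "0 < cmod z" "\<bar>Arg z\<bar> < \<phi>" using assms by (simp_all add: sector_def)
qed (rule refl)+

lemma open_sector: "\<phi> \<le> pi \<Longrightarrow> open (sector \<phi>)"
proof -
  assume \<phi>: "\<phi> \<le> pi"
  have *: "sector \<phi> = (- \<real>\<^sub>\<le>\<^sub>0) \<inter> Arg -` {- \<phi><..<\<phi>}"
  proof (intro equalityI subsetI)
    fix z assume z: "z \<in> sector \<phi>"
    then have "z \<noteq> 0" "Arg z \<noteq> pi" using \<phi> by (auto simp: sector_def)
    then have "z \<notin> \<real>\<^sub>\<le>\<^sub>0" using Arg_eq_pi_iff[of z] by (auto simp: complex_nonpos_Reals_iff complex_is_Real_iff complex_eq_iff)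
    then show "z \<in> (- \<real>\<^sub>\<le>\<^sub>0) \<inter> Arg -` {- \<phi><..<\<phi>}" using z by (auto simp: sector_def abs_less_iff)
  qed (auto simp: sector_def)
  have "open (- (\<real>\<^sub>\<le>\<^sub>0 :: complex set))" by (simp add: closed_nonpos_Reals_complex open_Compl)
  moreover have "continuous_on (- \<real>\<^sub>\<le>\<^sub>0) Arg" by (auto intro!: continuous_at_imp_continuous_on continuous_at_Arg)
  ultimately show ?thesis unfolding * by (intro continuous_open_preimage) auto
qed

text \<open>By the law of cosines the squared distance is at least r^2 + t^2 - 2 r t \<kappa>, and
  this exceeds (1 - \<kappa>)/2 (r + t)^2 by (1 + \<kappa>)/2 (r - t)^2.\<close>

lemma norm_diff_polar_ge:
  assumes "cos (\<alpha> - \<beta>) \<le> \<kappa>" "0 \<le> r" "0 \<le> t"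
  shows "sqrt ((1 - \<kappa>) / 2) * (r + t) \<le> cmod (of_real r * cis \<alpha> - of_real t * cis \<beta>)"
proof -
  define z where "z = of_real r * cis \<alpha> - of_real t * cis \<beta>"
  have k: "- 1 \<le> \<kappa>" using assms(1) cos_ge_minus_one[of "\<alpha> - \<beta>"] by linarith
  have "(cmod z)\<^sup>2 = (r * cos \<alpha> - t * cos \<beta>)\<^sup>2 + (r * sin \<alpha> - t * sin \<beta>)\<^sup>2"
    by (simp add: z_def cmod_power2)
  also have "\<dots> = r\<^sup>2 * ((sin \<alpha>)\<^sup>2 + (cos \<alpha>)\<^sup>2) + t\<^sup>2 * ((sin \<beta>)\<^sup>2 + (cos \<beta>)\<^sup>2) - 2 * r * t * cos (\<alpha> - \<beta>)"
    unfolding cos_diff by algebra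
  finally have e: "(cmod z)\<^sup>2 = r\<^sup>2 + t\<^sup>2 - 2 * r * t * cos (\<alpha> - \<beta>)"
    by (simp only: sin_cos_squared_add mult_1_right)
  have "2 * r * t * cos (\<alpha> - \<beta>) \<le> 2 * r * t * \<kappa>"
    using assms by (intro mult_left_mono) auto
  moreover have "0 \<le> (1 + \<kappa>) * (r - t)\<^sup>2" using k by simp
  ultimately have "(1 - \<kappa>) / 2 * (r + t)\<^sup>2 \<le> (cmod z)\<^sup>2"
    unfolding e by (simp add: field_simps power2_eq_square)
  then have "sqrt ((1 - \<kappa>) / 2 * (r + t)\<^sup>2) \<le> cmod z" by (rule real_le_lsqrt[rotated -1]) auto
  moreover have "sqrt ((1 - \<kappa>) / 2 * (r + t)\<^sup>2) = sqrt ((1 - \<kappa>) / 2) * (r + t)"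
    unfolding real_sqrt_mult using assms by simp
  ultimately show ?thesis by (simp add: z_def)
qed

text \<open>1 + z is the distance vector from z to the point -1 at angle pi, which keeps a positive
  angle from the sector.\<close>

lemma norm_one_plus_ge:
  assumes "0 < \<phi>" "\<phi> < pi"
  obtains c where "0 < c" "\<And>z. z \<in> sector \<phi> \<Longrightarrow> c * (1 + cmod z) \<le> cmod (1 + z)"
proof
  show "0 < sqrt ((1 - (- cos \<phi>)) / 2)"
    using cos_monotone_0_pi[of \<phi> pi] assms by simp
  fix z assume "z \<in> sector \<phi>"
  then obtain r \<theta> where z: "0 < r" "\<bar>\<theta>\<bar> < \<phi>" "z = of_real r * cis \<theta>" "cmod z = r" by (rule sector_polarE)
  have "cos \<phi> \<le> cos \<bar>\<theta>\<bar>" using z(2) assms by (intro cos_monotone_0_pi_le) auto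
  then have "cos (\<theta> - pi) \<le> - cos \<phi>" by (simp add: cos_diff)
  from norm_diff_polar_ge[OF this, of r 1] z
  show "sqrt ((1 - (- cos \<phi>)) / 2) * (1 + cmod z) \<le> cmod (1 + z)" by (simp add: cis_pi add.commute)
qed

section \<open>Contour integrals along the boundary of a sector\<close>

definition sector_integral :: "real \<Rightarrow> (complex \<Rightarrow> complex) \<Rightarrow> complex" where
  "sector_integral \<nu> f = ray_integral (- \<nu>) f - ray_integral \<nu> f"

definition ray_integrable :: "real \<Rightarrow> (complex \<Rightarrow> complex) \<Rightarrow> bool" where
  "ray_integrable \<theta> f \<longleftrightarrow> (\<lambda>r. cis \<theta> * f (of_real r * cis \<theta>)) integrable_on {0<..}"

lemma continuous_on_ray:
  fixes f :: "complex \<Rightarrow> 'b::topological_space"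
  assumes "\<And>r. 0 < r \<Longrightarrow> isCont f (of_real r * cis \<theta>)"
  shows "continuous_on {0<..} (\<lambda>r. f (of_real r * cis \<theta>))"
proof (intro continuous_at_imp_continuous_on ballI)
  fix r :: real assume "r \<in> {0<..}"
  then show "isCont (\<lambda>r. f (of_real r * cis \<theta>)) r"
    by (intro continuous_at_compose[of r "\<lambda>r. of_real r * cis \<theta>" f, unfolded o_def] continuous_intros)
      (use assms in auto)
qed

lemma ray_integrableI:
  assumes "\<And>r. 0 < r \<Longrightarrow> isCont f (of_real r * cis \<theta>)"
    and "0 < s" and "\<And>r. 0 < r \<Longrightarrow> cmod (f (of_real r * cis \<theta>)) \<le> C * decay s r"
  shows "ray_integrable \<theta> f"
  unfolding ray_integrable_def
  by (rule half_line_integral(1)[OF _ assms(2)])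
    (use assms in \<open>auto simp: norm_mult intro!: continuous_intros continuous_on_ray\<close>)

lemma ray_integrable_add: "ray_integrable \<theta> f \<Longrightarrow> ray_integrable \<theta> g \<Longrightarrow> ray_integrable \<theta> (\<lambda>w. f w + g w)"
  unfolding ray_integrable_def distrib_left by (rule integrable_add)

lemma ray_integrable_cmult: "ray_integrable \<theta> f \<Longrightarrow> ray_integrable \<theta> (\<lambda>w. c * f w)"
  unfolding ray_integrable_def mult.left_commute[of _ c] by (rule integrable_on_mult_right)

lemma ray_integral_add: "ray_integrable \<theta> f \<Longrightarrow> ray_integrable \<theta> g \<Longrightarrow>
    ray_integral \<theta> (\<lambda>w. f w + g w) = ray_integral \<theta> f + ray_integral \<theta> (g :: complex \<Rightarrow> complex)"
  unfolding ray_integrable_def ray_integral_complex distrib_left by (rule integral_add)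

lemma ray_integral_cmult: "ray_integral \<theta> (\<lambda>w. c * f w) = c * ray_integral \<theta> (f :: complex \<Rightarrow> complex)"
  unfolding ray_integral_complex mult.left_commute[of _ c] by (rule integral_mult_right)

lemma sector_integral_add:
  assumes "ray_integrable \<nu> f" "ray_integrable (- \<nu>) f" "ray_integrable \<nu> g" "ray_integrable (- \<nu>) g"
  shows "sector_integral \<nu> (\<lambda>w. f w + g w) = sector_integral \<nu> f + sector_integral \<nu> g"
  using assms by (simp add: sector_integral_def ray_integral_add)

lemma sector_integral_cmult: "sector_integral \<nu> (\<lambda>w. c * f w) = c * sector_integral \<nu> f"
  by (simp add: sector_integral_def ray_integral_cmult right_diff_distrib)

lemma ray_integral_cong:
  assumes "\<And>r. 0 < r \<Longrightarrow> f (of_real r * cis \<theta>) = g (of_real r * cis \<theta>)"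
  shows "ray_integral \<theta> f = ray_integral \<theta> g"
  unfolding ray_integral_def by (rule integral_cong) (use assms in auto)

lemma sector_integral_cong:
  assumes "\<And>r \<theta>. 0 < r \<Longrightarrow> \<bar>\<theta>\<bar> = \<nu> \<Longrightarrow> f (of_real r * cis \<theta>) = g (of_real r * cis \<theta>)" "0 < \<nu>"
  shows "sector_integral \<nu> f = sector_integral \<nu> g"
  unfolding sector_integral_def
  using assms by (intro arg_cong2[where f="(-)"] ray_integral_cong) auto

text \<open>The two rays of the contour can be turned into each other through the sector
  itself.\<close>

lemma sector_integral_zero:
  assumes "0 < \<nu>" "\<nu> < \<phi>" "0 < s"
    and hol: "\<And>r \<theta>. 0 < r \<Longrightarrow> \<bar>\<theta>\<bar> < \<phi> \<Longrightarrow> f field_differentiable (at (of_real r * cis \<theta>))"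
    and bd: "\<And>r \<theta>. 0 < r \<Longrightarrow> \<bar>\<theta>\<bar> < \<phi> \<Longrightarrow> cmod (f (of_real r * cis \<theta>)) \<le> C * decay s r"
  shows "sector_integral \<nu> f = 0"
proof -
  have "ray_integral (- \<nu>) f = ray_integral \<nu> f"
    by (rule ray_integral_rotate[where a="- \<phi>" and b=\<phi> and C=C, OF _ _ _ _ assms(3)])
      (use assms in \<open>auto simp: abs_less_iff\<close>)
  then show ?thesis by (simp add: sector_integral_def)
qed

lemma cis_reflect: "cis (x - pi) = - cis x" "cis (pi - x) = - cis (- x)"
  by (simp_all add: complex_eq_iff cos_diff sin_diff)

text \<open>The map w to -w carries the contour of angle \<nu> to that of angle pi - \<nu>; the sign
  of the differential and the exchange of the rays cancel. It turns the exterior of a sector, where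
  the resolvent lives, into a sector, where Cauchy's theorem is available.\<close>

lemma sector_integral_reflect:
  "sector_integral \<nu> f = sector_integral (pi - \<nu>) (\<lambda>w. f (- w))"
proof -
  have 1: "ray_integral \<nu> f = - ray_integral (\<nu> - pi) (\<lambda>w. f (- w))"
    unfolding ray_integral_complex by (simp add: cis_reflect)
  have 2: "ray_integral (- \<nu>) f = - ray_integral (pi - \<nu>) (\<lambda>w. f (- w))"
    unfolding ray_integral_complex by (simp add: cis_reflect)
  show ?thesis by (simp add: sector_integral_def 1 2)
qed

text \<open>An antiderivative of 2 / (1 - w^2) is a logarithm of (1 + w) / (1 - w). This fraction
  maps the upper half-plane to itself, and the factor -i turns that half-plane to the right one,
  away from the cut of \<open>Ln\<close>. The values of u run from -i at 0 to i at infinity, so the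
  logarithm increases by i pi.\<close>

lemma ray_integral_normalization:
  assumes "0 < \<nu>" "\<nu> < pi"
  shows "((\<lambda>r. cis \<nu> * (2 / (1 - (of_real r * cis \<nu>)\<^sup>2))) has_integral (\<i> * pi)) {0<..}"
proof -
  define w where "w r = of_real r * cis \<nu>" for r
  define u where "u r = - \<i> * ((1 + w r) / (1 - w r))" for r
  have Imw: "0 < Im (w r)" if "0 < r" for r
    using that sin_gt_zero[OF assms] by (simp add: w_def)
  have nz: "1 - w r \<noteq> 0" "1 + w r \<noteq> 0" if "0 \<le> r" for r
  proof -
    have "1 - w r \<noteq> 0 \<and> 1 + w r \<noteq> 0"
    proof (cases "r = 0")
      case False
      then have "Im (w r) \<noteq> 0" using Imw[of r] that by simp
      then show ?thesis by (auto simp: complex_eq_iff)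
    qed (simp add: w_def)
    then show "1 - w r \<noteq> 0" "1 + w r \<noteq> 0" by auto
  qed
  have u: "u r \<notin> \<real>\<^sub>\<le>\<^sub>0" if "0 \<le> r" for r
  proof (cases "r = 0")
    case True
    then show ?thesis by (auto simp: u_def w_def complex_nonpos_Reals_iff)
  next
    case False
    then have r: "0 < r" using that by simp
    have "(1 + w r) / (1 - w r) = (1 + w r) * cnj (1 - w r) / of_real ((cmod (1 - w r))\<^sup>2)"
      by (rule complex_div_cnj)
    moreover have "Re (- \<i> * (v / of_real R)) = Im v / R" for v R by simp
    ultimately have "Re (u r) = Im ((1 + w r) * cnj (1 - w r)) / (cmod (1 - w r))\<^sup>2"
      by (simp only: u_def)
    also have "Im ((1 + w r) * cnj (1 - w r)) = 2 * Im (w r)" by (simp add: algebra_simps)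
    finally have "0 < Re (u r)" using Imw[OF r] nz[OF that] by simp
    then show ?thesis by (auto simp: complex_nonpos_Reals_iff)
  qed
  have contu: "continuous_on {0..} u"
    unfolding u_def[abs_def] using nz by (intro continuous_intros) (auto simp: w_def intro!: continuous_intros)
  have cont: "continuous_on {0..} (\<lambda>r. Ln (u r))"
    by (rule continuous_on_compose2[OF _ contu, of "- \<real>\<^sub>\<le>\<^sub>0"])
      (use u in \<open>auto intro!: continuous_on_Ln\<close>)
  have der: "((\<lambda>r. Ln (u r)) has_vector_derivative cis \<nu> * (2 / (1 - (of_real r * cis \<nu>)\<^sup>2))) (at r)"
    if r: "0 < r" for r
  proof -
    have "((\<lambda>z. - \<i> * ((1 + z) / (1 - z))) has_field_derivative
        (- \<i> * (((0 + 1) * (1 - w r) - (1 + w r) * (0 - 1)) / ((1 - w r) * (1 - w r))))) (at (w r))"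
      by (intro DERIV_cmult DERIV_divide DERIV_add DERIV_diff DERIV_const DERIV_ident) (use nz[of r] r in auto)
    then have 1: "((\<lambda>z. - \<i> * ((1 + z) / (1 - z))) has_field_derivative
        (- \<i> * (2 / ((1 - w r) * (1 - w r))))) (at (w r))" by simp
    have "((\<lambda>z. Ln (- \<i> * ((1 + z) / (1 - z)))) has_field_derivative
         inverse (u r) * (- \<i> * (2 / ((1 - w r) * (1 - w r))))) (at (w r))"
      using DERIV_chain2[OF has_field_derivative_Ln[OF u[OF less_imp_le[OF r]], unfolded u_def] 1] by (simp only: u_def)
    moreover have "inverse (u r) * (- \<i> * (2 / ((1 - w r) * (1 - w r)))) = 2 / (1 - (w r)\<^sup>2)"
    proof -
      have "(1 - (w r)\<^sup>2) = (1 - w r) * (1 + w r)" by (simp add: power2_eq_square algebra_simps)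
      moreover have "inverse (u r) = \<i> * ((1 - w r) / (1 + w r))"
      proof (rule inverse_unique)
        have "j * (b / a) * (k * (a / b)) = j * k" if "a \<noteq> 0" "b \<noteq> 0" for j k a b :: complex
          using that by simp
        from this[OF nz, of r r "- \<i>" "\<i>"] show "u r * (\<i> * ((1 - w r) / (1 + w r))) = 1"
          using r unfolding u_def by simp
      qed
      moreover have "j * (a / b) * (- j * (2 / (a * a))) = - (j * j) * (2 / (a * b))"
        if "a \<noteq> 0" "b \<noteq> 0" for j a b :: complex using that by (simp add: field_simps)
      ultimately show ?thesis using nz[of r] r by (simp only: less_imp_le) simp
    qed
    ultimately have 2: "((\<lambda>z. Ln (- \<i> * ((1 + z) / (1 - z)))) has_field_derivative 2 / (1 - (w r)\<^sup>2)) (at (w r))"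
      by simp
    have "(w has_vector_derivative (of_real 1 * cis \<nu>)) (at r)"
      unfolding w_def[abs_def]
      by (intro has_vector_derivative_mult_left has_vector_derivative_of_real DERIV_ident)
    then have 3: "(w has_vector_derivative cis \<nu>) (at r)" by simp
    show ?thesis
      using field_vector_diff_chain_at[OF 3 2] by (simp add: o_def u_def w_def)
  qed
  \<comment> \<open>Dividing numerator and denominator by r turns the limit at infinity into a limit
    at 1/r = 0.\<close>
  have "((\<lambda>r. - \<i> * ((of_real (1 / r) + cis \<nu>) / (of_real (1 / r) - cis \<nu>))) \<longlongrightarrow>
      - \<i> * ((of_real 0 + cis \<nu>) / (of_real 0 - cis \<nu>))) at_top"
    by (intro tendsto_intros) (auto intro!: tendsto_divide_0[OF tendsto_const] filterlim_at_top_imp_at_infinity filterlim_ident)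
  moreover have "- \<i> * ((of_real 0 + cis \<nu>) / (of_real 0 - cis \<nu>)) = \<i>" by simp
  moreover have "eventually (\<lambda>r. - \<i> * ((of_real (1 / r) + cis \<nu>) / (of_real (1 / r) - cis \<nu>)) = u r) at_top"
    using eventually_gt_at_top[of 0]
  proof eventually_elim
    case (elim r)
    have "of_real (1 / r) + cis \<nu> = (1 + w r) / of_real r" "of_real (1 / r) - cis \<nu> = (1 - w r) / of_real r"
      using elim by (simp_all add: w_def field_simps)
    then show ?case using elim by (simp add: u_def)
  qed
  ultimately have "(u \<longlongrightarrow> \<i>) at_top" by (simp add: Lim_transform_eventually)
  then have "((\<lambda>r. Ln (u r)) \<longlongrightarrow> Ln \<i>) at_top"
    by (intro tendsto_Ln) (auto simp: complex_nonpos_Reals_iff)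
  from has_integral_half_line[OF cont der this]
  show ?thesis by (simp add: u_def w_def)
qed

text \<open>The one residue that is computed explicitly. Its pole 1 lies inside the contour and the
  compensating pole -1 outside; every other pole is reduced to it.\<close>

lemma sector_integral_normalization:
  assumes "0 < \<nu>" "\<nu> < pi"
  shows "sector_integral \<nu> (\<lambda>w. 1 / (w - 1) - 1 / (w + 1)) = 2 * of_real pi * \<i>"
proof -
  have eq: "1 / (w - 1) - 1 / (w + 1) = - (2 / (1 - w\<^sup>2))" if "w \<noteq> 1" "w \<noteq> -1" for w :: complex
  proof -
    have "1 - w\<^sup>2 = - ((w - 1) * (w + 1))" by (simp add: power2_eq_square algebra_simps)
    moreover have "w - 1 \<noteq> 0" "w + 1 \<noteq> 0" using that by (auto simp: eq_neg_iff_add_eq_0)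
    ultimately show ?thesis by (simp add: diff_frac_eq)
  qed
  have ne: "of_real r * cis \<theta> \<noteq> 1" "of_real r * cis \<theta> \<noteq> - 1" if "0 < r" "\<theta> = \<nu> \<or> \<theta> = - \<nu>" for r \<theta>
  proof -
    have "Im (of_real r * cis \<theta>) \<noteq> 0" using that sin_gt_zero[OF assms] by auto
    then show "of_real r * cis \<theta> \<noteq> 1" "of_real r * cis \<theta> \<noteq> - 1" by (auto simp: complex_eq_iff)
  qed
  have "ray_integral \<nu> (\<lambda>w. 1 / (w - 1) - 1 / (w + 1)) = ray_integral \<nu> (\<lambda>w. - 1 * (2 / (1 - w\<^sup>2)))"
    by (rule ray_integral_cong) (use eq ne in auto)
  also have "\<dots> = - (\<i> * pi)"
    unfolding ray_integral_cmult
    using integral_unique[OF ray_integral_normalization[OF assms]] by (simp add: ray_integral_complex)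
  finally have 1: "ray_integral \<nu> (\<lambda>w. 1 / (w - 1) - 1 / (w + 1)) = - (\<i> * pi)" .
  have "ray_integral (- \<nu>) (\<lambda>w. 1 / (w - 1) - 1 / (w + 1)) = ray_integral (- \<nu>) (\<lambda>w. - 1 * (2 / (1 - w\<^sup>2)))"
    by (rule ray_integral_cong) (use eq ne in auto)
  \<comment> \<open>The integrand has real coefficients, so the lower ray gives the complex
    conjugate of the upper one.\<close>
  also have "\<dots> = - integral {0<..} (\<lambda>r. cnj (cis \<nu> * (2 / (1 - (of_real r * cis \<nu>)\<^sup>2))))"
    unfolding ray_integral_cmult by (simp add: ray_integral_complex cis_cnj)
  also have "\<dots> = - cnj (\<i> * pi)"
    using ray_integral_normalization[OF assms] by (subst integral_cnj[symmetric]) (simp add: integral_unique)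
  finally have 2: "ray_integral (- \<nu>) (\<lambda>w. 1 / (w - 1) - 1 / (w + 1)) = \<i> * pi" by simp
  show ?thesis by (simp add: sector_integral_def 1 2)
qed

lemma norm_diff_polar_pos:
  assumes "0 < \<bar>\<alpha> - \<beta>\<bar>" "\<bar>\<alpha> - \<beta>\<bar> < 2 * pi"
  obtains c where "0 < c"
    "\<And>r t. 0 \<le> r \<Longrightarrow> 0 \<le> t \<Longrightarrow> c * (r + t) \<le> cmod (of_real r * cis \<alpha> - of_real t * cis \<beta>)"
proof
  have "cos (\<alpha> - \<beta>) \<noteq> 1"
  proof
    assume "cos (\<alpha> - \<beta>) = 1"
    then obtain n :: int where n: "\<alpha> - \<beta> = n * 2 * pi" by (auto simp: cos_one_2pi_int)
    then have "\<bar>real_of_int n\<bar> * (2 * pi) < 1 * (2 * pi)" using assms(2) by (simp add: abs_mult)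
    then have "\<bar>real_of_int n\<bar> < 1" using mult_less_cancel_right_pos[of "2 * pi" "\<bar>real_of_int n\<bar>" 1] by simp
    then have "n = 0" by linarith
    then show False using n assms(1) by simp
  qed
  then show "0 < sqrt ((1 - cos (\<alpha> - \<beta>)) / 2)" using cos_le_one[of "\<alpha> - \<beta>"] by (simp add: less_le)
qed (rule norm_diff_polar_ge, auto)

lemma norm_diff_sector:
  assumes "0 < \<phi>" "\<phi> < \<bar>\<beta>\<bar>" "\<bar>\<beta>\<bar> \<le> pi"
  obtains c where "0 < c"
    "\<And>w t. w \<in> sector \<phi> \<Longrightarrow> 0 \<le> t \<Longrightarrow> c * (cmod w + t) \<le> cmod (w - of_real t * cis \<beta>)"
proof
  \<comment> \<open>The angular distance is 2 pi - |\<theta> - \<beta>| once |\<theta> - \<beta>|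
    exceeds pi; in both cases it is at least |\<beta>| - \<phi>.\<close>
  have c1: "cos (\<theta> - \<beta>) \<le> cos (\<bar>\<beta>\<bar> - \<phi>)" if "\<bar>\<theta>\<bar> < \<phi>" for \<theta>
  proof (cases "\<bar>\<theta> - \<beta>\<bar> \<le> pi")
    case True
    have "\<bar>\<beta>\<bar> - \<phi> \<le> \<bar>\<theta> - \<beta>\<bar>" using that by linarith
    then have "cos \<bar>\<theta> - \<beta>\<bar> \<le> cos (\<bar>\<beta>\<bar> - \<phi>)" using assms True by (intro cos_monotone_0_pi_le) auto
    then show ?thesis by simp
  next
    case False
    have "\<bar>\<beta>\<bar> - \<phi> \<le> 2 * pi - \<bar>\<theta> - \<beta>\<bar>" using that assms by linarith
    then have "cos (2 * pi - \<bar>\<theta> - \<beta>\<bar>) \<le> cos (\<bar>\<beta>\<bar> - \<phi>)" using assms False by (intro cos_monotone_0_pi_le) auto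
    then show ?thesis by (simp add: cos_diff)
  qed
  have "cos (\<bar>\<beta>\<bar> - \<phi>) < 1" using assms cos_monotone_0_pi[of 0 "\<bar>\<beta>\<bar> - \<phi>"] by simp
  then show "0 < sqrt ((1 - cos (\<bar>\<beta>\<bar> - \<phi>)) / 2)" by simp
  fix w and t :: real assume w: "w \<in> sector \<phi>" and t: "0 \<le> t"
  from w obtain r \<theta> where "0 < r" "\<bar>\<theta>\<bar> < \<phi>" "w = of_real r * cis \<theta>" "cmod w = r"
    by (rule sector_polarE)
  then show "sqrt ((1 - cos (\<bar>\<beta>\<bar> - \<phi>)) / 2) * (cmod w + t) \<le> cmod (w - of_real t * cis \<beta>)"
    using norm_diff_polar_ge[OF c1, of \<theta> r t] t by simp
qed

lemma norm_diff_ray: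
  assumes "z \<in> sector \<nu>" "\<bar>\<theta>\<bar> = \<nu>" "\<nu> < pi"
  obtains c where "0 < c" "\<And>r. 0 \<le> r \<Longrightarrow> c * (r + cmod z) \<le> cmod (of_real r * cis \<theta> - z)"
proof -
  from assms(1) obtain t \<beta> where z: "0 < t" "\<bar>\<beta>\<bar> < \<nu>" "z = of_real t * cis \<beta>" "cmod z = t"
    by (rule sector_polarE)
  obtain c where "0 < c"
    "\<And>r t. 0 \<le> r \<Longrightarrow> 0 \<le> t \<Longrightarrow> c * (r + t) \<le> cmod (of_real r * cis \<theta> - of_real t * cis \<beta>)"
    using norm_diff_polar_pos[of \<theta> \<beta>] z(2) assms(2,3) by (auto simp: abs_if split: if_splits)
  then show ?thesis using that z by (metis less_imp_le)
qed

text \<open>Over the common denominator the difference has a constant numerator, hence quadratic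
  decay, which is what \<open>decay 1\<close> measures.\<close>

lemma recip_diff_bound:
  assumes "0 < r" "0 < c" "0 < d" "c * (1 + r) \<le> cmod (w - a)" "d * (1 + r) \<le> cmod (w - b)"
  shows "cmod (1 / (w - a) - 1 / (w - b)) \<le> cmod (a - b) / (c * d) * decay 1 r"
proof -
  have p: "0 < c * (1 + r)" "0 < d * (1 + r)" using assms by simp_all
  then have "0 < cmod (w - a)" "0 < cmod (w - b)" using assms(4,5) by linarith+
  then have nz: "w - a \<noteq> 0" "w - b \<noteq> 0" by auto
  have "1 / (w - a) - 1 / (w - b) = (a - b) / ((w - a) * (w - b))" using nz by (simp add: diff_frac_eq)
  then have "cmod (1 / (w - a) - 1 / (w - b)) = cmod (a - b) / (cmod (w - a) * cmod (w - b))"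
    by (simp add: norm_divide norm_mult)
  also have "\<dots> \<le> cmod (a - b) / ((c * (1 + r)) * (d * (1 + r)))"
    using p assms nz by (intro divide_left_mono mult_mono mult_pos_pos) auto
  also have "\<dots> = cmod (a - b) / (c * d) * decay 1 r"
    using assms by (simp add: decay_1 power2_eq_square)
  finally show ?thesis .
qed

text \<open>Brings lower bounds in r + m to the normalised form 1 + r that occurs in
  \<open>decay 1\<close>.\<close>

lemma scale_sum_ge:
  fixes c :: real
  assumes "0 < c" "0 < m" "0 < r" "c * (r + m) \<le> x"
  shows "c * min 1 m * (1 + r) \<le> x"
proof -
  have "min 1 m * (1 + r) \<le> r + m"
  proof (cases "m \<le> 1")
    case True
    then have "m * r \<le> 1 * r" using assms by (intro mult_right_mono) auto
    then show ?thesis using True by (simp add: algebra_simps)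
  qed auto
  then have "c * (min 1 m * (1 + r)) \<le> c * (r + m)" using assms by (intro mult_left_mono) auto
  then show ?thesis using assms(4) by (simp add: mult.assoc)
qed

lemma polar_ne_sector:
  assumes "z \<in> sector \<nu>" "\<bar>\<theta>\<bar> = \<nu>" "\<nu> < pi" "0 < r"
  shows "of_real r * cis \<theta> \<noteq> z"
proof
  assume "of_real r * cis \<theta> = z"
  then have "Arg z = \<theta>" using Arg_polar[of r \<theta>] assms by (auto simp: abs_if split: if_splits)
  then show False using assms by (auto simp: sector_def)
qed

lemma minus_one_notin_sector: "\<phi> \<le> pi \<Longrightarrow> - 1 \<notin> sector \<phi>"
  using Arg_polar[of 1 pi] by (simp add: sector_def)

text \<open>The single kernel \<open>1 / (w - z)\<close> is not integrable along the rays; subtracting the one with its pole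
  at \<open>- 1\<close>, outside the sector, makes it so.\<close>

lemma cauchy_kernel:
  assumes z: "z \<in> sector \<nu>" and \<nu>: "0 < \<nu>" "\<nu> < pi"
  shows "sector_integral \<nu> (\<lambda>w. 1 / (w - z) - 1 / (w + 1)) = 2 * of_real pi * \<i>"
    "\<bar>\<theta>\<bar> = \<nu> \<Longrightarrow> ray_integrable \<theta> (\<lambda>w. 1 / (w - z) - 1 / (w + 1))"
proof -
  have one: "1 \<in> sector \<nu>" using \<nu> by (simp add: sector_def)
  have z0: "0 < cmod z" using z by (simp add: sector_def)
  \<comment> \<open>Stated for a second pole b that is -1 or lies in the sector, because z is
    compared with -1 through the intermediate pole 1.\<close>
  have ii: "ray_integrable \<theta> (\<lambda>w. 1 / (w - z) - 1 / (w - b))"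
    if th: "\<bar>\<theta>\<bar> = \<nu>" and z: "z \<in> sector \<nu>" and b: "b \<in> sector \<nu> \<or> b = -1" for \<theta> b z
  proof -
    have z0: "0 < cmod z" using z by (simp add: sector_def)
    obtain c where c: "0 < c" "\<And>r. 0 \<le> r \<Longrightarrow> c * (r + cmod z) \<le> cmod (of_real r * cis \<theta> - z)"
      using norm_diff_ray[OF z th \<nu>(2)] by blast
    have "\<exists>d>0. \<forall>r>0. d * (1 + r) \<le> cmod (of_real r * cis \<theta> - b)"
    proof (cases "b = -1")
      case True
      have "0 < \<bar>\<theta> - pi\<bar>" "\<bar>\<theta> - pi\<bar> < 2 * pi" using th \<nu> by (auto simp: abs_if split: if_splits)
      from norm_diff_polar_pos[OF this] obtain d where "0 < d"
        "\<And>r t. 0 \<le> r \<Longrightarrow> 0 \<le> t \<Longrightarrow> d * (r + t) \<le> cmod (of_real r * cis \<theta> - of_real t * cis pi)" by blast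
      then show ?thesis using True by (intro exI[of _ d]) (metis add.commute cis_pi less_imp_le mult_1 of_real_1 zero_le_one)
    next
      case False
      then have b: "b \<in> sector \<nu>" using b by simp
      then have b0: "0 < cmod b" by (simp add: sector_def)
      obtain d where d: "0 < d" "\<And>r. 0 \<le> r \<Longrightarrow> d * (r + cmod b) \<le> cmod (of_real r * cis \<theta> - b)"
        using norm_diff_ray[OF b th \<nu>(2)] by blast
      then show ?thesis using b0
        by (intro exI[of _ "d * min 1 (cmod b)"]) (auto intro!: scale_sum_ge)
    qed
    then obtain d where d: "0 < d" "\<And>r. 0 < r \<Longrightarrow> d * (1 + r) \<le> cmod (of_real r * cis \<theta> - b)" by blast
    show ?thesis
    proof (rule ray_integrableI)
      fix r :: real assume r: "0 < r"
      have "c * min 1 (cmod z) * (1 + r) \<le> cmod (of_real r * cis \<theta> - z)"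
        using c r z0 by (intro scale_sum_ge) auto
      then show "cmod (1 / (of_real r * cis \<theta> - z) - 1 / (of_real r * cis \<theta> - b))
          \<le> cmod (z - b) / (c * min 1 (cmod z) * d) * decay 1 r"
        using c d r z0 by (intro recip_diff_bound) auto
      have "0 < d * (1 + r)" using d(1) r by simp
      then have "of_real r * cis \<theta> \<noteq> b" using d(2)[OF r] by (metis cmod_def diff_self not_less norm_zero)
      then show "isCont (\<lambda>w. 1 / (w - z) - 1 / (w - b)) (of_real r * cis \<theta>)"
        using polar_ne_sector[OF z th \<nu>(2) r] by (intro continuous_intros) auto
    qed simp
  qed
  from ii[OF _ z, of _ "-1"]
  show "\<bar>\<theta>\<bar> = \<nu> \<Longrightarrow> ray_integrable \<theta> (\<lambda>w. 1 / (w - z) - 1 / (w + 1))" by simp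
  \<comment> \<open>Both poles lie inside the contour, so the difference is holomorphic and
    quadratically small outside; after reflection the outside is a sector and the integral
    vanishes.\<close>
  have zero: "sector_integral \<nu> (\<lambda>w. 1 / (w - z) - 1 / (w - 1)) = 0"
  proof -
    from z obtain t \<beta> where zp: "0 < t" "\<bar>\<beta>\<bar> < \<nu>" "z = of_real t * cis \<beta>" "cmod z = t"
      by (rule sector_polarE)
    \<comment> \<open>Midway between pi - \<nu>, the angle of the reflected contour, and pi -
      |\<beta>|, the absolute angle of the reflected pole -z.\<close>
    define \<phi> where "\<phi> = pi - (\<bar>\<beta>\<bar> + \<nu>) / 2"
    have \<phi>: "pi - \<nu> < \<phi>" "\<phi> < pi - \<bar>\<beta>\<bar>" "0 < \<phi>" "\<phi> < pi" using zp \<nu> by (auto simp: \<phi>_def field_simps)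
    \<comment> \<open>An argument of -z; the case distinction makes its absolute value equal to pi -
      |\<beta>|.\<close>
    define \<beta>' where "\<beta>' = (if \<beta> \<le> 0 then \<beta> + pi else \<beta> - pi)"
    have cb: "cis \<beta>' = - cis \<beta>" by (simp add: \<beta>'_def complex_eq_iff cos_diff sin_diff cos_add sin_add)
    have "\<phi> < \<bar>\<beta>'\<bar>" "\<bar>\<beta>'\<bar> \<le> pi" using \<phi> zp \<nu> by (auto simp: \<beta>'_def)
    from norm_diff_sector[OF \<phi>(3) this] obtain c where c: "0 < c"
      "\<And>w t. w \<in> sector \<phi> \<Longrightarrow> 0 \<le> t \<Longrightarrow> c * (cmod w + t) \<le> cmod (w - of_real t * cis \<beta>')" by blast
    obtain d where d: "0 < d" "\<And>w. w \<in> sector \<phi> \<Longrightarrow> d * (1 + cmod w) \<le> cmod (1 + w)"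
      using norm_one_plus_ge[OF \<phi>(3,4)] by blast
    have c': "c * min 1 t * (1 + cmod w) \<le> cmod (w + z)" if "w \<in> sector \<phi>" for w
      using c(1) zp(1,3) c(2)[OF that, of t] that
      by (intro scale_sum_ge) (auto simp: cb sector_def)
    have "sector_integral (pi - \<nu>) (\<lambda>w. 1 / (- w - z) - 1 / (- w - 1)) = 0"
    proof (rule sector_integral_zero[where \<phi>=\<phi> and s=1 and C="cmod (- z - -1) / (c * min 1 t * d)"])
      fix r \<theta> :: real assume r: "0 < r" "\<bar>\<theta>\<bar> < \<phi>"
      define w where "w = of_real r * cis \<theta>"
      have w: "w \<in> sector \<phi>" "cmod w = r" using r \<phi> polar_in_sector[of r \<theta> \<phi>] by (auto simp: w_def norm_mult)
      have "0 < c * min 1 t * (1 + cmod w)" "0 < d * (1 + cmod w)" using c(1) d(1) zp(1) r(1) w(2) by simp_all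
      then have "0 < cmod (w + z)" "0 < cmod (1 + w)" using c'[OF w(1)] d(2)[OF w(1)] by linarith+
      then have nz: "w + z \<noteq> 0" "1 + w \<noteq> 0" by auto
      have "1 / (- w - z) - 1 / (- w - 1) = - (1 / (w - - z) - 1 / (w - - 1))"
      proof -
        have "1 / (- w - a) = - (1 / (w - - a))" for a
        proof -
          have "- w - a = - (w - - a)" by simp
          then show ?thesis by (simp only: minus_divide_right)
        qed
        from this[of z] this[of 1] show ?thesis by simp
      qed
      moreover have "cmod (1 / (w - - z) - 1 / (w - - 1)) \<le> cmod (- z - -1) / (c * min 1 t * d) * decay 1 r"
        using c'[OF w(1)] d(2)[OF w(1)] c d zp r w(2)
        by (intro recip_diff_bound) (auto simp: add.commute)
      ultimately show "cmod (1 / (- (of_real r * cis \<theta>) - z) - 1 / (- (of_real r * cis \<theta>) - 1))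
          \<le> cmod (- z - -1) / (c * min 1 t * d) * decay 1 r"
        unfolding w_def[symmetric] by (simp only: norm_minus_cancel)
      have "- w - z \<noteq> 0" "- w - 1 \<noteq> 0" using nz by (auto simp: eq_neg_iff_add_eq_0 neg_eq_iff_add_eq_0 add.commute)
      then show "(\<lambda>w. 1 / (- w - z) - 1 / (- w - 1)) field_differentiable at (of_real r * cis \<theta>)"
        unfolding w_def[symmetric] by (intro derivative_intros) auto
    qed (use \<phi> \<nu> in auto)
    then show ?thesis by (subst sector_integral_reflect) simp
  qed
  have "sector_integral \<nu> (\<lambda>w. 1 / (w - z) - 1 / (w + 1)) =
      sector_integral \<nu> (\<lambda>w. (1 / (w - z) - 1 / (w - 1)) + (1 / (w - 1) - 1 / (w + 1)))"
    by simp
  also have "\<dots> = 0 + 2 * of_real pi * \<i>"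
    using ii[OF _ z, of _ 1] ii[OF _ one, of _ "-1"] one \<nu>
    by (subst sector_integral_add) (simp_all add: zero sector_integral_normalization)
  finally show "sector_integral \<nu> (\<lambda>w. 1 / (w - z) - 1 / (w + 1)) = 2 * of_real pi * \<i>" by simp
qed

text \<open>The constant 1/3 comes from the factor 2: if one modulus is at least twice the other,
  their difference is at least a third of their sum.\<close>

lemma cauchy_kernel_far:
  assumes "z \<noteq> 0" "0 < d" "d * (1 + cmod w) \<le> cmod (1 + w)" "w \<noteq> 0"
    "cmod w \<le> cmod z / 2 \<or> 2 * cmod z \<le> cmod w"
  shows "cmod (1 / (w - z) - 1 / (w + 1)) \<le> cmod (z + 1) / (1 / 3 * min 1 (cmod z) * d) * decay 1 (cmod w)"
    "1 / 3 * min 1 (cmod z) * (1 + cmod w) \<le> cmod (w - z)"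
proof -
  have "1 / 3 * (cmod w + cmod z) \<le> cmod (w - z)"
    using assms(5) norm_triangle_ineq3[of w z] by auto
  then show *: "1 / 3 * min 1 (cmod z) * (1 + cmod w) \<le> cmod (w - z)"
    using assms by (intro scale_sum_ge) auto
  have "cmod (1 / (w - z) - 1 / (w - -1)) \<le> cmod (z - -1) / (1 / 3 * min 1 (cmod z) * d) * decay 1 (cmod w)"
    by (rule recip_diff_bound) (use assms * in \<open>auto simp: add.commute\<close>)
  then show "cmod (1 / (w - z) - 1 / (w + 1)) \<le> cmod (z + 1) / (1 / 3 * min 1 (cmod z) * d) * decay 1 (cmod w)"
    by simp
qed

text \<open>Subtracting from \<open>H\<close> its values at the poles leaves a holomorphic integrand, and \<open>cauchy_kernel\<close>
  accounts for the rest.\<close>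

lemma sector_cauchy:
  assumes \<nu>: "0 < \<nu>" "\<nu> < \<phi>" "\<phi> \<le> pi" and H: "H holomorphic_on sector \<phi>"
    and z: "z1 \<in> sector \<nu>" "z2 \<in> sector \<nu>" and s: "0 < s" "s \<le> 1" and m: "0 < m"
    and bd: "\<And>w. w \<in> sector \<phi> \<Longrightarrow> cmod w \<le> m \<or> M \<le> cmod w \<Longrightarrow>
      cmod (H w * (c1 / (w - z1) + c2 / (w - z2))) \<le> C * decay s (cmod w)"
  shows "sector_integral \<nu> (\<lambda>w. H w * (c1 / (w - z1) + c2 / (w - z2))) =
    2 * of_real pi * \<i> * (c1 * H z1 + c2 * H z2)"
proof -
  \<comment> \<open>Strictly between the contour and the boundary of the sector: the closed region
    |Arg w| \<le> \<phi>', cut to an annulus, is a compact subset of the open sector.\<close>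
  define \<phi>' where "\<phi>' = (\<nu> + \<phi>) / 2"
  have \<phi>': "\<nu> < \<phi>'" "\<phi>' < \<phi>" "0 < \<phi>'" "\<phi>' < pi" using \<nu> by (auto simp: \<phi>'_def)
  obtain d where d: "0 < d" "\<And>w. w \<in> sector \<phi>' \<Longrightarrow> d * (1 + cmod w) \<le> cmod (1 + w)"
    using norm_one_plus_ge[OF \<phi>'(3,4)] by blast
  have zz: "z1 \<noteq> 0" "z2 \<noteq> 0" using z by (auto simp: sector_def)
  define E where "E z w = 1 / (w - z) - 1 / (w + 1)" for z w :: complex
  \<comment> \<open>The difference quotient with its removable singularity filled in, holomorphic on
    the whole sector.\<close>
  define P where "P z w = (if w = z then deriv H z else (H w - H z) / (w - z))" for z w
  \<comment> \<open>The last term restores integrability at infinity: it compensates the subtracted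
    multiples of 1 / (w - z), which by themselves decay only like 1 / w.\<close>
  define g where "g w = c1 * P z1 w + c2 * P z2 w + (c1 * H z1 + c2 * H z2) * (1 / (w + 1))" for w
  have "P z holomorphic_on sector \<phi>" for z
    unfolding P_def[abs_def] by (rule pole_lemma_open[OF H open_sector[OF \<nu>(3)]])
  moreover have "(\<lambda>w. 1 / (w + 1)) holomorphic_on sector \<phi>"
    using minus_one_notin_sector[OF \<nu>(3)] by (intro holomorphic_intros) (auto simp: eq_neg_iff_add_eq_0[symmetric])
  ultimately have g: "g holomorphic_on sector \<phi>"
    unfolding g_def[abs_def] by (intro holomorphic_on_add holomorphic_on_mult holomorphic_on_const)
  have g_eq: "g w = H w * (c1 / (w - z1) + c2 / (w - z2)) - c1 * H z1 * E z1 w - c2 * H z2 * E z2 w"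
    if "w \<noteq> z1" "w \<noteq> z2" for w
  proof -
    have "c1 * ((H w - H z1) * a) + c2 * ((H w - H z2) * b) + (c1 * H z1 + c2 * H z2) * e =
        H w * (c1 * a + c2 * b) - c1 * H z1 * (a - e) - c2 * H z2 * (b - e)" for a b e
      by (simp add: algebra_simps)
    from this[of "1 / (w - z1)" "1 / (w - z2)" "1 / (w + 1)"] that
    show ?thesis by (simp add: g_def P_def E_def)
  qed
  \<comment> \<open>Outside the annulus between m' and M' the hypothesis \<open>bd\<close> and the
    estimate away from both poles hold together; inside it compactness bounds g by a multiple of the
    weight.\<close>
  define m' where "m' = min m (min (cmod z1) (cmod z2) / 2)"
  define M' where "M' = max M (2 * max (cmod z1) (cmod z2))"
  have m': "0 < m'" using m zz by (simp add: m'_def)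
  define K where "K = (\<lambda>(r, \<theta>). of_real r * cis \<theta>) ` ({m'..M'} \<times> {- \<phi>'..\<phi>'})"
  have "compact K" unfolding K_def split_def
    by (intro compact_continuous_image compact_Times continuous_intros) auto
  have Ksub: "K \<subseteq> sector \<phi>"
    unfolding K_def using m' \<phi>' \<nu> by (auto intro!: polar_in_sector)
  have "continuous_on K g"
    using holomorphic_on_imp_continuous_on[OF g] Ksub by (rule continuous_on_subset)
  moreover have "continuous_on K (\<lambda>w. decay s (cmod w))"
    by (rule continuous_on_compose2[OF decay_cont]) (use Ksub in \<open>auto intro!: continuous_intros simp: sector_def\<close>)
  moreover have "decay s (cmod w) \<noteq> 0" if "w \<in> K" for w
    using decay_pos[of "cmod w" s] that Ksub by (auto simp: sector_def)
  ultimately have "continuous_on K (\<lambda>w. cmod (g w) / decay s (cmod w))" by (intro continuous_intros) auto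
  from compact_imp_bounded[OF compact_continuous_image[OF this \<open>compact K\<close>]]
  obtain B where B: "\<And>w. w \<in> K \<Longrightarrow> \<bar>cmod (g w) / decay s (cmod w)\<bar> \<le> B"
    by (auto simp: bounded_iff)
  define Kc where "Kc z = cmod (z + 1) / (1 / 3 * min 1 (cmod z) * d)" for z
  define D where "D = \<bar>B\<bar> + \<bar>C\<bar> + cmod (c1 * H z1) * (Kc z1 * 4) + cmod (c2 * H z2) * (Kc z2 * 4)"
  have Kc: "0 \<le> Kc z" for z using d by (simp add: Kc_def)
  have gb: "cmod (g w) \<le> D * decay s (cmod w)" if w: "w \<in> sector \<phi>'" for w
  proof -
    have w0: "w \<noteq> 0" "0 < cmod w" using w by (auto simp: sector_def)
    have dp: "0 < decay s (cmod w)" by (rule decay_pos[OF w0(2)])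
    have w': "w \<in> sector \<phi>" using w \<phi>' by (auto simp: sector_def)
    have "w \<in> K \<or> cmod w < m' \<or> M' < cmod w"
    proof -
      obtain r \<theta> where "0 < r" "\<bar>\<theta>\<bar> < \<phi>'" "w = of_real r * cis \<theta>" "cmod w = r"
        using w by (rule sector_polarE)
      then show ?thesis by (force simp: K_def)
    qed
    have far: ?thesis if "cmod w \<le> m \<or> M \<le> cmod w"
      "cmod w \<le> cmod z1 / 2 \<or> 2 * cmod z1 \<le> cmod w" "cmod w \<le> cmod z2 / 2 \<or> 2 * cmod z2 \<le> cmod w"
    proof -
      have ne: "w \<noteq> z1" "w \<noteq> z2" using that zz by auto
      have EE: "cmod (E z w) \<le> Kc z * 4 * decay s (cmod w)"
        if "z \<noteq> 0" "cmod w \<le> cmod z / 2 \<or> 2 * cmod z \<le> cmod w" for z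
      proof -
        have "cmod (E z w) \<le> Kc z * decay 1 (cmod w)"
          unfolding E_def Kc_def by (rule cauchy_kernel_far(1)[OF that(1) d(1) d(2)[OF w] w0(1) that(2)])
        also have "\<dots> \<le> Kc z * (4 * decay s (cmod w))"
          by (intro mult_left_mono decay_mono Kc w0 s)
        finally show ?thesis by simp
      qed
      have "cmod (g w) \<le> cmod (H w * (c1 / (w - z1) + c2 / (w - z2))) + cmod (c1 * H z1) * cmod (E z1 w) + cmod (c2 * H z2) * cmod (E z2 w)"
        unfolding g_eq[OF ne] norm_mult[symmetric]
        by (intro order_trans[OF norm_triangle_ineq4] add_mono order_refl)
      also have "\<dots> \<le> \<bar>C\<bar> * decay s (cmod w) + cmod (c1 * H z1) * (Kc z1 * 4 * decay s (cmod w))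
          + cmod (c2 * H z2) * (Kc z2 * 4 * decay s (cmod w))"
        using bd[OF w' that(1)] EE[OF zz(1) that(2)] EE[OF zz(2) that(3)] dp
        by (intro add_mono mult_left_mono order_trans[OF bd[OF w' that(1)]] mult_right_mono) auto
      also have "\<dots> = (\<bar>C\<bar> + cmod (c1 * H z1) * (Kc z1 * 4) + cmod (c2 * H z2) * (Kc z2 * 4)) * decay s (cmod w)"
        by (simp add: algebra_simps)
      also have "\<dots> \<le> D * decay s (cmod w)"
        using dp unfolding D_def by (intro mult_right_mono) auto
      finally show ?thesis .
    qed
    from \<open>w \<in> K \<or> cmod w < m' \<or> M' < cmod w\<close> consider "w \<in> K" | "cmod w < m'" | "M' < cmod w" by blast
    then show ?thesis
    proof cases
      case 1
      have "cmod (g w) / decay s (cmod w) \<le> D" using B[OF 1] Kc unfolding D_def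
        by (smt (verit) mult_nonneg_nonneg norm_ge_zero)
      then show ?thesis using dp by (simp add: divide_le_eq)
    next
      case 2
      then show ?thesis by (intro far) (auto simp: m'_def)
    next
      case 3
      then show ?thesis by (intro far) (auto simp: M'_def)
    qed
  qed
  have g0: "sector_integral \<nu> g = 0"
  proof (rule sector_integral_zero[OF \<nu>(1) \<phi>'(1) s(1)])
    fix r \<theta> :: real assume r: "0 < r" "\<bar>\<theta>\<bar> < \<phi>'"
    then have w: "of_real r * cis \<theta> \<in> sector \<phi>'" using \<phi>' by (intro polar_in_sector) auto
    then have "of_real r * cis \<theta> \<in> sector \<phi>" using \<phi>' by (auto simp: sector_def)
    then show "g field_differentiable at (of_real r * cis \<theta>)"
      by (rule holomorphic_on_imp_differentiable_at[OF g open_sector[OF \<nu>(3)]])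
    show "cmod (g (of_real r * cis \<theta>)) \<le> D * decay s r"
      using gb[OF w] r by (simp add: norm_mult)
  qed
  have gi: "ray_integrable \<theta> g" if "\<bar>\<theta>\<bar> = \<nu>" for \<theta>
  proof (rule ray_integrableI[OF _ s(1)])
    fix r :: real assume r: "0 < r"
    then have w: "of_real r * cis \<theta> \<in> sector \<phi>'" using \<phi>' that by (intro polar_in_sector) auto
    then have "of_real r * cis \<theta> \<in> sector \<phi>" using \<phi>' by (auto simp: sector_def)
    then show "isCont g (of_real r * cis \<theta>)"
      by (intro field_differentiable_imp_continuous_at holomorphic_on_imp_differentiable_at[OF g open_sector[OF \<nu>(3)]])
    show "cmod (g (of_real r * cis \<theta>)) \<le> D * decay s r"
      using gb[OF w] r by (simp add: norm_mult)
  qed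
  have \<nu>pi: "\<nu> < pi" using \<nu> by simp
  note ck = cauchy_kernel[OF _ \<nu>(1) \<nu>pi, folded E_def]
  have Ei: "ray_integrable \<theta> (E z1)" "ray_integrable \<theta> (E z2)" if "\<bar>\<theta>\<bar> = \<nu>" for \<theta>
    using ck(2)[OF z(1) that] ck(2)[OF z(2) that] by (simp_all add: E_def[abs_def])
  have EI: "sector_integral \<nu> (E z1) = 2 * of_real pi * \<i>" "sector_integral \<nu> (E z2) = 2 * of_real pi * \<i>"
    using ck(1)[OF z(1)] ck(1)[OF z(2)] by (simp_all add: E_def[abs_def])
  have "sector_integral \<nu> (\<lambda>w. H w * (c1 / (w - z1) + c2 / (w - z2))) =
    sector_integral \<nu> (\<lambda>w. g w + (c1 * H z1 * E z1 w + c2 * H z2 * E z2 w))"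
  proof (rule sector_integral_cong[OF _ \<nu>(1)])
    fix r \<theta> :: real assume r: "0 < r" "\<bar>\<theta>\<bar> = \<nu>"
    show "H (of_real r * cis \<theta>) * (c1 / (of_real r * cis \<theta> - z1) + c2 / (of_real r * cis \<theta> - z2)) =
       g (of_real r * cis \<theta>) + (c1 * H z1 * E z1 (of_real r * cis \<theta>) + c2 * H z2 * E z2 (of_real r * cis \<theta>))"
      using g_eq[OF polar_ne_sector[OF z(1) r(2) \<nu>pi r(1)] polar_ne_sector[OF z(2) r(2) \<nu>pi r(1)]] by simp
  qed
  also have "\<dots> = sector_integral \<nu> g + (sector_integral \<nu> (\<lambda>w. c1 * H z1 * E z1 w) + sector_integral \<nu> (\<lambda>w. c2 * H z2 * E z2 w))"
    using \<nu> by (simp only: sector_integral_add ray_integrable_add ray_integrable_cmult gi Ei abs_of_pos abs_minus_cancel)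
  also have "\<dots> = 2 * of_real pi * \<i> * (c1 * H z1 + c2 * H z2)"
    unfolding sector_integral_cmult EI g0 by (simp add: algebra_simps)
  finally show ?thesis .
qed

text \<open>The form in which the class is used. The exponent is capped at 1, so that Cauchy
  kernels, which are of the order of \<open>decay 1\<close>, obey the same bound. The constant 16
  collects a factor 4 for the change of weight and a factor 4 for the change of exponent.\<close>

lemma Hinf0_iff:
  assumes "\<phi> \<le> pi"
  shows "f \<in> Hinf0 \<phi> \<longleftrightarrow> f holomorphic_on sector \<phi> \<and>
    (\<exists>C s. 0 \<le> C \<and> 0 < s \<and> s \<le> 1 \<and> (\<forall>z\<in>sector \<phi>. cmod (f z) \<le> C * (cmod z * decay s (cmod z))))"
proof (intro iffI conjI)
  assume f: "f \<in> Hinf0 \<phi>"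
  then show "f holomorphic_on sector \<phi>" by (simp add: Hinf0_def Hinf_def)
  obtain C s where C: "0 < C" "0 < s" "\<And>z. z \<in> sector \<phi> \<Longrightarrow> cmod (f z) \<le> C * min (cmod z powr s) (cmod z powr - s)"
    using f by (auto simp: Hinf0_def)
  have "cmod (f z) \<le> 16 * C * (cmod z * decay (min s 1) (cmod z))" if z: "z \<in> sector \<phi>" for z
  proof -
    have z0: "0 < cmod z" using z by (simp add: sector_def)
    have "cmod (f z) \<le> C * min (cmod z powr s) (cmod z powr - s)" by (rule C(3)[OF z])
    also have "\<dots> \<le> C * (4 * (4 * (cmod z * decay (min s 1) (cmod z))))"
      using C z0 by (intro mult_left_mono order_trans[OF min_le_times_decay] times_decay_mono) auto
    finally show ?thesis by simp
  qed
  then show "\<exists>C s. 0 \<le> C \<and> 0 < s \<and> s \<le> 1 \<and> (\<forall>z\<in>sector \<phi>. cmod (f z) \<le> C * (cmod z * decay s (cmod z)))"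
    using C by (intro exI[of _ "16 * C"] exI[of _ "min s 1"]) auto
next
  assume *: "f holomorphic_on sector \<phi> \<and>
    (\<exists>C s. 0 \<le> C \<and> 0 < s \<and> s \<le> 1 \<and> (\<forall>z\<in>sector \<phi>. cmod (f z) \<le> C * (cmod z * decay s (cmod z))))"
  then obtain C s where C: "0 \<le> C" "0 < s" "\<And>z. z \<in> sector \<phi> \<Longrightarrow> cmod (f z) \<le> C * (cmod z * decay s (cmod z))"
    by blast
  have le: "cmod (f z) \<le> (C + 1) * min (cmod z powr s) (cmod z powr - s)" if z: "z \<in> sector \<phi>" for z
  proof -
    have z0: "0 < cmod z" using z by (simp add: sector_def)
    have "cmod (f z) \<le> C * (cmod z * decay s (cmod z))" by (rule C(3)[OF z])
    also have "\<dots> \<le> C * min (cmod z powr s) (cmod z powr - s)"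
      using C z0 by (intro mult_left_mono times_decay_le_min) auto
    also have "\<dots> \<le> (C + 1) * min (cmod z powr s) (cmod z powr - s)"
      by (intro mult_right_mono) auto
    finally show ?thesis .
  qed
  moreover have "cmod (f z) \<le> (C + 1) * 1" if z: "z \<in> sector \<phi>" for z
  proof -
    have z0: "0 < cmod z" using z by (simp add: sector_def)
    show ?thesis using C(1) C(2) z0
      by (intro order_trans[OF le[OF z]] mult_left_mono min_powr_le_1) auto
  qed
  then have "bounded (f ` sector \<phi>)" by (auto simp: bounded_iff)
  moreover have "0 < C + 1" using C(1) by simp
  ultimately show "f \<in> Hinf0 \<phi>" unfolding Hinf0_def Hinf_def using * C(2) by blast
qed

text \<open>For a merely bounded H a single kernel decays too slowly at infinity, while a difference
  of two decays quadratically. This version is meant for functions such as w R(-w, A), which are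
  bounded but need not decay.\<close>

lemma cauchy_difference:
  assumes \<nu>: "0 < \<nu>" "\<nu> < \<phi>" "\<phi> \<le> pi" and H: "H holomorphic_on sector \<phi>"
    and B: "\<And>w. w \<in> sector \<phi> \<Longrightarrow> cmod (H w) \<le> B" and z: "z1 \<in> sector \<nu>" "z2 \<in> sector \<nu>"
  shows "sector_integral \<nu> (\<lambda>w. H w * (1 / (w - z1) - 1 / (w - z2))) = 2 * of_real pi * \<i> * (H z1 - H z2)"
proof -
  have zz: "0 < cmod z1" "0 < cmod z2" using z by (auto simp: sector_def)
  have far: "1 / 3 * min 1 (cmod z) * (1 + cmod w) \<le> cmod (w - z)"
    if "w \<in> sector \<phi>" "0 < cmod z" "cmod w \<le> cmod z / 2 \<or> 2 * cmod z \<le> cmod w" for z w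
  proof -
    have "1 / 3 * (cmod w + cmod z) \<le> cmod (w - z)"
      using that(3) norm_triangle_ineq3[of w z] by auto
    then show ?thesis using that by (intro scale_sum_ge) (auto simp: sector_def)
  qed
  define c where "c z = 1 / 3 * min 1 (cmod z)" for z :: complex
  define m where "m = min (cmod z1) (cmod z2) / 2"
  define M where "M = 2 * max (cmod z1) (cmod z2)"
  have "sector_integral \<nu> (\<lambda>w. H w * (1 / (w - z1) + (- 1) / (w - z2))) = 2 * of_real pi * \<i> * (1 * H z1 + (- 1) * H z2)"
  proof (rule sector_cauchy[OF \<nu> H z])
    fix w assume w: "w \<in> sector \<phi>" "cmod w \<le> m \<or> M \<le> cmod w"
    have "cmod w \<le> cmod z1 / 2 \<or> 2 * cmod z1 \<le> cmod w" "cmod w \<le> cmod z2 / 2 \<or> 2 * cmod z2 \<le> cmod w"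
      using w(2) by (auto simp: m_def M_def)
    from far[OF w(1) zz(1) this(1)] far[OF w(1) zz(2) this(2)]
    have "cmod (1 / (w - z1) - 1 / (w - z2)) \<le> cmod (z1 - z2) / (c z1 * c z2) * decay 1 (cmod w)"
      by (intro recip_diff_bound) (use w zz in \<open>auto simp: c_def sector_def\<close>)
    then have "cmod (H w) * cmod (1 / (w - z1) - 1 / (w - z2)) \<le> B * (cmod (z1 - z2) / (c z1 * c z2) * decay 1 (cmod w))"
      using order_trans[OF norm_ge_zero B[OF w(1)]] by (intro mult_mono B w) auto
    then show "cmod (H w * (1 / (w - z1) + (- 1) / (w - z2))) \<le> B * (cmod (z1 - z2) / (c z1 * c z2)) * decay 1 (cmod w)"
      by (simp add: norm_mult mult.assoc)
  qed (use zz in \<open>auto simp: m_def\<close>)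
  then show ?thesis by simp
qed

text \<open>The decay of f makes a single kernel integrable, so \<open>sector_cauchy\<close> is used
  with second coefficient 0.\<close>

lemma cauchy_Hinf0:
  assumes \<nu>: "0 < \<nu>" "\<nu> < \<phi>" "\<phi> \<le> pi" and f: "f \<in> Hinf0 \<phi>" and z: "z \<in> sector \<nu>"
  shows "sector_integral \<nu> (\<lambda>w. f w / (w - z)) = 2 * of_real pi * \<i> * f z"
proof -
  from f Hinf0_iff[OF \<nu>(3), of f] obtain C s where hol: "f holomorphic_on sector \<phi>"
    and C: "0 \<le> C" "0 < s" "s \<le> 1" "\<And>z. z \<in> sector \<phi> \<Longrightarrow> cmod (f z) \<le> C * (cmod z * decay s (cmod z))" by blast
  have z0: "0 < cmod z" using z by (simp add: sector_def)
  have "sector_integral \<nu> (\<lambda>w. f w * (1 / (w - z) + 0 / (w - z))) = 2 * of_real pi * \<i> * (1 * f z + 0 * f z)"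
  proof (rule sector_cauchy[OF \<nu> hol z z C(2,3)])
    show "0 < cmod z / 2" using z0 by simp
    fix w assume w: "w \<in> sector \<phi>" "cmod w \<le> cmod z / 2 \<or> 2 * cmod z \<le> cmod w"
    have w0: "0 < cmod w" using w by (simp add: sector_def)
    have far: "cmod w \<le> 3 * cmod (w - z)"
      using w(2) norm_triangle_ineq3[of w z] z0 by auto
    then have "0 < cmod (w - z)" using w0 by linarith
    have "cmod (f w) \<le> C * decay s (cmod w) * cmod w" using C(4)[OF w(1)] by (simp add: mult_ac)
    also have "\<dots> \<le> C * decay s (cmod w) * (3 * cmod (w - z))"
      using far C(1) decay_nonneg by (intro mult_left_mono) auto
    finally have "cmod (f w) / cmod (w - z) \<le> 3 * C * decay s (cmod w)"
      using \<open>0 < cmod (w - z)\<close> by (simp add: divide_le_eq mult_ac)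
    then show "cmod (f w * (1 / (w - z) + 0 / (w - z))) \<le> 3 * C * decay s (cmod w)"
      by (simp add: norm_mult norm_divide)
  qed
  then show ?thesis by simp
qed

text \<open>A slightly larger sector contains the contour and still avoids the pole; there the
  distance to the pole is at least c |w|, which turns the bound \<open>r * decay s r\<close> for f
  into the integrable \<open>decay s r\<close>.\<close>

lemma cauchy_outside:
  assumes \<nu>: "0 < \<nu>" "\<nu> < \<phi>" "\<phi> \<le> pi" and f: "f \<in> Hinf0 \<phi>"
    and \<beta>: "\<nu> < \<bar>\<beta>\<bar>" "\<bar>\<beta>\<bar> \<le> pi" and t: "0 < t"
  shows "sector_integral \<nu> (\<lambda>w. f w / (w - of_real t * cis \<beta>)) = 0"
proof -
  from f Hinf0_iff[OF \<nu>(3), of f] obtain C s where hol: "f holomorphic_on sector \<phi>"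
    and C: "0 \<le> C" "0 < s" "s \<le> 1" "\<And>z. z \<in> sector \<phi> \<Longrightarrow> cmod (f z) \<le> C * (cmod z * decay s (cmod z))" by blast
  define \<phi>' where "\<phi>' = (\<nu> + min \<phi> \<bar>\<beta>\<bar>) / 2"
  have \<phi>': "0 < \<phi>'" "\<nu> < \<phi>'" "\<phi>' < \<phi>" "\<phi>' < \<bar>\<beta>\<bar>" using \<nu> \<beta> by (auto simp: \<phi>'_def)
  obtain c where c: "0 < c" "\<And>w t. w \<in> sector \<phi>' \<Longrightarrow> 0 \<le> t \<Longrightarrow> c * (cmod w + t) \<le> cmod (w - of_real t * cis \<beta>)"
    using norm_diff_sector[OF \<phi>'(1,4) \<beta>(2)] by blast
  show ?thesis
  proof (rule sector_integral_zero[OF \<nu>(1) \<phi>'(2) C(2)])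
    fix r \<theta> :: real assume r: "0 < r" "\<bar>\<theta>\<bar> < \<phi>'"
    define w where "w = of_real r * cis \<theta>"
    have w: "w \<in> sector \<phi>'" "cmod w = r" using r \<phi>' \<nu> by (auto simp: w_def norm_mult intro!: polar_in_sector)
    have w': "w \<in> sector \<phi>" using w(1) \<phi>' by (auto simp: sector_def)
    have ge: "c * r \<le> cmod (w - of_real t * cis \<beta>)"
    proof -
      have "c * r \<le> c * (cmod w + t)" using c(1) t w by (intro mult_left_mono) auto
      then show ?thesis using c(2)[OF w(1), of t] t by linarith
    qed
    moreover have "0 < c * r" using c r by simp
    ultimately have pos: "0 < cmod (w - of_real t * cis \<beta>)" by linarith
    have "f field_differentiable at w" by (rule holomorphic_on_imp_differentiable_at[OF hol open_sector[OF \<nu>(3)] w'])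
    then show "(\<lambda>w. f w / (w - of_real t * cis \<beta>)) field_differentiable at (of_real r * cis \<theta>)"
      unfolding w_def[symmetric] using pos by (intro derivative_intros) auto
    have "cmod (f w) \<le> C * decay s r / c * (c * r)" using C(4)[OF w'] c w by (simp add: mult_ac)
    also have "\<dots> \<le> C * decay s r / c * cmod (w - of_real t * cis \<beta>)"
      using C c by (intro mult_left_mono ge) (auto simp: decay_nonneg)
    finally have "cmod (f w / (w - of_real t * cis \<beta>)) \<le> C * decay s r / c"
      using pos by (simp add: norm_divide divide_le_eq)
    then show "cmod (f (of_real r * cis \<theta>) / (of_real r * cis \<theta> - of_real t * cis \<beta>)) \<le> C / c * decay s r"
      by (simp add: w_def)
  qed
qed

lemma cfunctional_simps:
  assumes "cfunctional \<xi>"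
  shows "\<xi> (x + y) = \<xi> x + \<xi> y" "\<xi> (x - y) = \<xi> x - \<xi> y" "\<xi> (c *C x) = c * \<xi> x" "\<xi> 0 = 0" "\<xi> (- x) = - \<xi> x"
    "\<xi> (r *\<^sub>R x) = of_real r * \<xi> x"
proof -
  have l: "linear \<xi>" using assms by (simp add: cfunctional_def bounded_linear.linear)
  show "\<xi> (x + y) = \<xi> x + \<xi> y" "\<xi> (x - y) = \<xi> x - \<xi> y" "\<xi> (c *C x) = c * \<xi> x" "\<xi> 0 = 0" "\<xi> (- x) = - \<xi> x"
    using assms l by (auto simp: cfunctional_def linear_add linear_diff linear_0 linear_neg)
  show "\<xi> (r *\<^sub>R x) = of_real r * \<xi> x" using linear_scale[OF l, of r x] by (simp add: scaleR_conv_of_real)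
qed

lemma not_in_closure_sector:
  assumes "0 < \<omega>" "\<omega> < \<bar>\<beta>\<bar>" "\<bar>\<beta>\<bar> \<le> pi" "0 < t"
  shows "of_real t * cis \<beta> \<notin> closure (sector \<omega>)"
proof -
  obtain c where c: "0 < c" "\<And>w t. w \<in> sector \<omega> \<Longrightarrow> 0 \<le> t \<Longrightarrow> c * (cmod w + t) \<le> cmod (w - of_real t * cis \<beta>)"
    using norm_diff_sector[OF assms(1-3)] by blast
  have "\<not> (\<exists>w\<in>sector \<omega>. dist w (of_real t * cis \<beta>) < c * t)"
  proof safe
    fix w assume w: "w \<in> sector \<omega>" "dist w (of_real t * cis \<beta>) < c * t"
    have "c * t \<le> c * (cmod w + t)" using c(1) by (intro mult_left_mono) auto
    then show False using c(2)[OF w(1), of t] w(2) assms(4) by (simp add: dist_norm)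
  qed
  moreover have "0 < c * t" using c assms by simp
  ultimately show ?thesis unfolding closure_approachable by blast
qed

section \<open>The calculus for decaying functions\<close>

text \<open>Sectoriality with its quantifiers resolved: one constant \<open>M\<close> controls the
  resolvent outside the sector of angle \<mu>, and \<mu> < \<phi> leaves room for contours. The
  parameters are shared by all positive dilations of \<open>A\<close>, and later bounds depend on
  the operator only through them.\<close>

locale sectorial_operator =
  fixes D :: "'a::complex_banach set" and A :: "'a \<Rightarrow> 'a" and \<mu> \<phi> M :: real
  assumes lin: "linear_operator D A"
    and angles: "0 < \<mu>" "\<mu> < \<phi>" "\<phi> < pi"
    and M: "0 \<le> M"
    and res: "z \<notin> sector \<mu> \<Longrightarrow> z \<noteq> 0 \<Longrightarrow> z \<in> resolvent_set D A"
    and res_bound: "z \<notin> sector \<mu> \<Longrightarrow> z \<noteq> 0 \<Longrightarrow> norm (z *C resolvent D A z x) \<le> M * norm x"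
begin

abbreviation R where "R \<equiv> resolvent D A"

lemma D_add: "x \<in> D \<Longrightarrow> y \<in> D \<Longrightarrow> x + y \<in> D" "x \<in> D \<Longrightarrow> y \<in> D \<Longrightarrow> A (x + y) = A x + A y"
  and D_scale: "x \<in> D \<Longrightarrow> c *C x \<in> D" "x \<in> D \<Longrightarrow> A (c *C x) = c *C A x"
  and D_0: "0 \<in> D"
  using lin by (auto simp: linear_operator_def)

lemma resolvent_solves:
  assumes "z \<in> resolvent_set D A"
  shows "R z x \<in> D" "z *C R z x - A (R z x) = x"
proof -
  have b: "bij_betw (\<lambda>x. z *C x - A x) D UNIV" using assms by (simp add: resolvent_set_def)
  then have im: "(\<lambda>x. z *C x - A x) ` D = UNIV" by (simp add: bij_betw_def)
  show "R z x \<in> D" unfolding resolvent_def by (rule inv_into_into) (simp add: im)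
  show "z *C R z x - A (R z x) = x" unfolding resolvent_def
    using f_inv_into_f[of x "\<lambda>x. z *C x - A x" D] im by simp
qed

lemma resolvent_unique:
  assumes "z \<in> resolvent_set D A" "y \<in> D" "z *C y - A y = x"
  shows "R z x = y"
proof -
  have "inj_on (\<lambda>x. z *C x - A x) D" using assms(1) by (simp add: resolvent_set_def bij_betw_def)
  from inv_into_f_f[OF this assms(2)] assms(3) show ?thesis by (simp add: resolvent_def)
qed

lemma resolvent_bounded_linear: "z \<in> resolvent_set D A \<Longrightarrow> bounded_linear (R z)"
  by (simp add: resolvent_set_def)

lemma resolvent_scaleC:
  assumes "z \<in> resolvent_set D A"
  shows "R z (c *C x) = c *C R z x"
proof (rule resolvent_unique[OF assms])
  show "c *C R z x \<in> D" by (intro D_scale resolvent_solves assms)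
  have "z *C c *C R z x - A (c *C R z x) = c *C (z *C R z x - A (R z x))"
    by (simp add: D_scale resolvent_solves(1)[OF assms] scaleC_diff_right scaleC_scaleC mult.commute)
  then show "z *C c *C R z x - A (c *C R z x) = c *C x" by (simp add: resolvent_solves[OF assms])
qed

lemma cfunctional_resolvent:
  assumes "cfunctional \<xi>" "z \<in> resolvent_set D A"
  shows "cfunctional (\<lambda>x. \<xi> (R z x))"
  using assms bounded_linear_compose[OF _ resolvent_bounded_linear[OF assms(2)], of \<xi>]
  by (auto simp: cfunctional_def resolvent_scaleC)

lemma resolvent_identity:
  assumes "z \<in> resolvent_set D A" "w \<in> resolvent_set D A"
  shows "(w - z) *C R w (R z x) = R z x - R w x"
proof -
  define u where "u = R z x"
  have u: "u \<in> D" "z *C u - A u = x" using resolvent_solves[OF assms(1)] by (auto simp: u_def)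
  have "w *C u - A u = x + (w - z) *C u" by (simp add: u(2)[symmetric] scaleC_diff_left)
  then have "u = R w (x + (w - z) *C u)" using resolvent_unique[OF assms(2) u(1)] by simp
  also have "\<dots> = R w x + (w - z) *C R w u"
    using resolvent_bounded_linear[OF assms(2)]
    by (simp add: resolvent_scaleC[OF assms(2)] bounded_linear.linear linear_add)
  finally show ?thesis by (simp add: u_def algebra_simps)
qed

lemma resolvent_product:
  assumes "z \<in> resolvent_set D A" "w \<in> resolvent_set D A" "w \<noteq> z"
  shows "R w (R z x) = (1 / (w - z)) *C (R z x - R w x)"
  using resolvent_identity[OF assms(1,2), of x, symmetric] assms(3) by (simp add: scaleC_scaleC)

lemma resolvent_commute:
  assumes "z \<in> resolvent_set D A" "w \<in> resolvent_set D A"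
  shows "R w (R z x) = R z (R w x)"
proof (cases "w = z")
  case False
  have "(1 / (z - w)) *C (R w x - R z x) = (1 / (w - z)) *C (R z x - R w x)"
  proof -
    have "1 / (z - w) = - (1 / (w - z))" by (metis minus_diff_eq minus_divide_right)
    then show ?thesis by (simp add: scaleC_diff_right)
  qed
  then show ?thesis using resolvent_product[OF assms False] resolvent_product[OF assms(2,1)] False by simp
qed simp

text \<open>The closure and the point 0 are removed to obtain an open set, on which the resolvent is
  holomorphic. All rays of angle strictly between \<mu> and \<phi> lie in it.\<close>

definition exterior :: "complex set" where "exterior = - closure (sector \<mu>) - {0}"

lemma open_exterior: "open exterior"
  by (simp add: exterior_def open_Compl open_Diff)

lemma exteriorD: "z \<in> exterior \<Longrightarrow> z \<notin> sector \<mu>" "z \<in> exterior \<Longrightarrow> z \<noteq> 0"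
  using closure_subset[of "sector \<mu>"] by (auto simp: exterior_def)

lemma exterior_resolvent_set: "z \<in> exterior \<Longrightarrow> z \<in> resolvent_set D A"
  using res exteriorD by blast

lemma ray_in_exterior: "0 < r \<Longrightarrow> \<mu> < \<bar>\<theta>\<bar> \<Longrightarrow> \<bar>\<theta>\<bar> \<le> pi \<Longrightarrow> of_real r * cis \<theta> \<in> exterior"
  using not_in_closure_sector[OF angles(1)] by (simp add: exterior_def)

lemma resolvent_norm:
  assumes "z \<in> exterior"
  shows "norm (R z x) \<le> M / cmod z * norm x"
  using res_bound[OF exteriorD(1)[OF assms] exteriorD(2)[OF assms], of x] exteriorD(2)[OF assms]
  by (simp add: norm_scaleC field_simps)

lemma resolvent_continuous:
  assumes z0: "z0 \<in> exterior"
  shows "isCont (\<lambda>z. R z x) z0"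
proof -
  have z0': "z0 \<noteq> 0" using exteriorD(2)[OF z0] .
  have "((\<lambda>z. cmod (z - z0) * (M / cmod z * (M / cmod z0 * norm x))) \<longlongrightarrow>
      cmod (z0 - z0) * (M / cmod z0 * (M / cmod z0 * norm x))) (at z0)"
    by (intro tendsto_intros) (use z0' in auto)
  then have lim: "((\<lambda>z. cmod (z - z0) * (M / cmod z * (M / cmod z0 * norm x))) \<longlongrightarrow> 0) (at z0)" by simp
  have "((\<lambda>z. R z x - R z0 x) \<longlongrightarrow> 0) (at z0)"
  proof (rule Lim_null_comparison[OF _ lim])
    have "eventually (\<lambda>z. z \<in> exterior) (at z0)"
      using open_exterior z0 by (intro eventually_at_in_open') auto
    then show "\<forall>\<^sub>F z in at z0. norm (R z x - R z0 x) \<le> cmod (z - z0) * (M / cmod z * (M / cmod z0 * norm x))"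
    proof eventually_elim
      case (elim z)
      have "norm (R z x - R z0 x) = cmod (z - z0) * norm (R z (R z0 x))"
        using resolvent_identity[OF exterior_resolvent_set[OF z0] exterior_resolvent_set[OF elim], of x]
        by (metis norm_minus_commute norm_scaleC)
      also have "\<dots> \<le> cmod (z - z0) * (M / cmod z * (M / cmod z0 * norm x))"
        using M by (intro mult_left_mono order_trans[OF resolvent_norm[OF elim]] resolvent_norm z0) auto
      finally show ?case .
    qed
  qed
  then show ?thesis unfolding isCont_def using Lim_null by blast
qed

text \<open>By the resolvent identity the difference quotient at z0 is -R(z) R(z0) x, and the
  resolvent is continuous.\<close>

lemma resolvent_differentiable:
  assumes z0: "z0 \<in> exterior" and \<xi>: "cfunctional \<xi>"
  shows "(\<lambda>z. \<xi> (R z x)) field_differentiable (at z0)"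
proof -
  have bl: "bounded_linear \<xi>" using \<xi> by (simp add: cfunctional_def)
  have "((\<lambda>z. - \<xi> (R z (R z0 x))) \<longlongrightarrow> - \<xi> (R z0 (R z0 x))) (at z0)"
    using resolvent_continuous[OF z0, of "R z0 x"] unfolding isCont_def
    by (intro tendsto_minus bounded_linear.tendsto[OF bl])
  moreover have "eventually (\<lambda>z. z \<in> exterior \<and> z \<noteq> z0) (at z0)"
    using open_exterior z0 by (intro eventually_conj eventually_at_in_open' eventually_neq_at_within) auto
  then have "eventually (\<lambda>z. - \<xi> (R z (R z0 x)) = (\<xi> (R z x) - \<xi> (R z0 x)) / (z - z0)) (at z0)"
  proof eventually_elim
    case (elim z)
    then have z: "z \<in> exterior" "z \<noteq> z0" by auto
    have "\<xi> (R z (R z0 x)) = (1 / (z - z0)) * (\<xi> (R z0 x) - \<xi> (R z x))"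
      by (simp only: resolvent_product[OF exterior_resolvent_set[OF z0] exterior_resolvent_set[OF z(1)] z(2)] cfunctional_simps[OF \<xi>])
    then show ?case by (simp add: minus_divide_left)
  qed
  ultimately have "((\<lambda>z. (\<xi> (R z x) - \<xi> (R z0 x)) / (z - z0)) \<longlongrightarrow> - \<xi> (R z0 (R z0 x))) (at z0)"
    by (rule Lim_transform_eventually)
  then show ?thesis unfolding field_differentiable_def has_field_derivative_iff by blast
qed

abbreviation Phi where "Phi \<nu> \<equiv> Hinf0_calculus D A \<nu>"

lemma polar_in_sector_phi: "0 < r \<Longrightarrow> \<bar>\<theta>\<bar> < \<phi> \<Longrightarrow> of_real r * cis \<theta> \<in> sector \<phi>"
  using angles by (intro polar_in_sector) auto

lemma Hinf0_cont: "f \<in> Hinf0 \<phi> \<Longrightarrow> z \<in> sector \<phi> \<Longrightarrow> isCont f z"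
  using holomorphic_on_imp_differentiable_at[OF _ open_sector] angles
  by (force simp: Hinf0_def Hinf_def intro: field_differentiable_imp_continuous_at)

lemma Hinf0_diff: "f \<in> Hinf0 \<phi> \<Longrightarrow> z \<in> sector \<phi> \<Longrightarrow> f field_differentiable (at z)"
  using holomorphic_on_imp_differentiable_at[OF _ open_sector] angles
  by (force simp: Hinf0_def Hinf_def)

text \<open>The constants are named because they reappear in operator bounds that have to hold for
  all tA at once, independently of t.\<close>

definition Hinf0_bound :: "(complex \<Rightarrow> complex) \<Rightarrow> real \<Rightarrow> real \<Rightarrow> bool" where
  "Hinf0_bound f C s \<longleftrightarrow> 0 \<le> C \<and> 0 < s \<and> s \<le> 1 \<and> (\<forall>z\<in>sector \<phi>. cmod (f z) \<le> C * (cmod z * decay s (cmod z)))"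

lemma Hinf0_bound_exists: "f \<in> Hinf0 \<phi> \<Longrightarrow> \<exists>C s. Hinf0_bound f C s"
  using Hinf0_iff[of \<phi> f] angles by (auto simp: Hinf0_bound_def)

text \<open>The resolvent bound M / r removes the extra factor r from the bound of f and leaves the
  integrable weight \<open>decay s r\<close>. The dilation formula prepares the comparison of the
  calculi of A and tA, which use the same rays.\<close>

lemma calculus_ray:
  assumes f: "f \<in> Hinf0 \<phi>" and h: "Hinf0_bound f C s" and \<theta>: "\<mu> < \<bar>\<theta>\<bar>" "\<bar>\<theta>\<bar> < \<phi>"
  shows "(\<lambda>r. cis \<theta> *C (f (of_real r * cis \<theta>) *C R (of_real r * cis \<theta>) x)) integrable_on {0<..}"
    "norm (ray_integral \<theta> (\<lambda>z. f z *C R z x)) \<le> C * M * norm x / s"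
    "0 < t \<Longrightarrow> ray_integral \<theta> (\<lambda>z. f z *C R z x) =
      t *\<^sub>R integral {0<..} (\<lambda>r. cis \<theta> *C (f (of_real (t * r) * cis \<theta>) *C R (of_real (t * r) * cis \<theta>) x))"
proof -
  have cont: "continuous_on {0<..} (\<lambda>r. cis \<theta> *C (f (of_real r * cis \<theta>) *C R (of_real r * cis \<theta>) x))"
    using \<theta> angles by (intro continuous_on_scaleC continuous_intros continuous_on_ray
        resolvent_continuous Hinf0_cont[OF f] ray_in_exterior polar_in_sector_phi) auto
  have bd: "norm (cis \<theta> *C (f (of_real r * cis \<theta>) *C R (of_real r * cis \<theta>) x)) \<le> C * M * norm x * decay s r"
    if r: "0 < r" for r
  proof -
    define z where "z = of_real r * cis \<theta>"
    have z: "z \<in> exterior" "z \<in> sector \<phi>" "cmod z = r"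
      using r \<theta> angles by (auto simp: z_def norm_mult intro!: ray_in_exterior polar_in_sector_phi)
    have "norm (cis \<theta> *C (f z *C R z x)) = cmod (f z) * norm (R z x)" by (simp add: norm_scaleC)
    also have "\<dots> \<le> (C * (r * decay s r)) * (M / r * norm x)"
      using h z r decay_nonneg[of s r] resolvent_norm[OF z(1), of x] by (intro mult_mono) (auto simp: Hinf0_bound_def)
    also have "\<dots> = C * M * norm x * decay s r" using r by simp
    finally show ?thesis by (simp add: z_def)
  qed
  have s: "0 < s" using h by (simp add: Hinf0_bound_def)
  show "(\<lambda>r. cis \<theta> *C (f (of_real r * cis \<theta>) *C R (of_real r * cis \<theta>) x)) integrable_on {0<..}"
    by (rule half_line_integral(1)[OF cont s bd])
  show "norm (ray_integral \<theta> (\<lambda>z. f z *C R z x)) \<le> C * M * norm x / s"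
    unfolding ray_integral_def by (rule half_line_integral(2)[OF cont s bd])
  show "ray_integral \<theta> (\<lambda>z. f z *C R z x) =
      t *\<^sub>R integral {0<..} (\<lambda>r. cis \<theta> *C (f (of_real (t * r) * cis \<theta>) *C R (of_real (t * r) * cis \<theta>) x))"
    if t: "0 < t"
    using integral_unique[OF half_line_integral(3)[OF cont s bd t]] t by (simp add: ray_integral_def)
qed

text \<open>The bound sees f only through C and s and the operator only through \<open>M\<close>.
  The two rays double the estimate, and 1 / (2 pi) is generously replaced by 1 / 2.\<close>

lemma Phi_norm:
  assumes f: "f \<in> Hinf0 \<phi>" and h: "Hinf0_bound f C s" and \<nu>: "\<mu> < \<nu>" "\<nu> < \<phi>"
  shows "norm (Phi \<nu> f x) \<le> C * M / s * norm x"
proof -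
  define I where "I \<theta> = ray_integral \<theta> (\<lambda>z. f z *C R z x)" for \<theta>
  have b: "norm (I \<nu>) \<le> C * M * norm x / s" "norm (I (- \<nu>)) \<le> C * M * norm x / s"
    unfolding I_def using \<nu> angles by (auto intro!: calculus_ray[OF f h])
  have "norm (Phi \<nu> f x) = cmod (1 / (2 * of_real pi * \<i>)) * norm (I (- \<nu>) - I \<nu>)"
    by (simp add: Hinf0_calculus_def norm_scaleC I_def)
  also have "cmod (1 / (2 * of_real pi * \<i>)) = 1 / (2 * pi)" by (simp add: norm_divide norm_mult)
  also have "1 / (2 * pi) * norm (I (- \<nu>) - I \<nu>) \<le> 1 / 2 * norm (I (- \<nu>) - I \<nu>)"
    using pi_gt3 by (intro mult_right_mono) (auto simp: field_simps)
  also have "\<dots> \<le> C * M * norm x / s" using b norm_triangle_ineq4[of "I (- \<nu>)" "I \<nu>"] by linarith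
  finally show ?thesis by simp
qed

text \<open>A continuous functional passes through the integral and turns the calculus into a scalar
  contour integral; the algebraic rules for \<open>Phi\<close> are proved through this
  formula.\<close>

lemma Phi_functional:
  assumes f: "f \<in> Hinf0 \<phi>" and \<nu>: "\<mu> < \<nu>" "\<nu> < \<phi>" and \<xi>: "cfunctional \<xi>"
  shows "\<xi> (Phi \<nu> f x) = 1 / (2 * of_real pi * \<i>) * sector_integral \<nu> (\<lambda>z. f z * \<xi> (R z x))"
    "\<bar>\<theta>\<bar> = \<nu> \<Longrightarrow> ray_integrable \<theta> (\<lambda>z. f z * \<xi> (R z x))"
proof -
  obtain C s where h: "Hinf0_bound f C s" using Hinf0_bound_exists[OF f] by blast
  have bl: "bounded_linear \<xi>" using \<xi> by (simp add: cfunctional_def)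
  have ray: "\<xi> (ray_integral \<theta> (\<lambda>z. f z *C R z x)) = ray_integral \<theta> (\<lambda>z. f z * \<xi> (R z x))"
    "ray_integrable \<theta> (\<lambda>z. f z * \<xi> (R z x))"
    if "\<bar>\<theta>\<bar> = \<nu>" for \<theta>
  proof -
    have i: "(\<lambda>r. cis \<theta> *C (f (of_real r * cis \<theta>) *C R (of_real r * cis \<theta>) x)) integrable_on {0<..}"
      using that \<nu> by (intro calculus_ray(1)[OF f h]) auto
    show "\<xi> (ray_integral \<theta> (\<lambda>z. f z *C R z x)) = ray_integral \<theta> (\<lambda>z. f z * \<xi> (R z x))"
      unfolding ray_integral_complex unfolding ray_integral_def
      using integral_linear[OF i bl] by (simp add: o_def cfunctional_simps[OF \<xi>])
    show "ray_integrable \<theta> (\<lambda>z. f z * \<xi> (R z x))"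
      using integrable_linear[OF i bl] by (simp add: o_def ray_integrable_def cfunctional_simps[OF \<xi>])
  qed
  have "0 < \<nu>" using \<nu> angles by simp
  then show "\<xi> (Phi \<nu> f x) = 1 / (2 * of_real pi * \<i>) * sector_integral \<nu> (\<lambda>z. f z * \<xi> (R z x))"
    unfolding Hinf0_calculus_def cfunctional_simps[OF \<xi>]
    by (simp add: ray(1) sector_integral_def)
  show "\<bar>\<theta>\<bar> = \<nu> \<Longrightarrow> ray_integrable \<theta> (\<lambda>z. f z * \<xi> (R z x))" by (rule ray(2))
qed

lemma functional_resolvent_bound:
  assumes \<xi>: "cfunctional \<xi>"
  obtains B where "0 \<le> B" "\<And>z x. z \<in> exterior \<Longrightarrow> cmod (\<xi> (R z x)) \<le> B * norm x / cmod z"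
proof -
  have "bounded_linear \<xi>" using \<xi> by (simp add: cfunctional_def)
  then obtain K where K: "0 \<le> K" "\<And>x. cmod (\<xi> x) \<le> norm x * K"
    using bounded_linear.nonneg_bounded by blast
  have "cmod (\<xi> (R z x)) \<le> K * M * norm x / cmod z" if "z \<in> exterior" for z x
  proof -
    have "cmod (\<xi> (R z x)) \<le> norm (R z x) * K" by (rule K)
    also have "\<dots> \<le> (M / cmod z * norm x) * K" using resolvent_norm[OF that] K(1) by (intro mult_right_mono)
    finally show ?thesis by (simp add: mult_ac)
  qed
  then show ?thesis using that[of "K * M"] K M by simp
qed

text \<open>Between the angles \<mu> and \<phi> both f and the resolvent are holomorphic, so each
  ray may be turned separately. The product rule needs this freedom, as its two factors are
  integrated over different contours.\<close>

lemma Phi_angle: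
  assumes f: "f \<in> Hinf0 \<phi>" and \<nu>: "\<mu> < \<nu>" "\<nu> < \<phi>" and \<nu>': "\<mu> < \<nu>'" "\<nu>' < \<phi>"
  shows "Phi \<nu> f x = Phi \<nu>' f x"
proof (rule cfunctional_eqI)
  fix \<xi> :: "'a \<Rightarrow> complex" assume \<xi>: "cfunctional \<xi>"
  obtain C s where h: "Hinf0_bound f C s" using Hinf0_bound_exists[OF f] by blast
  then have s: "0 < s" by (simp add: Hinf0_bound_def)
  obtain B where B: "0 \<le> B" "\<And>z x. z \<in> exterior \<Longrightarrow> cmod (\<xi> (R z x)) \<le> B * norm x / cmod z"
    using functional_resolvent_bound[OF \<xi>] by blast
  have d: "(\<lambda>z. f z * \<xi> (R z x)) field_differentiable at (of_real r * cis \<theta>)"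
    if "0 < r" "\<mu> < \<bar>\<theta>\<bar>" "\<bar>\<theta>\<bar> < \<phi>" for r \<theta>
    using that angles by (intro field_differentiable_mult Hinf0_diff[OF f] resolvent_differentiable ray_in_exterior polar_in_sector_phi \<xi>) auto
  have b: "cmod (f (of_real r * cis \<theta>) * \<xi> (R (of_real r * cis \<theta>) x)) \<le> C * B * norm x * decay s r"
    if r: "0 < r" "\<mu> < \<bar>\<theta>\<bar>" "\<bar>\<theta>\<bar> < \<phi>" for r \<theta>
  proof -
    define z where "z = of_real r * cis \<theta>"
    have z: "z \<in> exterior" "z \<in> sector \<phi>" "cmod z = r"
      using r angles by (auto simp: z_def norm_mult intro!: ray_in_exterior polar_in_sector_phi)
    have "cmod (f z * \<xi> (R z x)) \<le> (C * (r * decay s r)) * (B * norm x / r)"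
      unfolding norm_mult using h z r decay_nonneg[of s r] B(2)[OF z(1), of x]
      by (intro mult_mono) (auto simp: Hinf0_bound_def)
    also have "\<dots> = C * B * norm x * decay s r" using r by simp
    finally show ?thesis by (simp add: z_def)
  qed
  have "ray_integral \<nu> (\<lambda>z. f z * \<xi> (R z x)) = ray_integral \<nu>' (\<lambda>z. f z * \<xi> (R z x))"
    by (rule ray_integral_rotate[OF \<nu> \<nu>' s, where C="C * B * norm x"]) (use d b angles in auto)
  moreover have "ray_integral (- \<nu>) (\<lambda>z. f z * \<xi> (R z x)) = ray_integral (- \<nu>') (\<lambda>z. f z * \<xi> (R z x))"
    by (rule ray_integral_rotate[where a="- \<phi>" and b="- \<mu>" and s=s and C="C * B * norm x"]) (use \<nu> \<nu>' s d b angles in auto)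
  ultimately show "\<xi> (Phi \<nu> f x) = \<xi> (Phi \<nu>' f x)"
    by (simp add: Phi_functional[OF f \<nu> \<xi>] Phi_functional[OF f \<nu>' \<xi>] sector_integral_def)
qed

end

section \<open>Exchange of contour integrals and multiplicativity\<close>

lemma ray_integral_diff: "ray_integrable \<theta> f \<Longrightarrow> ray_integrable \<theta> g \<Longrightarrow>
    ray_integral \<theta> (\<lambda>w. f w - g w) = ray_integral \<theta> f - ray_integral \<theta> (g :: complex \<Rightarrow> complex)"
  unfolding ray_integrable_def ray_integral_complex right_diff_distrib by (rule integral_diff)

text \<open>The kernel 1 / (w - z) is at most 1 / (c r), with r the modulus on the first ray; this
  uses up the extra factor r in the bound of f and leaves a product of two integrable weights, as
  Fubini's theorem requires.\<close>

lemma ray_integral_swap: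
  assumes f: "\<And>r. 0 < r \<Longrightarrow> isCont f (of_real r * cis \<alpha>)" and g: "\<And>r. 0 < r \<Longrightarrow> isCont g (of_real r * cis \<beta>)"
    and s: "0 < s1" "0 < s2"
    and bf: "\<And>r. 0 < r \<Longrightarrow> cmod (f (of_real r * cis \<alpha>)) \<le> C1 * (r * decay s1 r)"
    and bg: "\<And>r. 0 < r \<Longrightarrow> cmod (g (of_real r * cis \<beta>)) \<le> C2 * decay s2 r"
    and c: "0 < c" "\<And>r t. 0 \<le> r \<Longrightarrow> 0 \<le> t \<Longrightarrow> c * (r + t) \<le> cmod (of_real r * cis \<alpha> - of_real t * cis \<beta>)"
  shows "ray_integral \<alpha> (\<lambda>w. f w * ray_integral \<beta> (\<lambda>z. g z / (w - z))) =
      ray_integral \<beta> (\<lambda>z. g z * ray_integral \<alpha> (\<lambda>w. f w / (w - z)))"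
    and "ray_integrable \<alpha> (\<lambda>w. f w * ray_integral \<beta> (\<lambda>z. g z / (w - z)))"
    and "ray_integrable \<beta> (\<lambda>z. g z * ray_integral \<alpha> (\<lambda>w. f w / (w - z)))"
proof -
  define W where "W r = of_real r * cis \<alpha>" for r
  define Z where "Z t = of_real t * cis \<beta>" for t
  define K where "K r t = cis \<alpha> * f (W r) * (cis \<beta> * (g (Z t) / (W r - Z t)))" for r t
  have pos: "0 < cmod (W r - Z t)" "c * r \<le> cmod (W r - Z t)" if "0 < r" "0 < t" for r t
  proof -
    have "c * r \<le> c * (r + t)" using that c(1) by simp
    then show "c * r \<le> cmod (W r - Z t)" using c(2)[of r t] that by (simp add: W_def Z_def)
    moreover have "0 < c * r" using that c(1) by simp
    ultimately show "0 < cmod (W r - Z t)" by linarith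
  qed
  have contf: "continuous_on ({0<..} \<times> {0<..}) (\<lambda>p. f (W (fst p)))"
    unfolding W_def by (rule continuous_on_compose2[OF continuous_on_ray[OF f]]) (auto intro!: continuous_intros)
  have contg: "continuous_on ({0<..} \<times> {0<..}) (\<lambda>p. g (Z (snd p)))"
    unfolding Z_def by (rule continuous_on_compose2[OF continuous_on_ray[OF g]]) (auto intro!: continuous_intros)
  have K: "continuous_on ({0<..} \<times> {0<..}) (\<lambda>(r, t). K r t)"
    unfolding K_def split_def
  proof (intro continuous_on_mult continuous_on_divide contf contg continuous_on_const continuous_on_diff ballI)
    show "continuous_on ({0<..} \<times> {0<..}) (\<lambda>p. W (fst p))" "continuous_on ({0<..} \<times> {0<..}) (\<lambda>p. Z (snd p))"
      by (auto simp: W_def Z_def intro!: continuous_intros)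
  qed (use pos in auto)
  have bd: "cmod (K r t) \<le> (C1 / c * decay s1 r) * (C2 * decay s2 t)" if "r \<in> {0<..}" "t \<in> {0<..}" for r t
  proof -
    have rt: "0 < r" "0 < t" using that by auto
    have C2: "0 \<le> C2 * decay s2 t" using bg[OF rt(2)] norm_ge_zero order_trans by blast
    have "cmod (f (W r)) / cmod (W r - Z t) \<le> C1 / c * decay s1 r"
    proof -
      have "cmod (f (W r)) \<le> C1 * (r * decay s1 r)" using bf[OF rt(1)] by (simp add: W_def)
      also have "\<dots> = C1 / c * decay s1 r * (c * r)" using c(1) by simp
      also have "\<dots> \<le> C1 / c * decay s1 r * cmod (W r - Z t)"
      proof -
        have "0 \<le> C1 * (r * decay s1 r)" using bf[OF rt(1)] norm_ge_zero order_trans by blast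
        moreover have "0 < r * decay s1 r" using rt(1) decay_pos[OF rt(1), of s1] by simp
        ultimately have "0 \<le> C1" by (meson mult_neg_pos not_less)
        then show ?thesis using pos(2)[OF rt] c(1) decay_nonneg by (intro mult_left_mono) auto
      qed
      finally show ?thesis using pos(1)[OF rt] by (simp add: divide_le_eq)
    qed
    then have "cmod (f (W r)) / cmod (W r - Z t) * cmod (g (Z t)) \<le> (C1 / c * decay s1 r) * (C2 * decay s2 t)"
      using bg[OF rt(2)] C2 by (intro mult_mono order_trans[OF _ \<open>_ \<le> C1 / c * decay s1 r\<close>]) (auto simp: Z_def)
    then show ?thesis by (simp add: K_def norm_mult norm_divide mult_ac)
  qed
  have si: "set_integrable lborel {0<..} (\<lambda>r. C1 / c * decay s1 r)" "set_integrable lborel {0<..} (\<lambda>t. C2 * decay s2 t)"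
    by (intro set_integrable_mult_right decay_set_integrable s)+
  have e1: "integral {0<..} (K r) = cis \<alpha> * (f (W r) * ray_integral \<beta> (\<lambda>z. g z / (W r - z)))" for r
    unfolding K_def[abs_def] integral_mult_right ray_integral_complex Z_def by simp
  have e2: "integral {0<..} (\<lambda>r. K r t) = cis \<beta> * (g (Z t) * ray_integral \<alpha> (\<lambda>w. f w / (w - Z t)))" for t
  proof -
    have "integral {0<..} (\<lambda>r. K r t) = integral {0<..} (\<lambda>r. cis \<beta> * g (Z t) * (cis \<alpha> * (f (W r) / (W r - Z t))))"
      by (simp add: K_def mult_ac)
    then show ?thesis unfolding integral_mult_right ray_integral_complex W_def by simp
  qed
  note sw = integral_swap_dominated[of "{0<..}" "{0<..}", OF _ _ K bd si, unfolded e1 e2]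
  show "ray_integral \<alpha> (\<lambda>w. f w * ray_integral \<beta> (\<lambda>z. g z / (w - z))) =
      ray_integral \<beta> (\<lambda>z. g z * ray_integral \<alpha> (\<lambda>w. f w / (w - z)))"
    unfolding ray_integral_complex[of \<alpha> "\<lambda>w. f w * _ w"] ray_integral_complex[of \<beta> "\<lambda>w. g w * _ w"]
    using sw(1) by (simp add: W_def Z_def)
  show "ray_integrable \<alpha> (\<lambda>w. f w * ray_integral \<beta> (\<lambda>z. g z / (w - z)))"
    using sw(2) by (simp add: ray_integrable_def W_def)
  show "ray_integrable \<beta> (\<lambda>z. g z * ray_integral \<alpha> (\<lambda>w. f w / (w - z)))"
    using sw(3) by (simp add: ray_integrable_def Z_def)
qed

lemma Hinf0_add:
  assumes "f \<in> Hinf0 \<phi>" "g \<in> Hinf0 \<phi>" "\<phi> \<le> pi" shows "(\<lambda>z. f z + g z) \<in> Hinf0 \<phi>"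
proof -
  obtain C s C' s' where *: "f holomorphic_on sector \<phi>" "g holomorphic_on sector \<phi>"
     "0 \<le> C" "0 < s" "s \<le> 1" "\<And>z. z \<in> sector \<phi> \<Longrightarrow> cmod (f z) \<le> C * (cmod z * decay s (cmod z))"
     "0 \<le> C'" "0 < s'" "s' \<le> 1" "\<And>z. z \<in> sector \<phi> \<Longrightarrow> cmod (g z) \<le> C' * (cmod z * decay s' (cmod z))"
    using assms Hinf0_iff[OF assms(3), of f] Hinf0_iff[OF assms(3), of g] by blast
  have "cmod (f z + g z) \<le> (C * 4 + C' * 4) * (cmod z * decay (min s s') (cmod z))" if z: "z \<in> sector \<phi>" for z
  proof -
    have z0: "0 < cmod z" using z by (simp add: sector_def)
    have "cmod (f z + g z) \<le> C * (cmod z * decay s (cmod z)) + C' * (cmod z * decay s' (cmod z))"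
      using *(6,10)[OF z] norm_triangle_ineq[of "f z" "g z"] by linarith
    also have "\<dots> \<le> C * (4 * (cmod z * decay (min s s') (cmod z))) + C' * (4 * (cmod z * decay (min s s') (cmod z)))"
      using * z0 by (intro add_mono mult_left_mono times_decay_mono) auto
    finally show ?thesis by (simp add: algebra_simps)
  qed
  then show ?thesis unfolding Hinf0_iff[OF assms(3)] using *
    by (intro conjI holomorphic_intros exI[of _ "C * 4 + C' * 4"] exI[of _ "min s s'"]) auto
qed

lemma Hinf0_mult:
  assumes "f \<in> Hinf0 \<phi>" "g holomorphic_on sector \<phi>" "\<And>z. z \<in> sector \<phi> \<Longrightarrow> cmod (g z) \<le> B" "\<phi> \<le> pi"
  shows "(\<lambda>z. f z * g z) \<in> Hinf0 \<phi>"
proof -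
  obtain C s where *: "f holomorphic_on sector \<phi>"
     "0 \<le> C" "0 < s" "s \<le> 1" "\<And>z. z \<in> sector \<phi> \<Longrightarrow> cmod (f z) \<le> C * (cmod z * decay s (cmod z))"
    using assms Hinf0_iff[OF assms(4), of f] by blast
  have "cmod (f z * g z) \<le> (C * \<bar>B\<bar>) * (cmod z * decay s (cmod z))" if z: "z \<in> sector \<phi>" for z
  proof -
    have "cmod (f z * g z) \<le> (C * (cmod z * decay s (cmod z))) * \<bar>B\<bar>"
      unfolding norm_mult using *(2) *(5)[OF z] assms(3)[OF z] decay_nonneg by (intro mult_mono) auto
    then show ?thesis by (simp add: mult_ac)
  qed
  then show ?thesis unfolding Hinf0_iff[OF assms(4)] using * assms(2)
    by (intro conjI holomorphic_intros exI[of _ "C * \<bar>B\<bar>"] exI[of _ s]) auto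
qed

lemma Hinf0_cmult: "f \<in> Hinf0 \<phi> \<Longrightarrow> \<phi> \<le> pi \<Longrightarrow> (\<lambda>z. c * f z) \<in> Hinf0 \<phi>"
  using Hinf0_mult[of f \<phi> "\<lambda>_. c" "cmod c"] by (simp add: mult.commute)

lemma Hinf0_bounded: "f \<in> Hinf0 \<phi> \<Longrightarrow> \<exists>B. \<forall>z\<in>sector \<phi>. cmod (f z) \<le> B"
  by (auto simp: Hinf0_def Hinf_def bounded_iff)

lemma Hinf0_holomorphic: "f \<in> Hinf0 \<phi> \<Longrightarrow> f holomorphic_on sector \<phi>"
  by (simp add: Hinf0_def Hinf_def)

lemma Hinf0_cong: "(\<And>z. z \<in> sector \<phi> \<Longrightarrow> f z = g z) \<Longrightarrow> f \<in> Hinf0 \<phi> \<longleftrightarrow> g \<in> Hinf0 \<phi>"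
  unfolding Hinf0_def Hinf_def using holomorphic_cong[of "sector \<phi>" "sector \<phi>" f g] image_cong[of "sector \<phi>" "sector \<phi>" f g]
  by auto

lemma sector_scale: "0 < t \<Longrightarrow> of_real t * z \<in> sector \<phi> \<longleftrightarrow> z \<in> sector \<phi>"
  by (simp add: sector_def)

context sectorial_operator
begin

text \<open>The first factor is integrated over the larger angle \<open>\<nu>2\<close>. The resolvent identity splits the
  product of resolvents; after exchanging the integrals one of the two inner ones vanishes, and the
  other is Cauchy's formula for \<open>f\<close>.\<close>

lemma Phi_mult:
  assumes f: "f \<in> Hinf0 \<phi>" and h: "h \<in> Hinf0 \<phi>" and \<nu>: "\<mu> < \<nu>" "\<nu> < \<phi>"
  shows "Phi \<nu> f (Phi \<nu> h x) = Phi \<nu> (\<lambda>z. f z * h z) x"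
proof (rule cfunctional_eqI)
  fix \<xi> :: "'a \<Rightarrow> complex" assume \<xi>: "cfunctional \<xi>"
  define \<nu>2 where "\<nu>2 = (\<nu> + \<phi>) / 2"
  have \<nu>2: "\<nu> < \<nu>2" "\<nu>2 < \<phi>" "\<mu> < \<nu>2" "0 < \<nu>2" and \<nu>0: "0 < \<nu>" using \<nu> angles by (auto simp: \<nu>2_def)
  define F where "F z = \<xi> (R z x)" for z
  define g where "g z = h z * F z" for z
  define SI where "SI = sector_integral"
  define k where "k = 1 / (2 * of_real pi * \<i>)"
  obtain C1 s1 where C1: "Hinf0_bound f C1 s1" using Hinf0_bound_exists[OF f] by blast
  obtain C2 s2 where C2: "Hinf0_bound h C2 s2" using Hinf0_bound_exists[OF h] by blast
  obtain B where B: "0 \<le> B" "\<And>z x. z \<in> exterior \<Longrightarrow> cmod (\<xi> (R z x)) \<le> B * norm x / cmod z"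
    using functional_resolvent_bound[OF \<xi>] by blast
  have s12: "0 < s1" "0 < s2" using C1 C2 by (auto simp: Hinf0_bound_def)
  have bf: "cmod (f (of_real r * cis \<alpha>)) \<le> C1 * (r * decay s1 r)" if "0 < r" "\<bar>\<alpha>\<bar> < \<phi>" for r \<alpha>
    using C1 polar_in_sector_phi[OF that] that by (force simp: Hinf0_bound_def norm_mult)
  have bh: "cmod (h (of_real r * cis \<alpha>)) \<le> C2 * (r * decay s2 r)" if "0 < r" "\<bar>\<alpha>\<bar> < \<phi>" for r \<alpha>
    using C2 polar_in_sector_phi[OF that] that by (force simp: Hinf0_bound_def norm_mult)
  have bg: "cmod (g (of_real r * cis \<alpha>)) \<le> C2 * (B * norm x) * decay s2 r" if r: "0 < r" "\<mu> < \<bar>\<alpha>\<bar>" "\<bar>\<alpha>\<bar> < \<phi>" for r \<alpha>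
  proof -
    define z where "z = of_real r * cis \<alpha>"
    have z: "z \<in> exterior" "cmod z = r"
      using r angles by (auto simp: z_def norm_mult intro!: ray_in_exterior)
    have "cmod (h z * \<xi> (R z x)) \<le> (C2 * (r * decay s2 r)) * (B * norm x / r)"
      unfolding norm_mult using bh[OF r(1,3)] z r B(2)[OF z(1), of x] C2 decay_nonneg
      by (intro mult_mono) (auto simp: z_def Hinf0_bound_def)
    also have "\<dots> = C2 * (B * norm x) * decay s2 r" using r by simp
    finally show ?thesis by (simp add: z_def g_def F_def)
  qed
  have cf: "isCont f (of_real r * cis \<alpha>)" "isCont h (of_real r * cis \<alpha>)" if "0 < r" "\<bar>\<alpha>\<bar> < \<phi>" for r \<alpha>
    using that by (auto intro!: Hinf0_cont f h polar_in_sector_phi)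
  have bl: "bounded_linear \<xi>" using \<xi> by (simp add: cfunctional_def)
  have cg: "isCont g (of_real r * cis \<alpha>)" if "0 < r" "\<mu> < \<bar>\<alpha>\<bar>" "\<bar>\<alpha>\<bar> < \<phi>" for r \<alpha>
    unfolding g_def F_def using that angles
    by (intro isCont_mult cf bounded_linear.isCont[OF bl] resolvent_continuous ray_in_exterior) auto
  \<comment> \<open>Rays of the absolute angles \<nu>2 and \<nu> never coincide, so on them |w - z|
    is comparable to |w| + |z|.\<close>
  have sep: "\<exists>c>0. \<forall>r\<ge>0. \<forall>t\<ge>0. c * (r + t) \<le> cmod (of_real r * cis \<alpha> - of_real t * cis \<beta>)"
    if "\<bar>\<alpha>\<bar> = \<nu>2" "\<bar>\<beta>\<bar> = \<nu>" for \<alpha> \<beta>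
  proof -
    have "0 < \<bar>\<alpha> - \<beta>\<bar>" "\<bar>\<alpha> - \<beta>\<bar> < 2 * pi" using that \<nu>2 \<nu>0 angles by (auto simp: abs_if split: if_splits)
    from norm_diff_polar_pos[OF this] show ?thesis by metis
  qed
  have inner: "\<xi> (R w (Phi \<nu> h x)) = k * SI \<nu> (\<lambda>z. g z / (w - z))"
    if \<alpha>: "\<bar>\<alpha>\<bar> = \<nu>2" and r: "0 < r" and w: "w = of_real r * cis \<alpha>" for w r \<alpha>
  proof -
    have wout: "w \<in> exterior" unfolding w using r \<alpha> \<nu>2 angles by (intro ray_in_exterior) auto
    have wres: "w \<in> resolvent_set D A" by (rule exterior_resolvent_set[OF wout])
    have ri: "ray_integrable \<beta> (\<lambda>z. g z / (w - z))" "ray_integrable \<beta> (\<lambda>z. h z / (z - w))"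
       "\<And>t. 0 < t \<Longrightarrow> w \<noteq> of_real t * cis \<beta>" if \<beta>: "\<bar>\<beta>\<bar> = \<nu>" for \<beta>
    proof -
      obtain c where c: "0 < c" "\<And>r t. 0 \<le> r \<Longrightarrow> 0 \<le> t \<Longrightarrow> c * (r + t) \<le> cmod (of_real r * cis \<alpha> - of_real t * cis \<beta>)"
        using sep[OF \<alpha> \<beta>] by blast
      have ge: "c * r \<le> cmod (w - of_real t * cis \<beta>)" "c * t \<le> cmod (w - of_real t * cis \<beta>)"
         "0 < cmod (w - of_real t * cis \<beta>)" if t: "0 < t" for t
      proof -
        have "c * r \<le> c * (r + t)" "c * t \<le> c * (r + t)" "0 < c * (r + t)" using c(1) t r by auto
        then show "c * r \<le> cmod (w - of_real t * cis \<beta>)" "c * t \<le> cmod (w - of_real t * cis \<beta>)" "0 < cmod (w - of_real t * cis \<beta>)"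
          using c(2)[of r t] t r unfolding w by linarith+
      qed
      show ne: "w \<noteq> of_real t * cis \<beta>" if "0 < t" for t using ge(3)[OF that] by auto
      show "ray_integrable \<beta> (\<lambda>z. g z / (w - z))"
      proof (rule ray_integrableI[OF _ s12(2)])
        fix t :: real assume t: "0 < t"
        show "isCont (\<lambda>z. g z / (w - z)) (of_real t * cis \<beta>)"
          using ne[OF t] \<beta> \<nu> t by (intro continuous_intros cg) auto
        have "cmod (g (of_real t * cis \<beta>)) / cmod (w - of_real t * cis \<beta>) \<le> (C2 * (B * norm x) * decay s2 t) / (c * r)"
          using bg[OF t, of \<beta>] ge[OF t] \<beta> \<nu> c(1) r order_trans[OF norm_ge_zero bg[OF t, of \<beta>]] by (intro frac_le) auto
        then show "cmod (g (of_real t * cis \<beta>) / (w - of_real t * cis \<beta>)) \<le> C2 * (B * norm x) / (c * r) * decay s2 t"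
          by (simp add: norm_divide)
      qed
      show "ray_integrable \<beta> (\<lambda>z. h z / (z - w))"
      proof (rule ray_integrableI[OF _ s12(2)])
        fix t :: real assume t: "0 < t"
        show "isCont (\<lambda>z. h z / (z - w)) (of_real t * cis \<beta>)"
          using ne[OF t] \<beta> \<nu> t by (intro continuous_intros cf) auto
        have "cmod (h (of_real t * cis \<beta>)) / cmod (w - of_real t * cis \<beta>) \<le> (C2 * (t * decay s2 t)) / (c * t)"
          using bh[OF t, of \<beta>] ge[OF t] \<beta> \<nu> c(1) t order_trans[OF norm_ge_zero bh[OF t, of \<beta>]] by (intro frac_le) auto
        then show "cmod (h (of_real t * cis \<beta>) / (of_real t * cis \<beta> - w)) \<le> C2 / c * decay s2 t"
          using t by (simp add: norm_divide norm_minus_commute)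
      qed
    qed
    have "SI \<nu> (\<lambda>z. h z * \<xi> (R w (R z x))) = SI \<nu> (\<lambda>z. g z / (w - z) + F w * (h z / (z - w)))"
      unfolding SI_def
    proof (rule sector_integral_cong[OF _ \<nu>0])
      fix t \<beta> :: real assume t: "0 < t" "\<bar>\<beta>\<bar> = \<nu>"
      define z where "z = of_real t * cis \<beta>"
      have z: "z \<in> resolvent_set D A" unfolding z_def using t \<nu> angles by (intro exterior_resolvent_set ray_in_exterior) auto
      have ne: "w \<noteq> z" using ri(3)[OF t(2,1)] by (simp add: z_def)
      have e: "a * (1 / d * (b - c)) = a * b / d + c * (- (a / d))" for a b c d :: complex
        by (simp add: algebra_simps diff_divide_distrib)
      have "\<xi> (R w (R z x)) = 1 / (w - z) * (F z - F w)"
        unfolding resolvent_product[OF z wres ne] cfunctional_simps[OF \<xi>] F_def ..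
      then have "h z * \<xi> (R w (R z x)) = h z * F z / (w - z) + F w * (- (h z / (w - z)))"
        by (simp only: e)
      also have "- (h z / (w - z)) = h z / (z - w)" by (simp add: minus_divide_right)
      finally show "h (of_real t * cis \<beta>) * \<xi> (R w (R (of_real t * cis \<beta>) x)) =
        g (of_real t * cis \<beta>) / (w - of_real t * cis \<beta>) + F w * (h (of_real t * cis \<beta>) / (of_real t * cis \<beta> - w))"
        by (simp add: g_def z_def)
    qed
    also have "\<dots> = SI \<nu> (\<lambda>z. g z / (w - z)) + SI \<nu> (\<lambda>z. F w * (h z / (z - w)))"
      unfolding SI_def using \<nu>0 by (intro sector_integral_add ray_integrable_cmult ri) auto
    also have "SI \<nu> (\<lambda>z. F w * (h z / (z - w))) = F w * SI \<nu> (\<lambda>z. h z / (z - w))"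
      unfolding SI_def by (rule sector_integral_cmult)
    also have "SI \<nu> (\<lambda>z. h z / (z - w)) = 0"
      unfolding SI_def w using cauchy_outside[OF \<nu>0 \<nu>(2) _ h, of \<alpha> r] \<alpha> \<nu>2 angles r by simp
    finally have "SI \<nu> (\<lambda>z. h z * \<xi> (R w (R z x))) = SI \<nu> (\<lambda>z. g z / (w - z))" by simp
    then show ?thesis
      using Phi_functional(1)[OF h \<nu> cfunctional_resolvent[OF \<xi> wres], of x] by (simp add: k_def SI_def)
  qed
  \<comment> \<open>The integrals are exchanged for each of the four pairs of rays; the signs of the
    two contours are put back afterwards.\<close>
  define J where "J \<alpha> \<beta> = ray_integral \<alpha> (\<lambda>w. f w * ray_integral \<beta> (\<lambda>z. g z / (w - z)))" for \<alpha> \<beta>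
  have sw: "J \<alpha> \<beta> = ray_integral \<beta> (\<lambda>z. g z * ray_integral \<alpha> (\<lambda>w. f w / (w - z)))"
    "ray_integrable \<alpha> (\<lambda>w. f w * ray_integral \<beta> (\<lambda>z. g z / (w - z)))"
    "ray_integrable \<beta> (\<lambda>z. g z * ray_integral \<alpha> (\<lambda>w. f w / (w - z)))"
    if abn: "\<bar>\<alpha>\<bar> = \<nu>2" "\<bar>\<beta>\<bar> = \<nu>" for \<alpha> \<beta>
  proof -
    obtain c where c: "0 < c" "\<And>r t. 0 \<le> r \<Longrightarrow> 0 \<le> t \<Longrightarrow> c * (r + t) \<le> cmod (of_real r * cis \<alpha> - of_real t * cis \<beta>)"
      using sep[OF abn] by blast
    have al: "\<bar>\<alpha>\<bar> < \<phi>" "\<mu> < \<bar>\<beta>\<bar>" "\<bar>\<beta>\<bar> < \<phi>" using abn \<nu> \<nu>2 by auto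
    note * = ray_integral_swap[OF cf(1)[OF _ al(1)] cg[OF _ al(2,3)] s12 bf[OF _ al(1)] bg[OF _ al(2,3)] c]
    show "J \<alpha> \<beta> = ray_integral \<beta> (\<lambda>z. g z * ray_integral \<alpha> (\<lambda>w. f w / (w - z)))"
      "ray_integrable \<alpha> (\<lambda>w. f w * ray_integral \<beta> (\<lambda>z. g z / (w - z)))"
      "ray_integrable \<beta> (\<lambda>z. g z * ray_integral \<alpha> (\<lambda>w. f w / (w - z)))"
      unfolding J_def by (rule *; assumption)+
  qed
  have ab: "\<bar>\<nu>2\<bar> = \<nu>2" "\<bar>- \<nu>2\<bar> = \<nu>2" "\<bar>\<nu>\<bar> = \<nu>" "\<bar>- \<nu>\<bar> = \<nu>" using \<nu>2 \<nu>0 by auto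
  have "SI \<nu>2 (\<lambda>w. f w * SI \<nu> (\<lambda>z. g z / (w - z))) = (J (- \<nu>2) (- \<nu>) - J (- \<nu>2) \<nu>) - (J \<nu>2 (- \<nu>) - J \<nu>2 \<nu>)"
    unfolding SI_def sector_integral_def right_diff_distrib J_def
    by (simp only: ray_integral_diff sw(2) ab)
  also have "\<dots> = SI \<nu> (\<lambda>z. g z * SI \<nu>2 (\<lambda>w. f w / (w - z)))"
    unfolding SI_def sector_integral_def right_diff_distrib
    by (simp only: ray_integral_diff sw(3) sw(1) ab) simp
  also have "\<dots> = SI \<nu> (\<lambda>z. (2 * of_real pi * \<i>) * (f z * h z * F z))"
    unfolding SI_def
  proof (rule sector_integral_cong[OF _ \<nu>0])
    fix t \<beta> :: real assume t: "0 < t" "\<bar>\<beta>\<bar> = \<nu>"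
    have "of_real t * cis \<beta> \<in> sector \<nu>2" using t \<nu>2 angles by (intro polar_in_sector) auto
    from cauchy_Hinf0[OF \<nu>2(4,2) _ f this] angles
    show "g (of_real t * cis \<beta>) * sector_integral \<nu>2 (\<lambda>w. f w / (w - of_real t * cis \<beta>)) =
      2 * of_real pi * \<i> * (f (of_real t * cis \<beta>) * h (of_real t * cis \<beta>) * F (of_real t * cis \<beta>))"
      by (simp add: g_def mult_ac)
  qed
  also have "\<dots> = (2 * of_real pi * \<i>) * SI \<nu> (\<lambda>z. f z * h z * F z)"
    unfolding SI_def by (rule sector_integral_cmult)
  finally have main: "SI \<nu>2 (\<lambda>w. f w * SI \<nu> (\<lambda>z. g z / (w - z))) = (2 * of_real pi * \<i>) * SI \<nu> (\<lambda>z. f z * h z * F z)" .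
  have "\<xi> (Phi \<nu> f (Phi \<nu> h x)) = \<xi> (Phi \<nu>2 f (Phi \<nu> h x))"
    using Phi_angle[OF f \<nu> \<nu>2(3,2)] by simp
  also have "\<dots> = k * SI \<nu>2 (\<lambda>w. f w * \<xi> (R w (Phi \<nu> h x)))"
    unfolding k_def SI_def by (rule Phi_functional(1)[OF f \<nu>2(3,2) \<xi>])
  also have "SI \<nu>2 (\<lambda>w. f w * \<xi> (R w (Phi \<nu> h x))) = SI \<nu>2 (\<lambda>w. k * (f w * SI \<nu> (\<lambda>z. g z / (w - z))))"
    unfolding SI_def using inner
    by (intro sector_integral_cong[OF _ \<nu>2(4)]) (auto simp: SI_def)
  also have "\<dots> = k * ((2 * of_real pi * \<i>) * SI \<nu> (\<lambda>z. f z * h z * F z))"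
    using main by (simp only: SI_def sector_integral_cmult)
  also have "k * \<dots> = k * SI \<nu> (\<lambda>z. f z * h z * F z)" by (simp add: k_def)
  also have "\<dots> = \<xi> (Phi \<nu> (\<lambda>z. f z * h z) x)"
  proof -
    obtain B where "\<And>z. z \<in> sector \<phi> \<Longrightarrow> cmod (h z) \<le> B" using Hinf0_bounded[OF h] by blast
    then have "(\<lambda>z. f z * h z) \<in> Hinf0 \<phi>"
      using angles by (intro Hinf0_mult[OF f Hinf0_holomorphic[OF h]]) auto
    from Phi_functional(1)[OF this \<nu> \<xi>, of x] show ?thesis by (simp add: k_def SI_def F_def)
  qed
  finally show "\<xi> (Phi \<nu> f (Phi \<nu> h x)) = \<xi> (Phi \<nu> (\<lambda>z. f z * h z) x)" .
qed

end

text \<open>On the positive axis functions in \<open>Hinf0\<close> tend to 0 at both ends, while l /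
  (1 + z) + m tends to l + m at 0 and to m at infinity. This gives the definite description in
  \<open>elem_calculus\<close> its meaning.\<close>

lemma elem_unique:
  assumes "elem_remainder f l m \<in> Hinf0 \<phi>" "elem_remainder f l' m' \<in> Hinf0 \<phi>" "0 < \<phi>" "\<phi> \<le> pi"
  shows "l = l'" "m = m'"
proof -
  define d where "d z = (l - l') / (1 + z) + (m - m')" for z :: complex
  have "(\<lambda>z. elem_remainder f l' m' z + (- 1) * elem_remainder f l m z) \<in> Hinf0 \<phi>"
    using assms by (intro Hinf0_add Hinf0_cmult) auto
  moreover have "(\<lambda>z. elem_remainder f l' m' z + (- 1) * elem_remainder f l m z) = d"
    by (rule ext) (simp add: elem_remainder_def d_def diff_divide_distrib)
  ultimately have "d \<in> Hinf0 \<phi>" by simp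
  then obtain C s where C: "0 < s" "\<And>z. z \<in> sector \<phi> \<Longrightarrow> cmod (d z) \<le> C * (cmod z * decay s (cmod z))"
    unfolding Hinf0_iff[OF assms(4)] by blast
  have bd: "cmod (d (of_real r)) \<le> C * (r * decay s r)" if r: "0 < r" for r
  proof -
    have "of_real r \<in> sector \<phi>" using polar_in_sector[OF r, of 0 \<phi>] assms by simp
    from C(2)[OF this] r show ?thesis by simp
  qed
  have l1: "((\<lambda>r. d (of_real r)) \<longlongrightarrow> 0) (at_right 0)"
    by (rule Lim_null_comparison[OF _ tendsto_mult_right_zero[OF times_decay_lim_0[OF C(1)], of C]])
      (rule eventually_mono[OF eventually_at_right_less[of 0] bd])
  have l2: "((\<lambda>r. d (of_real r)) \<longlongrightarrow> d (of_real 0)) (at_right 0)"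
    unfolding d_def by (intro tendsto_intros) auto
  have "d 0 = 0" using tendsto_unique[OF trivial_limit_at_right_real l2 l1] by simp
  have l3: "((\<lambda>r. d (of_real r)) \<longlongrightarrow> 0) at_top"
    by (rule Lim_null_comparison[OF _ tendsto_mult_right_zero[OF times_decay_lim_top[OF C(1)], of C]])
      (rule eventually_mono[OF eventually_gt_at_top[of 0] bd])
  have l4: "((\<lambda>r. d (of_real r)) \<longlongrightarrow> 0 + (m - m')) at_top"
  proof -
    have "filterlim (\<lambda>r::real. 1 + of_real r :: complex) at_infinity at_top"
      by (intro tendsto_add_filterlim_at_infinity[OF tendsto_const] filterlim_of_real_at_infinity)
    then show ?thesis
      unfolding d_def by (intro tendsto_add tendsto_const tendsto_divide_0[OF tendsto_const])
  qed
  have "m - m' = 0" using tendsto_unique[OF trivial_limit_at_top_linorder l4 l3] by simp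
  then show "l = l'" "m = m'" using \<open>d 0 = 0\<close> by (auto simp: d_def)
qed

lemma recip_one_plus_bounded:
  assumes "0 < \<phi>" "\<phi> < pi" "0 < a"
  shows "(\<lambda>z. 1 / (1 + of_real a * z)) holomorphic_on sector \<phi>"
    "\<exists>B\<ge>0. \<forall>z\<in>sector \<phi>. cmod (1 / (1 + of_real a * z)) \<le> B / (1 + cmod z)"
proof -
  obtain c where c: "0 < c" "\<And>z. z \<in> sector \<phi> \<Longrightarrow> c * (1 + cmod z) \<le> cmod (1 + z)"
    using norm_one_plus_ge[OF assms(1,2)] by blast
  have ge: "c * min 1 a * (1 + cmod z) \<le> cmod (1 + of_real a * z)" "0 < c * min 1 a * (1 + cmod z)"
    if z: "z \<in> sector \<phi>" for z
  proof -
    have "min 1 a * (1 + cmod z) \<le> 1 + a * cmod z"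
    proof -
      have "min 1 a * 1 \<le> 1" "min 1 a * cmod z \<le> a * cmod z" by (auto intro!: mult_right_mono)
      then show ?thesis unfolding distrib_left by linarith
    qed
    then have "c * (min 1 a * (1 + cmod z)) \<le> c * (1 + a * cmod z)" using c(1) by (intro mult_left_mono) auto
    also have "\<dots> \<le> cmod (1 + of_real a * z)"
      using c(2)[of "of_real a * z"] sector_scale[OF assms(3), of z \<phi>] z assms(3) by (simp add: norm_mult)
    finally show "c * min 1 a * (1 + cmod z) \<le> cmod (1 + of_real a * z)" by (simp add: mult.assoc)
    show "0 < c * min 1 a * (1 + cmod z)" using c(1) assms(3) by (simp add: add_pos_nonneg)
  qed
  have "1 + of_real a * z \<noteq> 0" if "z \<in> sector \<phi>" for z
  proof -
    have "0 < cmod (1 + of_real a * z)" using ge[OF that] by linarith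
    then show ?thesis by auto
  qed
  then show "(\<lambda>z. 1 / (1 + of_real a * z)) holomorphic_on sector \<phi>" by (intro holomorphic_intros) auto
  show "\<exists>B\<ge>0. \<forall>z\<in>sector \<phi>. cmod (1 / (1 + of_real a * z)) \<le> B / (1 + cmod z)"
  proof (intro exI[of _ "1 / (c * min 1 a)"] conjI ballI)
    fix z assume z: "z \<in> sector \<phi>"
    have "cmod (1 / (1 + of_real a * z)) \<le> 1 / (c * min 1 a * (1 + cmod z))"
      unfolding norm_divide norm_one using ge[OF z] by (intro frac_le) auto
    then show "cmod (1 / (1 + of_real a * z)) \<le> 1 / (c * min 1 a) / (1 + cmod z)" by simp
  qed (use c assms in auto)
qed

lemma recip_one_plus_bounded':
  assumes "0 < \<phi>" "\<phi> < pi" "0 < a"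
  shows "\<exists>B. \<forall>z\<in>sector \<phi>. cmod (1 / (1 + of_real a * z)) \<le> B"
proof -
  obtain B where B: "0 \<le> B" "\<And>z. z \<in> sector \<phi> \<Longrightarrow> cmod (1 / (1 + of_real a * z)) \<le> B / (1 + cmod z)"
    using recip_one_plus_bounded(2)[OF assms] by blast
  have "cmod (1 / (1 + of_real a * z)) \<le> B" if "z \<in> sector \<phi>" for z
  proof -
    have "B / (1 + cmod z) \<le> B / 1" using B(1) by (intro divide_left_mono) (auto simp: add_pos_nonneg)
    then show ?thesis using B(2)[OF that] by simp
  qed
  then show ?thesis by blast
qed

lemma one_plus_nonzero:
  assumes "0 < \<phi>" "\<phi> < pi" "0 < a" "z \<in> sector \<phi>"
  shows "1 + of_real a * z \<noteq> 0"
proof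
  assume "1 + of_real a * z = 0"
  then have "of_real a * z = -1" by (simp add: eq_neg_iff_add_eq_0 add.commute)
  then show False using minus_one_notin_sector[of \<phi>] sector_scale[OF assms(3), of z \<phi>] assms by simp
qed

text \<open>The two reciprocals agree at 0 and both vanish at infinity, so their difference decays
  to first order at both ends. Hence 1 / (1 + a z) for every a > 0 can be expressed through the
  single basis function 1 / (1 + z).\<close>

lemma recip_diff_Hinf0:
  assumes "0 < \<phi>" "\<phi> < pi" "0 < a" "0 < b"
  shows "(\<lambda>z. 1 / (1 + of_real a * z) - 1 / (1 + of_real b * z)) \<in> Hinf0 \<phi>"
proof -
  obtain B B' where B: "0 \<le> B" "\<And>z. z \<in> sector \<phi> \<Longrightarrow> cmod (1 / (1 + of_real a * z)) \<le> B / (1 + cmod z)"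
    "0 \<le> B'" "\<And>z. z \<in> sector \<phi> \<Longrightarrow> cmod (1 / (1 + of_real b * z)) \<le> B' / (1 + cmod z)"
    using recip_one_plus_bounded(2)[OF assms(1-3)] recip_one_plus_bounded(2)[OF assms(1,2,4)] by blast
  have "cmod (1 / (1 + of_real a * z) - 1 / (1 + of_real b * z)) \<le> (\<bar>b - a\<bar> * B * B') * (cmod z * decay 1 (cmod z))"
    if z: "z \<in> sector \<phi>" for z
  proof -
    have z0: "0 < cmod z" using z by (simp add: sector_def)
    have "1 / (1 + of_real a * z) - 1 / (1 + of_real b * z) =
        of_real (b - a) * z * (1 / (1 + of_real a * z) * (1 / (1 + of_real b * z)))"
      using one_plus_nonzero[OF assms(1-3) z] one_plus_nonzero[OF assms(1,2,4) z]
      by (simp add: diff_frac_eq algebra_simps)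
    then have "cmod (1 / (1 + of_real a * z) - 1 / (1 + of_real b * z)) =
        \<bar>b - a\<bar> * cmod z * (cmod (1 / (1 + of_real a * z)) * cmod (1 / (1 + of_real b * z)))"
      by (simp only: norm_mult norm_of_real)
    also have "\<dots> \<le> \<bar>b - a\<bar> * cmod z * (B / (1 + cmod z) * (B' / (1 + cmod z)))"
      using B(1,3) B(2)[OF z] B(4)[OF z] by (intro mult_left_mono mult_mono) auto
    also have "\<dots> = (\<bar>b - a\<bar> * B * B') * (cmod z * decay 1 (cmod z))"
      by (simp add: decay_1[OF z0] power2_eq_square)
    finally show ?thesis .
  qed
  moreover have "(\<lambda>z. 1 / (1 + of_real a * z) - 1 / (1 + of_real b * z)) holomorphic_on sector \<phi>"
    using recip_one_plus_bounded(1)[OF assms(1-3)] recip_one_plus_bounded(1)[OF assms(1,2,4)]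
    by (rule holomorphic_on_diff)
  ultimately show ?thesis unfolding Hinf0_iff[OF less_imp_le[OF assms(2)]] using B
    by (intro conjI exI[of _ "\<bar>b - a\<bar> * B * B'"] exI[of _ 1]) auto
qed

section \<open>Linearity of the calculus and its action on resolvents\<close>

context sectorial_operator
begin

lemma Phi_cong:
  assumes "0 < \<nu>" "\<nu> < \<phi>" "\<And>z. z \<in> sector \<phi> \<Longrightarrow> f z = g z"
  shows "Phi \<nu> f x = Phi \<nu> g x"
proof -
  have "ray_integral \<theta> (\<lambda>z. f z *C R z x) = ray_integral \<theta> (\<lambda>z. g z *C R z x)" if "\<bar>\<theta>\<bar> = \<nu>" for \<theta>
    using that assms by (intro ray_integral_cong) (simp add: polar_in_sector_phi)
  then show ?thesis using assms(1) by (simp add: Hinf0_calculus_def)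
qed

lemma Phi_add_fun:
  assumes "f \<in> Hinf0 \<phi>" "g \<in> Hinf0 \<phi>" and \<nu>: "\<mu> < \<nu>" "\<nu> < \<phi>"
  shows "Phi \<nu> (\<lambda>z. f z + g z) x = Phi \<nu> f x + Phi \<nu> g x"
proof (rule cfunctional_eqI)
  fix \<xi> :: "'a \<Rightarrow> complex" assume \<xi>: "cfunctional \<xi>"
  have fg: "(\<lambda>z. f z + g z) \<in> Hinf0 \<phi>" using assms angles by (intro Hinf0_add) auto
  have "0 < \<nu>" using \<nu> angles by simp
  then show "\<xi> (Phi \<nu> (\<lambda>z. f z + g z) x) = \<xi> (Phi \<nu> f x + Phi \<nu> g x)"
    unfolding cfunctional_simps[OF \<xi>] Phi_functional(1)[OF fg \<nu> \<xi>] Phi_functional(1)[OF assms(1) \<nu> \<xi>]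
      Phi_functional(1)[OF assms(2) \<nu> \<xi>] distrib_right
    using sector_integral_add[OF Phi_functional(2)[OF assms(1) \<nu> \<xi>] Phi_functional(2)[OF assms(1) \<nu> \<xi>]
        Phi_functional(2)[OF assms(2) \<nu> \<xi>] Phi_functional(2)[OF assms(2) \<nu> \<xi>]]
    by (simp add: distrib_left add_divide_distrib)
qed

lemma Phi_cmult_fun:
  assumes "f \<in> Hinf0 \<phi>" and \<nu>: "\<mu> < \<nu>" "\<nu> < \<phi>"
  shows "Phi \<nu> (\<lambda>z. c * f z) x = c *C Phi \<nu> f x"
proof (rule cfunctional_eqI)
  fix \<xi> :: "'a \<Rightarrow> complex" assume \<xi>: "cfunctional \<xi>"
  have fg: "(\<lambda>z. c * f z) \<in> Hinf0 \<phi>" using assms angles by (intro Hinf0_cmult) auto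
  show "\<xi> (Phi \<nu> (\<lambda>z. c * f z) x) = \<xi> (c *C Phi \<nu> f x)"
    unfolding cfunctional_simps[OF \<xi>] Phi_functional(1)[OF fg \<nu> \<xi>] Phi_functional(1)[OF assms(1) \<nu> \<xi>] mult.assoc
    by (simp add: sector_integral_cmult)
qed

lemma Phi_linear:
  assumes f: "f \<in> Hinf0 \<phi>" and \<nu>: "\<mu> < \<nu>" "\<nu> < \<phi>"
  shows "Phi \<nu> f (x + y) = Phi \<nu> f x + Phi \<nu> f y" "Phi \<nu> f (c *C x) = c *C Phi \<nu> f x"
proof -
  have \<nu>0: "0 < \<nu>" using \<nu> angles by simp
  have rs: "of_real r * cis \<theta> \<in> resolvent_set D A" if "0 < r" "\<bar>\<theta>\<bar> = \<nu>" for r \<theta>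
    using that \<nu> angles by (intro exterior_resolvent_set ray_in_exterior) auto
  show "Phi \<nu> f (x + y) = Phi \<nu> f x + Phi \<nu> f y"
  proof (rule cfunctional_eqI)
    fix \<xi> :: "'a \<Rightarrow> complex" assume \<xi>: "cfunctional \<xi>"
    have "sector_integral \<nu> (\<lambda>z. f z * \<xi> (R z (x + y))) = sector_integral \<nu> (\<lambda>z. f z * \<xi> (R z x) + f z * \<xi> (R z y))"
      by (rule sector_integral_cong[OF _ \<nu>0])
        (simp add: linear_add[OF bounded_linear.linear[OF resolvent_bounded_linear[OF rs]]] cfunctional_simps[OF \<xi>] distrib_left)
    also have "\<dots> = sector_integral \<nu> (\<lambda>z. f z * \<xi> (R z x)) + sector_integral \<nu> (\<lambda>z. f z * \<xi> (R z y))"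
      using \<nu>0 by (intro sector_integral_add Phi_functional(2)[OF f \<nu> \<xi>]) auto
    finally show "\<xi> (Phi \<nu> f (x + y)) = \<xi> (Phi \<nu> f x + Phi \<nu> f y)"
      unfolding cfunctional_simps[OF \<xi>] Phi_functional(1)[OF f \<nu> \<xi>] by (simp add: add_divide_distrib)
  qed
  show "Phi \<nu> f (c *C x) = c *C Phi \<nu> f x"
  proof (rule cfunctional_eqI)
    fix \<xi> :: "'a \<Rightarrow> complex" assume \<xi>: "cfunctional \<xi>"
    have "sector_integral \<nu> (\<lambda>z. f z * \<xi> (R z (c *C x))) = sector_integral \<nu> (\<lambda>z. c * (f z * \<xi> (R z x)))"
      by (rule sector_integral_cong[OF _ \<nu>0])
        (simp add: resolvent_scaleC[OF rs] cfunctional_simps[OF \<xi>])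
    then show "\<xi> (Phi \<nu> f (c *C x)) = \<xi> (c *C Phi \<nu> f x)"
      unfolding cfunctional_simps[OF \<xi>] Phi_functional(1)[OF f \<nu> \<xi>] by (simp add: sector_integral_cmult)
  qed
qed

text \<open>\<open>inv_shift a = (1 + a A)\<inverse>\<close>.\<close>

definition inv_shift :: "real \<Rightarrow> 'a \<Rightarrow> 'a" where
  "inv_shift a x = of_real (- (1 / a)) *C R (of_real (- (1 / a))) x"

lemma neg_in_exterior: "0 < a \<Longrightarrow> of_real (- (1 / a)) \<in> exterior"
  using ray_in_exterior[of "1 / a" pi] angles by simp

lemma neg_in_resolvent_set: "0 < a \<Longrightarrow> of_real (- (1 / a)) \<in> resolvent_set D A"
  by (intro exterior_resolvent_set neg_in_exterior)

lemma inv_shift_norm: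
  assumes "0 < a" shows "norm (inv_shift a x) \<le> M * norm x"
  unfolding inv_shift_def by (intro res_bound exteriorD neg_in_exterior assms)

lemma inv_shift_linear:
  assumes "0 < a"
  shows "inv_shift a (x + y) = inv_shift a x + inv_shift a y" "inv_shift a (c *C x) = c *C inv_shift a x" "inv_shift a (x - y) = inv_shift a x - inv_shift a y"
proof -
  note l = bounded_linear.linear[OF resolvent_bounded_linear[OF neg_in_resolvent_set[OF assms]]]
  show "inv_shift a (x + y) = inv_shift a x + inv_shift a y" by (simp only: inv_shift_def linear_add[OF l] scaleC_add_right)
  show "inv_shift a (x - y) = inv_shift a x - inv_shift a y" by (simp only: inv_shift_def linear_diff[OF l] scaleC_diff_right)
  show "inv_shift a (c *C x) = c *C inv_shift a x"
    by (simp only: inv_shift_def resolvent_scaleC[OF neg_in_resolvent_set[OF assms]] scaleC_scaleC mult.commute)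
qed

lemma inv_shift_solves:
  assumes "0 < a"
  shows "inv_shift a x \<in> D" "inv_shift a x + a *\<^sub>R A (inv_shift a x) = x"
proof -
  note rs = resolvent_solves[OF neg_in_resolvent_set[OF assms], of x]
  show "inv_shift a x \<in> D" unfolding inv_shift_def by (intro D_scale rs)
  have "a *\<^sub>R A (inv_shift a x) = (of_real a * of_real (- (1 / a))) *C A (R (of_real (- (1 / a))) x)"
    by (simp only: inv_shift_def D_scale[OF rs(1)] scaleR_scaleC scaleC_scaleC)
  also have "of_real a * of_real (- (1 / a)) = (- 1 :: complex)" using assms by simp
  finally show "inv_shift a x + a *\<^sub>R A (inv_shift a x) = x" using rs(2) by (simp add: inv_shift_def)
qed

lemma inv_shift_unique:
  assumes "0 < a" "y \<in> D" "y + a *\<^sub>R A y = x"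
  shows "inv_shift a x = y"
proof -
  define z where "z = complex_of_real (- (1 / a))"
  have z: "z * of_real a = - 1" using assms(1) by (simp add: z_def)
  have "z *C y - A y = z *C x"
    by (simp add: assms(3)[symmetric] scaleC_add_right scaleR_scaleC scaleC_scaleC z)
  from resolvent_unique[OF _ assms(2) this] neg_in_resolvent_set[OF assms(1)]
  have "R z (z *C x) = y" by (simp add: z_def)
  then show ?thesis using resolvent_scaleC[OF neg_in_resolvent_set[OF assms(1)], of z x] by (simp add: inv_shift_def z_def)
qed

lemma inv_shift_inv_into: "0 < a \<Longrightarrow> inv_into D (\<lambda>y. y + a *\<^sub>R A y) x = inv_shift a x"
proof -
  assume a: "0 < a"
  have "inj_on (\<lambda>y. y + a *\<^sub>R A y) D" by (rule inj_on_inverseI[where g="inv_shift a"]) (rule inv_shift_unique[OF a _ refl])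
  then show ?thesis using inv_shift_solves[OF a, of x] by (intro inv_into_f_eq) auto
qed

lemma inv_shift_resolvent:
  assumes "0 < a" "z \<in> exterior" "z \<noteq> of_real (- (1 / a))"
  shows "inv_shift a (R z x) = (1 / (1 + of_real a * z)) *C (R z x - R (of_real (- (1 / a))) x)"
    "R z (inv_shift a x) = inv_shift a (R z x)"
proof -
  define w where "w = complex_of_real (- (1 / a))"
  have w: "w \<in> resolvent_set D A" "w * of_real a = - 1" unfolding w_def using neg_in_resolvent_set assms(1) by auto
  have "w * (1 / (w - z)) = 1 / (1 + of_real a * z)"
  proof -
    have nz: "w - z \<noteq> 0" using assms(3) by (simp add: w_def)
    have "w * (1 + of_real a * z) = w - z" using w(2) by (simp add: distrib_left mult.assoc[symmetric])
    moreover from this have "1 + of_real a * z \<noteq> 0" using nz by auto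
    ultimately show ?thesis using nz by (simp add: field_simps)
  qed
  then show "inv_shift a (R z x) = (1 / (1 + of_real a * z)) *C (R z x - R (of_real (- (1 / a))) x)"
    using resolvent_product[OF exterior_resolvent_set[OF assms(2)] w(1), of x] assms(3) by (simp add: inv_shift_def w_def scaleC_scaleC)
  show "R z (inv_shift a x) = inv_shift a (R z x)"
    unfolding inv_shift_def w_def[symmetric] resolvent_scaleC[OF exterior_resolvent_set[OF assms(2)]]
    using resolvent_commute[OF exterior_resolvent_set[OF assms(2)] w(1), of x] by simp
qed

lemma Hinf0_mult_recip: "f \<in> Hinf0 \<phi> \<Longrightarrow> 0 < a \<Longrightarrow> (\<lambda>z. f z * (1 / (1 + of_real a * z))) \<in> Hinf0 \<phi>"
proof -
  assume f: "f \<in> Hinf0 \<phi>" and a: "0 < a"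
  have ph: "0 < \<phi>" "\<phi> < pi" using angles by auto
  obtain B where B: "\<And>z. z \<in> sector \<phi> \<Longrightarrow> cmod (1 / (1 + of_real a * z)) \<le> B"
    using recip_one_plus_bounded'[OF ph a] by blast
  show ?thesis by (rule Hinf0_mult[OF f recip_one_plus_bounded(1)[OF ph a] B less_imp_le[OF ph(2)]])
qed

text \<open>On the contour the resolvent identity produces g(z) R(z) x, with g(z) = f(z) / (1 + a
  z), and a constant vector times g(z). The second term integrates to 0, because a g(z) = f(z) / (z
  + 1/a) has its pole outside the contour.\<close>

lemma Phi_inv_shift:
  assumes f: "f \<in> Hinf0 \<phi>" and a: "0 < a" and \<nu>: "\<mu> < \<nu>" "\<nu> < \<phi>"
  shows "inv_shift a (Phi \<nu> f x) = Phi \<nu> (\<lambda>z. f z * (1 / (1 + of_real a * z))) x"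
    "Phi \<nu> f (inv_shift a x) = Phi \<nu> (\<lambda>z. f z * (1 / (1 + of_real a * z))) x"
proof -
  define w where "w = complex_of_real (- (1 / a))"
  define g where "g z = f z * (1 / (1 + of_real a * z))" for z
  have \<nu>0: "0 < \<nu>" using \<nu> angles by simp
  have g: "g \<in> Hinf0 \<phi>" unfolding g_def by (rule Hinf0_mult_recip[OF f a])
  have ws: "w = of_real (1 / a) * cis pi" by (simp add: w_def)
  have zne: "of_real r * cis \<theta> \<in> exterior" "of_real r * cis \<theta> \<noteq> w" "1 + of_real a * (of_real r * cis \<theta>) \<noteq> 0"
    if "0 < r" "\<bar>\<theta>\<bar> = \<nu>" for r \<theta>
  proof -
    show "of_real r * cis \<theta> \<in> exterior" using that \<nu> angles by (intro ray_in_exterior) auto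
    have s: "of_real r * cis \<theta> \<in> sector \<phi>" using that \<nu> by (intro polar_in_sector_phi) auto
    show n: "1 + of_real a * (of_real r * cis \<theta>) \<noteq> 0"
      by (rule one_plus_nonzero[OF _ angles(3) a s]) (use angles in auto)
    show "of_real r * cis \<theta> \<noteq> w"
    proof
      assume "of_real r * cis \<theta> = w"
      then show False using n a by (simp add: w_def)
    qed
  qed
  have "f z / (z - w) = of_real a * g z" if "1 + of_real a * z \<noteq> 0" "z \<noteq> w" for z
  proof -
    have "of_real a * (z - w) = 1 + of_real a * z" using a by (simp add: w_def algebra_simps)
    then have "z - w = (1 + of_real a * z) / of_real a" using a by (simp add: field_simps)
    then show ?thesis by (simp add: g_def)
  qed
  then have "sector_integral \<nu> (\<lambda>z. f z / (z - w)) = sector_integral \<nu> (\<lambda>z. of_real a * g z)"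
    by (intro sector_integral_cong[OF _ \<nu>0]) (simp add: zne)
  moreover have "sector_integral \<nu> (\<lambda>z. f z / (z - w)) = 0"
    unfolding ws using cauchy_outside[OF \<nu>0 \<nu>(2) _ f, of pi "1 / a"] a \<nu> angles by simp
  ultimately have g0: "sector_integral \<nu> g = 0" using a by (simp add: sector_integral_cmult)
  have gi: "ray_integrable \<theta> g" if th: "\<bar>\<theta>\<bar> = \<nu>" for \<theta>
  proof -
    obtain C s where C: "0 \<le> C" "0 < s" "s \<le> 1" "\<And>z. z \<in> sector \<phi> \<Longrightarrow> cmod (f z) \<le> C * (cmod z * decay s (cmod z))"
      using Hinf0_bound_exists[OF f] by (auto simp: Hinf0_bound_def)
    obtain B where B: "0 \<le> B" "\<And>z. z \<in> sector \<phi> \<Longrightarrow> cmod (1 / (1 + of_real a * z)) \<le> B / (1 + cmod z)"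
      using recip_one_plus_bounded(2)[OF _ angles(3) a] angles by auto
    show ?thesis
    proof (rule ray_integrableI[OF _ C(2)])
      fix r :: real assume r: "0 < r"
      define z where "z = of_real r * cis \<theta>"
      have z: "z \<in> sector \<phi>" "cmod z = r" unfolding z_def using r th \<nu> \<nu>0 by (auto simp: norm_mult intro!: polar_in_sector_phi)
      show "isCont g (of_real r * cis \<theta>)" using Hinf0_cont[OF g z(1)] by (simp add: z_def)
      have "cmod (g z) \<le> (C * (r * decay s r)) * (B / (1 + r))"
        unfolding g_def norm_mult using C(4)[OF z(1)] B(2)[OF z(1)] z(2) C(1) r decay_nonneg by (intro mult_mono) auto
      also have "\<dots> = C * B * decay s r * (r / (1 + r))" by simp
      also have "\<dots> \<le> C * B * decay s r * 1"
        using C(1) B(1) r decay_nonneg by (intro mult_left_mono) auto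
      finally show "cmod (g (of_real r * cis \<theta>)) \<le> C * B * decay s r" by (simp add: z_def)
    qed
  qed
  have key: "sector_integral \<nu> (\<lambda>z. f z * \<xi> (inv_shift a (R z x))) = sector_integral \<nu> (\<lambda>z. g z * \<xi> (R z x))"
    if \<xi>: "cfunctional \<xi>" for \<xi> :: "'a \<Rightarrow> complex"
  proof -
    define \<kappa> where "\<kappa> = - \<xi> (R w x)"
    have "sector_integral \<nu> (\<lambda>z. f z * \<xi> (inv_shift a (R z x))) = sector_integral \<nu> (\<lambda>z. g z * \<xi> (R z x) + \<kappa> * g z)"
    proof (rule sector_integral_cong[OF _ \<nu>0])
      fix r \<theta> :: real assume r: "0 < r" "\<bar>\<theta>\<bar> = \<nu>"
      show "f (of_real r * cis \<theta>) * \<xi> (inv_shift a (R (of_real r * cis \<theta>) x)) =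
          g (of_real r * cis \<theta>) * \<xi> (R (of_real r * cis \<theta>) x) + \<kappa> * g (of_real r * cis \<theta>)"
      proof -
        have e: "p * (k * (u - v)) = p * k * u + (- v) * (p * k)" for p k u v :: complex
          by (simp add: algebra_simps)
        show ?thesis
          unfolding inv_shift_resolvent(1)[OF a zne(1)[OF r] zne(2)[OF r, unfolded w_def]] cfunctional_simps[OF \<xi>] g_def w_def[symmetric] \<kappa>_def
          by (rule e)
      qed
    qed
    also have "\<dots> = sector_integral \<nu> (\<lambda>z. g z * \<xi> (R z x)) + \<kappa> * sector_integral \<nu> g"
      using \<nu>0 by (subst sector_integral_add)
        (auto simp: sector_integral_cmult intro!: ray_integrable_cmult gi Phi_functional(2)[OF g \<nu> \<xi>])
    finally show ?thesis by (simp add: g0)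
  qed
  have "inv_shift a (Phi \<nu> f x) = Phi \<nu> g x"
  proof (rule cfunctional_eqI)
    fix \<xi> :: "'a \<Rightarrow> complex" assume \<xi>: "cfunctional \<xi>"
    define \<eta> where "\<eta> y = \<xi> (inv_shift a y)" for y
    have bl: "bounded_linear (inv_shift a)"
      by (rule bounded_linear_intro[where K=M])
        (use inv_shift_linear[OF a] inv_shift_norm[OF a] in \<open>auto simp: scaleR_scaleC mult.commute\<close>)
    have \<eta>: "cfunctional \<eta>"
      using \<xi> bounded_linear_compose[OF _ bl, of \<xi>] by (auto simp: cfunctional_def \<eta>_def[abs_def] inv_shift_linear[OF a])
    show "\<xi> (inv_shift a (Phi \<nu> f x)) = \<xi> (Phi \<nu> g x)"
      using Phi_functional(1)[OF f \<nu> \<eta>, of x] Phi_functional(1)[OF g \<nu> \<xi>, of x] key[OF \<xi>] by (simp add: \<eta>_def)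
  qed
  then show "inv_shift a (Phi \<nu> f x) = Phi \<nu> (\<lambda>z. f z * (1 / (1 + of_real a * z))) x" by (simp add: g_def[abs_def])
  have "Phi \<nu> f (inv_shift a x) = Phi \<nu> g x"
  proof (rule cfunctional_eqI)
    fix \<xi> :: "'a \<Rightarrow> complex" assume \<xi>: "cfunctional \<xi>"
    have "sector_integral \<nu> (\<lambda>z. f z * \<xi> (R z (inv_shift a x))) = sector_integral \<nu> (\<lambda>z. f z * \<xi> (inv_shift a (R z x)))"
      using zne(1) zne(2)[unfolded w_def] by (intro sector_integral_cong[OF _ \<nu>0]) (simp add: inv_shift_resolvent(2)[OF a])
    then show "\<xi> (Phi \<nu> f (inv_shift a x)) = \<xi> (Phi \<nu> g x)"
      using Phi_functional(1)[OF f \<nu> \<xi>] Phi_functional(1)[OF g \<nu> \<xi>, of x] key[OF \<xi>] by simp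
  qed
  then show "Phi \<nu> f (inv_shift a x) = Phi \<nu> (\<lambda>z. f z * (1 / (1 + of_real a * z))) x" by (simp add: g_def[abs_def])
qed

text \<open>Here the poles -1/a and -1/b of the function lie outside the contour, where the
  resolvent is holomorphic, so Cauchy's formula is applied to the resolvent instead of to the
  function. Reflection turns the outside into the sector of angle pi - \<mu> and the poles into 1/a
  and 1/b.\<close>

lemma Phi_recip_diff:
  assumes a: "0 < a" "0 < b" and \<nu>: "\<mu> < \<nu>" "\<nu> < \<phi>"
  shows "Phi \<nu> (\<lambda>z. 1 / (1 + of_real a * z) - 1 / (1 + of_real b * z)) x = inv_shift a x - inv_shift b x"
proof (rule cfunctional_eqI)
  fix \<xi> :: "'a \<Rightarrow> complex" assume \<xi>: "cfunctional \<xi>"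
  define f where "f z = 1 / (1 + of_real a * z) - 1 / (1 + of_real b * z)" for z :: complex
  have \<nu>0: "0 < \<nu>" "\<nu> < pi" using \<nu> angles by auto
  have f: "f \<in> Hinf0 \<phi>" unfolding f_def by (rule recip_diff_Hinf0) (use angles a in auto)
  \<comment> \<open>The factor w comes from the numerator of f(-w). Attached to the resolvent it
    gives a bounded holomorphic function on the reflected exterior.\<close>
  define G where "G w = w * \<xi> (R (- w) x)" for w
  obtain B where B: "0 \<le> B" "\<And>z x. z \<in> exterior \<Longrightarrow> cmod (\<xi> (R z x)) \<le> B * norm x / cmod z"
    using functional_resolvent_bound[OF \<xi>] by blast
  have neg: "- w \<in> exterior" if w: "w \<in> sector (pi - \<mu>)" for w
  proof -
    obtain r \<theta> where r: "0 < r" "\<bar>\<theta>\<bar> < pi - \<mu>" "w = of_real r * cis \<theta>" using w by (rule sector_polarE)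
    define \<theta>' where "\<theta>' = (if \<theta> \<le> 0 then \<theta> + pi else \<theta> - pi)"
    have "- w = of_real r * cis \<theta>'"
      by (simp add: r(3) \<theta>'_def complex_eq_iff cos_diff sin_diff cos_add sin_add)
    moreover have "\<mu> < \<bar>\<theta>'\<bar>" "\<bar>\<theta>'\<bar> \<le> pi" using r angles by (auto simp: \<theta>'_def)
    ultimately show ?thesis using ray_in_exterior[OF r(1)] by simp
  qed
  have hol: "G holomorphic_on sector (pi - \<mu>)"
  proof (rule holomorphic_onI)
    fix w assume w: "w \<in> sector (pi - \<mu>)"
    have "(\<lambda>z. \<xi> (R z x)) field_differentiable (at (- w))" by (rule resolvent_differentiable[OF neg[OF w] \<xi>])
    then have "((\<lambda>z. \<xi> (R z x)) \<circ> uminus) field_differentiable (at w)"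
      by (intro field_differentiable_compose) (auto intro!: derivative_intros)
    then have "G field_differentiable (at w)"
      unfolding G_def[abs_def] o_def by (intro field_differentiable_mult field_differentiable_ident)
    then show "G field_differentiable (at w within sector (pi - \<mu>))" by (rule field_differentiable_at_within)
  qed
  have Gb: "cmod (G w) \<le> B * norm x" if "w \<in> sector (pi - \<mu>)" for w
    using B(2)[OF neg[OF that], of x] that by (simp add: G_def norm_mult sector_def field_simps)
  have in_sec: "of_real (1 / c) \<in> sector (pi - \<nu>)" if "0 < c" for c
    using polar_in_sector[of "1 / c" 0 "pi - \<nu>"] that \<nu>0 by simp
  have "sector_integral \<nu> (\<lambda>z. f z * \<xi> (R z x)) = sector_integral (pi - \<nu>) (\<lambda>w. f (- w) * \<xi> (R (- w) x))"
    by (rule sector_integral_reflect)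
  \<comment> \<open>Partial fractions: f(-w) is -w times the difference of the kernels with poles
    1/a and 1/b.\<close>
  also have "\<dots> = sector_integral (pi - \<nu>) (\<lambda>w. (- 1) * (G w * (1 / (w - of_real (1 / a)) - 1 / (w - of_real (1 / b)))))"
  proof (rule sector_integral_cong)
    fix r \<theta> :: real assume r: "0 < r" "\<bar>\<theta>\<bar> = pi - \<nu>"
    define w where "w = of_real r * cis \<theta>"
    have ne: "of_real c * w \<noteq> 1" if "0 < c" for c
    proof
      assume "of_real c * w = 1"
      then have "w = of_real (1 / c)" using that by (simp add: field_simps)
      moreover have "w \<noteq> of_real (1 / c)" unfolding w_def
        by (rule polar_ne_sector[OF in_sec[OF that] r(2) _ r(1)]) (use \<nu>0 in simp)
      ultimately show False by simp
    qed
    have e1: "1 / (w - of_real (1 / c)) = of_real c / (of_real c * w - 1)" if "0 < c" for c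
    proof -
      have "w - of_real (1 / c) = (of_real c * w - 1) / of_real c" using that by (simp add: field_simps)
      then show ?thesis by simp
    qed
    have e2: "1 / (1 - of_real c * w) = - (1 / (of_real c * w - 1))" for c
      by (metis minus_diff_eq minus_divide_right)
    define p q where "p = of_real a * w - 1" and "q = of_real b * w - 1"
    have pq: "p \<noteq> 0" "q \<noteq> 0" using ne a by (auto simp: p_def q_def)
    have "f (- w) = - (1 / p) + 1 / q" unfolding f_def p_def q_def using e2 by simp
    also have "\<dots> = (p - q) / (p * q)" using pq by (simp add: field_simps)
    also have "p - q = w * (of_real a - of_real b)" by (simp add: p_def q_def algebra_simps)
    finally have 1: "f (- w) = w * ((of_real a - of_real b) / (p * q))" by simp
    have "1 / (w - of_real (1 / a)) - 1 / (w - of_real (1 / b)) = of_real a / p - of_real b / q"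
      using e1 a unfolding p_def q_def by simp
    also have "\<dots> = (of_real a * q - of_real b * p) / (p * q)" using pq by (simp add: diff_frac_eq)
    also have "of_real a * q - of_real b * p = - (of_real a - of_real b)" by (simp add: p_def q_def algebra_simps)
    finally have 2: "1 / (w - of_real (1 / a)) - 1 / (w - of_real (1 / b)) = - ((of_real a - of_real b) / (p * q))"
      by (simp add: minus_divide_left)
    show "f (- (of_real r * cis \<theta>)) * \<xi> (R (- (of_real r * cis \<theta>)) x) =
       - 1 * (G (of_real r * cis \<theta>) * (1 / (of_real r * cis \<theta> - of_real (1 / a)) - 1 / (of_real r * cis \<theta> - of_real (1 / b))))"
      unfolding w_def[symmetric] 1 2 G_def by simp
  qed (use \<nu>0 in simp)
  also have "\<dots> = (- 1) * (2 * of_real pi * \<i> * (G (of_real (1 / a)) - G (of_real (1 / b))))"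
    unfolding sector_integral_cmult
    by (subst cauchy_difference[OF _ _ _ hol Gb]) (use \<nu> \<nu>0 angles a in_sec in auto)
  also have "\<dots> = (- 1) * (2 * of_real pi * \<i> * (- \<xi> (inv_shift a x) - - \<xi> (inv_shift b x)))"
  proof -
    have "G (of_real (1 / c)) = - \<xi> (inv_shift c x)" for c
      unfolding inv_shift_def cfunctional_simps[OF \<xi>] by (simp add: G_def)
    then show ?thesis by (simp only:)
  qed
  finally show "\<xi> (Phi \<nu> (\<lambda>z. 1 / (1 + of_real a * z) - 1 / (1 + of_real b * z)) x) = \<xi> (inv_shift a x - inv_shift b x)"
    using Phi_functional(1)[OF f \<nu> \<xi>, of x] by (simp add: f_def[abs_def] cfunctional_simps[OF \<xi>])
qed

end

lemma Hinf0_scale: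
  assumes f: "f \<in> Hinf0 \<phi>" and t: "0 < t"
  shows "(\<lambda>z. f (of_real t * z)) \<in> Hinf0 \<phi>"
proof -
  obtain C s where C: "0 < C" "0 < s" "\<And>z. z \<in> sector \<phi> \<Longrightarrow> cmod (f z) \<le> C * min (cmod z powr s) (cmod z powr - s)"
    using f by (auto simp: Hinf0_def)
  have sc: "of_real t * z \<in> sector \<phi>" if "z \<in> sector \<phi>" for z using sector_scale[OF t] that by simp
  have hol: "(\<lambda>z. f (of_real t * z)) holomorphic_on sector \<phi>"
    using holomorphic_on_compose_gen[of "\<lambda>z. of_real t * z" "sector \<phi>" f "sector \<phi>"] Hinf0_holomorphic[OF f] sc
    by (auto simp: o_def intro!: holomorphic_intros)
  obtain B where "\<And>z. z \<in> sector \<phi> \<Longrightarrow> cmod (f z) \<le> B" using Hinf0_bounded[OF f] by blast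
  then have bdd: "bounded ((\<lambda>z. f (of_real t * z)) ` sector \<phi>)" using sc by (auto simp: bounded_iff)
  define K where "K = max (t powr s) (t powr - s)"
  have K: "0 < K" using t by (simp add: K_def less_max_iff_disj)
  have "cmod (f (of_real t * z)) \<le> (C * K) * min (cmod z powr s) (cmod z powr - s)" if z: "z \<in> sector \<phi>" for z
  proof -
    have "min ((t * cmod z) powr s) ((t * cmod z) powr - s) \<le> K * min (cmod z powr s) (cmod z powr - s)"
    proof -
      have "(t * cmod z) powr s \<le> K * cmod z powr s" "(t * cmod z) powr - s \<le> K * cmod z powr - s"
        using t by (auto simp: powr_mult K_def intro!: mult_right_mono)
      moreover have "K * min (cmod z powr s) (cmod z powr - s) = min (K * cmod z powr s) (K * cmod z powr - s)"
        using K by (simp add: min_mult_distrib_left)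
      ultimately show ?thesis by linarith
    qed
    then have "C * min ((t * cmod z) powr s) ((t * cmod z) powr - s) \<le> C * (K * min (cmod z powr s) (cmod z powr - s))"
      using C(1) by (intro mult_left_mono) auto
    then show ?thesis using C(3)[OF sc[OF z]] t by (simp add: norm_mult mult.assoc)
  qed
  moreover have "0 < C * K" using C(1) K by simp
  ultimately show ?thesis unfolding Hinf0_def Hinf_def using hol bdd C(2) by blast
qed

section \<open>The calculus for elementary functions\<close>

locale sectorial_calculus = sectorial_operator D A \<mu> \<phi> M
  for D :: "'a::complex_banach set" and A \<mu> \<phi> M +
  fixes \<nu> :: real
  assumes nu: "\<mu> < \<nu>" "\<nu> < \<phi>"
begin

lemma phi: "0 < \<phi>" "\<phi> \<le> pi" and nu0: "0 < \<nu>"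
  using angles nu by auto

text \<open>The relation f(A) = T. Sums, products and dilations can then be established by
  exhibiting some decomposition of f; the definite description is resolved once, in
  \<open>elem_calculus_eq\<close>.\<close>

definition has_calc :: "(complex \<Rightarrow> complex) \<Rightarrow> ('a \<Rightarrow> 'a) \<Rightarrow> bool" where
  "has_calc f T \<longleftrightarrow> (\<exists>l m. elem_remainder f l m \<in> Hinf0 \<phi> \<and>
     T = (\<lambda>x. Phi \<nu> (elem_remainder f l m) x + l *C inv_shift 1 x + m *C x))"

lemma has_calcI:
  assumes f0: "f0 \<in> Hinf0 \<phi>" and eq: "\<And>z. z \<in> sector \<phi> \<Longrightarrow> f z = f0 z + l * (1 / (1 + z)) + m"
    and T: "\<And>x. T x = Phi \<nu> f0 x + l *C inv_shift 1 x + m *C x"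
  shows "has_calc f T"
proof -
  have e: "elem_remainder f l m z = f0 z" if "z \<in> sector \<phi>" for z
    using eq[OF that] by (simp add: elem_remainder_def)
  have "elem_remainder f l m \<in> Hinf0 \<phi>" using Hinf0_cong[of \<phi> "elem_remainder f l m" f0] e f0 by simp
  moreover have "T = (\<lambda>x. Phi \<nu> (elem_remainder f l m) x + l *C inv_shift 1 x + m *C x)"
    using Phi_cong[OF nu0 nu(2) e] T by auto
  ultimately show ?thesis unfolding has_calc_def by blast
qed

lemma has_calcE:
  assumes "has_calc f T"
  obtains f0 l m where "f0 \<in> Hinf0 \<phi>" "\<And>z. f z = f0 z + l * (1 / (1 + z)) + m"
    "\<And>x. T x = Phi \<nu> f0 x + l *C inv_shift 1 x + m *C x"
proof -
  from assms obtain l m where *: "elem_remainder f l m \<in> Hinf0 \<phi>"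
     "T = (\<lambda>x. Phi \<nu> (elem_remainder f l m) x + l *C inv_shift 1 x + m *C x)" unfolding has_calc_def by blast
  show ?thesis by (rule that[OF *(1), of l m]) (auto simp: *(2) elem_remainder_def)
qed

lemma has_calc_cong:
  assumes "has_calc f T" "\<And>z. z \<in> sector \<phi> \<Longrightarrow> g z = f z" "\<And>x. U x = T x"
  shows "has_calc g U"
proof -
  obtain f0 l m where *: "f0 \<in> Hinf0 \<phi>" "\<And>z. f z = f0 z + l * (1 / (1 + z)) + m"
    "\<And>x. T x = Phi \<nu> f0 x + l *C inv_shift 1 x + m *C x" using has_calcE[OF assms(1)] by blast
  show ?thesis by (rule has_calcI[OF *(1)]) (use assms * in auto)
qed

lemma has_calc_unique:
  assumes "has_calc f T" "has_calc f U" shows "T = U"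
  using assms elem_unique[of f _ _ \<phi>] phi unfolding has_calc_def by blast

lemma Hinf0_zero: "(\<lambda>z. 0) \<in> Hinf0 \<phi>"
  unfolding Hinf0_iff[OF phi(2)] by (intro conjI, simp, rule exI[of _ 0], rule exI[of _ 1]) simp

lemma Phi_zero: "Phi \<nu> (\<lambda>z. 0) x = 0"
  using Phi_cmult_fun[OF Hinf0_zero nu, of 0 x] by simp

lemma has_calc_Hinf0: "f \<in> Hinf0 \<phi> \<Longrightarrow> has_calc f (Phi \<nu> f)"
  by (rule has_calcI[where l=0 and m=0]) auto

lemma has_calc_const: "has_calc (\<lambda>_. c) (\<lambda>x. c *C x)"
  by (rule has_calcI[OF Hinf0_zero, where l=0 and m=c]) (auto simp: Phi_zero)

text \<open>The coefficients are l = 1 and m = 0, since the reciprocals for a and for 1 differ by a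
  function in \<open>Hinf0\<close>.\<close>

lemma has_calc_recip:
  assumes "0 < a" shows "has_calc (\<lambda>z. 1 / (1 + of_real a * z)) (inv_shift a)"
  by (rule has_calcI[OF recip_diff_Hinf0[OF phi(1) angles(3) assms, of 1], where l=1 and m=0])
    (use Phi_recip_diff[OF assms _ nu, of 1] in auto)

lemma has_calc_add:
  assumes "has_calc f T" "has_calc g U" shows "has_calc (\<lambda>z. f z + g z) (\<lambda>x. T x + U x)"
proof -
  obtain f0 l m where f: "f0 \<in> Hinf0 \<phi>" "\<And>z. f z = f0 z + l * (1 / (1 + z)) + m"
    "\<And>x. T x = Phi \<nu> f0 x + l *C inv_shift 1 x + m *C x" using has_calcE[OF assms(1)] by blast
  obtain g0 l' m' where g: "g0 \<in> Hinf0 \<phi>" "\<And>z. g z = g0 z + l' * (1 / (1 + z)) + m'"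
    "\<And>x. U x = Phi \<nu> g0 x + l' *C inv_shift 1 x + m' *C x" using has_calcE[OF assms(2)] by blast
  show ?thesis
    by (rule has_calcI[OF Hinf0_add[OF f(1) g(1) phi(2)], where l="l + l'" and m="m + m'"])
      (simp_all add: f(2,3) g(2,3) Phi_add_fun[OF f(1) g(1) nu] distrib_right add_divide_distrib scaleC_add_left)
qed

lemma has_calc_cmult:
  assumes "has_calc f T" shows "has_calc (\<lambda>z. c * f z) (\<lambda>x. c *C T x)"
proof -
  obtain f0 l m where f: "f0 \<in> Hinf0 \<phi>" "\<And>z. f z = f0 z + l * (1 / (1 + z)) + m"
    "\<And>x. T x = Phi \<nu> f0 x + l *C inv_shift 1 x + m *C x" using has_calcE[OF assms(1)] by blast
  show ?thesis
    by (rule has_calcI[OF Hinf0_cmult[OF f(1) phi(2), of c], where l="c * l" and m="c * m"])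
      (simp_all add: f(2,3) Phi_cmult_fun[OF f(1) nu] distrib_left scaleC_add_right scaleC_scaleC)
qed

lemma has_calc_diff:
  assumes "has_calc f T" "has_calc g U" shows "has_calc (\<lambda>z. f z - g z) (\<lambda>x. T x - U x)"
  using has_calc_add[OF assms(1) has_calc_cmult[OF assms(2), of "- 1"]] by simp

lemma has_calc_linear:
  assumes "has_calc f T"
  shows "T (x + y) = T x + T y" "T (c *C x) = c *C T x"
proof -
  obtain f0 l m where f: "f0 \<in> Hinf0 \<phi>" "\<And>z. f z = f0 z + l * (1 / (1 + z)) + m"
    "\<And>x. T x = Phi \<nu> f0 x + l *C inv_shift 1 x + m *C x" using has_calcE[OF assms(1)] by blast
  show "T (x + y) = T x + T y" "T (c *C x) = c *C T x"
    by (simp_all add: f(3) Phi_linear[OF f(1) nu] inv_shift_linear scaleC_add_right scaleC_scaleC mult.commute)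
qed

text \<open>The one product not covered by the rules for \<open>Phi\<close>. With e = 1 / (1 + z)
  and d = 1 / (1 + 2 z) one has e e = (e - d) e + e d, where e - d is in \<open>Hinf0\<close>, and e
  d = 2 d - e by partial fractions.\<close>

lemma has_calc_recip_square: "has_calc (\<lambda>z. 1 / (1 + z) * (1 / (1 + z))) (\<lambda>x. inv_shift 1 (inv_shift 1 x))"
proof -
  define u where "u z = 1 / (1 + of_real 1 * z) - 1 / (1 + of_real 2 * z)" for z :: complex
  have u: "u \<in> Hinf0 \<phi>" unfolding u_def by (rule recip_diff_Hinf0) (use phi angles in auto)
  have Pu: "Phi \<nu> u x = inv_shift 1 x - inv_shift 2 x" for x
    unfolding u_def by (rule Phi_recip_diff[OF _ _ nu]) auto
  have "has_calc (\<lambda>z. u z * (1 / (1 + of_real 1 * z))) (Phi \<nu> (\<lambda>z. u z * (1 / (1 + of_real 1 * z))))"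
    by (rule has_calc_Hinf0[OF Hinf0_mult_recip[OF u]]) simp
  from has_calc_diff[OF has_calc_add[OF this has_calc_cmult[OF has_calc_recip[of 2], of 2]] has_calc_recip[of 1]]
  have "has_calc (\<lambda>z. u z * (1 / (1 + of_real 1 * z)) + 2 * (1 / (1 + of_real 2 * z)) - 1 / (1 + of_real 1 * z))
     (\<lambda>x. Phi \<nu> (\<lambda>z. u z * (1 / (1 + of_real 1 * z))) x + 2 *C inv_shift 2 x - inv_shift 1 x)" by simp
  then show ?thesis
  proof (rule has_calc_cong)
    fix z assume z: "z \<in> sector \<phi>"
    have nz: "1 + z \<noteq> 0" "1 + 2 * z \<noteq> 0"
      using one_plus_nonzero[OF phi(1) angles(3) _ z, of 1] one_plus_nonzero[OF phi(1) angles(3) _ z, of 2] by auto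
    have "1 / (1 + z) * (1 / (1 + 2 * z)) = 2 * (1 / (1 + 2 * z)) - 1 / (1 + z)"
      using nz by (simp add: field_simps)
    moreover have "e * e = (e - d) * e + e * d" for e d :: complex by (simp add: algebra_simps)
    from this[of "1 / (1 + z)" "1 / (1 + 2 * z)"]
    have "1 / (1 + z) * (1 / (1 + z)) = u z * (1 / (1 + z)) + 1 / (1 + z) * (1 / (1 + 2 * z))" by (simp add: u_def)
    ultimately show "1 / (1 + z) * (1 / (1 + z)) = u z * (1 / (1 + of_real 1 * z)) + 2 * (1 / (1 + of_real 2 * z)) - 1 / (1 + of_real 1 * z)"
      by simp
  next
    fix x
    \<comment> \<open>The operator form of e d = 2 d - e, checked by applying 1 + A.\<close>
    have S12: "inv_shift 1 (inv_shift 2 x) = 2 *C inv_shift 2 x - inv_shift 1 x"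
    proof (rule inv_shift_unique)
      have d: "inv_shift 1 x \<in> D" "inv_shift 2 x \<in> D" by (auto intro: inv_shift_solves)
      have n: "- inv_shift 1 x = (- 1) *C inv_shift 1 x" by simp
      have d': "2 *C inv_shift 2 x \<in> D" "(- 1) *C inv_shift 1 x \<in> D" using D_scale(1) d by blast+
      show "2 *C inv_shift 2 x - inv_shift 1 x \<in> D" using D_add(1)[OF d'] by simp
      have "A (2 *C inv_shift 2 x - inv_shift 1 x) = 2 *C A (inv_shift 2 x) - A (inv_shift 1 x)"
        using D_add(2)[OF d'] D_scale(2)[OF d(2), of 2] D_scale(2)[OF d(1), of "- 1"] by simp
      moreover have "2 *C y = y + y" for y :: 'a using scaleC_add_left[of 1 1 y] by simp
      moreover have "inv_shift 1 x + A (inv_shift 1 x) = x" "inv_shift 2 x + 2 *\<^sub>R A (inv_shift 2 x) = x"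
        using inv_shift_solves(2)[of 1 x] inv_shift_solves(2)[of 2 x] by auto
      moreover have "2 *\<^sub>R A (inv_shift 2 x) = A (inv_shift 2 x) + A (inv_shift 2 x)" by (simp add: scaleR_2)
      ultimately have *: "2 *C inv_shift 2 x - inv_shift 1 x + 1 *\<^sub>R A (2 *C inv_shift 2 x - inv_shift 1 x) =
          inv_shift 2 x + inv_shift 2 x - inv_shift 1 x + (A (inv_shift 2 x) + A (inv_shift 2 x) - A (inv_shift 1 x))"
        and x: "inv_shift 1 x + A (inv_shift 1 x) = x" "inv_shift 2 x + (A (inv_shift 2 x) + A (inv_shift 2 x)) = x"
        by simp_all
      have "inv_shift 2 x + inv_shift 2 x - inv_shift 1 x + (A (inv_shift 2 x) + A (inv_shift 2 x) - A (inv_shift 1 x)) =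
          inv_shift 2 x + (inv_shift 2 x + (A (inv_shift 2 x) + A (inv_shift 2 x))) - (inv_shift 1 x + A (inv_shift 1 x))"
        by (simp add: algebra_simps)
      also have "\<dots> = inv_shift 2 x" unfolding x by simp
      finally show "2 *C inv_shift 2 x - inv_shift 1 x + 1 *\<^sub>R A (2 *C inv_shift 2 x - inv_shift 1 x) = inv_shift 2 x" unfolding * .
    qed simp
    have "Phi \<nu> (\<lambda>z. u z * (1 / (1 + of_real 1 * z))) x = inv_shift 1 (inv_shift 1 x - inv_shift 2 x)"
      using Phi_inv_shift(1)[OF u _ nu, of 1 x] Pu[of x] by simp
    also have "\<dots> = inv_shift 1 (inv_shift 1 x) - (2 *C inv_shift 2 x - inv_shift 1 x)" by (simp add: inv_shift_linear S12)
    finally show "inv_shift 1 (inv_shift 1 x) = Phi \<nu> (\<lambda>z. u z * (1 / (1 + of_real 1 * z))) x + 2 *C inv_shift 2 x - inv_shift 1 x" by simp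
  qed
qed

lemma has_calc_mult:
  assumes "has_calc f T" "has_calc g U" shows "has_calc (\<lambda>z. f z * g z) (\<lambda>x. T (U x))"
proof -
  obtain f0 l m where f: "f0 \<in> Hinf0 \<phi>" "\<And>z. f z = f0 z + l * (1 / (1 + z)) + m"
    "\<And>x. T x = Phi \<nu> f0 x + l *C inv_shift 1 x + m *C x" using has_calcE[OF assms(1)] by blast
  obtain g0 l' m' where g: "g0 \<in> Hinf0 \<phi>" "\<And>z. g z = g0 z + l' * (1 / (1 + z)) + m'"
    "\<And>x. U x = Phi \<nu> g0 x + l' *C inv_shift 1 x + m' *C x" using has_calcE[OF assms(2)] by blast
  obtain B where "\<And>z. z \<in> sector \<phi> \<Longrightarrow> cmod (g0 z) \<le> B" using Hinf0_bounded[OF g(1)] by blast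
  from Hinf0_mult[OF f(1) Hinf0_holomorphic[OF g(1)] this phi(2)]
  have fg: "has_calc (\<lambda>z. f0 z * g0 z) (\<lambda>x. Phi \<nu> f0 (Phi \<nu> g0 x))"
    by (intro has_calc_cong[OF has_calc_Hinf0]) (auto simp: Phi_mult[OF f(1) g(1) nu])
  have fe: "has_calc (\<lambda>z. f0 z * (1 / (1 + z))) (\<lambda>x. Phi \<nu> f0 (inv_shift 1 x))"
    by (rule has_calc_cong[OF has_calc_Hinf0[OF Hinf0_mult_recip[OF f(1), of 1]]]) (auto simp: Phi_inv_shift(2)[OF f(1) _ nu])
  have ge: "has_calc (\<lambda>z. g0 z * (1 / (1 + z))) (\<lambda>x. inv_shift 1 (Phi \<nu> g0 x))"
    by (rule has_calc_cong[OF has_calc_Hinf0[OF Hinf0_mult_recip[OF g(1), of 1]]]) (auto simp: Phi_inv_shift(1)[OF g(1) _ nu])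
  have e: "has_calc (\<lambda>z. 1 / (1 + z)) (inv_shift 1)" using has_calc_recip[of 1] by simp
  \<comment> \<open>Each factor has three summands; for each of the nine products a rule is at
    hand.\<close>
  note sum = has_calc_add[OF has_calc_add[OF has_calc_add[OF fg
        has_calc_add[OF has_calc_cmult[OF fe, of l'] has_calc_cmult[OF has_calc_Hinf0[OF f(1)], of m']]]
        has_calc_add[OF has_calc_cmult[OF ge, of l] has_calc_cmult[OF has_calc_Hinf0[OF g(1)], of m]]]
        has_calc_add[OF has_calc_cmult[OF has_calc_recip_square, of "l * l'"]
           has_calc_add[OF has_calc_cmult[OF e, of "l * m' + m * l'"] has_calc_const[of "m * m'"]]]]
  show ?thesis
  proof (rule has_calc_cong[OF sum])
    fix z
    have "(a + l * e + m) * (b + l' * e + m') = a * b + (l' * (a * e) + m' * a) + (l * (b * e) + m * b) +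
        (l * l' * (e * e) + ((l * m' + m * l') * e + m * m'))" for a b e :: complex
      by (simp add: algebra_simps)
    then show "f z * g z = f0 z * g0 z + (l' * (f0 z * (1 / (1 + z))) + m' * f0 z) + (l * (g0 z * (1 / (1 + z))) + m * g0 z) +
      (l * l' * (1 / (1 + z) * (1 / (1 + z))) + ((l * m' + m * l') * (1 / (1 + z)) + m * m'))"
      unfolding f(2) g(2) .
  next
    fix x
    show "T (U x) = Phi \<nu> f0 (Phi \<nu> g0 x) + (l' *C Phi \<nu> f0 (inv_shift 1 x) + m' *C Phi \<nu> f0 x) +
      (l *C inv_shift 1 (Phi \<nu> g0 x) + m *C Phi \<nu> g0 x) +
      ((l * l') *C inv_shift 1 (inv_shift 1 x) + ((l * m' + m * l') *C inv_shift 1 x + (m * m') *C x))"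
      unfolding f(3) g(3)
      by (simp add: Phi_linear[OF f(1) nu] inv_shift_linear scaleC_add_right scaleC_add_left scaleC_scaleC algebra_simps)
  qed
qed

text \<open>The constant is kept explicit: it involves the operator only through \<open>M\<close>,
  which is what makes the bounds for f(tA) uniform in t.\<close>

lemma has_calc_norm:
  assumes "f0 \<in> Hinf0 \<phi>" "Hinf0_bound f0 C s"
  shows "norm (Phi \<nu> f0 x + l *C inv_shift 1 x + m *C x) \<le> (C * M / s + cmod l * M + cmod m) * norm x"
proof -
  have "norm (Phi \<nu> f0 x + l *C inv_shift 1 x + m *C x) \<le> norm (Phi \<nu> f0 x) + cmod l * norm (inv_shift 1 x) + cmod m * norm x"
    using norm_triangle_ineq[of "Phi \<nu> f0 x + l *C inv_shift 1 x" "m *C x"] norm_triangle_ineq[of "Phi \<nu> f0 x" "l *C inv_shift 1 x"]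
    by (simp add: norm_scaleC)
  also have "\<dots> \<le> C * M / s * norm x + cmod l * (M * norm x) + cmod m * norm x"
    using Phi_norm[OF assms nu, of x] inv_shift_norm[of 1 x] by (intro add_mono mult_left_mono) auto
  finally show ?thesis by (simp add: algebra_simps)
qed

section \<open>The calculus of the dilated operators\<close>

lemma elem_calculus_eq:
  assumes "elem_remainder f l m \<in> Hinf0 \<phi>"
  shows "elem_calculus D A \<phi> \<nu> f x = Phi \<nu> (elem_remainder f l m) x + l *C inv_shift 1 x + m *C x"
proof -
  have "(THE p. elem_remainder f (fst p) (snd p) \<in> Hinf0 \<phi>) = (l, m)"
  proof (rule the_equality)
    fix p assume p: "elem_remainder f (fst p) (snd p) \<in> Hinf0 \<phi>"
    show "p = (l, m)" using elem_unique[OF p assms phi] by (simp add: prod_eq_iff)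
  qed (use assms in simp)
  moreover have "inv_into D (\<lambda>y. y + A y) x = inv_shift 1 x" using inv_shift_inv_into[of 1 x] by simp
  ultimately show ?thesis by (simp add: elem_calculus_def)
qed

lemma scaled_resolvent_bij:
  assumes t: "0 < t" and z: "z / of_real t \<in> resolvent_set D A"
  shows "z \<in> resolvent_set D (\<lambda>y. t *\<^sub>R A y)" "resolvent D (\<lambda>y. t *\<^sub>R A y) z x = (1 / t) *\<^sub>R R (z / of_real t) x"
proof -
  define w where "w = z / of_real t"
  have eq: "z *C x - t *\<^sub>R A x = t *\<^sub>R (w *C x - A x)" for x
  proof -
    have z: "z = of_real t * w" using t by (simp add: w_def)
    show ?thesis unfolding z by (simp only: scaleR_scaleC scaleC_diff_right scaleC_scaleC)
  qed
  have bij: "bij_betw (\<lambda>x. z *C x - t *\<^sub>R A x) D UNIV"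
  proof -
    have "bij_betw (\<lambda>x. w *C x - A x) D UNIV" using z by (simp add: resolvent_set_def w_def)
    moreover have "bij (\<lambda>y::'a. t *\<^sub>R y)"
      by (rule bij_betw_byWitness[where f'="\<lambda>y. (1 / t) *\<^sub>R y"]) (use t in auto)
    ultimately have "bij_betw ((\<lambda>y. t *\<^sub>R y) \<circ> (\<lambda>x. w *C x - A x)) D UNIV" by (rule bij_betw_trans)
    then show ?thesis by (simp add: eq o_def)
  qed
  have r: "resolvent D (\<lambda>y. t *\<^sub>R A y) z x = (1 / t) *\<^sub>R R w x" for x
    unfolding resolvent_def
  proof (rule inv_into_f_eq)
    show "inj_on (\<lambda>x. z *C x - t *\<^sub>R A x) D" using bij by (simp add: bij_betw_def)
    have d: "R w x \<in> D" "w *C R w x - A (R w x) = x" using resolvent_solves z by (auto simp: w_def)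
    have e: "(1 / t) *\<^sub>R R w x = of_real (1 / t) *C R w x" by (rule scaleR_scaleC)
    show "(1 / t) *\<^sub>R inv_into D (\<lambda>x. w *C x - A x) x \<in> D"
      unfolding resolvent_def[symmetric] e by (intro D_scale d)
    have "t *\<^sub>R (w *C ((1 / t) *\<^sub>R R w x) - A ((1 / t) *\<^sub>R R w x)) = t *\<^sub>R (1 / t) *\<^sub>R (w *C R w x - A (R w x))"
      unfolding e D_scale(2)[OF d(1)] by (simp only: scaleR_scaleC scaleC_scaleC scaleC_diff_right mult.commute mult.left_commute)
    then show "z *C (1 / t) *\<^sub>R inv_into D (\<lambda>x. w *C x - A x) x - t *\<^sub>R A ((1 / t) *\<^sub>R inv_into D (\<lambda>x. w *C x - A x) x) = x"
      unfolding resolvent_def[symmetric] eq using t d(2) by simp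
  qed
  show "resolvent D (\<lambda>y. t *\<^sub>R A y) z x = (1 / t) *\<^sub>R R (z / of_real t) x" using r by (simp add: w_def)
  have "bounded_linear (\<lambda>x. (1 / t) *\<^sub>R R w x)"
    using resolvent_bounded_linear z by (intro bounded_linear_compose[OF bounded_linear_scaleR_right]) (simp add: w_def)
  moreover have "resolvent D (\<lambda>y. t *\<^sub>R A y) z = (\<lambda>x. (1 / t) *\<^sub>R R w x)" using r by (rule ext)
  ultimately have "bounded_linear (resolvent D (\<lambda>y. t *\<^sub>R A y) z)" by (simp only:)
  then show "z \<in> resolvent_set D (\<lambda>y. t *\<^sub>R A y)" using bij by (simp add: resolvent_set_def)
qed

text \<open>Sectors are invariant under positive dilations and z R(z, tA) = (z/t) R(z/t, A), so tA
  satisfies the axioms with the same angles and the same \<open>M\<close>.\<close>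

lemma scaled_sectorial_calculus:
  assumes t: "0 < t"
  shows "sectorial_calculus D (\<lambda>y. t *\<^sub>R A y) \<mu> \<phi> M \<nu>"
proof unfold_locales
  show "linear_operator D (\<lambda>y. t *\<^sub>R A y)"
    using D_add D_scale D_0 unfolding linear_operator_def
    by (auto simp: scaleC_add_right scaleR_scaleC scaleC_scaleC mult.commute)
  fix z assume z: "z \<notin> sector \<mu>" "z \<noteq> 0"
  define w where "w = z / of_real t"
  have zw: "z = of_real t * w" using t by (simp add: w_def)
  have w: "w \<notin> sector \<mu>" "w \<noteq> 0" using z sector_scale[OF t, of w \<mu>] by (auto simp: zw)
  show "z \<in> resolvent_set D (\<lambda>y. t *\<^sub>R A y)"
    by (rule scaled_resolvent_bij(1)[OF t]) (use res[OF w] in \<open>simp add: w_def\<close>)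
  fix x
  have "z *C resolvent D (\<lambda>y. t *\<^sub>R A y) z x = w *C R w x"
    using scaled_resolvent_bij(2)[OF t, of z x] res[OF w] t
    by (simp add: w_def scaleR_scaleC scaleC_scaleC)
  then show "norm (z *C resolvent D (\<lambda>y. t *\<^sub>R A y) z x) \<le> M * norm x" using res_bound[OF w] by simp
qed (use angles M nu in auto)

text \<open>Dilation maps each ray to itself, and the factor t from the differential cancels the 1/t
  in the resolvent of tA.\<close>

lemma scaled_Phi:
  assumes t: "0 < t" and f: "f \<in> Hinf0 \<phi>"
  shows "Hinf0_calculus D (\<lambda>y. t *\<^sub>R A y) \<nu> f x = Phi \<nu> (\<lambda>z. f (of_real t * z)) x"
proof -
  interpret tA: sectorial_calculus D "\<lambda>y. t *\<^sub>R A y" \<mu> \<phi> M \<nu> by (rule scaled_sectorial_calculus[OF t])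
  obtain C s where h: "Hinf0_bound f C s" using Hinf0_bound_exists[OF f] by blast
  have "ray_integral \<theta> (\<lambda>z. f z *C resolvent D (\<lambda>y. t *\<^sub>R A y) z x) = ray_integral \<theta> (\<lambda>z. f (of_real t * z) *C R z x)"
    if \<theta>: "\<bar>\<theta>\<bar> = \<nu>" for \<theta>
  proof -
    have "ray_integral \<theta> (\<lambda>z. f z *C resolvent D (\<lambda>y. t *\<^sub>R A y) z x) =
       t *\<^sub>R integral {0<..} (\<lambda>r. cis \<theta> *C (f (of_real (t * r) * cis \<theta>) *C resolvent D (\<lambda>y. t *\<^sub>R A y) (of_real (t * r) * cis \<theta>) x))"
      by (rule tA.calculus_ray(3)[OF f h _ _ t]) (use \<theta> nu in auto)
    also have "\<dots> = integral {0<..} (\<lambda>r. t *\<^sub>R (cis \<theta> *C (f (of_real (t * r) * cis \<theta>) *C resolvent D (\<lambda>y. t *\<^sub>R A y) (of_real (t * r) * cis \<theta>) x)))"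
      by (rule integral_cmul[symmetric])
    also have "\<dots> = integral {0<..} (\<lambda>r. cis \<theta> *C (f (of_real t * (of_real r * cis \<theta>)) *C R (of_real r * cis \<theta>) x))"
    proof (rule integral_cong)
      fix r :: real assume "r \<in> {0<..}"
      then have r: "0 < r" by simp
      have e: "of_real (t * r) * cis \<theta> / of_real t = of_real r * cis \<theta>" using t by simp
      have "of_real r * cis \<theta> \<in> resolvent_set D A" using r \<theta> nu angles by (intro exterior_resolvent_set ray_in_exterior) auto
      then have "resolvent D (\<lambda>y. t *\<^sub>R A y) (of_real (t * r) * cis \<theta>) x = (1 / t) *\<^sub>R R (of_real r * cis \<theta>) x"
        using scaled_resolvent_bij(2)[OF t, of "of_real (t * r) * cis \<theta>" x] unfolding e by simp
      then show "t *\<^sub>R (cis \<theta> *C (f (of_real (t * r) * cis \<theta>) *C resolvent D (\<lambda>y. t *\<^sub>R A y) (of_real (t * r) * cis \<theta>) x)) =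
          cis \<theta> *C (f (of_real t * (of_real r * cis \<theta>)) *C R (of_real r * cis \<theta>) x)"
        using t by (simp add: scaleR_scaleC scaleC_scaleC mult_ac)
    qed
    finally show ?thesis by (simp add: ray_integral_def)
  qed
  then show ?thesis using nu0 by (simp add: Hinf0_calculus_def)
qed

lemma scaled_inv_shift:
  assumes t: "0 < t"
  shows "sectorial_operator.inv_shift D (\<lambda>y. t *\<^sub>R A y) 1 x = inv_shift t x"
proof -
  interpret tA: sectorial_calculus D "\<lambda>y. t *\<^sub>R A y" \<mu> \<phi> M \<nu> by (rule scaled_sectorial_calculus[OF t])
  show ?thesis by (rule tA.inv_shift_unique) (use inv_shift_solves[OF t, of x] in auto)
qed

text \<open>f(tA) becomes the function f(t z) evaluated at the single operator A, so that operators
  with different t can be multiplied and compared.\<close>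

lemma has_calc_scaled_elem:
  assumes t: "0 < t" and f: "f \<in> elem_fun \<phi>"
  shows "has_calc (\<lambda>z. f (of_real t * z)) (elem_calculus D (\<lambda>y. t *\<^sub>R A y) \<phi> \<nu> f)"
proof -
  interpret tA: sectorial_calculus D "\<lambda>y. t *\<^sub>R A y" \<mu> \<phi> M \<nu> by (rule scaled_sectorial_calculus[OF t])
  obtain l m where lm: "elem_remainder f l m \<in> Hinf0 \<phi>" using f by (auto simp: elem_fun_def)
  from has_calc_add[OF has_calc_add[OF has_calc_Hinf0[OF Hinf0_scale[OF lm t]] has_calc_cmult[OF has_calc_recip[OF t], of l]] has_calc_const[of m]]
  show ?thesis
  proof (rule has_calc_cong)
    show "elem_calculus D (\<lambda>y. t *\<^sub>R A y) \<phi> \<nu> f x = Phi \<nu> (\<lambda>z. elem_remainder f l m (of_real t * z)) x + l *C inv_shift t x + m *C x" for x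
      by (simp add: tA.elem_calculus_eq[OF lm] scaled_Phi[OF t lm] scaled_inv_shift[OF t])
  qed (simp add: elem_remainder_def)
qed

lemma elem_scale_bounded:
  assumes f: "f \<in> elem_fun \<phi>"
  shows "\<exists>K\<ge>0. \<forall>t>0. \<forall>x. norm (elem_calculus D (\<lambda>y. t *\<^sub>R A y) \<phi> \<nu> f x) \<le> K * norm x"
proof -
  obtain l m where lm: "elem_remainder f l m \<in> Hinf0 \<phi>" using f by (auto simp: elem_fun_def)
  obtain C s where h: "Hinf0_bound (elem_remainder f l m) C s" using Hinf0_bound_exists[OF lm] by blast
  have "norm (elem_calculus D (\<lambda>y. t *\<^sub>R A y) \<phi> \<nu> f x) \<le> (C * M / s + cmod l * M + cmod m) * norm x"
    if t: "0 < t" for t x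
  proof -
    interpret tA: sectorial_calculus D "\<lambda>y. t *\<^sub>R A y" \<mu> \<phi> M \<nu> by (rule scaled_sectorial_calculus[OF t])
    show ?thesis unfolding tA.elem_calculus_eq[OF lm] by (rule tA.has_calc_norm[OF lm h])
  qed
  moreover have "0 \<le> C * M / s + cmod l * M + cmod m" using h M by (simp add: Hinf0_bound_def)
  ultimately show ?thesis by blast
qed

end

section \<open>The approximating functions\<close>

text \<open>A mean value inequality with the majorant in integrated form; the integrals along rays
  below are all estimated through explicit antiderivatives G.\<close>

lemma norm_diff_le_antiderivative:
  fixes F :: "real \<Rightarrow> 'a::banach"
  assumes "a \<le> b" and F: "\<And>s. a \<le> s \<Longrightarrow> s \<le> b \<Longrightarrow> (F has_vector_derivative f s) (at s)"
    and G: "\<And>s. a \<le> s \<Longrightarrow> s \<le> b \<Longrightarrow> (G has_real_derivative g s) (at s)"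
    and le: "\<And>s. a \<le> s \<Longrightarrow> s \<le> b \<Longrightarrow> norm (f s) \<le> g s"
  shows "norm (F b - F a) \<le> G b - G a"
proof -
  have "(f has_integral (F b - F a)) {a..b}"
    using assms(1) by (intro fundamental_theorem_of_calculus has_vector_derivative_at_within[OF F]) auto
  moreover have "(g has_integral (G b - G a)) {a..b}"
    using assms(1) by (intro fundamental_theorem_of_calculus)
      (auto intro: has_field_derivative_at_within G simp: has_real_derivative_iff_has_vector_derivative[symmetric])
  ultimately show ?thesis
    using integral_norm_bound_integral[of f "{a..b}" g] le by (auto simp: has_integral_iff)
qed

lemma Hinf0I:
  assumes hol: "f holomorphic_on sector \<phi>" and s: "0 < s"
    and le: "\<And>z. z \<in> sector \<phi> \<Longrightarrow> cmod (f z) \<le> C * min (cmod z powr s) (cmod z powr - s)"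
  shows "f \<in> Hinf0 \<phi>"
proof -
  have le': "cmod (f z) \<le> (\<bar>C\<bar> + 1) * min (cmod z powr s) (cmod z powr - s)" if "z \<in> sector \<phi>" for z
    using le[OF that] by (rule order_trans) (intro mult_right_mono, auto)
  have "cmod (f z) \<le> (\<bar>C\<bar> + 1) * 1" if z: "z \<in> sector \<phi>" for z
  proof -
    have "0 < cmod z" using z by (simp add: sector_def)
    then show ?thesis using s by (intro order_trans[OF le'[OF z]] mult_left_mono min_powr_le_1) auto
  qed
  then have "bounded (f ` sector \<phi>)" by (auto simp: bounded_iff)
  moreover have "0 < \<bar>C\<bar> + 1" by simp
  ultimately show ?thesis unfolding Hinf0_def Hinf_def using hol s le' by blast
qed

lemma cnj_sector: "\<phi> \<le> pi \<Longrightarrow> cnj z \<in> sector \<phi> \<longleftrightarrow> z \<in> sector \<phi>"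
proof -
  assume \<phi>: "\<phi> \<le> pi"
  have *: "cnj z \<in> sector \<phi>" if "z \<in> sector \<phi>" for z
  proof -
    from that obtain r \<theta> where "0 < r" "\<bar>\<theta>\<bar> < \<phi>" "z = of_real r * cis \<theta>" by (rule sector_polarE)
    then show ?thesis using polar_in_sector[of r "- \<theta>" \<phi>] \<phi> by (simp add: cis_cnj)
  qed
  show ?thesis using *[of z] *[of "cnj z"] by auto
qed

text \<open>The sector need not be convex, so the primitive is built in logarithmic coordinates, on
  a strip. On the positive axis the two bounds for p give limits at infinity and at 0; on the other
  rays the limits are the same, because the connecting arcs contribute amounts that vanish at both
  ends.\<close>

lemma sector_primitive:
  assumes \<phi>: "0 < \<phi>" "\<phi> \<le> pi" and p: "p holomorphic_on sector \<phi>"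
    and bd: "\<And>z. z \<in> sector \<phi> \<Longrightarrow> cmod (p z) \<le> K * cmod z" "\<And>z. z \<in> sector \<phi> \<Longrightarrow> cmod (p z) \<le> K / (1 + cmod z)\<^sup>2"
  shows "\<exists>Q J1 J0. \<forall>z\<in>sector \<phi>. (Q has_field_derivative p z) (at z) \<and>
    ((\<lambda>s. Q (of_real s * z)) \<longlongrightarrow> J1) at_top \<and> ((\<lambda>s. Q (of_real s * z)) \<longlongrightarrow> J0) (at_right 0)"
proof -
  have K: "0 \<le> K"
  proof -
    have "1 \<in> sector \<phi>" using \<phi> by (simp add: sector_def)
    from order_trans[OF norm_ge_zero bd(1)[OF this]] show ?thesis by simp
  qed
  define S where "S = {w. - \<phi> < Im w} \<inter> {w. Im w < \<phi>}"
  have S: "open S" "convex S" unfolding S_def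
    by (auto intro!: open_Int open_halfspace_Im_gt open_halfspace_Im_lt convex_Int
        convex_halfspace_Im_gt convex_halfspace_Im_lt)
  have expS: "exp w \<in> sector \<phi>" if "w \<in> S" for w
    using polar_in_sector[of "exp (Re w)" "Im w" \<phi>] that \<phi> by (simp add: S_def exp_eq_polar abs_less_iff)
  have "(p \<circ> exp) holomorphic_on S"
    by (rule holomorphic_on_compose_gen[OF _ p]) (use expS in \<open>auto intro: holomorphic_intros\<close>)
  then have "(\<lambda>w. exp w * p (exp w)) holomorphic_on S"
    by (intro holomorphic_on_mult holomorphic_on_exp) (simp add: o_def)
  from holomorphic_convex_primitive'[OF S(2,1) this]
  obtain H where H: "\<And>w. w \<in> S \<Longrightarrow> (H has_field_derivative exp w * p (exp w)) (at w within S)" by blast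
  have H': "(H has_field_derivative exp w * p (exp w)) (at w)" if "w \<in> S" for w
    using H[OF that] by (simp only: at_within_open[OF that S(1)])
  define Q where "Q z = H (Ln z)" for z
  have LnS: "Ln z \<in> S" "z \<notin> \<real>\<^sub>\<le>\<^sub>0" "z \<noteq> 0" "Im (Ln z) = Arg z" if z: "z \<in> sector \<phi>" for z
  proof -
    show z0: "z \<noteq> 0" using z by (simp add: sector_def)
    show a: "Im (Ln z) = Arg z" using z0 by (simp add: Arg_eq_Im_Ln)
    show "Ln z \<in> S" using z unfolding S_def by (simp add: a sector_def abs_less_iff)
    have "Arg z \<noteq> pi" using z \<phi> by (auto simp: sector_def)
    then show "z \<notin> \<real>\<^sub>\<le>\<^sub>0" using Arg_eq_pi_iff[of z] z0
      by (auto simp: complex_nonpos_Reals_iff complex_is_Real_iff complex_eq_iff)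
  qed
  have dQ: "(Q has_field_derivative p z) (at z)" if z: "z \<in> sector \<phi>" for z
  proof -
    have "(Q has_field_derivative (exp (Ln z) * p (exp (Ln z))) * inverse z) (at z)"
      unfolding Q_def[abs_def]
      by (rule DERIV_chain2[OF H'[OF LnS(1)[OF z]] has_field_derivative_Ln[OF LnS(2)[OF z]]])
    moreover have "exp (Ln z) * p (exp (Ln z)) * inverse z = p z"
      using LnS(3)[OF z] by (simp add: exp_Ln field_simps)
    ultimately show ?thesis by simp
  qed
  have one: "of_real s \<in> sector \<phi>" if "0 < s" for s :: real
    using polar_in_sector[OF that, of 0 \<phi>] \<phi> by simp
  have dQr: "((\<lambda>s. Q (of_real s)) has_vector_derivative p (of_real s)) (at s)" if "0 < s" for s :: real
    using field_vector_diff_chain_at[OF has_vector_derivative_of_real[OF DERIV_ident] dQ[OF one[OF that]]]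
    by (simp add: o_def)
  \<comment> \<open>The bound K s integrates to K s^2 / 2 and gives the limit at 0; in the same way
    K / (1 + s)^2 integrates to -K / (1 + s) and gives the limit at infinity.\<close>
  have inc0: "norm (Q (of_real x) - Q (of_real y)) \<le> K / 2 * \<bar>x\<^sup>2 - y\<^sup>2\<bar>" if "0 < x" "0 < y" for x y :: real
  proof -
    have *: "norm (Q (of_real b) - Q (of_real a)) \<le> K / 2 * b\<^sup>2 - K / 2 * a\<^sup>2" if "0 < a" "a \<le> b" for a b :: real
    proof (rule norm_diff_le_antiderivative[OF that(2)])
      fix s assume s: "a \<le> s" "s \<le> b"
      then have "0 < s" using that by simp
      show "((\<lambda>s. Q (of_real s)) has_vector_derivative p (of_real s)) (at s)" by (rule dQr[OF \<open>0 < s\<close>])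
      show "((\<lambda>s. K / 2 * s\<^sup>2) has_real_derivative K * s) (at s)" by (auto intro!: derivative_eq_intros)
      show "cmod (p (of_real s)) \<le> K * s" using bd(1)[OF one[OF \<open>0 < s\<close>]] \<open>0 < s\<close> by simp
    qed
    show ?thesis
    proof (cases "x \<le> y")
      case True
      have "x\<^sup>2 \<le> y\<^sup>2" using that True by (intro power_mono) auto
      then show ?thesis using *[OF that(1) True] by (simp add: norm_minus_commute right_diff_distrib)
    next
      case False
      then have "y\<^sup>2 \<le> x\<^sup>2" using that by (intro power_mono) auto
      then show ?thesis using *[OF that(2), of x] False by (simp add: right_diff_distrib)
    qed
  qed
  have inc1: "norm (Q (of_real x) - Q (of_real y)) \<le> K * \<bar>1 / (1 + x) - 1 / (1 + y)\<bar>" if "0 < x" "0 < y" for x y :: real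
  proof -
    have *: "norm (Q (of_real b) - Q (of_real a)) \<le> - (K / (1 + b)) - - (K / (1 + a))" if "0 < a" "a \<le> b" for a b :: real
    proof (rule norm_diff_le_antiderivative[OF that(2)])
      fix s assume s: "a \<le> s" "s \<le> b"
      then have "0 < s" using that by simp
      show "((\<lambda>s. Q (of_real s)) has_vector_derivative p (of_real s)) (at s)" by (rule dQr[OF \<open>0 < s\<close>])
      show "((\<lambda>s. - (K / (1 + s))) has_real_derivative K / (1 + s)\<^sup>2) (at s)"
        using \<open>0 < s\<close> by (auto intro!: derivative_eq_intros simp: power2_eq_square)
      show "cmod (p (of_real s)) \<le> K / (1 + s)\<^sup>2" using bd(2)[OF one[OF \<open>0 < s\<close>]] \<open>0 < s\<close> by simp
    qed
    show ?thesis
    proof (cases "x \<le> y")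
      case True
      then have "1 / (1 + y) \<le> 1 / (1 + x)" using that by (intro divide_left_mono) auto
      then show ?thesis using *[OF that(1) True] by (simp add: norm_minus_commute right_diff_distrib)
    next
      case False
      then have "1 / (1 + x) \<le> 1 / (1 + y)" using that by (intro divide_left_mono) auto
      then show ?thesis using *[OF that(2), of x] False by (simp add: norm_minus_commute right_diff_distrib)
    qed
  qed
  have "((\<lambda>s::real. s\<^sup>2) \<longlongrightarrow> 0\<^sup>2) (at_right 0)" by (intro tendsto_intros)
  from lipschitz_limit[OF this trivial_limit_at_right_real eventually_at_right_less inc0]
  obtain J0 where J0: "((\<lambda>s. Q (of_real s)) \<longlongrightarrow> J0) (at_right 0)" by blast
  have "((\<lambda>s::real. 1 / (1 + s)) \<longlongrightarrow> 0) at_top" by real_asymp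
  from lipschitz_limit[OF this trivial_limit_at_top_linorder eventually_gt_at_top inc1]
  obtain J1 where J1: "((\<lambda>s. Q (of_real s)) \<longlongrightarrow> J1) at_top" by blast
  \<comment> \<open>The arc of radius r is a vertical segment in logarithmic coordinates; its length
    is at most \<phi>, and the derivative of H there is at most r b.\<close>
  have arc: "cmod (Q (of_real r * cis \<theta>) - Q (of_real r)) \<le> (r * b) * \<phi>"
    if r: "0 < r" and \<theta>: "\<bar>\<theta>\<bar> < \<phi>" and b: "\<And>z. z \<in> sector \<phi> \<Longrightarrow> cmod z = r \<Longrightarrow> cmod (p z) \<le> b" for r \<theta> b
  proof -
    define T where "T = {w. Re w = ln r} \<inter> S"
    have "convex {w. Re w = ln r}"
      using convex_hyperplane[of "1::complex" "ln r"] by simp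
    then have "convex T" unfolding T_def by (rule convex_Int[OF _ S(2)])
    have b0: "0 \<le> b" using order_trans[OF norm_ge_zero b[OF one[OF r]]] r by simp
    have "cmod (H (of_real (ln r) + \<i> * of_real \<theta>) - H (of_real (ln r)))
        \<le> (r * b) * cmod ((of_real (ln r) + \<i> * of_real \<theta>) - of_real (ln r))"
    proof (rule field_differentiable_bound[OF \<open>convex T\<close>])
      fix w assume w: "w \<in> T"
      then show "(H has_field_derivative exp w * p (exp w)) (at w within T)"
        by (intro has_field_derivative_at_within[OF H']) (simp add: T_def)
      have "cmod (exp w) = r" using w r by (simp add: T_def)
      then show "cmod (exp w * p (exp w)) \<le> r * b"
        unfolding norm_mult using b[OF expS, of w] w r by (auto simp: T_def)
    qed (use \<theta> \<phi> in \<open>auto simp: T_def S_def\<close>)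
    also have "\<dots> = (r * b) * \<bar>\<theta>\<bar>" by (simp add: norm_mult)
    also have "\<dots> \<le> (r * b) * \<phi>" using \<theta> r b0 by (intro mult_left_mono) auto
    finally have *: "cmod (H (of_real (ln r) + \<i> * of_real \<theta>) - H (of_real (ln r))) \<le> (r * b) * \<phi>" .
    have "Ln (of_real r * cis \<theta>) = of_real (ln r) + \<i> * of_real \<theta>"
      unfolding exp_log_polar[OF r, symmetric] using \<theta> \<phi> by (intro Ln_exp) auto
    moreover have "Ln (of_real r) = of_real (ln r)" using r by (simp add: Ln_of_real)
    ultimately show ?thesis using * by (simp add: Q_def)
  qed
  have scale_lim: "filterlim (\<lambda>s::real. s * r) at_top at_top" "filterlim (\<lambda>s::real. s * r) (at_right 0) (at_right 0)"
    if "0 < r" for r :: real using that by real_asymp+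
  show ?thesis
  proof (intro exI ballI conjI)
    fix z assume z: "z \<in> sector \<phi>"
    then show "(Q has_field_derivative p z) (at z)" by (rule dQ)
    from z obtain r \<theta> where zp: "0 < r" "\<bar>\<theta>\<bar> < \<phi>" "z = of_real r * cis \<theta>" "cmod z = r" by (rule sector_polarE)
    have e: "of_real s * z = of_real (s * r) * cis \<theta>" for s by (simp add: zp(3))
    have "((\<lambda>s. Q (of_real s * cis \<theta>) - Q (of_real s)) \<longlongrightarrow> 0) at_top"
    proof (rule Lim_null_comparison)
      show "\<forall>\<^sub>F s in at_top. norm (Q (of_real s * cis \<theta>) - Q (of_real s)) \<le> (s * (K / (1 + s)\<^sup>2)) * \<phi>"
        using eventually_gt_at_top[of 0]
        by eventually_elim (intro arc zp, use bd(2) in auto)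
      show "((\<lambda>s. (s * (K / (1 + s)\<^sup>2)) * \<phi>) \<longlongrightarrow> 0) at_top" by real_asymp
    qed
    from tendsto_add[OF this J1] have "((\<lambda>s. Q (of_real s * cis \<theta>)) \<longlongrightarrow> J1) at_top" by simp
    from filterlim_compose[OF this scale_lim(1)[OF zp(1)]]
    show "((\<lambda>s. Q (of_real s * z)) \<longlongrightarrow> J1) at_top" by (simp add: e)
    have "((\<lambda>s. Q (of_real s * cis \<theta>) - Q (of_real s)) \<longlongrightarrow> 0) (at_right 0)"
    proof (rule Lim_null_comparison)
      show "\<forall>\<^sub>F s in at_right 0. norm (Q (of_real s * cis \<theta>) - Q (of_real s)) \<le> (s * (K * s)) * \<phi>"
        using eventually_at_right_less[of 0]
        by eventually_elim (intro arc zp, use bd(1) in auto)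
      have "((\<lambda>s. (s * (K * s)) * \<phi>) \<longlongrightarrow> (0 * (K * 0)) * \<phi>) (at_right 0)" by (intro tendsto_intros)
      then show "((\<lambda>s. (s * (K * s)) * \<phi>) \<longlongrightarrow> 0) (at_right 0)" by simp
    qed
    from tendsto_add[OF this J0] have "((\<lambda>s. Q (of_real s * cis \<theta>)) \<longlongrightarrow> J0) (at_right 0)" by simp
    from filterlim_compose[OF this scale_lim(2)[OF zp(1)]]
    show "((\<lambda>s. Q (of_real s * z)) \<longlongrightarrow> J0) (at_right 0)" by (simp add: e)
  qed
qed

text \<open>The growth condition is there to make r = q / g bounded: along the ray through z it
  gives |g(s z)| \<le> B |g(z)| for s \<ge> 1, so |g(z)| can be pulled out of the tail integral that
  defines q(z). The function (1 - q) / z serves to estimate b - q(tA) b on the domain, the bounds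
  with W to place the differences q(\<epsilon> z) - q(t z) in \<open>Hinf0\<close>.\<close>

lemma approximating_functions:
  assumes \<phi>: "0 < \<phi>" "\<phi> < pi" and g: "g \<in> elem_fun \<phi>" "\<And>z. z \<in> sector \<phi> \<Longrightarrow> g z \<noteq> 0"
    and L: "L \<noteq> 0" "(g \<longlongrightarrow> L) (at 0 within sector \<phi>)"
    and B: "\<And>z s. z \<in> sector \<phi> \<Longrightarrow> 1 \<le> s \<Longrightarrow> cmod (g (of_real s * z)) \<le> B * cmod (g z)"
  obtains k r q W where "k \<in> Hinf0 \<phi>" "r \<in> elem_fun \<phi>" "\<And>z. z \<in> sector \<phi> \<Longrightarrow> q z = r z * g z"
    "\<And>z. z \<in> sector \<phi> \<Longrightarrow> (q has_field_derivative - (g z * k z)) (at z)"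
    "(\<lambda>z. (1 - q z) / z) \<in> Hinf0 \<phi>"
    "\<And>z. z \<in> sector \<phi> \<Longrightarrow> cmod (1 - q z) \<le> W * cmod z"
    "\<And>z. z \<in> sector \<phi> \<Longrightarrow> cmod (q z) \<le> W / (1 + cmod z)"
proof -
  have \<phi>': "\<phi> \<le> pi" using \<phi> by simp
  obtain l m where lm: "elem_remainder g l m \<in> Hinf0 \<phi>" using g(1) by (auto simp: elem_fun_def)
  define g0 where "g0 = elem_remainder g l m"
  have g_eq: "g z = g0 z + l * (1 / (1 + z)) + m" for z by (simp add: g0_def elem_remainder_def)
  obtain C s where C: "g0 holomorphic_on sector \<phi>" "0 \<le> C" "0 < s" "s \<le> 1"
    "\<And>z. z \<in> sector \<phi> \<Longrightarrow> cmod (g0 z) \<le> C * (cmod z * decay s (cmod z))"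
    using lm[folded g0_def] unfolding Hinf0_iff[OF \<phi>'] by blast
  obtain E where E: "0 \<le> E" "\<And>z. z \<in> sector \<phi> \<Longrightarrow> cmod (1 / (1 + z)) \<le> E / (1 + cmod z)"
    and Ehol: "(\<lambda>z. 1 / (1 + z)) holomorphic_on sector \<phi>"
    using recip_one_plus_bounded[OF \<phi>, of 1] by auto
  have nz1: "1 + z \<noteq> 0" if "z \<in> sector \<phi>" for z using one_plus_nonzero[OF \<phi> _ that, of 1] by simp
  have g_hol: "g holomorphic_on sector \<phi>"
  proof -
    have "(\<lambda>z. g0 z + l * (1 / (1 + z)) + m) holomorphic_on sector \<phi>"
      by (intro holomorphic_on_add holomorphic_on_mult holomorphic_on_const C(1) Ehol)
    then show ?thesis by (simp only: g_eq[symmetric] eta_contract_eq)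
  qed
  define G where "G = C + cmod l * E + cmod m"
  have G0: "0 \<le> G" using C(2) E(1) by (simp add: G_def)
  have E1: "cmod (1 / (1 + z)) \<le> E" if z: "z \<in> sector \<phi>" for z
  proof -
    have "E / (1 + cmod z) \<le> E / 1" using E(1) by (intro divide_left_mono) (auto simp: add_pos_nonneg)
    then show ?thesis using E(2)[OF z] by simp
  qed
  have g_bd: "cmod (g z) \<le> G" if z: "z \<in> sector \<phi>" for z
  proof -
    have z0: "0 < cmod z" using z by (simp add: sector_def)
    have "cmod (g z) \<le> cmod (g0 z) + cmod l * cmod (1 / (1 + z)) + cmod m"
      unfolding g_eq norm_mult[symmetric] by (intro order_trans[OF norm_triangle_ineq] add_mono norm_triangle_ineq) auto
    also have "\<dots> \<le> C * 1 + cmod l * E + cmod m"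
      using C(2) C(5)[OF z] E1[OF z] times_decay_le_1[OF z0 C(3)]
      by (intro add_mono mult_left_mono order_trans[OF C(5)[OF z]]) auto
    finally show ?thesis by (simp add: G_def)
  qed
  have real_sec: "of_real x \<in> sector \<phi>" if "0 < x" for x :: real
    using polar_in_sector[OF that, of 0 \<phi>] \<phi> by simp
  \<comment> \<open>Along the positive axis towards 0 the part in \<open>Hinf0\<close> vanishes and
    leaves l + m.\<close>
  have lmL: "l + m = L"
  proof -
    have "filterlim (\<lambda>x::real. of_real x) (at 0 within sector \<phi>) (at_right 0)"
      unfolding filterlim_at
    proof
      show "((\<lambda>x::real. complex_of_real x) \<longlongrightarrow> 0) (at_right 0)"
        using tendsto_of_real[OF tendsto_ident_at[of "0::real" "{0<..}"]] by simp
      show "\<forall>\<^sub>F x in at_right 0. complex_of_real x \<in> sector \<phi> \<and> complex_of_real x \<noteq> 0"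
        using eventually_at_right_less[of 0] by eventually_elim (auto intro: real_sec)
    qed
    from filterlim_compose[OF L(2) this] have 1: "((\<lambda>x. g (of_real x)) \<longlongrightarrow> L) (at_right 0)" .
    have "((\<lambda>x. g0 (of_real x)) \<longlongrightarrow> 0) (at_right 0)"
      by (rule Lim_null_comparison[OF _ tendsto_mult_right_zero[OF times_decay_lim_0[OF C(3)], of C]])
        (rule eventually_mono[OF eventually_at_right_less[of 0]], use C(5)[OF real_sec] in auto)
    then have "((\<lambda>x. g0 (of_real x) + l * (1 / (1 + of_real x)) + m) \<longlongrightarrow> 0 + l * (1 / (1 + of_real 0)) + m) (at_right 0)"
      by (intro tendsto_intros) auto
    then have 2: "((\<lambda>x. g (of_real x)) \<longlongrightarrow> l + m) (at_right 0)" by (simp add: g_eq)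
    show ?thesis by (rule tendsto_unique[OF trivial_limit_at_right_real 2 1])
  qed
  define Hd where "Hd = C + cmod l * E"
  have Hd0: "0 \<le> Hd" using C(2) E(1) by (simp add: Hd_def)
  have le_powr: "cmod z \<le> cmod z powr s" if "z \<in> sector \<phi>" "cmod z \<le> 1" for z
    using powr_mono'[of s 1 "cmod z"] that C(4) by (auto simp: sector_def)
  \<comment> \<open>Near 0 the function g approaches L at the rate |z|^s. The mere limit would not
    place the remainder of q / g in \<open>Hinf0\<close>.\<close>
  have holder: "cmod (g z - L) \<le> Hd * cmod z powr s" if z: "z \<in> sector \<phi>" "cmod z \<le> 1" for z
  proof -
    have z0: "0 < cmod z" using z by (simp add: sector_def)
    have "g z - L = g0 z - l * (z * (1 / (1 + z)))"
      unfolding g_eq lmL[symmetric] using nz1[OF z(1)] by (simp add: field_simps)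
    then have "cmod (g z - L) \<le> cmod (g0 z) + cmod l * (cmod z * cmod (1 / (1 + z)))"
      by (simp only: norm_mult[symmetric] norm_triangle_ineq4)
    also have "\<dots> \<le> C * cmod z powr s + cmod l * (cmod z powr s * E)"
      using C(2) E1[OF z(1)] le_powr[OF z] times_decay_le_min[OF z0, of s] E(1)
      by (intro add_mono mult_left_mono mult_mono order_trans[OF C(5)[OF z(1)]]) auto
    finally show ?thesis by (simp add: Hd_def algebra_simps)
  qed
  \<comment> \<open>Conjugating argument and value keeps holomorphy, and on the positive axis the
    product with g is |g|^2.\<close>
  define gs where "gs z = cnj (g (cnj z))" for z
  have gs_hol: "gs holomorphic_on sector \<phi>"
  proof -
    have "cnj ` sector \<phi> = sector \<phi>"
    proof (intro equalityI subsetI)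
      fix z assume "z \<in> sector \<phi>"
      then have "cnj z \<in> sector \<phi>" "z = cnj (cnj z)" using cnj_sector[OF \<phi>'] by auto
      then show "z \<in> cnj ` sector \<phi>" by (rule rev_image_eqI)
    qed (use cnj_sector[OF \<phi>'] in auto)
    then have "(cnj \<circ> g \<circ> cnj) holomorphic_on sector \<phi>"
      using g_hol by (intro holomorphic_on_compose_cnj_cnj open_sector \<phi>') simp
    then show ?thesis by (simp add: gs_def[abs_def] o_def)
  qed
  have gs_bd: "cmod (gs z) \<le> G" if "z \<in> sector \<phi>" for z
    using g_bd[of "cnj z"] cnj_sector[OF \<phi>', of z] that by (simp add: gs_def)
  \<comment> \<open>The third power leaves a bound of order |z| at 0 and |z|^{-2} at infinity; both
    ends of the integral of g k1 then converge.\<close>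
  define k1 where "k1 z = z * (1 / (1 + z))^3 * gs z" for z
  have k1_hol: "k1 holomorphic_on sector \<phi>" unfolding k1_def[abs_def]
    by (intro holomorphic_on_mult holomorphic_on_power holomorphic_on_ident Ehol gs_hol)
  define K where "K = E^3 * G"
  have K0: "0 \<le> K" using E(1) G0 by (simp add: K_def)
  have k1_bd: "cmod (k1 z) \<le> K * cmod z / (1 + cmod z)^3" if z: "z \<in> sector \<phi>" for z
  proof -
    have "cmod (k1 z) \<le> cmod z * (E / (1 + cmod z))^3 * G"
      unfolding k1_def norm_mult norm_power using E(1) E(2)[OF z] gs_bd[OF z]
      by (intro mult_mono power_mono mult_nonneg_nonneg) auto
    then show ?thesis by (simp add: K_def power_divide mult_ac)
  qed
  have frac: "x / (1 + x)^3 \<le> x" "x / (1 + x)^3 \<le> 1 / (1 + x)\<^sup>2" if "0 \<le> x" for x :: real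
  proof -
    have "x / (1 + x)^3 \<le> x / 1" using that by (intro divide_left_mono) auto
    then show "x / (1 + x)^3 \<le> x" by simp
    have "x / (1 + x)^3 = x / (1 + x) * (1 / (1 + x)\<^sup>2)" by (simp add: power3_eq_cube power2_eq_square)
    also have "\<dots> \<le> 1 * (1 / (1 + x)\<^sup>2)" using that by (intro mult_right_mono) auto
    finally show "x / (1 + x)^3 \<le> 1 / (1 + x)\<^sup>2" by simp
  qed
  have k1_bd1: "cmod (k1 z) \<le> K * cmod z" and k1_bd2: "cmod (k1 z) \<le> K / (1 + cmod z)\<^sup>2" if z: "z \<in> sector \<phi>" for z
    using k1_bd[OF z] mult_left_mono[OF frac(1)[of "cmod z"] K0] mult_left_mono[OF frac(2)[of "cmod z"] K0] by simp_all
  define p where "p z = g z * k1 z" for z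
  have p_hol: "p holomorphic_on sector \<phi>" unfolding p_def[abs_def] by (intro holomorphic_on_mult g_hol k1_hol)
  have p_bd: "cmod (p z) \<le> (G * K) * cmod z" "cmod (p z) \<le> (G * K) / (1 + cmod z)\<^sup>2" if z: "z \<in> sector \<phi>" for z
  proof -
    have "cmod (g z) * cmod (k1 z) \<le> G * (K * cmod z)" "cmod (g z) * cmod (k1 z) \<le> G * (K / (1 + cmod z)\<^sup>2)"
      using g_bd[OF z] k1_bd1[OF z] k1_bd2[OF z] G0 by (intro mult_mono; simp)+
    then show "cmod (p z) \<le> (G * K) * cmod z" "cmod (p z) \<le> (G * K) / (1 + cmod z)\<^sup>2"
      by (simp_all add: p_def norm_mult mult.assoc)
  qed
  obtain Q J1 J0 where Q: "\<And>z. z \<in> sector \<phi> \<Longrightarrow> (Q has_field_derivative p z) (at z)"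
    "\<And>z. z \<in> sector \<phi> \<Longrightarrow> ((\<lambda>s. Q (of_real s * z)) \<longlongrightarrow> J1) at_top"
    "\<And>z. z \<in> sector \<phi> \<Longrightarrow> ((\<lambda>s. Q (of_real s * z)) \<longlongrightarrow> J0) (at_right 0)"
    using sector_primitive[OF \<phi>(1) \<phi>' p_hol p_bd(1) p_bd(2)] by blast
  have Qray: "((\<lambda>x. Q (of_real x * z)) has_vector_derivative z * p (of_real x * z)) (at x)"
    if "0 < x" "z \<in> sector \<phi>" for x :: real and z
  proof -
    have d: "((\<lambda>x. of_real x * z) has_vector_derivative (of_real 1 * z)) (at x)"
      by (intro has_vector_derivative_mult_left has_vector_derivative_of_real DERIV_ident)
    have "of_real x * z \<in> sector \<phi>" using sector_scale[OF that(1)] that(2) by simp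
    from field_vector_diff_chain_at[OF d Q(1)[OF this]] show ?thesis by (simp add: o_def)
  qed
  have B0: "0 \<le> B"
  proof -
    have "1 \<in> sector \<phi>" using \<phi> by (simp add: sector_def)
    then have "cmod (g 1) \<le> B * cmod (g 1)" "0 < cmod (g 1)" using B[of 1 1] g(2)[of 1] by auto
    then show ?thesis by (smt (verit) mult_neg_pos)
  qed
  \<comment> \<open>Integration from z outwards along its ray. Once |g(s z)| is replaced by B
    |g(z)|, the rest is at most K |z| / (1 + s |z|)^2, with antiderivative -K / (1 + s |z|).\<close>
  have far: "cmod (J1 - Q z) \<le> K * B * cmod (g z) / (1 + cmod z)" if z: "z \<in> sector \<phi>" for z
  proof -
    define c where "c = K * B * cmod (g z)"
    have c0: "0 \<le> c" using K0 B0 by (simp add: c_def)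
    have z0: "0 < cmod z" using z by (simp add: sector_def)
    have le1: "cmod (Q (of_real x * z) - Q z) \<le> c / (1 + cmod z)" if x: "1 \<le> x" for x
    proof -
      have "cmod (Q (of_real x * z) - Q (of_real 1 * z)) \<le> - (c / (1 + x * cmod z)) - - (c / (1 + 1 * cmod z))"
      proof (rule norm_diff_le_antiderivative[OF x])
        fix t assume t: "1 \<le> t" "t \<le> x"
        then have t0: "0 < t" by simp
        have tz: "of_real t * z \<in> sector \<phi>" using sector_scale[OF t0] z by simp
        show "((\<lambda>x. Q (of_real x * z)) has_vector_derivative z * p (of_real t * z)) (at t)" by (rule Qray[OF t0 z])
        have "0 < 1 + t * cmod z" using t0 z0 by (simp add: add_pos_pos)
        then show "((\<lambda>x. - (c / (1 + x * cmod z))) has_real_derivative c * cmod z / (1 + t * cmod z)\<^sup>2) (at t)"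
          by (auto intro!: derivative_eq_intros simp: power2_eq_square)
        have "cmod (p (of_real t * z)) \<le> (B * cmod (g z)) * (K / (1 + cmod (of_real t * z))\<^sup>2)"
          unfolding p_def norm_mult[of "g _"] using B[OF z t(1)] k1_bd2[OF tz] B0 by (intro mult_mono) auto
        then have "cmod z * cmod (p (of_real t * z)) \<le> cmod z * ((B * cmod (g z)) * (K / (1 + cmod (of_real t * z))\<^sup>2))"
          by (intro mult_left_mono) auto
        then show "cmod (z * p (of_real t * z)) \<le> c * cmod z / (1 + t * cmod z)\<^sup>2"
          using t0 by (simp add: norm_mult c_def mult_ac)
      qed
      moreover have "0 \<le> c / (1 + x * cmod z)" using c0 x z0 by simp
      ultimately show ?thesis by simp
    qed
    have "\<forall>\<^sub>F x in at_top. cmod (Q (of_real x * z) - Q z) \<le> c / (1 + cmod z)"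
      by (rule eventually_mono[OF eventually_ge_at_top[of 1]]) (rule le1)
    from tendsto_upperbound[OF tendsto_norm[OF tendsto_diff[OF Q(2)[OF z] tendsto_const]] this]
    show ?thesis by (simp add: c_def)
  qed
  \<comment> \<open>Integration from 0 to z, where |p(w)| \<le> G K |w| makes the integral
    quadratically small; a factor 1/2 is given away.\<close>
  have near: "cmod (Q z - J0) \<le> G * K * (cmod z)\<^sup>2" if z: "z \<in> sector \<phi>" for z
  proof -
    define c where "c = G * K * (cmod z)\<^sup>2 / 2"
    have c0: "0 \<le> c" using K0 G0 by (simp add: c_def)
    have "cmod (Q (of_real 1 * z) - Q (of_real x * z)) \<le> c * 1\<^sup>2 - c * x\<^sup>2" if x: "0 < x" "x \<le> 1" for x
    proof (rule norm_diff_le_antiderivative[OF x(2)])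
      fix t assume t: "x \<le> t" "t \<le> 1"
      then have t0: "0 < t" using x by simp
      have tz: "of_real t * z \<in> sector \<phi>" using sector_scale[OF t0] z by simp
      show "((\<lambda>x. Q (of_real x * z)) has_vector_derivative z * p (of_real t * z)) (at t)" by (rule Qray[OF t0 z])
      show "((\<lambda>x. c * x\<^sup>2) has_real_derivative 2 * c * t) (at t)" by (auto intro!: derivative_eq_intros)
      have "cmod z * cmod (p (of_real t * z)) \<le> cmod z * ((G * K) * cmod (of_real t * z))"
        by (intro mult_left_mono p_bd tz) auto
      then show "cmod (z * p (of_real t * z)) \<le> 2 * c * t"
        using t0 by (simp add: norm_mult c_def power2_eq_square mult_ac)
    qed
    moreover have "c * 1\<^sup>2 - c * x\<^sup>2 \<le> G * K * (cmod z)\<^sup>2" for x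
    proof -
      have "0 \<le> c * x\<^sup>2" using c0 by simp
      moreover have "G * K * (cmod z)\<^sup>2 = c + c" by (simp add: c_def)
      ultimately show ?thesis using c0 unfolding power_one mult_1_right by linarith
    qed
    ultimately have *: "cmod (Q z - Q (of_real x * z)) \<le> G * K * (cmod z)\<^sup>2" if "0 < x" "x \<le> 1" for x
      using that by (metis (no_types, opaque_lifting) mult_1 of_real_1 order_trans)
    have "\<forall>\<^sub>F x in at_right 0. cmod (Q z - Q (of_real x * z)) \<le> G * K * (cmod z)\<^sup>2"
      by (rule eventually_mono[OF eventually_at_right_real[OF zero_less_one]]) (use * in auto)
    from tendsto_upperbound[OF tendsto_norm[OF tendsto_diff[OF tendsto_const Q(3)[OF z]]] this]
    show ?thesis by simp
  qed
  \<comment> \<open>On the positive axis p(x) = x (1 + x)^{-3} |g(x)|^2 > 0, so Re Q increases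
    strictly; comparison at 1 and 2 keeps a gap between the limits.\<close>
  have J: "J1 \<noteq> J0"
  proof -
    define f where "f x = Re (Q (of_real x))" for x :: real
    have df: "(f has_real_derivative Re (p (of_real x))) (at x)" "0 < Re (p (of_real x))" if x: "0 < x" for x
    proof -
      have "((\<lambda>x. Q (of_real x * 1)) has_vector_derivative 1 * p (of_real x * 1)) (at x)"
        using Qray[OF x real_sec[of 1]] by simp
      then have "((\<lambda>x. Q (of_real x)) has_vector_derivative p (of_real x)) (at x)" by simp
      from bounded_linear.has_vector_derivative[OF bounded_linear_Re this]
      show "(f has_real_derivative Re (p (of_real x))) (at x)"
        by (simp add: f_def[abs_def] has_real_derivative_iff_has_vector_derivative)
      have "p (of_real x) = of_real (x * (1 / (1 + x))^3) * (g (of_real x) * cnj (g (of_real x)))"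
        by (simp add: p_def k1_def gs_def mult_ac)
      also have "g (of_real x) * cnj (g (of_real x)) = of_real ((cmod (g (of_real x)))\<^sup>2)"
        by (rule complex_norm_square[symmetric])
      finally have "Re (p (of_real x)) = x * (1 / (1 + x))^3 * (cmod (g (of_real x)))\<^sup>2" by (simp only: of_real_mult[symmetric] Re_complex_of_real)
      then show "0 < Re (p (of_real x))" using x g(2)[OF real_sec[OF x]] by simp
    qed
    have inc: "f a < f b" if "0 < a" "a < b" for a b
    proof (rule DERIV_pos_imp_increasing[OF that(2)])
      fix x assume "a \<le> x" "x \<le> b"
      then have "0 < x" using that(1) by simp
      from df[OF this] show "\<exists>y. (f has_real_derivative y) (at x) \<and> 0 < y" by blast
    qed
    have "(f \<longlongrightarrow> Re J1) at_top" "(f \<longlongrightarrow> Re J0) (at_right 0)"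
      using tendsto_Re[OF Q(2)[OF real_sec[of 1]]] tendsto_Re[OF Q(3)[OF real_sec[of 1]]] by (simp_all add: f_def[abs_def])
    moreover have "\<forall>\<^sub>F x in at_top. f 2 \<le> f x"
      using eventually_gt_at_top[of 2] by eventually_elim (use inc[of 2] in force)
    moreover have "\<forall>\<^sub>F x in at_right 0. f x \<le> f 1"
      by (rule eventually_mono[OF eventually_at_right_real[OF zero_less_one]]) (use inc[of _ 1] in force)
    ultimately have "f 2 \<le> Re J1" "Re J0 \<le> f 1"
      using tendsto_lowerbound[of f "Re J1" at_top] tendsto_upperbound[of f "Re J0" "at_right 0"] by auto
    moreover have "f 1 < f 2" by (rule inc) auto
    ultimately have "Re J0 < Re J1" by linarith
    then show ?thesis by auto
  qed
  define c where "c = 1 / (J1 - J0)"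
  define k where "k z = c * k1 z" for z
  define q where "q z = c * (J1 - Q z)" for z
  define r where "r z = q z / g z" for z
  have q1: "1 - q z = c * (Q z - J0)" for z
  proof -
    have "c * (J1 - J0) = 1" using J by (simp add: c_def)
    then show ?thesis by (simp add: q_def algebra_simps)
  qed
  have dq: "(q has_field_derivative - (g z * k z)) (at z)" if z: "z \<in> sector \<phi>" for z
  proof -
    have "((\<lambda>z. c * (J1 - Q z)) has_field_derivative c * (0 - p z)) (at z)"
      by (intro DERIV_cmult DERIV_diff DERIV_const Q(1) z)
    then show ?thesis by (simp add: q_def[abs_def] k_def p_def mult_ac)
  qed
  have q_hol: "q holomorphic_on sector \<phi>"
  proof (rule holomorphic_onI)
    fix z assume "z \<in> sector \<phi>"
    then have "q field_differentiable (at z)" unfolding field_differentiable_def using dq by blast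
    then show "q field_differentiable (at z within sector \<phi>)" by (rule field_differentiable_at_within)
  qed
  have r_bd: "cmod (r z) \<le> cmod c * K * B / (1 + cmod z)" if z: "z \<in> sector \<phi>" for z
  proof -
    have gp: "0 < cmod (g z)" using g(2)[OF z] by simp
    have "cmod (q z) \<le> cmod c * (K * B * cmod (g z) / (1 + cmod z))"
      unfolding q_def norm_mult by (intro mult_left_mono far z) auto
    also have "\<dots> = cmod c * K * B / (1 + cmod z) * cmod (g z)" by simp
    finally show ?thesis using gp by (simp add: r_def norm_divide divide_le_eq)
  qed
  define R where "R = cmod c * K * B"
  have R0: "0 \<le> R" using K0 B0 by (simp add: R_def)
  have k: "k \<in> Hinf0 \<phi>"
  proof (rule Hinf0I[where s=1 and C="cmod c * K"])
    show "k holomorphic_on sector \<phi>" unfolding k_def[abs_def] by (intro holomorphic_intros k1_hol)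
    fix z assume z: "z \<in> sector \<phi>"
    have z0: "0 < cmod z" using z by (simp add: sector_def)
    have "(1 + cmod z)\<^sup>2 = 1 + 2 * cmod z + (cmod z)\<^sup>2" by (simp add: power2_sum)
    then have "cmod z \<le> (1 + cmod z)\<^sup>2" using z0 zero_le_power2[of "cmod z"] by linarith
    then have "K / (1 + cmod z)\<^sup>2 \<le> K / cmod z" using K0 z0 by (intro frac_le) auto
    then have "K / (1 + cmod z)\<^sup>2 \<le> K * (1 / cmod z)" by simp
    then have "cmod (k1 z) \<le> K * (1 / cmod z)" using k1_bd2[OF z] by linarith
    then have "cmod (k1 z) \<le> K * min (cmod z) (1 / cmod z)" using k1_bd1[OF z] by (simp add: min_def)
    then have "cmod c * cmod (k1 z) \<le> cmod c * (K * min (cmod z) (1 / cmod z))" by (intro mult_left_mono) auto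
    then show "cmod (k z) \<le> cmod c * K * min (cmod z powr 1) (cmod z powr - 1)"
      using z0 by (simp add: k_def norm_mult powr_minus_divide mult.assoc)
  qed simp
  \<comment> \<open>Near 0 the quadratic bound for 1 - q survives the division by z to first order;
    at infinity q is bounded and the division itself gives the decay.\<close>
  have h: "(\<lambda>z. (1 - q z) / z) \<in> Hinf0 \<phi>"
  proof (rule Hinf0I[where s=1 and C="cmod c * (G * K) + (1 + R * G)"])
    show "(\<lambda>z. (1 - q z) / z) holomorphic_on sector \<phi>"
      by (intro holomorphic_intros q_hol) (auto simp: sector_def)
    fix z assume z: "z \<in> sector \<phi>"
    have z0: "0 < cmod z" using z by (simp add: sector_def)
    have "cmod (1 - q z) \<le> cmod c * (G * K * (cmod z)\<^sup>2)"
      unfolding q1 norm_mult by (intro mult_left_mono near z) auto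
    then have a: "cmod (1 - q z) / cmod z \<le> cmod c * (G * K) * cmod z"
      using z0 by (simp add: divide_le_eq power2_eq_square mult_ac)
    have "q z = r z * g z" using g(2)[OF z] by (simp add: r_def)
    then have "cmod (q z) = cmod (r z) * cmod (g z)" by (simp add: norm_mult)
    also have "\<dots> \<le> R / (1 + cmod z) * G"
      using r_bd[OF z, folded R_def] g_bd[OF z] R0 by (intro mult_mono) auto
    also have "\<dots> \<le> R * G"
    proof -
      have "R / (1 + cmod z) \<le> R / 1" using R0 z0 by (intro frac_le) auto
      then show ?thesis using G0 by (intro mult_right_mono) auto
    qed
    finally have "cmod (1 - q z) \<le> 1 + R * G" using norm_triangle_ineq4[of 1 "q z"] by simp
    then have b: "cmod (1 - q z) / cmod z \<le> (1 + R * G) * (1 / cmod z)"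
      using z0 by (simp add: divide_right_mono)
    define CC where "CC = cmod c * (G * K) + (1 + R * G)"
    have CC: "cmod c * (G * K) \<le> CC" "1 + R * G \<le> CC" using G0 K0 R0 by (simp_all add: CC_def add_nonneg_nonneg)
    have "cmod c * (G * K) * cmod z \<le> CC * cmod z" using CC(1) by (rule mult_right_mono) simp
    moreover have "(1 + R * G) * (1 / cmod z) \<le> CC * (1 / cmod z)" using CC(2) by (rule mult_right_mono) simp
    ultimately have "cmod (1 - q z) / cmod z \<le> CC * cmod z" "cmod (1 - q z) / cmod z \<le> CC * (1 / cmod z)"
      using a b by linarith+
    then have "cmod (1 - q z) / cmod z \<le> CC * min (cmod z) (1 / cmod z)" by (simp add: min_def)
    then show "cmod ((1 - q z) / z) \<le> (cmod c * (G * K) + (1 + R * G)) * min (cmod z powr 1) (cmod z powr - 1)"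
      using z0 by (simp add: norm_divide powr_minus_divide CC_def)
  qed simp
  \<comment> \<open>The quotient r tends to 1 / L at 0 and to 0 at infinity, so its elementary part
    can only be (1 / L) / (1 + z).\<close>
  have r: "r \<in> elem_fun \<phi>"
  proof -
    have "0 < cmod L / 2" using L(1) by simp
    from tendstoD[OF L(2) this] obtain \<delta> where d: "0 < \<delta>"
      "\<forall>z\<in>sector \<phi>. z \<noteq> 0 \<and> dist z 0 < \<delta> \<longrightarrow> dist (g z) L < cmod L / 2"
      unfolding eventually_at by blast
    have \<delta>: "0 < \<delta>" "\<And>z. z \<in> sector \<phi> \<Longrightarrow> cmod z < \<delta> \<Longrightarrow> cmod (g z - L) < cmod L / 2"
      using d by (auto simp: dist_norm sector_def)
    \<comment> \<open>Below this modulus |g| is at least |L| / 2, which controls the denominator of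
      r.\<close>
    define \<delta>' where "\<delta>' = min \<delta> 1"
    have \<delta>': "0 < \<delta>'" "\<delta>' \<le> 1" using \<delta>(1) by (auto simp: \<delta>'_def)
    \<comment> \<open>\<open>T\<close> bounds (1 + |z|) |rem z| on the whole sector, and
      \<open>V\<close> below bounds |rem z| / |z|^s near 0.\<close>
    define T where "T = R + E / cmod L"
    have T0: "0 \<le> T" using R0 E(1) by (simp add: T_def)
    define V where "V = (cmod L * (cmod c * (G * K)) + Hd) * (2 / (cmod L)\<^sup>2) + E / cmod L"
    have V0: "0 \<le> V" using G0 K0 Hd0 E(1) by (simp add: V_def)
    define rem where "rem = elem_remainder r (1 / L) 0"
    have rem_eq: "rem z = r z - (1 / L) * (1 / (1 + z))" for z by (simp add: rem_def elem_remainder_def)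
    have "rem \<in> Hinf0 \<phi>"
    proof (rule Hinf0I[OF _ C(3), where C="V + T * \<delta>' powr - s"])
      have "(\<lambda>z. r z - (1 / L) * (1 / (1 + z))) holomorphic_on sector \<phi>"
        unfolding r_def using g(2)
        by (intro holomorphic_on_diff holomorphic_on_mult holomorphic_on_const holomorphic_on_divide q_hol g_hol Ehol) auto
      then show "rem holomorphic_on sector \<phi>" by (simp only: rem_eq[symmetric] eta_contract_eq)
      fix z assume z: "z \<in> sector \<phi>"
      have z0: "0 < cmod z" using z by (simp add: sector_def)
      have far': "cmod (rem z) \<le> T / (1 + cmod z)"
      proof -
        have "cmod (rem z) \<le> cmod (r z) + cmod (1 / L) * cmod (1 / (1 + z))"
          unfolding rem_eq norm_mult[symmetric] by (rule norm_triangle_ineq4)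
        also have "\<dots> \<le> R / (1 + cmod z) + cmod (1 / L) * (E / (1 + cmod z))"
          using r_bd[OF z] E(2)[OF z] by (intro add_mono mult_left_mono) (auto simp: R_def)
        finally show ?thesis by (simp add: T_def norm_divide add_divide_distrib)
      qed
      have ds: "1 \<le> \<delta>' powr - s"
        using \<delta>' C(3) powr_mono'[of "- s" 0 "\<delta>'"] by simp
      define W where "W = V + T * \<delta>' powr - s"
      have TW: "T \<le> W" "V \<le> W" "T * \<delta>' powr - s \<le> W"
        using T0 V0 ds mult_left_mono[OF ds T0] by (auto simp: W_def)
      have W0: "0 \<le> W" using TW(1) T0 by simp
      \<comment> \<open>Beyond 1 the decay 1 / (1 + |z|) is used and below \<delta>' the rate |z|^s;
        in between the constant T is at most T (|z| / \<delta>')^s.\<close>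
      consider "1 < cmod z" | "cmod z < \<delta>'" | "\<delta>' \<le> cmod z" "cmod z \<le> 1" by linarith
      then have "cmod (rem z) \<le> W * min (cmod z powr s) (cmod z powr - s)"
      proof cases
        case 1
        then have p: "1 \<le> cmod z powr s" using C(3) by (intro ge_one_powr_ge_zero) auto
        have "cmod z powr s \<le> cmod z powr 1" using 1 C(4) by (intro powr_mono) auto
        then have "cmod z powr s \<le> 1 + cmod z" using z0 by simp
        then have "T / (1 + cmod z) \<le> W / cmod z powr s" using p T0 W0 TW(1) by (intro frac_le) auto
        then have "cmod (rem z) \<le> W * cmod z powr - s" using far' by (simp add: powr_minus_divide)
        moreover have "cmod z powr - s \<le> cmod z powr s" using 1 C(3) by (intro powr_mono) auto
        ultimately show ?thesis by simp
      next
        case 3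
        have "\<delta>' powr s \<le> cmod z powr s" using 3 \<delta>' C(3) by (intro powr_mono2) auto
        then have "1 \<le> \<delta>' powr - s * cmod z powr s" using \<delta>' by (simp add: powr_minus_divide field_simps)
        then have "T * 1 \<le> T * (\<delta>' powr - s * cmod z powr s)" using T0 by (intro mult_left_mono)
        moreover have "T / (1 + cmod z) \<le> T / 1" using T0 z0 by (intro frac_le) auto
        moreover have "T * \<delta>' powr - s * cmod z powr s \<le> W * cmod z powr s" using TW(3) by (intro mult_right_mono) auto
        ultimately have "cmod (rem z) \<le> W * cmod z powr s" using far' by (simp add: mult.assoc)
        moreover have "cmod z powr s \<le> cmod z powr - s" using 3 z0 C(3) by (intro powr_mono') auto
        ultimately show ?thesis by simp
      next
        case 2
        then have z1: "cmod z \<le> 1" "cmod z < \<delta>" by (auto simp: \<delta>'_def)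
        have "cmod (L - g z) = cmod (g z - L)" by (rule norm_minus_commute)
        then have gL: "cmod L / 2 \<le> cmod (g z)"
          using \<delta>(2)[OF z z1(2)] norm_triangle_ineq2[of L "g z"] by linarith
        have Lp: "0 < cmod L" using L(1) by simp
        have gz: "g z \<noteq> 0" by (rule g(2)[OF z])
        \<comment> \<open>The splitting leaves only the factors q - 1, L - g and z / (1 + z), each
          of which is O(|z|^s) near 0.\<close>
        have "rem z = (L * (q z - 1) + (L - g z)) / (g z * L) + (1 / L) * (z * (1 / (1 + z)))"
        proof -
          have a1: "r z - 1 / L = (L * (q z - 1) + (L - g z)) / (g z * L)"
            using gz L(1) by (simp add: r_def field_simps)
          have "1 - 1 / (1 + z) = z * (1 / (1 + z))" using nz1[OF z] by (simp add: field_simps)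
          then have a2: "1 / L - (1 / L) * (1 / (1 + z)) = (1 / L) * (z * (1 / (1 + z)))"
            using right_diff_distrib[of "1 / L" 1 "1 / (1 + z)"] by simp
          show ?thesis unfolding rem_eq a1[symmetric] a2[symmetric] by simp
        qed
        then have "cmod (rem z) \<le> cmod ((L * (q z - 1) + (L - g z)) / (g z * L)) + cmod ((1 / L) * (z * (1 / (1 + z))))"
          by (simp only: norm_triangle_ineq)
        also have "\<dots> = cmod (L * (q z - 1) + (L - g z)) / (cmod (g z) * cmod L) + 1 / cmod L * (cmod z * cmod (1 / (1 + z)))"
          by (simp only: norm_divide norm_mult norm_one)
        also have "\<dots> \<le> (cmod L * (cmod c * (G * K)) + Hd) * cmod z powr s * (2 / (cmod L)\<^sup>2) + 1 / cmod L * (cmod z powr s * E)"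
        proof (intro add_mono mult_left_mono mult_mono)
          have "cmod (q z - 1) \<le> cmod c * (G * K) * cmod z powr s"
          proof -
            have "cmod (1 - q z) \<le> cmod c * (G * K * (cmod z)\<^sup>2)"
              unfolding q1 norm_mult by (intro mult_left_mono near z) auto
            also have "\<dots> \<le> cmod c * (G * K * cmod z powr s)"
            proof (intro mult_left_mono)
              have "cmod z * cmod z \<le> 1 * cmod z" using z1(1) by (intro mult_right_mono) auto
              then show "(cmod z)\<^sup>2 \<le> cmod z powr s" using le_powr[OF z z1(1)] by (simp add: power2_eq_square)
            qed (use G0 K0 in auto)
            finally show ?thesis by (simp add: norm_minus_commute mult.assoc)
          qed
          then have "cmod L * cmod (q z - 1) \<le> cmod L * (cmod c * (G * K) * cmod z powr s)" by (intro mult_left_mono) auto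
          moreover have "cmod (L - g z) \<le> Hd * cmod z powr s" using holder[OF z z1(1)] by (simp add: norm_minus_commute)
          moreover have "cmod (L * (q z - 1) + (L - g z)) \<le> cmod L * cmod (q z - 1) + cmod (L - g z)"
            unfolding norm_mult[symmetric] by (rule norm_triangle_ineq)
          ultimately have num: "cmod (L * (q z - 1) + (L - g z)) \<le> (cmod L * (cmod c * (G * K)) + Hd) * cmod z powr s"
            by (simp add: algebra_simps)
          have den: "(cmod L)\<^sup>2 / 2 \<le> cmod (g z) * cmod L"
            using mult_right_mono[OF gL, of "cmod L"] by (simp add: power2_eq_square)
          have "cmod (L * (q z - 1) + (L - g z)) / (cmod (g z) * cmod L) \<le>
              (cmod L * (cmod c * (G * K)) + Hd) * cmod z powr s / ((cmod L)\<^sup>2 / 2)"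
            using num den Lp order_trans[OF norm_ge_zero num] by (intro frac_le) auto
          then show "cmod (L * (q z - 1) + (L - g z)) / (cmod (g z) * cmod L) \<le>
              (cmod L * (cmod c * (G * K)) + Hd) * cmod z powr s * (2 / (cmod L)\<^sup>2)" by simp
        qed (use le_powr[OF z z1(1)] E1[OF z] in auto)
        also have "\<dots> = V * cmod z powr s" by (simp add: V_def algebra_simps)
        also have "\<dots> \<le> W * cmod z powr s" using TW(2) by (intro mult_right_mono) auto
        finally have "cmod (rem z) \<le> W * cmod z powr s" .
        moreover have "cmod z powr s \<le> cmod z powr - s" using z1 z0 C(3) by (intro powr_mono') auto
        ultimately show ?thesis by simp
      qed
      then show "cmod (rem z) \<le> (V + T * \<delta>' powr - s) * min (cmod z powr s) (cmod z powr - s)" by (simp add: W_def)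
    qed
    then show ?thesis unfolding elem_fun_def rem_def by blast
  qed
  have q_eq: "q z = r z * g z" if "z \<in> sector \<phi>" for z using g(2)[OF that] by (simp add: r_def)
  have q_far: "cmod (q z) \<le> R * G / (1 + cmod z)" if z: "z \<in> sector \<phi>" for z
  proof -
    have "cmod (r z) * cmod (g z) \<le> R / (1 + cmod z) * G"
      using r_bd[OF z, folded R_def] g_bd[OF z] R0 by (intro mult_mono) auto
    then show ?thesis by (simp add: q_eq[OF z] norm_mult)
  qed
  define W where "W = cmod c * (G * K) + 1 + R * G"
  have RG: "0 \<le> R * G" "0 \<le> cmod c * (G * K)" using R0 G0 K0 by auto
  have q_near: "cmod (1 - q z) \<le> W * cmod z" if z: "z \<in> sector \<phi>" for z
  proof (cases "cmod z \<le> 1")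
    case True
    have "cmod z * cmod z \<le> 1 * cmod z" using True by (intro mult_right_mono) auto
    then have z2: "(cmod z)\<^sup>2 \<le> cmod z" by (simp add: power2_eq_square)
    have "cmod (1 - q z) \<le> cmod c * (G * K * (cmod z)\<^sup>2)"
      unfolding q1 norm_mult by (intro mult_left_mono near z) auto
    also have "\<dots> = cmod c * (G * K) * (cmod z)\<^sup>2" by simp
    also have "\<dots> \<le> W * cmod z" using z2 RG unfolding W_def by (intro mult_mono) auto
    finally show ?thesis .
  next
    case False
    have "R * G / (1 + cmod z) \<le> R * G / 1" using RG by (intro frac_le) auto
    then have "cmod (1 - q z) \<le> 1 + R * G" using norm_triangle_ineq4[of 1 "q z"] q_far[OF z] by simp
    also have "\<dots> \<le> W * 1" using RG by (simp add: W_def)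
    also have "\<dots> \<le> W * cmod z" using False RG unfolding W_def by (intro mult_left_mono) auto
    finally show ?thesis .
  qed
  have q_far': "cmod (q z) \<le> W / (1 + cmod z)" if z: "z \<in> sector \<phi>" for z
  proof -
    have "R * G / (1 + cmod z) \<le> W / (1 + cmod z)" using RG unfolding W_def by (intro divide_right_mono) auto
    then show ?thesis using q_far[OF z] by linarith
  qed
  show ?thesis by (rule that[OF k r q_eq dq h q_near q_far'])
qed

lemma elem_fun_bounded:
  assumes "f \<in> elem_fun \<phi>" "0 < \<phi>" "\<phi> < pi"
  shows "f holomorphic_on sector \<phi>" "\<exists>B. \<forall>z\<in>sector \<phi>. cmod (f z) \<le> B"
proof -
  obtain l m where lm: "elem_remainder f l m \<in> Hinf0 \<phi>" using assms(1) by (auto simp: elem_fun_def)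
  define f0 where "f0 = elem_remainder f l m"
  have f_eq: "f z = f0 z + l * (1 / (1 + of_real 1 * z)) + m" for z by (simp add: f0_def elem_remainder_def)
  obtain B where B: "\<And>z. z \<in> sector \<phi> \<Longrightarrow> cmod (f0 z) \<le> B" using Hinf0_bounded[OF lm[folded f0_def]] by blast
  obtain B' where B': "\<And>z. z \<in> sector \<phi> \<Longrightarrow> cmod (1 / (1 + of_real 1 * z)) \<le> B'"
    using recip_one_plus_bounded'[OF assms(2,3), of 1] by auto
  have "(\<lambda>z. f0 z + l * (1 / (1 + of_real 1 * z)) + m) holomorphic_on sector \<phi>"
    by (intro holomorphic_on_add holomorphic_on_mult holomorphic_on_const Hinf0_holomorphic[OF lm[folded f0_def]]
        recip_one_plus_bounded(1)[OF assms(2,3)]) simp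
  then show "f holomorphic_on sector \<phi>" by (simp only: f_eq[symmetric] eta_contract_eq)
  have "cmod (f z) \<le> B + cmod l * B' + cmod m" if z: "z \<in> sector \<phi>" for z
  proof -
    have "cmod (f z) \<le> cmod (f0 z) + cmod l * cmod (1 / (1 + of_real 1 * z)) + cmod m"
      unfolding f_eq norm_mult[symmetric] by (intro order_trans[OF norm_triangle_ineq] add_mono norm_triangle_ineq) auto
    also have "\<dots> \<le> B + cmod l * B' + cmod m"
      by (intro add_mono mult_left_mono B[OF z] B'[OF z]) auto
    finally show ?thesis .
  qed
  then show "\<exists>B. \<forall>z\<in>sector \<phi>. cmod (f z) \<le> B" by blast
qed

lemma Hinf0_elem_fun: "f \<in> Hinf0 \<phi> \<Longrightarrow> f \<in> elem_fun \<phi>"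
  by (auto simp: elem_fun_def elem_remainder_def intro!: exI[of _ 0])

section \<open>The operators f(tA): domains, continuity in t and integral estimates\<close>

context sectorial_calculus
begin

definition scaled :: "(complex \<Rightarrow> complex) \<Rightarrow> real \<Rightarrow> 'a \<Rightarrow> 'a" where
  "scaled f t = elem_calculus D (\<lambda>y. t *\<^sub>R A y) \<phi> \<nu> f"

lemma has_calc_scaled: "0 < t \<Longrightarrow> f \<in> elem_fun \<phi> \<Longrightarrow> has_calc (\<lambda>z. f (of_real t * z)) (scaled f t)"
  unfolding scaled_def by (rule has_calc_scaled_elem)

lemma scaled_bounded: "f \<in> elem_fun \<phi> \<Longrightarrow> \<exists>K\<ge>0. \<forall>t>0. \<forall>x. norm (scaled f t x) \<le> K * norm x"
  unfolding scaled_def by (rule elem_scale_bounded)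

text \<open>Both products belong to the same function on the sector, and that function determines
  its operator.\<close>

lemma has_calc_commute:
  assumes "has_calc f T" "has_calc g U" shows "T (U x) = U (T x)"
proof -
  have "has_calc (\<lambda>z. f z * g z) (\<lambda>x. T (U x))" by (rule has_calc_mult[OF assms])
  moreover have "has_calc (\<lambda>z. f z * g z) (\<lambda>x. U (T x))"
    by (rule has_calc_cong[OF has_calc_mult[OF assms(2,1)]]) auto
  ultimately show ?thesis by (metis has_calc_unique)
qed

lemma inv_shift_graph: "b \<in> D \<Longrightarrow> inv_shift 1 (b + A b) = b"
  by (rule inv_shift_unique) auto

text \<open>If \<open>f = t z g\<close> then \<open>f(A) = t A g(A)\<close>: both sides are compared after
  multiplication by the resolvent \<open>(1 + A)\<inverse>\<close>.\<close>

lemma has_calc_times_id: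
  assumes f: "has_calc f T" and g: "has_calc g U"
    and eq: "\<And>z. z \<in> sector \<phi> \<Longrightarrow> f z = of_real t * z * g z"
  shows "b \<in> D \<Longrightarrow> T b = t *\<^sub>R U (A b)" "t *\<^sub>R U x \<in> D" "A (t *\<^sub>R U x) = T x"
proof -
  have e: "has_calc (\<lambda>z. 1 / (1 + z)) (inv_shift 1)" using has_calc_recip[of 1] by simp
  have c: "has_calc (\<lambda>z. of_real t * (1 - 1 / (1 + z))) (\<lambda>x. of_real t *C (1 *C x - inv_shift 1 x))"
    by (intro has_calc_cmult has_calc_diff has_calc_const e)
  have h1: "has_calc (\<lambda>z. 1 / (1 + z) * f z) (\<lambda>x. inv_shift 1 (T x))" by (rule has_calc_mult[OF e f])
  have h2: "has_calc (\<lambda>z. 1 / (1 + z) * f z) (\<lambda>x. of_real t *C (1 *C U x - inv_shift 1 (U x)))"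
  proof (rule has_calc_cong[OF has_calc_mult[OF c g]])
    fix z assume z: "z \<in> sector \<phi>"
    have "1 + z \<noteq> 0" using one_plus_nonzero[OF phi(1) angles(3) _ z, of 1] by simp
    then have "1 - 1 / (1 + z) = z * (1 / (1 + z))" by (simp add: field_simps)
    then show "1 / (1 + z) * f z = of_real t * (1 - 1 / (1 + z)) * g z" using eq[OF z] by simp
  qed simp
  have ST: "inv_shift 1 (T x) = of_real t *C (U x - inv_shift 1 (U x))" for x
    using fun_cong[OF has_calc_unique[OF h1 h2], of x] by simp
  show "T b = t *\<^sub>R U (A b)" if b: "b \<in> D"
  proof -
    have b': "inv_shift 1 (b + A b) = b" by (rule inv_shift_graph[OF b])
    have "T b = T (inv_shift 1 (b + A b))" by (simp add: b')
    also have "\<dots> = inv_shift 1 (T (b + A b))" by (rule has_calc_commute[OF f e])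
    also have "\<dots> = of_real t *C (U (b + A b) - U (inv_shift 1 (b + A b)))"
      by (simp add: ST has_calc_commute[OF e g])
    also have "\<dots> = t *\<^sub>R U (A b)" by (simp add: b' has_calc_linear[OF g] scaleR_scaleC)
    finally show ?thesis .
  qed
  have eqU: "of_real t *C U x = inv_shift 1 (T x + of_real t *C U x)"
    by (simp add: inv_shift_linear ST scaleC_diff_right)
  show "t *\<^sub>R U x \<in> D" unfolding scaleR_scaleC by (subst eqU) (rule inv_shift_solves(1), simp)
  have "inv_shift 1 (T x + of_real t *C U x) + A (inv_shift 1 (T x + of_real t *C U x)) = T x + of_real t *C U x"
    using inv_shift_solves(2)[of 1 "T x + of_real t *C U x"] by simp
  then show "A (t *\<^sub>R U x) = T x" unfolding eqU[symmetric] by (simp add: scaleR_scaleC algebra_simps)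
qed

text \<open>The increments of z R(z) are controlled by the ratio w / v alone: w R(w) - v R(v) = (w -
  v) (R(v) - w R(w) R(v)), and R(v) supplies the factor 1 / |v|.\<close>

lemma times_resolvent_diff:
  assumes w: "w \<in> exterior" "v \<in> exterior"
  shows "norm (w *C R w x - v *C R v x) \<le> cmod (w / v - 1) * (M * (M + 1) * norm x)"
proof -
  have v0: "v \<noteq> 0" using exteriorD(2)[OF w(2)] .
  have "R w x = R v x + (v - w) *C R w (R v x)"
    using resolvent_identity[OF exterior_resolvent_set[OF w(2)] exterior_resolvent_set[OF w(1)], of x]
    by (simp add: scaleC_diff_left algebra_simps)
  moreover have "w *C (p + (v - w) *C q) - v *C p = (w - v) *C (p - w *C q)" for p q :: 'a
    by (simp add: scaleC_add_right scaleC_diff_right scaleC_diff_left scaleC_scaleC algebra_simps)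
  ultimately have "w *C R w x - v *C R v x = (w - v) *C (R v x - w *C R w (R v x))" by simp
  then have "norm (w *C R w x - v *C R v x) = cmod (w - v) * norm (R v x - w *C R w (R v x))"
    by (simp add: norm_scaleC)
  also have "\<dots> \<le> cmod (w - v) * ((M + 1) * (M / cmod v * norm x))"
  proof (intro mult_left_mono)
    have "norm (R v x - w *C R w (R v x)) \<le> norm (R v x) + M * norm (R v x)"
      using norm_triangle_ineq4[of "R v x" "w *C R w (R v x)"] res_bound[OF exteriorD[OF w(1)], of "R v x"] by linarith
    also have "\<dots> = (M + 1) * norm (R v x)" by (simp add: algebra_simps)
    also have "\<dots> \<le> (M + 1) * (M / cmod v * norm x)" using resolvent_norm[OF w(2)] M by (intro mult_left_mono) auto
    finally show "norm (R v x - w *C R w (R v x)) \<le> (M + 1) * (M / cmod v * norm x)" .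
  qed simp
  also have "\<dots> = cmod ((w - v) / v) * (M * (M + 1) * norm x)" by (simp add: norm_divide)
  also have "(w - v) / v = w / v - 1" using v0 by (simp add: diff_divide_distrib)
  finally show ?thesis .
qed

text \<open>On a fixed contour z R(z, tA) = (z/t) R(z/t, A), so passing from t to u changes the
  argument by the ratio u / t, and \<open>times_resolvent_diff\<close> applies under the integral.
  The resulting continuity of t \<mapsto> f(tA) x provides the measurability and local integrability
  on (0,\<infinity>) needed later.\<close>

lemma scaled_lipschitz:
  assumes f: "f \<in> elem_fun \<phi>"
  shows "\<exists>K. \<forall>t>0. \<forall>u>0. norm (scaled f t x - scaled f u x) \<le> K * \<bar>u / t - 1\<bar>"
proof -
  obtain l m where lm: "elem_remainder f l m \<in> Hinf0 \<phi>" using f by (auto simp: elem_fun_def)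
  define f0 where "f0 = elem_remainder f l m"
  have f0: "f0 \<in> Hinf0 \<phi>" using lm by (simp add: f0_def)
  obtain C s where h: "Hinf0_bound f0 C s" using Hinf0_bound_exists[OF f0] by blast
  then have s: "0 < s" "0 \<le> C" by (auto simp: Hinf0_bound_def)
  define N where "N = M * (M + 1) * norm x"
  have N: "0 \<le> N" using M by (simp add: N_def)
  have "norm (scaled f t x - scaled f u x) \<le> (C * N / s + cmod l * N) * \<bar>u / t - 1\<bar>" if t: "0 < t" "0 < u" for t u
  proof -
    interpret tA: sectorial_calculus D "\<lambda>y. t *\<^sub>R A y" \<mu> \<phi> M \<nu> by (rule scaled_sectorial_calculus[OF t(1)])
    interpret uA: sectorial_calculus D "\<lambda>y. u *\<^sub>R A y" \<mu> \<phi> M \<nu> by (rule scaled_sectorial_calculus[OF t(2)])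
    define d where "d = \<bar>u / t - 1\<bar>"
    have dr: "norm (tA.R z x - uA.R z x) \<le> d * N / cmod z" if z: "z / of_real t \<in> exterior" "z / of_real u \<in> exterior" for z
    proof -
      have z0: "z \<noteq> 0" using exteriorD(2)[OF z(1)] by auto
      have "tA.R z x = (1 / z) *C (z / of_real t) *C R (z / of_real t) x" "uA.R z x = (1 / z) *C (z / of_real u) *C R (z / of_real u) x"
        using scaled_resolvent_bij(2)[OF t(1) exterior_resolvent_set[OF z(1)], of x] scaled_resolvent_bij(2)[OF t(2) exterior_resolvent_set[OF z(2)], of x] z0
        by (simp_all add: scaleC_scaleC scaleR_scaleC)
      then have "norm (tA.R z x - uA.R z x) = cmod (1 / z) * norm ((z / of_real t) *C R (z / of_real t) x - (z / of_real u) *C R (z / of_real u) x)"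
        by (simp add: scaleC_diff_right[symmetric] norm_scaleC)
      also have "\<dots> \<le> cmod (1 / z) * (cmod ((z / of_real t) / (z / of_real u) - 1) * N)"
        unfolding N_def by (intro mult_left_mono times_resolvent_diff z) auto
      also have "(z / of_real t) / (z / of_real u) - 1 = complex_of_real (u / t - 1)" using z0 t by (simp add: field_simps)
      finally show ?thesis unfolding norm_of_real d_def[symmetric] by (simp add: norm_divide)
    qed
    have ray: "norm (ray_integral \<theta> (\<lambda>z. f0 z *C tA.R z x) - ray_integral \<theta> (\<lambda>z. f0 z *C uA.R z x)) \<le> C * (d * N) / s"
      if \<theta>: "\<bar>\<theta>\<bar> = \<nu>" for \<theta>
    proof -
      have i: "(\<lambda>r. cis \<theta> *C (f0 (of_real r * cis \<theta>) *C tA.R (of_real r * cis \<theta>) x)) integrable_on {0<..}"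
        "(\<lambda>r. cis \<theta> *C (f0 (of_real r * cis \<theta>) *C uA.R (of_real r * cis \<theta>) x)) integrable_on {0<..}"
        using \<theta> nu by (auto intro!: tA.calculus_ray(1)[OF f0 h] uA.calculus_ray(1)[OF f0 h])
      have "norm (integral {0<..} (\<lambda>r. cis \<theta> *C (f0 (of_real r * cis \<theta>) *C tA.R (of_real r * cis \<theta>) x) -
          cis \<theta> *C (f0 (of_real r * cis \<theta>) *C uA.R (of_real r * cis \<theta>) x))) \<le> integral {0<..} (\<lambda>r. C * (d * N) * decay s r)"
      proof (rule integral_norm_bound_integral)
        show "(\<lambda>r. C * (d * N) * decay s r) integrable_on {0<..}"
          using decay_has_integral[OF s(1)] by (intro integrable_on_mult_right) blast
        fix r :: real assume "r \<in> {0<..}"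
        then have r: "0 < r" by simp
        define z where "z = of_real r * cis \<theta>"
        have z: "z \<in> sector \<phi>" "cmod z = r" unfolding z_def using r \<theta> nu by (auto simp: norm_mult intro!: polar_in_sector_phi)
        have o: "z / of_real a \<in> exterior" if "0 < a" for a
        proof -
          have "of_real (r / a) * cis \<theta> \<in> exterior" using that r \<theta> nu angles by (intro ray_in_exterior) auto
          then show ?thesis by (simp add: z_def)
        qed
        have "norm (cis \<theta> *C (f0 z *C tA.R z x) - cis \<theta> *C (f0 z *C uA.R z x)) = cmod (f0 z) * norm (tA.R z x - uA.R z x)"
          by (simp add: scaleC_diff_right[symmetric] norm_scaleC)
        also have "\<dots> \<le> (C * (r * decay s r)) * (d * N / r)"
          using h z r decay_nonneg[of s r] dr[OF o[OF t(1)] o[OF t(2)]] by (intro mult_mono) (auto simp: Hinf0_bound_def)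
        also have "\<dots> = C * (d * N) * decay s r" using r by simp
        finally show "norm (cis \<theta> *C (f0 (of_real r * cis \<theta>) *C tA.R (of_real r * cis \<theta>) x) -
          cis \<theta> *C (f0 (of_real r * cis \<theta>) *C uA.R (of_real r * cis \<theta>) x)) \<le> C * (d * N) * decay s r" by (simp add: z_def)
      qed (intro integrable_diff i)
      also have "integral {0<..} (\<lambda>r. C * (d * N) * decay s r) = C * (d * N) * (1 / s)"
        using has_integral_mult_right[OF decay_has_integral[OF s(1)]] by (rule integral_unique)
      finally show ?thesis unfolding ray_integral_def integral_diff[OF i, symmetric] by simp
    qed
    define It where "It \<theta> = ray_integral \<theta> (\<lambda>z. f0 z *C tA.R z x)" for \<theta>
    define Iu where "Iu \<theta> = ray_integral \<theta> (\<lambda>z. f0 z *C uA.R z x)" for \<theta>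
    have "tA.Phi \<nu> f0 x - uA.Phi \<nu> f0 x = (1 / (2 * of_real pi * \<i>)) *C ((It (- \<nu>) - Iu (- \<nu>)) - (It \<nu> - Iu \<nu>))"
      by (simp add: Hinf0_calculus_def It_def Iu_def scaleC_diff_right[symmetric] algebra_simps)
    then have "norm (tA.Phi \<nu> f0 x - uA.Phi \<nu> f0 x) = 1 / (2 * pi) * norm ((It (- \<nu>) - Iu (- \<nu>)) - (It \<nu> - Iu \<nu>))"
      by (simp add: norm_scaleC norm_divide norm_mult)
    also have "\<dots> \<le> 1 / 2 * norm ((It (- \<nu>) - Iu (- \<nu>)) - (It \<nu> - Iu \<nu>))"
      using pi_gt3 by (intro mult_right_mono) (auto simp: field_simps)
    also have "\<dots> \<le> C * (d * N) / s"
    proof -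
      have "norm (It \<nu> - Iu \<nu>) \<le> C * (d * N) / s" "norm (It (- \<nu>) - Iu (- \<nu>)) \<le> C * (d * N) / s"
        using nu0 unfolding It_def Iu_def by (auto intro!: ray)
      moreover have "1 / 2 * n \<le> X" if "a \<le> X" "b \<le> X" "n \<le> b + a" for n a b X :: real
        using that by linarith
      ultimately show ?thesis using norm_triangle_ineq4 by blast
    qed
    finally have P: "norm (tA.Phi \<nu> f0 x - uA.Phi \<nu> f0 x) \<le> C * (d * N) / s" .
    have S: "norm (inv_shift t x - inv_shift u x) \<le> d * N"
    proof -
      have "norm (inv_shift t x - inv_shift u x) \<le> cmod (of_real (- (1 / t)) / of_real (- (1 / u)) - 1) * N"
        unfolding inv_shift_def N_def by (intro times_resolvent_diff neg_in_exterior t)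
      also have "of_real (- (1 / t)) / of_real (- (1 / u)) - 1 = complex_of_real (u / t - 1)" using t by simp
      finally show ?thesis by (simp only: norm_of_real d_def)
    qed
    have "scaled f t x - scaled f u x = (tA.Phi \<nu> f0 x - uA.Phi \<nu> f0 x) + l *C (inv_shift t x - inv_shift u x)"
      unfolding scaled_def tA.elem_calculus_eq[OF lm] uA.elem_calculus_eq[OF lm] f0_def[symmetric]
      by (simp add: scaled_inv_shift[OF t(1)] scaled_inv_shift[OF t(2)] scaleC_diff_right)
    then have "norm (scaled f t x - scaled f u x) \<le> C * (d * N) / s + cmod l * (d * N)"
      using P mult_left_mono[OF S, of "cmod l"] norm_triangle_ineq[of "tA.Phi \<nu> f0 x - uA.Phi \<nu> f0 x" "l *C (inv_shift t x - inv_shift u x)"]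
      by (simp add: norm_scaleC)
    then show ?thesis by (simp add: d_def algebra_simps)
  qed
  then show ?thesis by blast
qed

lemma scaled_continuous:
  assumes "f \<in> elem_fun \<phi>"
  shows "continuous_on {0<..} (\<lambda>t. scaled f t x)"
proof -
  obtain K where K: "\<And>t u. 0 < t \<Longrightarrow> 0 < u \<Longrightarrow> norm (scaled f t x - scaled f u x) \<le> K * \<bar>u / t - 1\<bar>"
    using scaled_lipschitz[OF assms, of x] by blast
  show ?thesis unfolding continuous_on
  proof
    fix u :: real assume u: "u \<in> {0<..}"
    have "((\<lambda>t. K * \<bar>u / t - 1\<bar>) \<longlongrightarrow> K * \<bar>u / u - 1\<bar>) (at u within {0<..})"
      using u by (intro tendsto_intros) auto
    then have "((\<lambda>t. K * \<bar>u / t - 1\<bar>) \<longlongrightarrow> 0) (at u within {0<..})" using u by simp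
    moreover have "\<forall>\<^sub>F t in at u within {0<..}. norm (scaled f t x - scaled f u x) \<le> K * \<bar>u / t - 1\<bar>"
      using u K by (auto simp: eventually_at_filter)
    ultimately have "((\<lambda>t. scaled f t x - scaled f u x) \<longlongrightarrow> 0) (at u within {0<..})"
      by (rule Lim_null_comparison[rotated])
    then show "((\<lambda>t. scaled f t x) \<longlongrightarrow> scaled f u x) (at u within {0<..})" using Lim_null by blast
  qed
qed

text \<open>If f(z) is the integral of \<kappa>(\<sigma> z) d\<sigma>/\<sigma>, then f(A) x should
  be that of \<kappa>(\<sigma>A) x d\<sigma>/\<sigma>. Only the norm inequality is wanted, so a
  norming functional is applied first and Fubini's theorem is used for complex functions; the 2 is
  the bound of that functional.\<close>

lemma Phi_integral_bound:
  assumes \<kappa>: "\<kappa> \<in> Hinf0 \<phi>" and f: "f \<in> Hinf0 \<phi>" and \<epsilon>: "0 < \<epsilon>" "\<epsilon> \<le> t"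
    and f_eq: "\<And>z. z \<in> sector \<phi> \<Longrightarrow> ((\<lambda>\<sigma>. \<kappa> (of_real \<sigma> * z) / of_real \<sigma>) has_integral f z) {\<epsilon>..t}"
    and v: "v integrable_on {\<epsilon>..t}"
      "\<And>\<sigma>. \<epsilon> \<le> \<sigma> \<Longrightarrow> \<sigma> \<le> t \<Longrightarrow> norm (Phi \<nu> (\<lambda>z. \<kappa> (of_real \<sigma> * z)) x) / \<sigma> \<le> v \<sigma>"
  shows "norm (Phi \<nu> f x) \<le> 2 * integral {\<epsilon>..t} v"
proof -
  obtain \<xi> :: "'a \<Rightarrow> complex" where \<xi>: "cfunctional \<xi>" "\<And>y. cmod (\<xi> y) \<le> 2 * norm y" "norm (Phi \<nu> f x) \<le> cmod (\<xi> (Phi \<nu> f x))"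
    using norming_functional[of "Phi \<nu> f x"] by blast
  define F where "F z = \<xi> (R z x)" for z
  have bl: "bounded_linear \<xi>" using \<xi> by (simp add: cfunctional_def)
  obtain B where B: "0 \<le> B" "\<And>z x. z \<in> exterior \<Longrightarrow> cmod (\<xi> (R z x)) \<le> B * norm x / cmod z"
    using functional_resolvent_bound[OF \<xi>(1)] by blast
  obtain C s where C: "0 < C" "0 < s" "\<And>z. z \<in> sector \<phi> \<Longrightarrow> cmod (\<kappa> z) \<le> C * min (cmod z powr s) (cmod z powr - s)"
    using \<kappa> by (auto simp: Hinf0_def)
  \<comment> \<open>Bounds \<sigma>^s and \<sigma>^{-s} for all \<sigma> in the interval, which
    therefore has to stay away from 0.\<close>
  define L where "L = max (t powr s) (\<epsilon> powr - s)"
  have L0: "0 \<le> L" by (simp add: L_def le_max_iff_disj)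
  have \<kappa>b: "cmod (\<kappa> (of_real \<sigma> * z)) \<le> C * L * 4 * (cmod z * decay s (cmod z))"
    if z: "z \<in> sector \<phi>" and \<sigma>: "\<epsilon> \<le> \<sigma>" "\<sigma> \<le> t" for z \<sigma>
  proof -
    have z0: "0 < cmod z" using z by (simp add: sector_def)
    have \<sigma>0: "0 < \<sigma>" using \<sigma> \<epsilon> by simp
    have "\<sigma> powr s \<le> t powr s" using \<sigma> \<sigma>0 C(2) by (intro powr_mono2) auto
    then have 1: "\<sigma> powr s * cmod z powr s \<le> L * cmod z powr s" by (intro mult_right_mono) (auto simp: L_def)
    have "\<epsilon> powr s \<le> \<sigma> powr s" using \<sigma> \<epsilon> C(2) by (intro powr_mono2) auto
    then have "\<sigma> powr - s \<le> \<epsilon> powr - s" using \<epsilon> by (simp add: powr_minus_divide frac_le)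
    then have 2: "\<sigma> powr - s * cmod z powr - s \<le> L * cmod z powr - s" by (intro mult_right_mono) (auto simp: L_def)
    have "min ((\<sigma> * cmod z) powr s) ((\<sigma> * cmod z) powr - s) \<le> L * min (cmod z powr s) (cmod z powr - s)"
    proof -
      have "L * min (cmod z powr s) (cmod z powr - s) = min (L * cmod z powr s) (L * cmod z powr - s)"
        using L0 by (simp add: min_mult_distrib_left)
      moreover have "(\<sigma> * cmod z) powr s = \<sigma> powr s * cmod z powr s" "(\<sigma> * cmod z) powr - s = \<sigma> powr - s * cmod z powr - s"
        using \<sigma>0 z0 by (simp_all add: powr_mult)
      ultimately show ?thesis using 1 2 by linarith
    qed
    also have "\<dots> \<le> L * (4 * (cmod z * decay s (cmod z)))" by (intro mult_left_mono min_le_times_decay z0 L0)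
    finally have *: "min ((\<sigma> * cmod z) powr s) ((\<sigma> * cmod z) powr - s) \<le> L * (4 * (cmod z * decay s (cmod z)))" .
    have "of_real \<sigma> * z \<in> sector \<phi>" using sector_scale[OF \<sigma>0] z by simp
    from C(3)[OF this] have "cmod (\<kappa> (of_real \<sigma> * z)) \<le> C * min ((\<sigma> * cmod z) powr s) ((\<sigma> * cmod z) powr - s)"
      using \<sigma>0 by (simp add: norm_mult)
    also have "\<dots> \<le> C * (L * (4 * (cmod z * decay s (cmod z))))" using * C(1) by (intro mult_left_mono) auto
    finally show ?thesis by (simp add: mult_ac)
  qed
  have \<kappa>\<sigma>: "(\<lambda>z. \<kappa> (of_real \<sigma> * z)) \<in> Hinf0 \<phi>" if "\<epsilon> \<le> \<sigma>" for \<sigma> using that \<epsilon> by (intro Hinf0_scale[OF \<kappa>]) auto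
  \<comment> \<open>On each ray the integrals over r and \<sigma> are exchanged; integrating over
    \<sigma> first returns f.\<close>
  have ray: "ray_integral \<theta> (\<lambda>z. f z * F z) = integral {\<epsilon>..t} (\<lambda>\<sigma>. 1 / of_real \<sigma> * ray_integral \<theta> (\<lambda>z. \<kappa> (of_real \<sigma> * z) * F z))"
    "(\<lambda>\<sigma>. 1 / of_real \<sigma> * ray_integral \<theta> (\<lambda>z. \<kappa> (of_real \<sigma> * z) * F z)) integrable_on {\<epsilon>..t}"
    if \<theta>: "\<bar>\<theta>\<bar> = \<nu>" for \<theta>
  proof -
    define Z where "Z r = of_real r * cis \<theta>" for r
    have Z: "Z r \<in> sector \<phi>" "Z r \<in> exterior" "cmod (Z r) = r" if "0 < r" for r
      unfolding Z_def using that \<theta> nu angles by (auto simp: norm_mult intro!: polar_in_sector_phi ray_in_exterior)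
    define K where "K r \<sigma> = cis \<theta> * (\<kappa> (of_real \<sigma> * Z r) / of_real \<sigma> * F (Z r))" for r \<sigma>
    have contF: "continuous_on ({0<..} \<times> {\<epsilon>..t}) (\<lambda>p. F (Z (fst p)))"
    proof -
      have "continuous_on {0<..} (\<lambda>r. F (of_real r * cis \<theta>))"
        unfolding F_def using \<theta> nu angles
        by (intro continuous_on_ray bounded_linear.isCont[OF bl] resolvent_continuous ray_in_exterior) auto
      then show ?thesis unfolding Z_def by (rule continuous_on_compose2) (auto intro!: continuous_intros)
    qed
    have cont\<kappa>: "continuous_on ({0<..} \<times> {\<epsilon>..t}) (\<lambda>p. \<kappa> (of_real (snd p) * Z (fst p)))"
    proof (rule continuous_on_compose2[OF holomorphic_on_imp_continuous_on[OF Hinf0_holomorphic[OF \<kappa>]]])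
      show "continuous_on ({0<..} \<times> {\<epsilon>..t}) (\<lambda>p. of_real (snd p) * Z (fst p))"
        unfolding Z_def by (auto intro!: continuous_intros)
      show "(\<lambda>p. of_real (snd p) * Z (fst p)) ` ({0<..} \<times> {\<epsilon>..t}) \<subseteq> sector \<phi>"
        using Z(1) sector_scale \<epsilon> by auto
    qed
    have K: "continuous_on ({0<..} \<times> {\<epsilon>..t}) (\<lambda>(r, \<sigma>). K r \<sigma>)"
      unfolding K_def split_def using \<epsilon>
      by (intro continuous_on_mult continuous_on_divide cont\<kappa> contF continuous_on_const) (auto intro!: continuous_intros)
    define a where "a r = C * L * 4 * (B * norm x) * decay s r" for r
    have bd: "cmod (K r \<sigma>) \<le> a r * (1 / \<epsilon>)" if "r \<in> {0<..}" "\<sigma> \<in> {\<epsilon>..t}" for r \<sigma>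
    proof -
      have r: "0 < r" and \<sigma>: "\<epsilon> \<le> \<sigma>" "\<sigma> \<le> t" using that by auto
      have \<sigma>0: "0 < \<sigma>" using \<sigma> \<epsilon> by simp
      have n1: "cmod (\<kappa> (of_real \<sigma> * Z r)) \<le> C * L * 4 * (r * decay s r)" using \<kappa>b[OF Z(1)[OF r] \<sigma>] Z(3)[OF r] by simp
      have n2: "cmod (F (Z r)) \<le> B * norm x / r" using B(2)[OF Z(2)[OF r], of x] Z(3)[OF r] by (simp add: F_def)
      have "cmod (K r \<sigma>) = cmod (\<kappa> (of_real \<sigma> * Z r)) * cmod (F (Z r)) * (1 / \<sigma>)"
        using \<sigma>0 by (simp add: K_def norm_mult norm_divide)
      also have "\<dots> \<le> (C * L * 4 * (r * decay s r)) * (B * norm x / r) * (1 / \<epsilon>)"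
      proof (rule mult_mono)
        show "cmod (\<kappa> (of_real \<sigma> * Z r)) * cmod (F (Z r)) \<le> (C * L * 4 * (r * decay s r)) * (B * norm x / r)"
          by (rule mult_mono[OF n1 n2 order_trans[OF norm_ge_zero n1] norm_ge_zero])
        show "1 / \<sigma> \<le> 1 / \<epsilon>" using \<sigma> \<epsilon> by (intro frac_le) auto
        show "0 \<le> (C * L * 4 * (r * decay s r)) * (B * norm x / r)"
          by (rule mult_nonneg_nonneg[OF order_trans[OF norm_ge_zero n1] order_trans[OF norm_ge_zero n2]])
      qed (use \<sigma>0 in simp)
      also have "\<dots> = a r * (1 / \<epsilon>)" using r by (simp add: a_def)
      finally show ?thesis .
    qed
    have sa: "set_integrable lborel {0<..} a" unfolding a_def[abs_def]
      by (intro set_integrable_mult_right decay_set_integrable C)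
    have sb: "set_integrable lborel {\<epsilon>..t} (\<lambda>_. 1 / \<epsilon>)"
      by (intro borel_integrable_atLeastAtMost' continuous_intros)
    have e1: "integral {\<epsilon>..t} (K r) = cis \<theta> * (f (Z r) * F (Z r))" if "0 < r" for r
      using integral_unique[OF has_integral_mult_right[OF has_integral_mult_left[OF f_eq[OF Z(1)[OF that]]], of "cis \<theta>" "F (Z r)"]]
      by (simp add: K_def[abs_def])
    have e2: "integral {0<..} (\<lambda>r. K r \<sigma>) = 1 / of_real \<sigma> * ray_integral \<theta> (\<lambda>z. \<kappa> (of_real \<sigma> * z) * F z)" for \<sigma>
    proof -
      have "integral {0<..} (\<lambda>r. K r \<sigma>) = integral {0<..} (\<lambda>r. 1 / of_real \<sigma> * (cis \<theta> * (\<kappa> (of_real \<sigma> * Z r) * F (Z r))))"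
        by (simp add: K_def mult_ac)
      then show ?thesis unfolding integral_mult_right ray_integral_complex Z_def .
    qed
    note sw = integral_swap_dominated[of "{0<..}" "{\<epsilon>..t}", OF _ _ K bd sa sb, unfolded e2]
    have "ray_integral \<theta> (\<lambda>z. f z * F z) = integral {0<..} (\<lambda>r. integral {\<epsilon>..t} (K r))"
      unfolding ray_integral_complex by (rule integral_cong) (simp add: e1 Z_def)
    then show "ray_integral \<theta> (\<lambda>z. f z * F z) = integral {\<epsilon>..t} (\<lambda>\<sigma>. 1 / of_real \<sigma> * ray_integral \<theta> (\<lambda>z. \<kappa> (of_real \<sigma> * z) * F z))"
      using sw(1) by simp
    show "(\<lambda>\<sigma>. 1 / of_real \<sigma> * ray_integral \<theta> (\<lambda>z. \<kappa> (of_real \<sigma> * z) * F z)) integrable_on {\<epsilon>..t}"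
      using sw(3) by simp
  qed
  define k where "k = 1 / (2 * of_real pi * \<i>)"
  define J where "J \<theta> \<sigma> = 1 / of_real \<sigma> * ray_integral \<theta> (\<lambda>z. \<kappa> (of_real \<sigma> * z) * F z)" for \<theta> \<sigma>
  have ab: "\<bar>\<nu>\<bar> = \<nu>" "\<bar>- \<nu>\<bar> = \<nu>" using nu0 by auto
  have Ji: "J \<nu> integrable_on {\<epsilon>..t}" "J (- \<nu>) integrable_on {\<epsilon>..t}" unfolding J_def[abs_def] by (intro ray(2) ab)+
  have "\<xi> (Phi \<nu> f x) = k * (integral {\<epsilon>..t} (J (- \<nu>)) - integral {\<epsilon>..t} (J \<nu>))"
    using Phi_functional(1)[OF f nu \<xi>(1), of x] ray(1)[OF ab(1)] ray(1)[OF ab(2)]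
    by (simp add: sector_integral_def k_def F_def J_def[abs_def])
  also have "\<dots> = integral {\<epsilon>..t} (\<lambda>\<sigma>. k * (J (- \<nu>) \<sigma> - J \<nu> \<sigma>))"
    by (simp only: integral_mult_right integral_diff[OF Ji(2,1)])
  finally have eq: "\<xi> (Phi \<nu> f x) = integral {\<epsilon>..t} (\<lambda>\<sigma>. k * (J (- \<nu>) \<sigma> - J \<nu> \<sigma>))" .
  have "cmod (integral {\<epsilon>..t} (\<lambda>\<sigma>. k * (J (- \<nu>) \<sigma> - J \<nu> \<sigma>))) \<le> integral {\<epsilon>..t} (\<lambda>\<sigma>. 2 * v \<sigma>)"
  proof (rule integral_norm_bound_integral)
    show "(\<lambda>\<sigma>. k * (J (- \<nu>) \<sigma> - J \<nu> \<sigma>)) integrable_on {\<epsilon>..t}" by (intro integrable_on_mult_right integrable_diff Ji)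
    show "(\<lambda>\<sigma>. 2 * v \<sigma>) integrable_on {\<epsilon>..t}" by (intro integrable_on_mult_right v)
    fix \<sigma> assume \<sigma>: "\<sigma> \<in> {\<epsilon>..t}"
    then have \<sigma>0: "0 < \<sigma>" using \<epsilon> by simp
    have "k * (J (- \<nu>) \<sigma> - J \<nu> \<sigma>) = 1 / of_real \<sigma> * \<xi> (Phi \<nu> (\<lambda>z. \<kappa> (of_real \<sigma> * z)) x)"
    proof -
      have e: "k * (u * p - u * q) = u * (k * (p - q))" for u p q :: complex by (simp add: algebra_simps)
      have "\<xi> (Phi \<nu> (\<lambda>z. \<kappa> (of_real \<sigma> * z)) x) = k * sector_integral \<nu> (\<lambda>z. \<kappa> (of_real \<sigma> * z) * F z)"
        unfolding k_def F_def by (rule Phi_functional(1)[OF \<kappa>\<sigma> nu \<xi>(1)]) (use \<sigma> in simp)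
      then show ?thesis unfolding J_def e sector_integral_def by simp
    qed
    then have "cmod (k * (J (- \<nu>) \<sigma> - J \<nu> \<sigma>)) = cmod (\<xi> (Phi \<nu> (\<lambda>z. \<kappa> (of_real \<sigma> * z)) x)) / \<sigma>"
      using \<sigma>0 by (simp add: norm_mult norm_divide)
    also have "\<dots> \<le> 2 * norm (Phi \<nu> (\<lambda>z. \<kappa> (of_real \<sigma> * z)) x) / \<sigma>"
      using \<xi>(2) \<sigma>0 by (intro divide_right_mono) auto
    also have "\<dots> \<le> 2 * v \<sigma>" using v(2)[of \<sigma>] \<sigma> by simp
    finally show "norm (k * (J (- \<nu>) \<sigma> - J \<nu> \<sigma>)) \<le> 2 * v \<sigma>" .
  qed
  then show ?thesis using eq \<xi>(3) by simp
qed

text \<open>Apart from the uniform bounds, each estimate reflects one identity on the sector: \<psi>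
  = z g, r \<psi> = z q, 1 - q = z h0, and the integral representation of q(\<epsilon> z) - q(t z)
  with kernel k \<psi>. The first three pass to operators through \<open>has_calc_times_id\<close>,
  the last through \<open>Phi_integral_bound\<close>.\<close>

lemma approximating_operators:
  assumes \<psi>: "\<psi> \<in> elem_fun \<phi>" "(\<lambda>z. inverse z * \<psi> z) \<in> elem_fun \<phi>"
    and L: "L \<noteq> 0" "((\<lambda>z. inverse z * \<psi> z) \<longlongrightarrow> L) (at 0 within sector \<phi>)"
    and nz: "\<And>z. z \<in> sector \<phi> \<Longrightarrow> \<psi> z \<noteq> 0"
    and B: "\<And>z s. z \<in> sector \<phi> \<Longrightarrow> 1 \<le> s \<Longrightarrow> cmod (\<psi> (of_real s * z) / (of_real s * \<psi> z)) \<le> B"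
  obtains C Q where "0 \<le> C"
    "\<And>t x. 0 < t \<Longrightarrow> norm (scaled \<psi> t x) \<le> C * norm x"
    "\<And>t b. 0 < t \<Longrightarrow> b \<in> D \<Longrightarrow> norm (scaled \<psi> t b) \<le> C * t * norm (A b)"
    "\<And>t x. 0 < t \<Longrightarrow> Q t x \<in> D"
    "\<And>t x. 0 < t \<Longrightarrow> norm (Q t x) \<le> C * norm x"
    "\<And>t x. 0 < t \<Longrightarrow> norm (A (Q t x)) \<le> C * (norm (scaled \<psi> t x) / t)"
    "\<And>t b. 0 < t \<Longrightarrow> b \<in> D \<Longrightarrow> norm (b - Q t b) \<le> C * t * norm (A b)"
    "\<And>t x. 0 < t \<Longrightarrow> Q t (inv_shift 1 x) = inv_shift 1 (Q t x)"
    "\<And>\<epsilon> t x. 0 < \<epsilon> \<Longrightarrow> \<epsilon> \<le> t \<Longrightarrow>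
      norm (Q \<epsilon> x - Q t x) \<le> C * integral {\<epsilon>..t} (\<lambda>\<sigma>. norm (scaled \<psi> \<sigma> x) / \<sigma>)"
proof -
  define g where "g z = inverse z * \<psi> z" for z
  have g: "g \<in> elem_fun \<phi>" "(g \<longlongrightarrow> L) (at 0 within sector \<phi>)" using \<psi>(2) L(2) by (simp_all add: g_def[abs_def])
  have gnz: "g z \<noteq> 0" if "z \<in> sector \<phi>" for z using nz[OF that] that by (simp add: g_def sector_def)
  have \<psi>g: "\<psi> z = z * g z" if "z \<in> sector \<phi>" for z using that by (simp add: g_def sector_def)
  have gB: "cmod (g (of_real s * z)) \<le> B * cmod (g z)" if z: "z \<in> sector \<phi>" and s: "1 \<le> s" for z s
  proof -
    have s0: "0 < s" and z0: "z \<noteq> 0" using s z by (auto simp: sector_def)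
    have p: "0 < cmod (of_real s * \<psi> z)" using nz[OF z] s0 by simp
    have "cmod (\<psi> (of_real s * z)) \<le> B * cmod (of_real s * \<psi> z)"
      using B[OF z s] p by (simp add: norm_divide divide_le_eq)
    then have "cmod (\<psi> (of_real s * z)) / (s * cmod z) \<le> B * cmod (of_real s * \<psi> z) / (s * cmod z)"
      using s0 by (intro divide_right_mono) auto
    moreover have "cmod (g (of_real s * z)) = cmod (\<psi> (of_real s * z)) / (s * cmod z)"
      using s0 by (simp add: g_def norm_mult norm_inverse divide_inverse mult_ac)
    moreover have "B * cmod (of_real s * \<psi> z) / (s * cmod z) = B * cmod (g z)"
      using s0 by (simp add: g_def norm_mult norm_inverse divide_inverse mult_ac)
    ultimately show ?thesis by simp
  qed
  obtain k r q W where k: "k \<in> Hinf0 \<phi>" and r: "r \<in> elem_fun \<phi>" and q: "\<And>z. z \<in> sector \<phi> \<Longrightarrow> q z = r z * g z"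
    and dq: "\<And>z. z \<in> sector \<phi> \<Longrightarrow> (q has_field_derivative - (g z * k z)) (at z)"
    and h: "(\<lambda>z. (1 - q z) / z) \<in> Hinf0 \<phi>"
    and W: "\<And>z. z \<in> sector \<phi> \<Longrightarrow> cmod (1 - q z) \<le> W * cmod z"
      "\<And>z. z \<in> sector \<phi> \<Longrightarrow> cmod (q z) \<le> W / (1 + cmod z)"
    using approximating_functions[OF phi(1) angles(3) g(1) gnz L(1) g(2) gB] by blast
  define h0 where "h0 z = (1 - q z) / z" for z
  have h0: "h0 \<in> elem_fun \<phi>" using Hinf0_elem_fun[OF h] by (simp add: h0_def[abs_def])
  have k': "k \<in> elem_fun \<phi>" by (rule Hinf0_elem_fun[OF k])
  have sc: "of_real t * z \<in> sector \<phi>" if "0 < t" "z \<in> sector \<phi>" for t z using sector_scale[OF that(1)] that(2) by simp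
  obtain K\<psi> where K\<psi>: "0 \<le> K\<psi>" "\<And>t x. 0 < t \<Longrightarrow> norm (scaled \<psi> t x) \<le> K\<psi> * norm x" using scaled_bounded[OF \<psi>(1)] by blast
  obtain Kg where Kg: "0 \<le> Kg" "\<And>t x. 0 < t \<Longrightarrow> norm (scaled g t x) \<le> Kg * norm x" using scaled_bounded[OF g(1)] by blast
  obtain Kr where Kr: "0 \<le> Kr" "\<And>t x. 0 < t \<Longrightarrow> norm (scaled r t x) \<le> Kr * norm x" using scaled_bounded[OF r] by blast
  obtain Kh where Kh: "0 \<le> Kh" "\<And>t x. 0 < t \<Longrightarrow> norm (scaled h0 t x) \<le> Kh * norm x" using scaled_bounded[OF h0] by blast
  obtain Kk where Kk: "0 \<le> Kk" "\<And>t x. 0 < t \<Longrightarrow> norm (scaled k t x) \<le> Kk * norm x" using scaled_bounded[OF k'] by blast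
  \<comment> \<open>This is q(tA), written as a product of two operators that are already bounded
    uniformly in t.\<close>
  define Q where "Q t x = scaled r t (scaled g t x)" for t x
  have Qc: "has_calc (\<lambda>z. q (of_real t * z)) (Q t)" if t: "0 < t" for t
    by (rule has_calc_cong[OF has_calc_mult[OF has_calc_scaled[OF t r] has_calc_scaled[OF t g(1)]]])
      (use q sc[OF t] in \<open>auto simp: Q_def\<close>)
  \<comment> \<open>One constant for all estimates; the 2 before \<open>Kk\<close> is the factor in
    \<open>Phi_integral_bound\<close>.\<close>
  define C where "C = K\<psi> + Kg + Kr * Kg + Kr + Kh + 2 * Kk"
  have RG: "0 \<le> Kr * Kg" using Kr(1) Kg(1) by simp
  have C: "K\<psi> \<le> C" "Kg \<le> C" "Kr * Kg \<le> C" "Kr \<le> C" "Kh \<le> C" "2 * Kk \<le> C" "0 \<le> C"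
    unfolding C_def using K\<psi>(1) Kg(1) Kr(1) Kh(1) Kk(1) RG by linarith+
  have c2: "norm (scaled \<psi> t b) \<le> C * t * norm (A b)" if t: "0 < t" "b \<in> D" for t b
  proof -
    have "scaled \<psi> t b = t *\<^sub>R scaled g t (A b)"
      by (rule has_calc_times_id(1)[OF has_calc_scaled[OF t(1) \<psi>(1)] has_calc_scaled[OF t(1) g(1)] _ t(2)])
        (simp add: \<psi>g[OF sc[OF t(1)]])
    then have "norm (scaled \<psi> t b) = t * norm (scaled g t (A b))" using t by simp
    also have "\<dots> \<le> t * (C * norm (A b))"
      using t by (intro mult_left_mono order_trans[OF Kg(2)] mult_right_mono C) auto
    finally show ?thesis by (simp add: mult_ac)
  qed
  have rp: "has_calc (\<lambda>z. r (of_real t * z) * \<psi> (of_real t * z)) (\<lambda>x. scaled r t (scaled \<psi> t x))" if "0 < t" for t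
    by (rule has_calc_mult[OF has_calc_scaled[OF that r] has_calc_scaled[OF that \<psi>(1)]])
  have AQ: "Q t x \<in> D" "norm (A (Q t x)) \<le> C * (norm (scaled \<psi> t x) / t)" if t: "0 < t" for t x
  proof -
    have eq: "r (of_real t * z) * \<psi> (of_real t * z) = of_real t * z * q (of_real t * z)" if "z \<in> sector \<phi>" for z
      using q[OF sc[OF t that]] \<psi>g[OF sc[OF t that]] by simp
    have AQd: "t *\<^sub>R Q t x \<in> D" by (rule has_calc_times_id(2)[OF rp[OF t] Qc[OF t] eq])
    have AQe: "A (t *\<^sub>R Q t x) = scaled r t (scaled \<psi> t x)" by (rule has_calc_times_id(3)[OF rp[OF t] Qc[OF t] eq])
    have Qe: "Q t x = of_real (1 / t) *C (t *\<^sub>R Q t x)" using t by (simp add: scaleR_scaleC scaleC_scaleC)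
    show "Q t x \<in> D" by (subst Qe) (rule D_scale(1)[OF AQd])
    have "A (Q t x) = of_real (1 / t) *C A (t *\<^sub>R Q t x)" by (subst Qe) (rule D_scale(2)[OF AQd])
    then have "A (Q t x) = of_real (1 / t) *C scaled r t (scaled \<psi> t x)" by (simp only: AQe)
    then have "norm (A (Q t x)) = norm (scaled r t (scaled \<psi> t x)) / t"
      using t by (simp add: norm_scaleC norm_divide)
    also have "\<dots> \<le> (C * norm (scaled \<psi> t x)) / t"
      using t by (intro divide_right_mono order_trans[OF Kr(2)] mult_right_mono C) auto
    finally show "norm (A (Q t x)) \<le> C * (norm (scaled \<psi> t x) / t)" by simp
  qed
  have c5: "norm (Q t x) \<le> C * norm x" if t: "0 < t" for t x
  proof -
    have "norm (Q t x) \<le> Kr * (Kg * norm x)"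
      unfolding Q_def using Kr(1) by (intro order_trans[OF Kr(2)[OF t]] mult_left_mono Kg(2) t)
    also have "\<dots> = Kr * Kg * norm x" by simp
    also have "\<dots> \<le> C * norm x" by (intro mult_right_mono C) auto
    finally show ?thesis .
  qed
  have c7: "norm (b - Q t b) \<le> C * t * norm (A b)" if t: "0 < t" "b \<in> D" for t b
  proof -
    have eq: "1 - q (of_real t * z) = of_real t * z * h0 (of_real t * z)" if "z \<in> sector \<phi>" for z
      using sc[OF t(1) that] t by (simp add: h0_def sector_def)
    have "1 *C b - Q t b = t *\<^sub>R scaled h0 t (A b)"
      by (rule has_calc_times_id(1)[OF has_calc_diff[OF has_calc_const[of 1] Qc[OF t(1)]] has_calc_scaled[OF t(1) h0] eq t(2)])
    then have "norm (b - Q t b) = t * norm (scaled h0 t (A b))" using t by simp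
    also have "\<dots> \<le> t * (C * norm (A b))"
      using t by (intro mult_left_mono order_trans[OF Kh(2)] mult_right_mono C) auto
    finally show ?thesis by (simp add: mult_ac)
  qed
  have c8: "Q t (inv_shift 1 x) = inv_shift 1 (Q t x)" if "0 < t" for t x
    using has_calc_commute[OF Qc[OF that] has_calc_recip[of 1]] by simp
  have c9: "norm (Q \<epsilon> x - Q t x) \<le> C * integral {\<epsilon>..t} (\<lambda>\<sigma>. norm (scaled \<psi> \<sigma> x) / \<sigma>)"
    if \<epsilon>: "0 < \<epsilon>" "\<epsilon> \<le> t" for \<epsilon> t x
  proof -
    have t: "0 < t" using \<epsilon> by simp
    define f where "f z = q (of_real \<epsilon> * z) - q (of_real t * z)" for z
    define \<kappa> where "\<kappa> z = k z * \<psi> z" for z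
    obtain B\<psi> where "\<And>z. z \<in> sector \<phi> \<Longrightarrow> cmod (\<psi> z) \<le> B\<psi>"
      using elem_fun_bounded(2)[OF \<psi>(1) phi(1) angles(3)] by blast
    then have \<kappa>: "\<kappa> \<in> Hinf0 \<phi>"
      unfolding \<kappa>_def by (rule Hinf0_mult[OF k elem_fun_bounded(1)[OF \<psi>(1) phi(1) angles(3)] _ phi(2)])
    have dqs: "((\<lambda>z. q (of_real a * z)) has_field_derivative (- (g (of_real a * z) * k (of_real a * z)) * of_real a)) (at z)"
      if "0 < a" "z \<in> sector \<phi>" for a z
      using DERIV_chain2[OF dq[OF sc[OF that]] DERIV_cmult[OF DERIV_ident, of "of_real a" z UNIV]] by simp
    have W0: "0 \<le> W"
    proof -
      have "1 \<in> sector \<phi>" using phi by (simp add: sector_def)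
      from order_trans[OF norm_ge_zero W(1)[OF this]] show ?thesis by simp
    qed
    \<comment> \<open>Near 0 the difference is rewritten through 1 - q, which is O(z); at infinity
      both values of q are O(1/z).\<close>
    have f: "f \<in> Hinf0 \<phi>"
    proof (rule Hinf0I[where s=1 and C="W * (\<epsilon> + t) + W * (1 / \<epsilon> + 1 / t)"])
      show "f holomorphic_on sector \<phi>"
      proof (rule holomorphic_onI)
        fix z assume z: "z \<in> sector \<phi>"
        have "f field_differentiable (at z)"
          unfolding f_def[abs_def] using dqs[OF \<epsilon>(1) z] dqs[OF t z]
          by (intro field_differentiable_diff) (auto simp: field_differentiable_def)
        then show "f field_differentiable (at z within sector \<phi>)" by (rule field_differentiable_at_within)
      qed
      fix z assume z: "z \<in> sector \<phi>"
      have z0: "0 < cmod z" using z by (simp add: sector_def)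
      have n: "cmod (of_real a * z) = a * cmod z" if "0 < a" for a using that by (simp add: norm_mult)
      have "f z = (1 - q (of_real t * z)) - (1 - q (of_real \<epsilon> * z))" by (simp add: f_def)
      then have "cmod (f z) \<le> W * (t * cmod z) + W * (\<epsilon> * cmod z)"
        using norm_triangle_ineq4[of "1 - q (of_real t * z)" "1 - q (of_real \<epsilon> * z)"]
          W(1)[OF sc[OF t z]] W(1)[OF sc[OF \<epsilon>(1) z]] n[OF t] n[OF \<epsilon>(1)] by simp
      then have a1: "cmod (f z) \<le> W * (\<epsilon> + t) * cmod z" by (simp add: algebra_simps)
      have dec: "W / (1 + a * cmod z) \<le> W * (1 / a) * (1 / cmod z)" if a: "0 < a" for a
      proof -
        have "0 < a * cmod z" using a z0 by simp
        then have "W / (1 + a * cmod z) \<le> W / (a * cmod z)" using W0 by (intro frac_le) auto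
        then show ?thesis by simp
      qed
      have "cmod (f z) \<le> W / (1 + \<epsilon> * cmod z) + W / (1 + t * cmod z)"
        using norm_triangle_ineq4[of "q (of_real \<epsilon> * z)" "q (of_real t * z)"]
          W(2)[OF sc[OF t z]] W(2)[OF sc[OF \<epsilon>(1) z]] n[OF t] n[OF \<epsilon>(1)] by (simp add: f_def)
      also have "\<dots> \<le> W * (1 / \<epsilon>) * (1 / cmod z) + W * (1 / t) * (1 / cmod z)"
        by (intro add_mono dec t \<epsilon>)
      finally have a2: "cmod (f z) \<le> W * (1 / \<epsilon> + 1 / t) * (1 / cmod z)" by (simp only: distrib_left distrib_right)
      define X Y where "X = W * (\<epsilon> + t)" and "Y = W * (1 / \<epsilon> + 1 / t)"
      have XY: "0 \<le> X" "0 \<le> Y" unfolding X_def Y_def using W0 \<epsilon> t by (intro mult_nonneg_nonneg; simp)+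
      have "cmod (f z) \<le> (X + Y) * cmod z"
        using a1 mult_right_mono[of X "X + Y" "cmod z"] XY unfolding X_def[symmetric] by simp
      moreover have "cmod (f z) \<le> (X + Y) * (1 / cmod z)"
        using a2 mult_right_mono[of Y "X + Y" "1 / cmod z"] XY unfolding Y_def[symmetric] by simp
      ultimately show "cmod (f z) \<le> (W * (\<epsilon> + t) + W * (1 / \<epsilon> + 1 / t)) * min (cmod z powr 1) (cmod z powr - 1)"
        using z0 unfolding X_def[symmetric] Y_def[symmetric] by (simp add: powr_minus_divide min_def)
    qed simp
    have "continuous_on {\<epsilon>..t} (\<lambda>\<sigma>. scaled \<psi> \<sigma> x)"
      by (rule continuous_on_subset[OF scaled_continuous[OF \<psi>(1)]]) (use \<epsilon> in auto)
    then have vi: "(\<lambda>\<sigma>. norm (scaled \<psi> \<sigma> x) / \<sigma>) integrable_on {\<epsilon>..t}"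
      using \<epsilon> by (intro integrable_continuous_real continuous_intros) auto
    have "has_calc f (\<lambda>x. Q \<epsilon> x - Q t x)"
      unfolding f_def by (rule has_calc_diff[OF Qc[OF \<epsilon>(1)] Qc[OF t]])
    from fun_cong[OF has_calc_unique[OF this has_calc_Hinf0[OF f]], of x]
    have "norm (Q \<epsilon> x - Q t x) = norm (Phi \<nu> f x)" by simp
    also have "\<dots> \<le> 2 * integral {\<epsilon>..t} (\<lambda>\<sigma>. Kk * (norm (scaled \<psi> \<sigma> x) / \<sigma>))"
    proof (rule Phi_integral_bound[OF \<kappa> f \<epsilon>])
      fix z assume z: "z \<in> sector \<phi>"
      \<comment> \<open>The derivative of -q(\<sigma> z) in \<sigma> is z (g k)(\<sigma> z), and
        this is \<kappa>(\<sigma> z) / \<sigma> because \<psi>(w) = w g(w).\<close>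
      have "((\<lambda>\<sigma>. z * (g (of_real \<sigma> * z) * k (of_real \<sigma> * z))) has_integral
          (- q (of_real t * z)) - (- q (of_real \<epsilon> * z))) {\<epsilon>..t}"
      proof (rule fundamental_theorem_of_calculus[OF \<epsilon>(2)])
        fix \<sigma> assume "\<sigma> \<in> {\<epsilon>..t}"
        then have \<sigma>: "0 < \<sigma>" using \<epsilon> by simp
        have d: "((\<lambda>x. of_real x * z) has_vector_derivative (of_real 1 * z)) (at \<sigma>)"
          by (intro has_vector_derivative_mult_left has_vector_derivative_of_real DERIV_ident)
        from has_vector_derivative_minus[OF field_vector_diff_chain_at[OF d dq[OF sc[OF \<sigma> z]]]]
        have "((\<lambda>\<sigma>. - q (of_real \<sigma> * z)) has_vector_derivative z * (g (of_real \<sigma> * z) * k (of_real \<sigma> * z))) (at \<sigma>)"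
          by (simp add: o_def)
        then show "((\<lambda>\<sigma>. - q (of_real \<sigma> * z)) has_vector_derivative z * (g (of_real \<sigma> * z) * k (of_real \<sigma> * z))) (at \<sigma> within {\<epsilon>..t})"
          by (rule has_vector_derivative_at_within)
      qed
      moreover have "z * (g (of_real \<sigma> * z) * k (of_real \<sigma> * z)) = \<kappa> (of_real \<sigma> * z) / of_real \<sigma>" if "\<sigma> \<in> {\<epsilon>..t}" for \<sigma>
      proof -
        have \<sigma>: "0 < \<sigma>" using that \<epsilon> by simp
        show ?thesis using \<psi>g[OF sc[OF \<sigma> z]] \<sigma> by (simp add: \<kappa>_def)
      qed
      ultimately have "((\<lambda>\<sigma>. \<kappa> (of_real \<sigma> * z) / of_real \<sigma>) has_integral
          (- q (of_real t * z)) - (- q (of_real \<epsilon> * z))) {\<epsilon>..t}"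
        by (rule has_integral_eq[rotated])
      then show "((\<lambda>\<sigma>. \<kappa> (of_real \<sigma> * z) / of_real \<sigma>) has_integral f z) {\<epsilon>..t}" by (simp add: f_def)
    next
      show "(\<lambda>\<sigma>. Kk * (norm (scaled \<psi> \<sigma> x) / \<sigma>)) integrable_on {\<epsilon>..t}"
        by (rule integrable_on_mult_right[OF vi])
    next
      fix \<sigma> assume "\<epsilon> \<le> \<sigma>" "\<sigma> \<le> t"
      then have \<sigma>: "0 < \<sigma>" using \<epsilon> by simp
      have "has_calc (\<lambda>z. \<kappa> (of_real \<sigma> * z)) (\<lambda>x. scaled k \<sigma> (scaled \<psi> \<sigma> x))"
        unfolding \<kappa>_def by (rule has_calc_mult[OF has_calc_scaled[OF \<sigma> k'] has_calc_scaled[OF \<sigma> \<psi>(1)]])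
      from fun_cong[OF has_calc_unique[OF has_calc_Hinf0[OF Hinf0_scale[OF \<kappa> \<sigma>]] this], of x]
      have "norm (Phi \<nu> (\<lambda>z. \<kappa> (of_real \<sigma> * z)) x) \<le> Kk * norm (scaled \<psi> \<sigma> x)" using Kk(2)[OF \<sigma>] by simp
      then have "norm (Phi \<nu> (\<lambda>z. \<kappa> (of_real \<sigma> * z)) x) / \<sigma> \<le> Kk * norm (scaled \<psi> \<sigma> x) / \<sigma>"
        using \<sigma> by (intro divide_right_mono) auto
      then show "norm (Phi \<nu> (\<lambda>z. \<kappa> (of_real \<sigma> * z)) x) / \<sigma> \<le> Kk * (norm (scaled \<psi> \<sigma> x) / \<sigma>)" by simp
    qed
    also have "\<dots> = 2 * Kk * integral {\<epsilon>..t} (\<lambda>\<sigma>. norm (scaled \<psi> \<sigma> x) / \<sigma>)"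
      by (simp only: integral_mult_right mult.assoc)
    also have "\<dots> \<le> C * integral {\<epsilon>..t} (\<lambda>\<sigma>. norm (scaled \<psi> \<sigma> x) / \<sigma>)"
      using \<epsilon> by (intro mult_right_mono C integral_nonneg[OF vi]) auto
    finally show ?thesis .
  qed
  have c1: "norm (scaled \<psi> t x) \<le> C * norm x" if "0 < t" for t x
    using K\<psi>(2)[OF that, of x] mult_right_mono[OF C(1), of "norm x"] by simp
  show ?thesis by (rule that[OF C(7) c1 c2 AQ(1) c5 AQ(2) c7 c8 c9])
qed

end

section \<open>The interpolation norms\<close>

text \<open>The infimum provides an angle \<omega> < \<nu> of sectoriality. The resolvent bound is
  given only for angles strictly above \<omega>, so \<mu> is taken midway between \<omega> and
  \<nu>.\<close>

lemma sectorial_calculus_exists: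
  assumes "sectorial D A" "sectoriality_angle D A < \<nu>" "\<nu> < \<phi>" "\<phi> < pi"
  shows "\<exists>\<mu> M. sectorial_calculus D A \<mu> \<phi> M \<nu>"
proof -
  have "{\<omega>. sectorial_of_angle D A \<omega>} \<noteq> {}" using assms(1) by (auto simp: sectorial_def)
  from cInf_lessD[OF this] assms(2) obtain \<omega> where \<omega>: "sectorial_of_angle D A \<omega>" "\<omega> < \<nu>"
    by (auto simp: sectoriality_angle_def)
  define \<mu> where "\<mu> = (\<omega> + \<nu>) / 2"
  have \<omega>0: "0 < \<omega>" using \<omega>(1) by (simp add: sectorial_of_angle_def)
  have \<mu>: "\<omega> < \<mu>" "\<mu> < \<nu>" "0 < \<mu>" "\<mu> < pi" using \<omega>(2) \<omega>0 assms(3,4) by (auto simp: \<mu>_def)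
  have "bdd_above ((\<lambda>l. onorm (\<lambda>x. l *C resolvent D A l x)) ` (- sector \<mu> - {0}))"
    using \<omega>(1) \<mu> unfolding sectorial_of_angle_def by auto
  then obtain M0 where "\<forall>y\<in>(\<lambda>l. onorm (\<lambda>x. l *C resolvent D A l x)) ` (- sector \<mu> - {0}). y \<le> M0"
    unfolding bdd_above_def by blast
  then have M0: "onorm (\<lambda>x. l *C resolvent D A l x) \<le> M0" if "l \<notin> sector \<mu>" "l \<noteq> 0" for l
    using that by blast
  have res: "z \<in> resolvent_set D A" if z: "z \<notin> sector \<mu>" "z \<noteq> 0" for z
  proof -
    have "\<mu> \<le> \<bar>Arg z\<bar>" using z by (simp add: sector_def)
    then have "of_real (cmod z) * cis (Arg z) \<notin> closure (sector \<omega>)"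
      using z \<mu> by (intro not_in_closure_sector[OF \<omega>0]) (use Arg_bounded[of z] in auto)
    then have "z \<notin> spectrum D A" using \<omega>(1) polar_form[of z] by (auto simp: sectorial_of_angle_def)
    then show ?thesis by (simp add: spectrum_def)
  qed
  have "sectorial_calculus D A \<mu> \<phi> (max 0 M0) \<nu>"
  proof unfold_locales
    show "linear_operator D A" using \<omega>(1) by (simp add: sectorial_of_angle_def)
    fix z x assume z: "z \<notin> sector \<mu>" "z \<noteq> 0"
    show "z \<in> resolvent_set D A" by (rule res[OF z])
    have "bounded_linear (resolvent D A z)" using res[OF z] by (simp add: resolvent_set_def)
    moreover have "bounded_linear (\<lambda>y::'a. z *C y)"
      by (rule bounded_linear_intro[where K="cmod z"])
        (auto simp: scaleC_add_right scaleR_scaleC scaleC_scaleC norm_scaleC mult.commute)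
    ultimately have "bounded_linear (\<lambda>x. z *C resolvent D A z x)" by (rule bounded_linear_compose[rotated])
    from onorm[OF this, of x] have "norm (z *C resolvent D A z x) \<le> onorm (\<lambda>x. z *C resolvent D A z x) * norm x" .
    also have "\<dots> \<le> max 0 M0 * norm x" using M0[OF z] by (intro mult_right_mono) auto
    finally show "norm (z *C resolvent D A z x) \<le> max 0 M0 * norm x" .
  qed (use \<mu> assms in auto)
  then show ?thesis by blast
qed

section \<open>Norm comparison in Banach function spaces\<close>

lemma AE_lebesgue_on_pos:
  assumes "\<And>t. 0 < t \<Longrightarrow> P t" shows "AE t in lebesgue_on {0::real..}. P t"
proof -
  have "AE t in lebesgue. t \<noteq> (0::real)" by (rule AE_completion[OF AE_lborel_singleton])
  then have "AE t in lebesgue. t \<in> {0::real..} \<longrightarrow> P t" by eventually_elim (simp add: assms)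
  then show ?thesis by (subst AE_restrict_space_iff) auto
qed

text \<open>The interval [1,2] has positive measure; this is what detects that the norms of
  functions nonvanishing there are positive.\<close>

lemma not_AE_lebesgue_on_Icc:
  assumes "AE t in lebesgue_on {0::real..}. P t" shows "\<exists>t\<in>{1..2}. P t"
proof (rule ccontr)
  assume "\<not> (\<exists>t\<in>{1..2}. P t)"
  then have n: "\<And>t. t \<in> {1..2} \<Longrightarrow> \<not> P t" by blast
  have "AE t in lebesgue. t \<in> {0::real..} \<longrightarrow> P t" using assms by (subst (asm) AE_restrict_space_iff) auto
  then have "AE t in lebesgue. t \<notin> {1..2::real}" by eventually_elim (use n in force)
  then have "{1..2::real} \<in> null_sets lebesgue" by (subst AE_iff_null_sets) auto
  then have "emeasure lborel {1..2::real} = 0" by (simp add: null_sets_completion_iff null_sets_def)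
  then show False by simp
qed

context banach_function_space
begin

lemma dominated:
  assumes "g \<in> \<Phi>" "f \<in> borel_measurable (lebesgue_on {0..})" "\<And>t. 0 < t \<Longrightarrow> cmod (f t) \<le> cmod (g t)"
  shows "f \<in> \<Phi>" "N f \<le> N g"
  using ideal[OF assms(1,2) AE_lebesgue_on_pos[OF assms(3)]] by auto

lemma N_pos:
  assumes "f \<in> \<Phi>" "\<And>t. 1 \<le> t \<Longrightarrow> t \<le> 2 \<Longrightarrow> f t \<noteq> 0" shows "0 < N f"
proof -
  have "N f \<noteq> 0" using not_AE_lebesgue_on_Icc[of "\<lambda>t. f t = 0"] assms norm_eq_0[OF assms(1)] by force
  then show ?thesis using norm_nonneg[OF assms(1)] by simp
qed

lemma combination:
  assumes "f \<in> \<Phi>" "g \<in> \<Phi>" "0 \<le> a" "0 \<le> b"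
  shows "(\<lambda>t. of_real a * f t + of_real b * g t) \<in> \<Phi>"
    "N (\<lambda>t. of_real a * f t + of_real b * g t) \<le> a * N f + b * N g"
proof -
  have m: "(\<lambda>t. of_real a * f t) \<in> \<Phi>" "(\<lambda>t. of_real b * g t) \<in> \<Phi>" by (intro mult assms)+
  show "(\<lambda>t. of_real a * f t + of_real b * g t) \<in> \<Phi>" by (rule add[OF m])
  show "N (\<lambda>t. of_real a * f t + of_real b * g t) \<le> a * N f + b * N g"
    using norm_triangle[OF m] norm_mult[OF assms(1), of "of_real a"] norm_mult[OF assms(2), of "of_real b"] assms(3,4)
    by simp
qed

end

section \<open>The K-functional and the two norm inequalities\<close>

context sectorial_calculus
begin

lemma K_functional_le:
  assumes "0 \<le> t" "b \<in> D"
  shows "K_functional D A t x \<le> norm (x - b) + t * (norm b + norm (A b))"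
proof -
  have "bdd_below {norm a + t * graph_norm A b |a b. b \<in> D \<and> a + b = x}"
    by (rule bdd_belowI[of _ 0]) (use assms(1) in \<open>auto simp: graph_norm_def\<close>)
  moreover have "norm (x - b) + t * (norm b + norm (A b)) \<in> {norm a + t * graph_norm A b |a b. b \<in> D \<and> a + b = x}"
    using assms(2) by (force simp: graph_norm_def)
  ultimately show ?thesis unfolding K_functional_def by (intro cInf_lower)
qed

lemma K_functional_ge:
  assumes "\<And>b. b \<in> D \<Longrightarrow> c \<le> norm (x - b) + t * (norm b + norm (A b))"
  shows "c \<le> K_functional D A t x"
  unfolding K_functional_def
proof (rule cInf_greatest)
  show "{norm a + t * graph_norm A b |a b. b \<in> D \<and> a + b = x} \<noteq> {}" using D_0 by force
next
  fix y assume "y \<in> {norm a + t * graph_norm A b |a b. b \<in> D \<and> a + b = x}"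
  then obtain a b where ab: "y = norm a + t * graph_norm A b" "b \<in> D" "a + b = x" by blast
  then have "a = x - b" by (simp add: algebra_simps)
  then show "c \<le> y" using assms[OF ab(2)] ab(1) by (simp add: graph_norm_def)
qed

lemma K_functional_mono:
  assumes "0 \<le> s" "s \<le> t" shows "K_functional D A s x \<le> K_functional D A t x"
proof (rule K_functional_ge)
  fix b assume b: "b \<in> D"
  have "s * (norm b + norm (A b)) \<le> t * (norm b + norm (A b))" using assms by (intro mult_right_mono) auto
  then show "K_functional D A s x \<le> norm (x - b) + t * (norm b + norm (A b))"
    using K_functional_le[OF assms(1) b, of x] by linarith
qed

lemma K_functional_nonneg: "0 \<le> t \<Longrightarrow> 0 \<le> K_functional D A t x"
  by (rule K_functional_ge) auto

text \<open>Measurability comes from monotonicity in t; the maximum with 0 extends the monotone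
  function to the whole line.\<close>

lemma K_function_measurable: "K_function D A x \<in> borel_measurable (lebesgue_on {0..})"
proof -
  have "mono (\<lambda>t. K_functional D A (max 0 t) x)" by (rule monoI) (rule K_functional_mono, auto)
  then have m: "(\<lambda>t. K_functional D A (max 0 t) x) \<in> borel_measurable borel" by (rule borel_measurable_mono)
  have "(\<lambda>t. complex_of_real (K_functional D A (max 0 t) x / t)) \<in> borel_measurable borel"
    using m by measurable
  then have "(\<lambda>t. complex_of_real (K_functional D A (max 0 t) x / t)) \<in> borel_measurable (lebesgue_on {0..})"
    by (intro measurable_restrict_space1 measurable_completion) simp
  then show ?thesis by (rule measurable_cong[THEN iffD1, rotated]) (simp add: K_function_def)
qed

lemma calculus_function_nonneg: "0 \<le> t \<Longrightarrow> calculus_function D A \<phi> \<nu> \<psi> x t = of_real (norm (scaled \<psi> t x) / t)"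
  by (simp add: calculus_function_def scaled_def)

lemma calculus_function_measurable:
  assumes "\<psi> \<in> elem_fun \<phi>"
  shows "calculus_function D A \<phi> \<nu> \<psi> x \<in> borel_measurable (lebesgue_on {0..})"
proof -
  have "continuous_on {0<..} (\<lambda>t. complex_of_real (norm (scaled \<psi> t x) / t))"
    by (intro continuous_intros scaled_continuous[OF assms]) auto
  then have "(\<lambda>t. indicator {0<..} t *\<^sub>R complex_of_real (norm (scaled \<psi> t x) / t)) \<in> borel_measurable borel"
    by (intro borel_measurable_continuous_on_indicator) auto
  then have "(\<lambda>t. indicator {0<..} t *\<^sub>R complex_of_real (norm (scaled \<psi> t x) / t)) \<in> borel_measurable (lebesgue_on {0..})"
    by (intro measurable_restrict_space1 measurable_completion) simp
  then show ?thesis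
    by (rule measurable_cong[THEN iffD1, rotated]) (auto simp: calculus_function_nonneg indicator_def)
qed

text \<open>The witness b is q(tA) x. The integral estimate is available only between \<epsilon> > 0
  and t, so the passage to \<epsilon> = 0 has to be justified without density of the domain.\<close>

lemma approximation_estimates:
  assumes \<psi>: "\<psi> \<in> elem_fun \<phi>" "(\<lambda>z. inverse z * \<psi> z) \<in> elem_fun \<phi>"
    and L: "L \<noteq> 0" "((\<lambda>z. inverse z * \<psi> z) \<longlongrightarrow> L) (at 0 within sector \<phi>)"
    and nz: "\<And>z. z \<in> sector \<phi> \<Longrightarrow> \<psi> z \<noteq> 0"
    and B: "\<And>z s. z \<in> sector \<phi> \<Longrightarrow> 1 \<le> s \<Longrightarrow> cmod (\<psi> (of_real s * z) / (of_real s * \<psi> z)) \<le> B"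
  obtains C where "0 \<le> C"
    "\<And>t x. 0 < t \<Longrightarrow> norm (scaled \<psi> t x) \<le> C * K_functional D A t x"
    "\<And>t x. 0 < t \<Longrightarrow> calculus_function D A \<phi> \<nu> \<psi> x \<in> L1_loc \<Longrightarrow>
      \<exists>b\<in>D. norm (x - b) \<le> C * cmod (t * hardy (calculus_function D A \<phi> \<nu> \<psi> x) t) \<and> norm b \<le> C * norm x \<and>
        norm (A b) \<le> C * cmod (calculus_function D A \<phi> \<nu> \<psi> x t)"
proof -
  obtain C Q where C: "0 \<le> C"
    and U1: "\<And>t x. 0 < t \<Longrightarrow> norm (scaled \<psi> t x) \<le> C * norm x"
    and U2: "\<And>t b. 0 < t \<Longrightarrow> b \<in> D \<Longrightarrow> norm (scaled \<psi> t b) \<le> C * t * norm (A b)"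
    and Q1: "\<And>t x. 0 < t \<Longrightarrow> Q t x \<in> D"
    and Q2: "\<And>t x. 0 < t \<Longrightarrow> norm (Q t x) \<le> C * norm x"
    and Q3: "\<And>t x. 0 < t \<Longrightarrow> norm (A (Q t x)) \<le> C * (norm (scaled \<psi> t x) / t)"
    and Q4: "\<And>t b. 0 < t \<Longrightarrow> b \<in> D \<Longrightarrow> norm (b - Q t b) \<le> C * t * norm (A b)"
    and Q5: "\<And>t x. 0 < t \<Longrightarrow> Q t (inv_shift 1 x) = inv_shift 1 (Q t x)"
    and Q6: "\<And>\<epsilon> t x. 0 < \<epsilon> \<Longrightarrow> \<epsilon> \<le> t \<Longrightarrow>
      norm (Q \<epsilon> x - Q t x) \<le> C * integral {\<epsilon>..t} (\<lambda>\<sigma>. norm (scaled \<psi> \<sigma> x) / \<sigma>)"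
    using approximating_operators[OF \<psi> L nz B] by blast
  \<comment> \<open>The infimum is estimated after division by C, which requires C > 0; for C = 0
    the left side vanishes.\<close>
  have K: "norm (scaled \<psi> t x) \<le> C * K_functional D A t x" if t: "0 < t" for t x
  proof (cases "C = 0")
    case True
    then show ?thesis using U1[OF t, of x] by simp
  next
    case False
    then have C': "0 < C" using C by simp
    have "norm (scaled \<psi> t x) / C \<le> K_functional D A t x"
    proof (rule K_functional_ge)
      fix b assume b: "b \<in> D"
      have "scaled \<psi> t x = scaled \<psi> t (x - b) + scaled \<psi> t b"
        using has_calc_linear(1)[OF has_calc_scaled[OF t \<psi>(1)], of "x - b" b] by simp
      then have "norm (scaled \<psi> t x) \<le> C * norm (x - b) + C * t * norm (A b)"
        using norm_triangle_ineq[of "scaled \<psi> t (x - b)" "scaled \<psi> t b"] U1[OF t, of "x - b"] U2[OF t b] by simp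
      also have "\<dots> \<le> C * (norm (x - b) + t * (norm b + norm (A b)))"
        using C t by (simp add: distrib_left)
      finally show "norm (scaled \<psi> t x) / C \<le> norm (x - b) + t * (norm b + norm (A b))"
        using C' by (simp add: divide_le_eq mult.commute)
    qed
    then show ?thesis using C' by (simp add: divide_le_eq mult.commute)
  qed
  have E: "\<exists>b\<in>D. norm (x - b) \<le> C * cmod (t * hardy (calculus_function D A \<phi> \<nu> \<psi> x) t) \<and> norm b \<le> C * norm x \<and>
        norm (A b) \<le> C * cmod (calculus_function D A \<phi> \<nu> \<psi> x t)"
    if t: "0 < t" and L1: "calculus_function D A \<phi> \<nu> \<psi> x \<in> L1_loc" for t x
  proof -
    define w where "w \<sigma> = norm (scaled \<psi> \<sigma> x) / \<sigma>" for \<sigma>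
    define G where "G s = integral {0..s} w" for s
    have int: "integrable (lebesgue_on {0..s}) w" if "0 \<le> s" for s
    proof -
      have "integrable (lebesgue_on {0..s}) (calculus_function D A \<phi> \<nu> \<psi> x)" using L1 that by (simp add: L1_loc_def)
      then have "integrable (lebesgue_on {0..s}) (\<lambda>\<sigma>. Re (calculus_function D A \<phi> \<nu> \<psi> x \<sigma>))" by (rule integrable_Re)
      then show ?thesis
        by (rule Bochner_Integration.integrable_cong[THEN iffD1, OF refl, rotated]) (simp add: calculus_function_nonneg w_def)
    qed
    have HK: "w integrable_on {0..s}" if "0 \<le> s" for s by (rule integrable_on_lebesgue_on[OF int[OF that]]) simp
    \<comment> \<open>Multiplied by t, the Hardy average is the primitive G of w; on nonnegative
      functions its Lebesgue and gauge forms agree.\<close>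
    have hardy: "t * hardy (calculus_function D A \<phi> \<nu> \<psi> x) t = of_real (G t)"
    proof -
      have "integral\<^sup>L (lebesgue_on {0..t}) (calculus_function D A \<phi> \<nu> \<psi> x) = integral\<^sup>L (lebesgue_on {0..t}) (\<lambda>\<sigma>. complex_of_real (w \<sigma>))"
        by (rule Bochner_Integration.integral_cong) (auto simp: calculus_function_nonneg w_def)
      also have "\<dots> = of_real (integral\<^sup>L (lebesgue_on {0..t}) w)" by (rule integral_complex_of_real)
      also have "integral\<^sup>L (lebesgue_on {0..t}) w = G t"
        unfolding G_def using t by (intro lebesgue_integral_eq_integral int) auto
      finally show ?thesis using t by (simp add: hardy_def)
    qed
    have G0: "0 \<le> G s" if "0 \<le> s" for s
      unfolding G_def by (rule integral_nonneg[OF HK[OF that]]) (simp add: w_def)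
    have Gd: "integral {a..b} w = G b - G a" if "0 \<le> a" "a \<le> b" for a b
      using Henstock_Kurzweil_Integration.integral_combine[OF that HK] that unfolding G_def by simp
    have Qd: "norm (Q a x - Q b x) \<le> C * (G b - G a)" if "0 < a" "a \<le> b" for a b
      using Q6[OF that, of x] Gd[OF _ that(2)] that(1) unfolding w_def[abs_def, symmetric] by simp
    have lip: "norm (Q a x - Q b x) \<le> C * \<bar>G a - G b\<bar>" if "0 < a" "0 < b" for a b
    proof (cases "a \<le> b")
      case True
      have "C * (G b - G a) \<le> C * \<bar>G a - G b\<bar>" using C by (intro mult_left_mono) auto
      with Qd[OF that(1) True] show ?thesis by linarith
    next
      case False
      have "C * (G a - G b) \<le> C * \<bar>G a - G b\<bar>" using C by (intro mult_left_mono) auto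
      with Qd[OF that(2), of a] False show ?thesis by (simp add: norm_minus_commute)
    qed
    have "continuous_on {0..1} G" unfolding G_def by (rule indefinite_integral_continuous_1[OF HK]) simp
    then have "(G \<longlongrightarrow> G 0) (at 0 within {0..1})" by (simp add: continuous_on)
    then have "(G \<longlongrightarrow> G 0) (at_right 0)" by (simp add: at_within_Icc_at_right)
    \<comment> \<open>The increments of \<epsilon> \<mapsto> Q \<epsilon> x are bounded by those of
      C G, and G is continuous at 0 as the primitive of an integrable function.\<close>
    from lipschitz_limit[OF this _ _ lip, of "\<lambda>s. 0 < s"]
    obtain y where y: "((\<lambda>\<epsilon>. Q \<epsilon> x) \<longlongrightarrow> y) (at_right 0)" by (auto simp: eventually_at_right_less)
    have pos: "eventually (\<lambda>\<epsilon>::real. 0 < \<epsilon>) (at_right 0)" by (rule eventually_at_right_less)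
    \<comment> \<open>The limit y is identified through (1 + A)^{-1}: it is bounded and so preserves
      the convergence, its values lie in D, where Q \<epsilon> b tends to b, and it is
      injective.\<close>
    have "((\<lambda>\<epsilon>. inv_shift 1 (Q \<epsilon> x) - inv_shift 1 y) \<longlongrightarrow> 0) (at_right 0)"
    proof (rule Lim_null_comparison)
      have "((\<lambda>\<epsilon>. M * norm (Q \<epsilon> x - y)) \<longlongrightarrow> M * norm (y - y)) (at_right 0)" by (intro tendsto_intros y)
      then show "((\<lambda>\<epsilon>. M * norm (Q \<epsilon> x - y)) \<longlongrightarrow> 0) (at_right 0)" by simp
      show "\<forall>\<^sub>F \<epsilon> in at_right 0. norm (inv_shift 1 (Q \<epsilon> x) - inv_shift 1 y) \<le> M * norm (Q \<epsilon> x - y)"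
        using inv_shift_norm[of 1] inv_shift_linear(3)[of 1, symmetric] by simp
    qed
    then have l1: "((\<lambda>\<epsilon>. inv_shift 1 (Q \<epsilon> x)) \<longlongrightarrow> inv_shift 1 y) (at_right 0)" by (rule LIM_zero_cancel)
    have "((\<lambda>\<epsilon>. inv_shift 1 (Q \<epsilon> x) - inv_shift 1 x) \<longlongrightarrow> 0) (at_right 0)"
    proof (rule Lim_null_comparison)
      have "((\<lambda>\<epsilon>. C * \<epsilon> * norm (A (inv_shift 1 x))) \<longlongrightarrow> C * 0 * norm (A (inv_shift 1 x))) (at_right 0)"
        by (intro tendsto_intros)
      then show "((\<lambda>\<epsilon>. C * \<epsilon> * norm (A (inv_shift 1 x))) \<longlongrightarrow> 0) (at_right 0)" by simp
      show "\<forall>\<^sub>F \<epsilon> in at_right 0. norm (inv_shift 1 (Q \<epsilon> x) - inv_shift 1 x) \<le> C * \<epsilon> * norm (A (inv_shift 1 x))"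
        using pos
      proof eventually_elim
        case (elim \<epsilon>)
        show ?case using Q4[OF elim inv_shift_solves(1)[of 1 x]] Q5[OF elim] by (simp add: norm_minus_commute)
      qed
    qed
    then have l2: "((\<lambda>\<epsilon>. inv_shift 1 (Q \<epsilon> x)) \<longlongrightarrow> inv_shift 1 x) (at_right 0)" by (rule LIM_zero_cancel)
    have "inv_shift 1 y = inv_shift 1 x" by (rule tendsto_unique[OF _ l1 l2]) simp
    then have "y = x" using inv_shift_solves(2)[of 1 x] inv_shift_solves(2)[of 1 y] by simp
    have "norm (x - Q t x) \<le> C * G t"
    proof (rule tendsto_upperbound)
      show "((\<lambda>\<epsilon>. norm (Q \<epsilon> x - Q t x)) \<longlongrightarrow> norm (x - Q t x)) (at_right 0)"
        using y \<open>y = x\<close> by (intro tendsto_intros) simp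
      show "\<forall>\<^sub>F \<epsilon> in at_right 0. norm (Q \<epsilon> x - Q t x) \<le> C * G t"
        using pos eventually_at_right_real[OF t]
      proof eventually_elim
        case (elim \<epsilon>)
        then have "norm (Q \<epsilon> x - Q t x) \<le> C * (G t - G \<epsilon>)" using Qd[of \<epsilon> t] by simp
        also have "\<dots> \<le> C * G t" using C G0[of \<epsilon>] elim(1) by (intro mult_left_mono) auto
        finally show ?case .
      qed
    qed simp
    then have "norm (x - Q t x) \<le> C * cmod (t * hardy (calculus_function D A \<phi> \<nu> \<psi> x) t)"
      using G0[of t] t unfolding hardy by simp
    moreover have "norm (A (Q t x)) \<le> C * cmod (calculus_function D A \<phi> \<nu> \<psi> x t)"
      using Q3[OF t, of x] t by (simp add: calculus_function_nonneg norm_divide)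
    ultimately show ?thesis using Q1[OF t, of x] Q2[OF t, of x] by blast
  qed
  show ?thesis by (rule that[OF C K E])
qed

text \<open>The upper bound is the choice b = 0. The lower bound holds because the graph norm
  contains |b| itself; it is what recovers |x| from the interpolation norm.\<close>

lemma K_functional_estimates:
  assumes t: "0 < t"
  shows "K_functional D A t x / t \<le> norm x * (1 / t)" "norm x * min 1 (1 / t) \<le> K_functional D A t x / t"
proof -
  show "K_functional D A t x / t \<le> norm x * (1 / t)"
    using divide_right_mono[OF K_functional_le[of t 0 x], of t] D_0 D_scale(2)[OF D_0, of 0] t by simp
  have "min 1 t * norm x \<le> K_functional D A t x"
  proof (rule K_functional_ge)
    fix b assume "b \<in> D"
    have "min 1 t * norm x \<le> min 1 t * (norm (x - b) + norm b)"
      using t norm_triangle_ineq[of "x - b" b] by (intro mult_left_mono) auto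
    also have "\<dots> \<le> 1 * norm (x - b) + t * norm b"
      unfolding distrib_left by (intro add_mono mult_right_mono) auto
    also have "\<dots> \<le> norm (x - b) + t * (norm b + norm (A b))" using t by simp
    finally show "min 1 t * norm x \<le> norm (x - b) + t * (norm b + norm (A b))" .
  qed
  then have "min 1 t * norm x / t \<le> K_functional D A t x / t" using t by (intro divide_right_mono) auto
  moreover have "min 1 t * norm x / t = norm x * min 1 (1 / t)" using t by (simp add: min_def field_simps)
  ultimately show "norm x * min 1 (1 / t) \<le> K_functional D A t x / t" by simp
qed

lemma invertible_lower_bound:
  assumes "invertible_operator D A"
  obtains c where "0 \<le> c" "\<And>b. b \<in> D \<Longrightarrow> norm b \<le> c * norm (A b)"
proof -
  have 0: "0 \<in> resolvent_set D A" using assms by (simp add: invertible_operator_def)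
  have z: "0 *C x = 0" for x :: 'a using norm_scaleC[of 0 x] by simp
  obtain c where c: "0 \<le> c" "\<And>x. norm (R 0 x) \<le> norm x * c"
    using bounded_linear.nonneg_bounded[OF resolvent_bounded_linear[OF 0]] by blast
  have "norm b \<le> c * norm (A b)" if b: "b \<in> D" for b
    using c(2)[of "- A b"] resolvent_unique[OF 0 b, of "- A b"] by (simp add: z mult.commute)
  with c(1) show ?thesis by (rule that)
qed

text \<open>One direction combines the pointwise bound of u by K(t,x)/t with the lower bound for K.
  In the other, the decomposition is used for t < 1 and b = 0 for t \<ge> 1, so that |x| enters with
  the weight min(1, 1/t). Pointwise majorants become membership and norm bounds by the ideal
  property.\<close>

lemma interpolation_equivalence:
  assumes \<psi>: "\<psi> \<in> elem_fun \<phi>" "(\<lambda>z. inverse z * \<psi> z) \<in> elem_fun \<phi>"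
    and L: "L \<noteq> 0" "((\<lambda>z. inverse z * \<psi> z) \<longlongrightarrow> L) (at 0 within sector \<phi>)"
    and nz: "\<And>z. z \<in> sector \<phi> \<Longrightarrow> \<psi> z \<noteq> 0"
    and B: "\<And>z s. z \<in> sector \<phi> \<Longrightarrow> 1 \<le> s \<Longrightarrow> cmod (\<psi> (of_real s * z) / (of_real s * \<psi> z)) \<le> B"
    and bfs: "banach_function_space \<Phi> N" and hardy: "hardy_bounded_on \<Phi> N"
    and m: "(\<lambda>t. complex_of_real (min 1 (1 / t))) \<in> \<Phi>"
  shows "interp_space D A \<Phi> = {x. calculus_function D A \<phi> \<nu> \<psi> x \<in> \<Phi>} \<and>
         equivalent_on (interp_space D A \<Phi>) (interp_norm D A N)
           (\<lambda>x. norm x + N (calculus_function D A \<phi> \<nu> \<psi> x)) \<and>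
         (invertible_operator D A \<longrightarrow>
          equivalent_on (interp_space D A \<Phi>) (interp_norm D A N)
            (\<lambda>x. N (calculus_function D A \<phi> \<nu> \<psi> x)))"
proof -
  interpret banach_function_space \<Phi> N by (rule bfs)
  define u where "u = calculus_function D A \<phi> \<nu> \<psi>"
  define m' where "m' t = complex_of_real (min 1 (1 / t))" for t
  define \<mu>' where "\<mu>' = N m'"
  have m': "m' \<in> \<Phi>" using m by (simp add: m'_def[abs_def])
  \<comment> \<open>The weight min(1, 1/t) does not vanish on [1,2]. Its norm converts |x| into a
    quantity measured in \<Phi>.\<close>
  have \<mu>': "0 < \<mu>'" unfolding \<mu>'_def by (rule N_pos[OF m']) (auto simp: m'_def min_def)
  obtain C where C: "0 \<le> C"
    and CK: "\<And>t x. 0 < t \<Longrightarrow> norm (scaled \<psi> t x) \<le> C * K_functional D A t x"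
    and Cb: "\<And>t x. 0 < t \<Longrightarrow> u x \<in> L1_loc \<Longrightarrow> \<exists>b\<in>D. norm (x - b) \<le> C * cmod (t * hardy (u x) t) \<and>
        norm b \<le> C * norm x \<and> norm (A b) \<le> C * cmod (u x t)"
    using approximation_estimates[OF \<psi> L nz B] unfolding u_def by blast
  obtain H0 where H0: "\<And>f. f \<in> \<Phi> \<Longrightarrow> N (hardy f) \<le> H0 * N f"
    and L1: "\<Phi> \<subseteq> L1_loc" and Hin: "\<And>f. f \<in> \<Phi> \<Longrightarrow> hardy f \<in> \<Phi>"
    using hardy by (auto simp: hardy_bounded_on_def)
  \<comment> \<open>The constant for the Hardy operator comes without a sign; its positive part
    serves equally well.\<close>
  define H where "H = max 0 H0"
  have H: "0 \<le> H" "\<And>f. f \<in> \<Phi> \<Longrightarrow> N (hardy f) \<le> H * N f"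
  proof -
    show "0 \<le> H" by (simp add: H_def)
    fix f assume f: "f \<in> \<Phi>"
    show "N (hardy f) \<le> H * N f" using H0[OF f] norm_nonneg[OF f] mult_right_mono[of H0 H "N f"] by (simp add: H_def)
  qed
  have um: "u x \<in> borel_measurable (lebesgue_on {0..})" for x
    unfolding u_def by (rule calculus_function_measurable[OF \<psi>(1)])
  have Kt: "cmod (K_function D A x t) = K_functional D A t x / t" if "0 < t" for t x
    using that K_functional_nonneg[of t x] by (simp add: K_function_def norm_divide)
  have ut: "cmod (u x t) = norm (scaled \<psi> t x) / t" if "0 < t" for t x
    using that by (simp add: u_def calculus_function_nonneg norm_divide)
  have real_u: "u x t = of_real (cmod (u x t))" if "0 < t" for t x
    using that by (simp add: u_def calculus_function_nonneg norm_divide)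
  \<comment> \<open>u and its average are nonnegative reals, so in the complex-valued majorants
    below the modulus of a sum is the sum of the moduli.\<close>
  have real_hardy: "hardy (u x) t = of_real (cmod (hardy (u x) t))" if t: "0 < t" for t x
  proof -
    have "hardy (u x) t = of_real (1 / t * integral\<^sup>L (lebesgue_on {0..t}) (\<lambda>\<sigma>. norm (scaled \<psi> \<sigma> x) / \<sigma>))"
    proof -
      have "integral\<^sup>L (lebesgue_on {0..t}) (u x) = integral\<^sup>L (lebesgue_on {0..t}) (\<lambda>\<sigma>. complex_of_real (norm (scaled \<psi> \<sigma> x) / \<sigma>))"
        by (rule Bochner_Integration.integral_cong) (auto simp: u_def calculus_function_nonneg)
      then show ?thesis by (simp only: hardy_def integral_complex_of_real of_real_mult)
    qed
    moreover have "0 \<le> 1 / t * integral\<^sup>L (lebesgue_on {0..t}) (\<lambda>\<sigma>. norm (scaled \<psi> \<sigma> x) / \<sigma>)"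
      using t by (intro mult_nonneg_nonneg Bochner_Integration.integral_nonneg) auto
    ultimately show ?thesis by (simp only: norm_of_real abs_of_nonneg)
  qed
  have fwd: "u x \<in> \<Phi> \<and> N (u x) \<le> C * N (K_function D A x) \<and> norm x * \<mu>' \<le> N (K_function D A x)"
    if K: "K_function D A x \<in> \<Phi>" for x
  proof -
    have "cmod (u x t) \<le> cmod (of_real C * K_function D A x t)" if t: "0 < t" for t
      using divide_right_mono[OF CK[OF t, of x], of t] t C by (simp add: ut Kt Real_Vector_Spaces.norm_mult)
    note d = dominated[OF mult[OF K] um this]
    have "(\<lambda>t. of_real (norm x) * m' t) \<in> borel_measurable (lebesgue_on {0..})"
      using mult[OF m'] measurable by blast
    moreover have "cmod (of_real (norm x) * m' t) \<le> cmod (K_function D A x t)" if t: "0 < t" for t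
      using K_functional_estimates(2)[OF t, of x] t by (simp add: Kt Real_Vector_Spaces.norm_mult m'_def min_def)
    ultimately have "N (\<lambda>t. of_real (norm x) * m' t) \<le> N (K_function D A x)" by (rule dominated(2)[OF K])
    then show ?thesis using d C by (simp add: norm_mult[OF K] norm_mult[OF m'] \<mu>'_def)
  qed
  have bwd: "K_function D A x \<in> \<Phi> \<and> N (K_function D A x) \<le> (C * H + C) * N (u x) + (C + 1) * \<mu>' * norm x"
    if u: "u x \<in> \<Phi>" for x
  proof -
    have uL: "u x \<in> L1_loc" using u L1 by blast
    \<comment> \<open>The majorant h consists of the average for x - b, of u for A b, and of (C + 1)
      |x| min(1, 1/t). The last coefficient covers C |x| from b when t < 1 and |x| / t from the
      choice b = 0 when t \<ge> 1.\<close>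
    define g where "g t = of_real C * hardy (u x) t + of_real C * u x t" for t
    define h where "h t = of_real (1::real) * g t + of_real ((C + 1) * norm x) * m' t" for t
    have g: "g \<in> \<Phi>" "N g \<le> C * N (hardy (u x)) + C * N (u x)"
      unfolding g_def by (intro combination Hin u C)+
    have cx: "0 \<le> (C + 1) * norm x" using C by simp
    have h: "h \<in> \<Phi>" "N h \<le> 1 * N g + (C + 1) * norm x * N m'"
      unfolding h_def by (intro combination g(1) m' cx; simp)+
    have "cmod (K_function D A x t) \<le> cmod (h t)" if t: "0 < t" for t
    proof -
      obtain b where b: "b \<in> D" "norm (x - b) \<le> C * cmod (t * hardy (u x) t)" "norm b \<le> C * norm x"
        "norm (A b) \<le> C * cmod (u x t)" using Cb[OF t uL] by blast
      have hr: "hardy (u x) t = of_real (cmod (hardy (u x) t))" and ur: "u x t = of_real (cmod (u x t))"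
        using t real_hardy[OF t] real_u[OF t] by auto
      have he: "cmod (h t) = C * cmod (hardy (u x) t) + C * cmod (u x t) + (C + 1) * norm x * min 1 (1 / t)"
      proof -
        define p q where "p = cmod (hardy (u x) t)" and "q = cmod (u x t)"
        have pq: "0 \<le> p" "0 \<le> q" by (simp_all add: p_def q_def)
        have "h t = of_real (C * p + C * q + (C + 1) * norm x * min 1 (1 / t))"
          unfolding h_def g_def m'_def using hr ur by (simp add: p_def q_def)
        moreover have "0 \<le> C * p + C * q + (C + 1) * norm x * min 1 (1 / t)"
          using C t pq by (intro add_nonneg_nonneg mult_nonneg_nonneg) auto
        ultimately show ?thesis unfolding p_def[symmetric] q_def[symmetric] by (simp only: norm_of_real abs_of_nonneg)
      qed
      show ?thesis
      proof (cases "1 \<le> t")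
        case True
        have "norm x * (1 / t) \<le> (C + 1) * norm x * (1 / t)"
          using C t by (intro mult_right_mono) (auto simp: distrib_right)
        moreover have "0 \<le> C * cmod (hardy (u x) t) + C * cmod (u x t)" using C by simp
        ultimately have "K_functional D A t x / t \<le> C * cmod (hardy (u x) t) + C * cmod (u x t) + (C + 1) * norm x * (1 / t)"
          using K_functional_estimates(1)[OF t, of x] by linarith
        moreover have "min 1 (1 / t) = 1 / t" using True by (simp add: min_def)
        ultimately show ?thesis unfolding he Kt[OF t] by simp
      next
        case False
        have "K_functional D A t x \<le> C * cmod (t * hardy (u x) t) + t * (C * norm x + C * cmod (u x t))"
          by (rule order_trans[OF K_functional_le[OF _ b(1)]]) (use t b in \<open>auto intro!: add_mono mult_left_mono\<close>)
        also have "\<dots> = (C * cmod (hardy (u x) t) + C * cmod (u x t) + C * norm x) * t"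
          using t by (simp add: Real_Vector_Spaces.norm_mult algebra_simps)
        finally have "K_functional D A t x / t \<le> C * cmod (hardy (u x) t) + C * cmod (u x t) + C * norm x"
          using t by (simp add: divide_le_eq)
        also have "\<dots> \<le> C * cmod (hardy (u x) t) + C * cmod (u x t) + (C + 1) * norm x * min 1 (1 / t)"
          using False t by (simp add: min_def distrib_right)
        finally show ?thesis unfolding he Kt[OF t] .
      qed
    qed
    note d = dominated[OF h(1) K_function_measurable this]
    have "C * N (hardy (u x)) \<le> C * (H * N (u x))" by (intro mult_left_mono H(2) u C)
    with d h g show ?thesis by (simp add: \<mu>'_def algebra_simps)
  qed
  have space: "interp_space D A \<Phi> = {x. u x \<in> \<Phi>}" using fwd bwd by (auto simp: interp_space_def)
  have Nu: "0 \<le> N (u x)" if "u x \<in> \<Phi>" for x by (rule norm_nonneg[OF that])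
  define E where "E = C * H + C"
  have E: "0 \<le> E" using C H(1) by (simp add: E_def)
  have eq1: "equivalent_on (interp_space D A \<Phi>) (interp_norm D A N) (\<lambda>x. norm x + N (u x))"
    unfolding equivalent_on_def interp_norm_def
  proof (intro exI conjI ballI)
    \<comment> \<open>The norm of u is at most C times that of the K-function, and |x| at most 1 /
      \<mu>' times it.\<close>
    show "0 < 1 / (C + 1 / \<mu>')" using C \<mu>' by (simp add: add_nonneg_pos)
    show "0 < E + (C + 1) * \<mu>'" using C \<mu>' E by (intro add_nonneg_pos mult_pos_pos) auto
    fix x assume x: "x \<in> interp_space D A \<Phi>"
    then have K: "K_function D A x \<in> \<Phi>" by (simp add: interp_space_def)
    note f = fwd[OF K]
    have "norm x \<le> N (K_function D A x) / \<mu>'" using f \<mu>' by (simp add: le_divide_eq)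
    then have "norm x + N (u x) \<le> N (K_function D A x) * (C + 1 / \<mu>')" using f by (simp add: algebra_simps)
    moreover have "0 < C + 1 / \<mu>'" using C \<mu>' by (simp add: add_nonneg_pos)
    ultimately show "1 / (C + 1 / \<mu>') * (norm x + N (u x)) \<le> N (K_function D A x)"
      by (simp only: times_divide_eq_left mult_1 pos_divide_le_eq)
    have "E * N (u x) + (C + 1) * \<mu>' * norm x \<le> (E + (C + 1) * \<mu>') * (norm x + N (u x))"
      using C \<mu>' E f Nu[of x] by (simp add: distrib_left distrib_right)
    then show "N (K_function D A x) \<le> (E + (C + 1) * \<mu>') * (norm x + N (u x))"
      using bwd[of x] f unfolding E_def by linarith
  qed
  have eq2: "equivalent_on (interp_space D A \<Phi>) (interp_norm D A N) (\<lambda>x. N (u x))" if inv: "invertible_operator D A"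
  proof -
    obtain c where c: "0 \<le> c" "\<And>b. b \<in> D \<Longrightarrow> norm b \<le> c * norm (A b)" using invertible_lower_bound[OF inv] by blast
    \<comment> \<open>The indicator of [1,2] is at most 2 min(1, 1/t) and hence lies in
      \<Phi>.\<close>
    define i where "i t = complex_of_real (indicator {1..2} t)" for t :: real
    have "i \<in> borel_measurable borel" unfolding i_def[abs_def] by measurable
    then have im: "i \<in> borel_measurable (lebesgue_on {0..})"
      by (intro measurable_restrict_space1 measurable_completion) simp
    have "i \<in> \<Phi>"
      by (rule dominated(1)[OF mult[OF m', of 2] im])
        (auto simp: i_def m'_def indicator_def Real_Vector_Spaces.norm_mult min_def field_simps)
    define j where "j = N i"
    have j: "0 < j" unfolding j_def by (rule N_pos[OF \<open>i \<in> \<Phi>\<close>]) (simp add: i_def)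
    \<comment> \<open>For t in [1,2] one has |x| \<le> |x - b| + |b| \<le> C t Pu(t) + c |A b| \<le>
      2 C Pu(t) + c C u(t); norms are taken and divided by that of the indicator.\<close>
    define F where "F = (2 * C * H + c * C) / j"
    have F: "0 \<le> F" using C H(1) c(1) j by (simp add: F_def)
    have low: "norm x \<le> F * N (u x)" if u: "u x \<in> \<Phi>" for x
    proof -
      have uL: "u x \<in> L1_loc" using u L1 by blast
      define g where "g t = of_real (2 * C) * hardy (u x) t + of_real (c * C) * u x t" for t
      have g: "g \<in> \<Phi>" "N g \<le> 2 * C * N (hardy (u x)) + c * C * N (u x)"
        unfolding g_def by (intro combination Hin u mult_nonneg_nonneg C c(1); simp)+
      have xm: "(\<lambda>t. of_real (norm x) * i t) \<in> borel_measurable (lebesgue_on {0..})"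
        using mult[OF \<open>i \<in> \<Phi>\<close>] measurable by blast
      have "cmod (of_real (norm x) * i t) \<le> cmod (g t)" if t: "0 < t" for t
      proof (cases "t \<in> {1..2}")
        case True
        obtain b where b: "b \<in> D" "norm (x - b) \<le> C * cmod (t * hardy (u x) t)"
          "norm (A b) \<le> C * cmod (u x t)" using Cb[OF t uL] by blast
        define p q where "p = cmod (hardy (u x) t)" and "q = cmod (u x t)"
        have pq: "0 \<le> p" "0 \<le> q" by (simp_all add: p_def q_def)
        have "norm x \<le> norm (x - b) + norm b" using norm_triangle_ineq[of "x - b" b] by simp
        also have "\<dots> \<le> C * (t * p) + c * (C * q)"
        proof (rule add_mono)
          show "norm (x - b) \<le> C * (t * p)" using b(2) t by (simp add: Real_Vector_Spaces.norm_mult p_def)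
          show "norm b \<le> c * (C * q)"
            using c(2)[OF b(1)] mult_left_mono[OF b(3) c(1)] unfolding q_def by linarith
        qed
        also have "\<dots> \<le> C * (2 * p) + c * (C * q)"
          using True C pq by (intro add_mono mult_left_mono mult_right_mono) auto
        finally have le: "norm x \<le> 2 * C * p + c * C * q" by simp
        have "g t = of_real (2 * C * p + c * C * q)"
          unfolding g_def using real_hardy[OF t, of x] real_u[OF t, of x] by (simp add: p_def q_def)
        then have "cmod (g t) = \<bar>2 * C * p + c * C * q\<bar>" by (simp only: norm_of_real)
        with le True show ?thesis by (simp add: i_def)
      next
        case False
        then show ?thesis by (simp add: i_def)
      qed
      from dominated(2)[OF g(1) xm this] have "norm x * j \<le> N g"
        by (simp add: norm_mult[OF \<open>i \<in> \<Phi>\<close>] j_def)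
      also have "\<dots> \<le> (2 * C * H + c * C) * N (u x)"
        using g(2) mult_left_mono[OF H(2)[OF u], of "2 * C"] C by (simp add: algebra_simps)
      finally show ?thesis using j by (simp add: F_def field_simps)
    qed
    \<comment> \<open>The term |x| of the general estimate is absorbed by F times the norm of u; the
      summand 1 keeps T positive.\<close>
    define T where "T = E + (C + 1) * \<mu>' * F + 1"
    have T0: "0 \<le> (C + 1) * \<mu>' * F" using C \<mu>' F by (intro mult_nonneg_nonneg) auto
    show ?thesis
      unfolding equivalent_on_def interp_norm_def
    proof (intro exI conjI ballI)
      show "0 < 1 / (C + 1)" using C by simp
      show "0 < T" using T0 E by (simp add: T_def)
      fix x assume x: "x \<in> interp_space D A \<Phi>"
      then have K: "K_function D A x \<in> \<Phi>" by (simp add: interp_space_def)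
      note f = fwd[OF K]
      have "N (u x) \<le> N (K_function D A x) * (C + 1)" using f norm_nonneg[OF K] by (simp add: algebra_simps)
      then show "1 / (C + 1) * N (u x) \<le> N (K_function D A x)" using C by (simp add: pos_divide_le_eq)
      have "(C + 1) * \<mu>' * norm x \<le> (C + 1) * \<mu>' * (F * N (u x))"
        using C \<mu>' low[of x] f by (intro mult_left_mono) auto
      then show "N (K_function D A x) \<le> T * N (u x)"
        using bwd[of x] f Nu[of x] unfolding E_def[symmetric] T_def by (simp add: distrib_right mult.assoc)
    qed
  qed
  show ?thesis using space eq1 eq2 unfolding u_def by blast
qed

end

theorem theorem3p1:
  fixes A :: "'a::complex_banach \<Rightarrow> 'a" and D :: "'a set"
    and \<phi> \<nu> :: real and \<psi> :: "complex \<Rightarrow> complex"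
    and \<Phi> :: "(real \<Rightarrow> complex) set" and N :: "(real \<Rightarrow> complex) \<Rightarrow> real"
  assumes "sectorial D A"
    and "sectoriality_angle D A < \<phi>" and "\<phi> < pi"
    and "sectoriality_angle D A < \<nu>" and "\<nu> < \<phi>"
    and "\<psi> holomorphic_on sector \<phi>"
    and "\<psi> \<in> elem_fun \<phi>" and "(\<lambda>z. inverse z * \<psi> z) \<in> elem_fun \<phi>"
    and "\<exists>L. L \<noteq> 0 \<and> ((\<lambda>z. inverse z * \<psi> z) \<longlongrightarrow> L) (at 0 within sector \<phi>)"
    and "\<forall>z\<in>sector \<phi>. \<psi> z \<noteq> 0"
    and "bdd_above {cmod (\<psi> (complex_of_real s * z) / (complex_of_real s * \<psi> z)) |z s.
           z \<in> sector \<phi> \<and> s \<ge> 1}"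
    and "banach_function_space \<Phi> N"
    and "hardy_bounded_on \<Phi> N"
    and "(\<lambda>t. complex_of_real (min 1 (1 / t))) \<in> \<Phi>"
  shows "interp_space D A \<Phi> = {x. calculus_function D A \<phi> \<nu> \<psi> x \<in> \<Phi>} \<and>
         equivalent_on (interp_space D A \<Phi>) (interp_norm D A N)
           (\<lambda>x. norm x + N (calculus_function D A \<phi> \<nu> \<psi> x)) \<and>
         (invertible_operator D A \<longrightarrow>
          equivalent_on (interp_space D A \<Phi>) (interp_norm D A N)
            (\<lambda>x. N (calculus_function D A \<phi> \<nu> \<psi> x)))"
proof -
  obtain \<mu> M where "sectorial_calculus D A \<mu> \<phi> M \<nu>"
    using sectorial_calculus_exists[OF assms(1,4,5,3)] by blast
  then interpret sectorial_calculus D A \<mu> \<phi> M \<nu> .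
  obtain L where L: "L \<noteq> 0" "((\<lambda>z. inverse z * \<psi> z) \<longlongrightarrow> L) (at 0 within sector \<phi>)" using assms(9) by blast
  obtain B where "\<And>z s. z \<in> sector \<phi> \<Longrightarrow> 1 \<le> s \<Longrightarrow> cmod (\<psi> (of_real s * z) / (of_real s * \<psi> z)) \<le> B"
    using assms(11) unfolding bdd_above_def by blast
  from interpolation_equivalence[OF assms(7,8) L _ this assms(12-14)] assms(10) show ?thesis by blast
qed

end
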